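(* Let $\beta\geq-1$ be an integer or half-integer, $n\in\mathbb N$ and $k\in\{1,\ldots,n\}$. If both $2\beta+n$ and $n-k$ are odd, then $\mathbf J_{n,k}(\beta)=q\,\pi^{-(n-k-1)}$ for some rational number $q$.
   Context: For $d\in\mathbb N$ and $\beta>-1$ the $d$-dimensional beta distribution has density $f_{d,\beta}(x)=c_{d,\beta}(1-\|x\|^2)^\beta\mathbf 1_{\{\|x\|<1\}}$ with $c_{d,\beta}=\Gamma(\frac d2+\beta+1)/(\pi^{d/2}\Gamma(\beta+1))$; for $\beta=-1$ it means the uniform distribution on $\mathbb S^{d-1}$. The internal angle $\beta(F,T)$ of a simplex $T\subset\mathbb R^d$ at a face $F$ is $\lim_{r\downarrow0}\mathrm{Vol}_d(B_r(z)\cap T)/\mathrm{Vol}_d(B_r(z))$ with $z$ in the relative interior of $F$ (full angle $=1$). For $n\ge2$ and $X_1,\ldots,X_n$ i.i.d. in $\mathbb R^{n-1}$ with distribution $f_{n-1,\beta}$, $\mathbf J_{n,k}(\beta)=\binom nk\,\mathbb E\,\beta([X_1,\ldots,X_k],[X_1,\ldots,X_n])$; also $\mathbf J_{1,1}(\beta)=1$. *)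

theory Defs
  imports "HOL-Analysis.Analysis"
begin

text \<open>Beta distribution on R^d (d = CARD('d)) with parameter b > -1, and for b = -1
  the uniform distribution on the unit sphere, realised as the radial projection of
  the uniform distribution on the unit ball (i.e. the normalised cone measure,
  which is the normalised surface measure on the sphere).\<close>

definition beta_const :: "nat \<Rightarrow> real \<Rightarrow> real" where
  "beta_const d b = Gamma (real d / 2 + b + 1) / (pi powr (real d / 2) * Gamma (b + 1))"

definition beta_dist :: "real \<Rightarrow> (real ^ 'd) measure" where
  "beta_dist b =
     (if b = -1 then
        distr (uniform_measure lborel (ball 0 1)) borel (\<lambda>x. x /\<^sub>R norm x)
      else
        density lborel (\<lambda>x::real ^ 'd. ennreal (beta_const CARD('d) b
              * (1 - (norm x)\<^sup>2) powr b * indicator (ball 0 1) x)))"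

definition internal_angle :: "(real ^ 'd) set \<Rightarrow> (real ^ 'd) set \<Rightarrow> real" where
  "internal_angle F T =
     (let z = (SOME z. z \<in> rel_interior F) in
        Lim (at_right 0) (\<lambda>r. measure lborel (ball z r \<inter> T) / measure lborel (ball z r)))"

definition J :: "'d::finite itself \<Rightarrow> nat \<Rightarrow> real \<Rightarrow> real" where
  "J (_ :: 'd itself) k b =
     (let n = CARD('d) + 1 in
        real (n choose k) *
        (\<integral>X. internal_angle (convex hull (X ` {1..k})) (convex hull (X ` {1..n}))
           \<partial>(PiM {1..n} (\<lambda>_. (beta_dist b :: (real ^ 'd) measure)))))"

end

theory Submission
  imports Defs "HOL-Probability.Probability" "HOL-Complex_Analysis.Cauchy_Integral_Formula" "HOL-Combinatorics.Stirling"
begin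

text \<open>Let \<open>n = d + 1\<close> and \<open>p = b + d / 2\<close>. For \<open>b > -1\<close> lift the points to \<open>Z\<^sub>j \<in> \<real>\<^sup>d \<times> \<real>\<close> with weight
  \<open>(1 - \<parallel>Z\<^sub>j\<parallel>\<^sup>2)\<^sup>b\<close> and integrate the Gaussian \<open>exp (- \<parallel>\<Sum>\<^sub>i u\<^sub>i (Z\<^sub>i - Z\<^sub>1)\<parallel>\<^sup>2 / 2)\<close> over the coefficients \<open>u\<close> of the
  tangent cone at the face spanned by the first \<open>k\<close> points. The lifted points lie on the graph of an affine function, and
  sections of beta weights by such graphs are affine images of beta weights; hence the integral is a constant,
  independent of \<open>k\<close>, times the expected angle. On the other hand, writing the Gaussian as a characteristic function
  factorises the integral along a random direction, so that only the one-dimensional marginal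
  \<open>f(s) = c (1 - s\<^sup>2)\<^sup>p\<close> enters: the expected angle is the quotient of
  \<open>\<integral> f (2 \<pi> f)\<^sup>k\<^sup>-\<^sup>1 (\<pi> f + \<i> V)\<^sup>n\<^sup>-\<^sup>k\<close> by \<open>\<integral> f (2 \<pi> f)\<^sup>n\<^sup>-\<^sup>1\<close>, where \<open>V(s)\<close> is the principal value of \<open>\<integral> f(t) / (t - s) dt\<close>.
  The case \<open>b = -1\<close> follows by continuity in \<open>b\<close>.

  Under the parity hypotheses \<open>p\<close> is an integer, unless \<open>n - k = 1\<close>, in which case the cone is a half-space. Then
  \<open>V = R - f L\<close> with \<open>L(s) = ln ((1 + s) / (1 - s))\<close> and, for \<open>c = 1\<close>, a polynomial \<open>R\<close> with rational coefficients, and the real part of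
  the first integral is a rational combination of \<open>\<integral> s\<^sup>a Im ((L + \<i> \<pi>)\<^sup>j) ds\<close>. These are rational multiples of \<open>\<pi>\<close>: their
  generating function in \<open>j\<close> is \<open>sin (\<pi> u)\<close> times a Beta integral, which by the reflection formula
  is \<open>\<pi>\<close> times a polynomial in \<open>u\<close>.\<close>

section \<open>Product measures and linear changes of variables\<close>

text \<open>Why lift: integrating the Gaussian over the coefficients \<open>u\<close> for points of
  R^d itself would give the angle divided by the determinant of the edges. The heights of the lifted
  points, rewritten as affine functions on R^d, supply exactly this determinant. The remaining
  constant is eliminated by comparison with \<open>k = n\<close>, where the cone is the whole space.
  Obstacle: \<open>u\<close> ranges over an unbounded cone, so absolute convergence is lost once the
  Gaussian is replaced by characters. Hence a factor exp(- e |u_i|), removed at the end. It turns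
  each coordinate integral into 1 / (e - \<i> x), whose limit produces \<pi> f + \<i> V; a
  coefficient running over the full line gives twice the real part. The limit uses that f is
  Lipschitz, hence p \<ge> 1; for integral p this follows from n - k \<ge> 3. Oddness of n - k turns
  the real part of (\<pi> f + \<i> V)^(n-k) into an imaginary part, whose moments carry a single
  factor \<pi>, against (2 \<pi>)^(n-k) from the normalisation.\<close>

lemma PiM_density:
  fixes M :: "'a measure"
  assumes "finite I" "sigma_finite_measure M" and f [measurable]: "f \<in> borel_measurable M"
    and "sigma_finite_measure (density M f)"
  shows "PiM I (\<lambda>_. density M f) = density (PiM I (\<lambda>_. M)) (\<lambda>x. \<Prod>i\<in>I. f (x i))"
proof (rule sym, rule product_sigma_finite.PiM_eqI)
  interpret M: product_sigma_finite "\<lambda>_. M" using assms(2) by (simp add: product_sigma_finite_def)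
  show "product_sigma_finite (\<lambda>_. density M f)" using assms(4) by (simp add: product_sigma_finite_def)
  show "finite I" by fact
  show "sets (density (PiM I (\<lambda>_. M)) (\<lambda>x. \<Prod>i\<in>I. f (x i))) = sets (PiM I (\<lambda>_. density M f))"
    unfolding sets_density by (intro sets_PiM_cong) auto
  fix A :: "_ \<Rightarrow> 'a set" assume A: "\<And>i. i \<in> I \<Longrightarrow> A i \<in> sets (density M f)"
  have [measurable]: "Pi\<^sub>E I A \<in> sets (PiM I (\<lambda>_. M))"
    using A \<open>finite I\<close> by (intro sets_PiM_I_finite) auto
  have "emeasure (density (PiM I (\<lambda>_. M)) (\<lambda>x. \<Prod>i\<in>I. f (x i))) (Pi\<^sub>E I A)
      = (\<integral>\<^sup>+x. (\<Prod>i\<in>I. f (x i)) * indicator (Pi\<^sub>E I A) x \<partial>PiM I (\<lambda>_. M))"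
    by (subst emeasure_density) auto
  also have "\<dots> = (\<integral>\<^sup>+x. (\<Prod>i\<in>I. f (x i) * indicator (A i) (x i)) \<partial>PiM I (\<lambda>_. M))"
    using \<open>finite I\<close> by (intro nn_integral_cong)
      (auto simp: prod.distrib indicator_def space_PiM PiE_iff prod_zero_iff split: if_splits
         intro!: prod.neutral prod_zero)
  also have "\<dots> = (\<Prod>i\<in>I. \<integral>\<^sup>+x. f x * indicator (A i) x \<partial>M)"
    using A \<open>finite I\<close> by (intro M.product_nn_integral_prod) auto
  also have "\<dots> = (\<Prod>i\<in>I. emeasure (density M f) (A i))"
    using A by (intro prod.cong refl) (auto simp: emeasure_density)
  finally show "emeasure (density (PiM I (\<lambda>_. M)) (\<lambda>x. \<Prod>i\<in>I. f (x i))) (Pi\<^sub>E I A)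
      = (\<Prod>i\<in>I. emeasure (density M f) (A i))" .
qed

text \<open>The image of the product measure under \<open>T\<close> in every coordinate, scaled by
  \<open>c ^ card I\<close>, has the right value on boxes and is therefore the product measure.
  Applied with \<open>T\<close> an affine map of R^d that moves all vertices of a simplex at
  once.\<close>

lemma nn_integral_PiM_affine:
  fixes M :: "'a measure"
  assumes I: "finite I" and sf: "sigma_finite_measure M"
    and T [measurable]: "T \<in> measurable M M"
    and eq: "\<And>f. f \<in> borel_measurable M \<Longrightarrow> (\<integral>\<^sup>+x. f x \<partial>M) = c * (\<integral>\<^sup>+x. f (T x) \<partial>M)"
    and F [measurable]: "F \<in> borel_measurable (PiM I (\<lambda>_. M))"
  shows "(\<integral>\<^sup>+y. F y \<partial>PiM I (\<lambda>_. M)) = c ^ card I * (\<integral>\<^sup>+y. F (\<lambda>i\<in>I. T (y i)) \<partial>PiM I (\<lambda>_. M))"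
proof -
  interpret M: product_sigma_finite "\<lambda>_. M" using sf by (simp add: product_sigma_finite_def)
  let ?P = "PiM I (\<lambda>_. M)"
  let ?D = "density (distr ?P ?P (\<lambda>y. \<lambda>i\<in>I. T (y i))) (\<lambda>_. c ^ card I)"
  have Tm [measurable]: "(\<lambda>y. \<lambda>i\<in>I. T (y i)) \<in> measurable ?P ?P" by measurable
  have "?D = ?P"
  proof (rule M.PiM_eqI[OF I])
    fix A assume A: "\<And>i. i \<in> I \<Longrightarrow> A i \<in> sets M"
    have [measurable]: "Pi\<^sub>E I A \<in> sets ?P" using A I by (intro sets_PiM_I_finite) auto
    have "emeasure ?D (Pi\<^sub>E I A) = c ^ card I * (\<integral>\<^sup>+y. indicator (Pi\<^sub>E I A) (\<lambda>i\<in>I. T (y i)) \<partial>?P)"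
      by (subst nn_integral_distr[symmetric, OF Tm]) (simp_all add: emeasure_density nn_integral_cmult)
    also have "(\<integral>\<^sup>+y. indicator (Pi\<^sub>E I A) (\<lambda>i\<in>I. T (y i)) \<partial>?P) =
        (\<integral>\<^sup>+y. (\<Prod>i\<in>I. indicator (A i) (T (y i))) \<partial>?P)"
      using I by (intro nn_integral_cong) (auto simp: indicator_def PiE_iff prod_zero_iff
         intro!: prod.neutral split: if_splits)
    also have "\<dots> = (\<Prod>i\<in>I. \<integral>\<^sup>+x. indicator (A i) (T x) \<partial>M)"
      using A I by (intro M.product_nn_integral_prod) auto
    also have "c ^ card I * \<dots> = (\<Prod>i\<in>I. c * (\<integral>\<^sup>+x. indicator (A i) (T x) \<partial>M))"
      by (simp add: prod.distrib)
    also have "\<dots> = (\<Prod>i\<in>I. emeasure M (A i))"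
    proof (intro prod.cong refl)
      fix i assume "i \<in> I"
      then show "c * (\<integral>\<^sup>+x. indicator (A i) (T x) \<partial>M) = emeasure M (A i)"
        using eq[of "indicator (A i)"] A by simp
    qed
    finally show "emeasure ?D (Pi\<^sub>E I A) = (\<Prod>i\<in>I. emeasure M (A i))" .
  qed simp
  then have "(\<integral>\<^sup>+y. F y \<partial>?P) = (\<integral>\<^sup>+y. F y \<partial>?D)" by simp
  also have "\<dots> = c ^ card I * (\<integral>\<^sup>+y. F (\<lambda>i\<in>I. T (y i)) \<partial>?P)"
    by (simp add: nn_integral_density nn_integral_distr nn_integral_cmult)
  finally show ?thesis .
qed

text \<open>Agreement on boxes suffices here too. The lemma separates a family of lifted points into
  the family of base points and the family of heights.\<close>

lemma distr_PiM_pair: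
  fixes M1 :: "'a measure" and M2 :: "'b measure" and N :: "'c measure"
  assumes I: "finite I" and "sigma_finite_measure M1" "sigma_finite_measure M2"
    and T [measurable]: "T \<in> measurable (M1 \<Otimes>\<^sub>M M2) N"
    and "sigma_finite_measure (distr (M1 \<Otimes>\<^sub>M M2) N T)"
  shows "PiM I (\<lambda>_. distr (M1 \<Otimes>\<^sub>M M2) N T) =
    distr (PiM I (\<lambda>_. M1) \<Otimes>\<^sub>M PiM I (\<lambda>_. M2)) (PiM I (\<lambda>_. N)) (\<lambda>(y, t). \<lambda>i\<in>I. T (y i, t i))"
proof (rule sym, rule product_sigma_finite.PiM_eqI)
  interpret M1: product_sigma_finite "\<lambda>_. M1" using assms by (simp add: product_sigma_finite_def)
  interpret M2: product_sigma_finite "\<lambda>_. M2" using assms by (simp add: product_sigma_finite_def)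
  interpret P1: sigma_finite_measure "PiM I (\<lambda>_. M1)" by (rule M1.sigma_finite) fact
  interpret P2: sigma_finite_measure "PiM I (\<lambda>_. M2)" by (rule M2.sigma_finite) fact
  let ?N = "distr (M1 \<Otimes>\<^sub>M M2) N T"
  let ?Q = "PiM I (\<lambda>_. M1) \<Otimes>\<^sub>M PiM I (\<lambda>_. M2)"
  show "product_sigma_finite (\<lambda>_. ?N)" using assms by (simp add: product_sigma_finite_def)
  show "finite I" by fact
  show "sets (distr ?Q (PiM I (\<lambda>_. N)) (\<lambda>(y, t). \<lambda>i\<in>I. T (y i, t i))) = sets (PiM I (\<lambda>_. ?N))"
    unfolding sets_distr by (intro sets_PiM_cong) auto
  have Tm [measurable]: "(\<lambda>(y, t). \<lambda>i\<in>I. T (y i, t i)) \<in> measurable ?Q (PiM I (\<lambda>_. N))" by measurable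
  fix A assume A0: "\<And>i. i \<in> I \<Longrightarrow> A i \<in> sets ?N"
  then have A [measurable]: "\<And>i. i \<in> I \<Longrightarrow> A i \<in> sets N" by simp
  have [measurable]: "Pi\<^sub>E I A \<in> sets (PiM I (\<lambda>_. N))" using A I by (intro sets_PiM_I_finite) auto
  have "emeasure (distr ?Q (PiM I (\<lambda>_. N)) (\<lambda>(y, t). \<lambda>i\<in>I. T (y i, t i))) (Pi\<^sub>E I A)
     = (\<integral>\<^sup>+z. indicator (Pi\<^sub>E I A) (case z of (y, t) \<Rightarrow> \<lambda>i\<in>I. T (y i, t i)) \<partial>?Q)"
    by (subst nn_integral_distr[symmetric, OF Tm]) auto
  also have "\<dots> = (\<integral>\<^sup>+z. (\<Prod>i\<in>I. indicator (A i) (T (fst z i, snd z i))) \<partial>?Q)"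
    using I by (intro nn_integral_cong) (auto simp: indicator_def PiE_iff prod_zero_iff
         intro!: prod.neutral split: if_splits)
  also have "\<dots> = (\<integral>\<^sup>+y. \<integral>\<^sup>+t. (\<Prod>i\<in>I. indicator (A i) (T (y i, t i))) \<partial>PiM I (\<lambda>_. M2) \<partial>PiM I (\<lambda>_. M1))"
    by (subst P2.nn_integral_fst[symmetric]) (auto simp: A)
  also have "\<dots> = (\<integral>\<^sup>+y. (\<Prod>i\<in>I. \<integral>\<^sup>+t. indicator (A i) (T (y i, t)) \<partial>M2) \<partial>PiM I (\<lambda>_. M1))"
  proof (intro nn_integral_cong M2.product_nn_integral_prod I)
    fix y i assume "y \<in> space (PiM I (\<lambda>_. M1))" "i \<in> I"
    then have "y i \<in> space M1" by (auto simp: space_PiM)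
    then show "(\<lambda>t. indicator (A i) (T (y i, t)) :: ennreal) \<in> borel_measurable M2"
      using A[OF \<open>i \<in> I\<close>] by measurable
  qed
  also have "\<dots> = (\<Prod>i\<in>I. \<integral>\<^sup>+y. \<integral>\<^sup>+t. indicator (A i) (T (y, t)) \<partial>M2 \<partial>M1)"
    by (intro M1.product_nn_integral_prod I) (auto simp: A)
  also have "\<dots> = (\<Prod>i\<in>I. emeasure ?N (A i))"
  proof (intro prod.cong refl)
    fix i assume i: "i \<in> I"
    have "emeasure ?N (A i) = (\<integral>\<^sup>+z. indicator (A i) (T z) \<partial>(M1 \<Otimes>\<^sub>M M2))"
      using A[OF i] by (subst nn_integral_distr[symmetric, OF T]) auto
    then show "(\<integral>\<^sup>+y. \<integral>\<^sup>+t. indicator (A i) (T (y, t)) \<partial>M2 \<partial>M1) = emeasure ?N (A i)"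
      using A[OF i] by (subst (asm) sigma_finite_measure.nn_integral_fst[OF assms(3), symmetric]) auto
  qed
  finally show "emeasure (distr ?Q (PiM I (\<lambda>_. N)) (\<lambda>(y, t). \<lambda>i\<in>I. T (y i, t i))) (Pi\<^sub>E I A)
      = (\<Prod>i\<in>I. emeasure ?N (A i))" .
qed

lemma prod_Basis_vec:
  fixes g :: "real ^ 'n \<Rightarrow> 'b::comm_monoid_mult"
  shows "(\<Prod>b\<in>Basis. g b) = (\<Prod>i\<in>UNIV. g (axis i 1))"
proof -
  have "Basis = range (\<lambda>i::'n. axis i (1::real))" by (auto simp: Basis_vec_def)
  moreover have "inj (\<lambda>i::'n. axis i (1::real))" by (auto simp: inj_def axis_eq_axis)
  ultimately show ?thesis using prod.reindex[of "\<lambda>i::'n. axis i (1::real)" UNIV g] by (simp add: o_def)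
qed

lemma borel_measurable_vec_lambda:
  fixes f :: "'a \<Rightarrow> 'n::finite \<Rightarrow> real"
  assumes "\<And>i. (\<lambda>x. f x i) \<in> borel_measurable M"
  shows "(\<lambda>x. \<chi> i. f x i) \<in> measurable M (borel :: (real ^ 'n) measure)"
  using assms by (subst borel_measurable_euclidean_space) (auto simp: Basis_vec_def inner_axis)

text \<open>The labelling \<open>e\<close> is left free so that it can be a permutation of the
  coordinates, or \<open>vertex_index\<close>, which labels coordinates by the vertex numbers
  \<open>2, ..., d + 1\<close>.\<close>

lemma lborel_vec_eq_distr_PiM:
  fixes e :: "'n::finite \<Rightarrow> 'i"
  assumes "inj e"
  shows "(lborel :: (real ^ 'n) measure) = distr (PiM (range e) (\<lambda>_. lborel)) borel (\<lambda>f. \<chi> i. f (e i))"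
proof (rule lborel_eqI)
  interpret L: product_sigma_finite "\<lambda>_::'i. lborel :: real measure" by standard
  have m [measurable]: "(\<lambda>f. \<chi> i. f (e i)) \<in> measurable (PiM (range e) (\<lambda>_. lborel)) (borel :: (real ^ 'n) measure)"
    by (rule borel_measurable_vec_lambda) auto
  fix l u :: "real ^ 'n" assume lu: "\<And>b. b \<in> Basis \<Longrightarrow> l \<bullet> b \<le> u \<bullet> b"
  have lu': "l $ i \<le> u $ i" for i using lu[of "axis i 1"] by (auto simp: inner_axis Basis_vec_def)
  have "(\<lambda>f. \<chi> i. f (e i)) -` box l u \<inter> space (PiM (range e) (\<lambda>_. lborel))
      = Pi\<^sub>E (range e) (\<lambda>j. {l $ inv e j <..< u $ inv e j})"
    using assms by (auto simp: space_PiM mem_box_cart PiE_iff)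
  then have "emeasure (distr (PiM (range e) (\<lambda>_. lborel)) borel (\<lambda>f. \<chi> i. f (e i))) (box l u)
     = emeasure (PiM (range e) (\<lambda>_. lborel)) (Pi\<^sub>E (range e) (\<lambda>j. {l $ inv e j <..< u $ inv e j}))"
    by (subst emeasure_distr) auto
  also have "\<dots> = (\<Prod>j\<in>range e. emeasure lborel {l $ inv e j <..< u $ inv e j})"
    by (intro L.emeasure_PiM) auto
  also have "\<dots> = (\<Prod>i\<in>UNIV. ennreal ((u - l) $ i))"
    using assms lu' by (subst prod.reindex) auto
  also have "\<dots> = ennreal (\<Prod>i\<in>UNIV. (u - l) $ i)"
    using lu' by (intro prod_ennreal) auto
  also have "\<dots> = ennreal (\<Prod>b\<in>Basis. (u - l) \<bullet> b)"
    by (simp add: prod_Basis_vec inner_axis)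
  finally show "emeasure (distr (PiM (range e) (\<lambda>_. lborel)) borel (\<lambda>f. \<chi> i. f (e i))) (box l u)
     = ennreal (\<Prod>b\<in>Basis. (u - l) \<bullet> b)" .
qed simp

lemma nn_integral_lborel_vec:
  fixes F :: "real ^ 'n::finite \<Rightarrow> ennreal"
  assumes [measurable]: "F \<in> borel_measurable borel"
  shows "(\<integral>\<^sup>+x. F x \<partial>lborel) = (\<integral>\<^sup>+f. F (\<chi> i. f i) \<partial>PiM UNIV (\<lambda>_. lborel))"
proof -
  have m: "(\<lambda>f. \<chi> i. f i) \<in> measurable (PiM UNIV (\<lambda>_. lborel)) (borel :: (real ^ 'n) measure)"
    by (rule borel_measurable_vec_lambda) auto
  show ?thesis
    by (subst lborel_vec_eq_distr_PiM[of "\<lambda>i::'n. i"]) (simp_all add: nn_integral_distr[OF m])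
qed

text \<open>With the other coordinates frozen the shear is a translation of coordinate
  \<open>m\<close> alone, because \<open>m \<noteq> n\<close> keeps the amount of translation fixed;
  Fubini in that coordinate then suffices.\<close>

lemma nn_integral_lborel_shear:
  fixes F :: "real ^ 'n::finite \<Rightarrow> ennreal" and m n :: 'n
  assumes F [measurable]: "F \<in> borel_measurable borel" and mn: "m \<noteq> n"
  shows "(\<integral>\<^sup>+x. F (x + axis m (c * x $ n)) \<partial>lborel) = (\<integral>\<^sup>+x. F x \<partial>lborel)"
proof -
  interpret L: product_sigma_finite "\<lambda>_::'n. lborel :: real measure" by standard
  have U: "(UNIV :: 'n set) = insert m (UNIV - {m})" by auto
  have vm: "(\<lambda>f. \<chi> i. f i) \<in> measurable (PiM UNIV (\<lambda>_. lborel)) (borel :: (real ^ 'n) measure)"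
    by (rule borel_measurable_vec_lambda) auto
  have ax: "(\<lambda>x::real^'n. axis m (c * x $ n)) \<in> borel_measurable borel"
    unfolding axis_def by (rule borel_measurable_vec_lambda) auto
  have G [measurable]: "(\<lambda>x. F (x + axis m (c * x $ n))) \<in> borel_measurable borel"
    by (intro measurable_compose[OF _ F] borel_measurable_add ax) auto
  have split: "(\<integral>\<^sup>+x. G x \<partial>lborel) =
      (\<integral>\<^sup>+f. \<integral>\<^sup>+t. G (\<chi> i. (f(m := t)) i) \<partial>lborel \<partial>PiM (UNIV - {m}) (\<lambda>_. lborel))"
    if [measurable]: "G \<in> borel_measurable borel" for G :: "real ^ 'n \<Rightarrow> ennreal"
  proof -
    have "(\<lambda>f. G (\<chi> i. f i)) \<in> borel_measurable (PiM (insert m (UNIV - {m})) (\<lambda>_. lborel))"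
      unfolding U[symmetric] using vm by measurable
    then show ?thesis
      unfolding nn_integral_lborel_vec[OF that] by (subst U, subst L.product_nn_integral_insert) auto
  qed
  have "(\<integral>\<^sup>+x. F (x + axis m (c * x $ n)) \<partial>lborel) =
    (\<integral>\<^sup>+f. \<integral>\<^sup>+t. F (\<chi> i. (f(m := c * f n + 1 * t)) i) \<partial>lborel \<partial>PiM (UNIV - {m}) (\<lambda>_. lborel))"
    unfolding split[OF G] using mn
    by (intro nn_integral_cong arg_cong[where f=F]) (auto simp: vec_eq_iff axis_def)
  also have "\<dots> = (\<integral>\<^sup>+f. \<integral>\<^sup>+t. F (\<chi> i. (f(m := t)) i) \<partial>lborel \<partial>PiM (UNIV - {m}) (\<lambda>_. lborel))"
  proof (rule nn_integral_cong)
    fix f :: "'n \<Rightarrow> real"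
    have [measurable]: "(\<lambda>t. F (\<chi> i. if i = m then t else f i)) \<in> borel_measurable borel"
      by (intro measurable_compose[OF _ F] borel_measurable_vec_lambda) auto
    show "(\<integral>\<^sup>+t. F (\<chi> i. (f(m := c * f n + 1 * t)) i) \<partial>lborel) = (\<integral>\<^sup>+t. F (\<chi> i. (f(m := t)) i) \<partial>lborel)"
      using nn_integral_real_affine[of "\<lambda>t. F (\<chi> i. (f(m := t)) i)" 1 "c * f n"] by (simp add: fun_upd_def)
  qed
  also have "\<dots> = (\<integral>\<^sup>+x. F x \<partial>lborel)" by (rule split[OF F, symmetric])
  finally show ?thesis .
qed

lemma nn_integral_lborel_permute:
  fixes F :: "real ^ 'n::finite \<Rightarrow> ennreal"
  assumes F [measurable]: "F \<in> borel_measurable borel" and p: "bij p"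
  shows "(\<integral>\<^sup>+x. F (\<chi> i. x $ p i) \<partial>lborel) = (\<integral>\<^sup>+x. F x \<partial>lborel)"
proof -
  have m: "(\<lambda>x. \<chi> i. x $ p i) \<in> measurable borel (borel :: (real ^ 'n) measure)"
    by (rule borel_measurable_vec_lambda) auto
  have "range p = UNIV" using p by (auto simp: bij_def)
  then have L: "(lborel :: (real^'n) measure) = distr (PiM UNIV (\<lambda>_. lborel)) borel (\<lambda>f. \<chi> i. f (p i))"
    using lborel_vec_eq_distr_PiM[OF bij_is_inj[OF p]] by metis
  have [measurable]: "(\<lambda>f. \<chi> i. f (p i)) \<in> measurable (PiM UNIV (\<lambda>_. lborel)) (borel :: (real ^ 'n) measure)"
    by (rule borel_measurable_vec_lambda) auto
  have "(\<integral>\<^sup>+x. F x \<partial>lborel) = (\<integral>\<^sup>+f. F (\<chi> i. f (p i)) \<partial>PiM UNIV (\<lambda>_. lborel))"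
    by (subst L) (simp add: nn_integral_distr)
  also have "\<dots> = (\<integral>\<^sup>+x. F (\<chi> i. x $ p i) \<partial>lborel)"
    using m by (subst nn_integral_lborel_vec) auto
  finally show ?thesis ..
qed

lemma borel_measurable_matrix_vector [measurable]:
  fixes A :: "real ^ 'n ^ 'm"
  shows "(\<lambda>x. A *v x) \<in> measurable borel borel"
  by (rule borel_measurable_continuous_onI) (rule matrix_vector_mult_linear_continuous_on)

text \<open>Induction over elementary matrices: the claim is multiplicative in the matrix, and each
  invertible generator is a scaling of coordinates, a transposition or a shear. With nonnegative
  extended integrands no integrability has to be tracked.\<close>

proposition nn_integral_lborel_matrix:
  fixes A :: "real ^ 'n::finite ^ 'n" and F :: "real ^ 'n \<Rightarrow> ennreal"
  assumes "det A \<noteq> 0" and "F \<in> borel_measurable borel"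
  shows "(\<integral>\<^sup>+x. F x \<partial>lborel) = ennreal \<bar>det A\<bar> * (\<integral>\<^sup>+x. F (A *v x) \<partial>lborel)"
proof -
  define P where "P A \<longleftrightarrow> (det A \<noteq> 0 \<longrightarrow> (\<forall>F :: real ^ 'n \<Rightarrow> ennreal. F \<in> borel_measurable borel \<longrightarrow>
      (\<integral>\<^sup>+x. F x \<partial>lborel) = ennreal \<bar>det A\<bar> * (\<integral>\<^sup>+x. F (A *v x) \<partial>lborel)))" for A :: "real ^ 'n ^ 'n"
  have "P A"
  proof (induct A rule: induct_matrix_elementary)
    case (1 A B)
    show ?case unfolding P_def
    proof (intro impI allI)
      fix F :: "real ^ 'n \<Rightarrow> ennreal" assume d: "det (A ** B) \<noteq> 0" and F [measurable]: "F \<in> borel_measurable borel"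
      have "(\<integral>\<^sup>+x. F x \<partial>lborel) = ennreal \<bar>det A\<bar> * (\<integral>\<^sup>+x. F (A *v x) \<partial>lborel)"
        by (rule 1(1)[unfolded P_def, rule_format]) (use d in \<open>auto simp: det_mul\<close>)
      also have "(\<integral>\<^sup>+x. F (A *v x) \<partial>lborel) = ennreal \<bar>det B\<bar> * (\<integral>\<^sup>+x. F (A *v (B *v x)) \<partial>lborel)"
        by (rule 1(2)[unfolded P_def, rule_format]) (use d in \<open>auto simp: det_mul\<close>)
      finally show "(\<integral>\<^sup>+x. F x \<partial>lborel) = ennreal \<bar>det (A ** B)\<bar> * (\<integral>\<^sup>+x. F ((A ** B) *v x) \<partial>lborel)"
        by (simp add: det_mul abs_mult ennreal_mult' matrix_vector_mul_assoc mult.assoc)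
    qed
  next
    case (2 A i)
    then show ?case by (auto simp: P_def det_zero_row)
  next
    case (3 A)
    show ?case unfolding P_def
    proof (intro impI allI)
      fix F :: "real ^ 'n \<Rightarrow> ennreal" assume d: "det A \<noteq> 0" and F [measurable]: "F \<in> borel_measurable borel"
      have det: "det A = (\<Prod>i\<in>UNIV. A $ i $ i)" by (intro det_diagonal 3) 
      define c where "c b = b \<bullet> (A *v b)" for b :: "real ^ 'n"
      have c: "c (axis i 1) = A $ i $ i" for i
        by (simp add: c_def inner_axis' matrix_vector_mult_basis column_def)
      have Av: "A *v x = 0 + (\<Sum>j\<in>Basis. (c j * (x \<bullet> j)) *\<^sub>R j)" for x
      proof -
        have "(A *v x) $ i = (0 + (\<Sum>j\<in>Basis. (c j * (x \<bullet> j)) *\<^sub>R j)) $ i" for i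
        proof -
          have "(A *v x) $ i = A $ i $ i * x $ i"
            unfolding matrix_vector_mult_def using 3 by (simp add: sum.remove[of UNIV i])
          moreover have "(0 + (\<Sum>j\<in>Basis. (c j * (x \<bullet> j)) *\<^sub>R j)) $ i = (\<Sum>j\<in>Basis. (c j * (x \<bullet> j)) *\<^sub>R j) \<bullet> axis i 1"
            by (simp add: inner_axis)
          moreover have "\<dots> = c (axis i 1) * (x \<bullet> axis i 1)"
            by (subst inner_sum_left_Basis) auto
          ultimately show ?thesis by (simp add: c inner_axis)
        qed
        then show ?thesis by (simp add: vec_eq_iff)
      qed
      have nz: "c j \<noteq> 0" if "j \<in> Basis" for j
        using that d unfolding det by (auto simp: Basis_vec_def c)
      have "(\<Prod>j\<in>Basis. \<bar>c j\<bar>) = \<bar>det A\<bar>"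
        by (simp add: prod_Basis_vec c det abs_prod)
      then have eq: "lborel = density (distr lborel borel (\<lambda>x. A *v x)) (\<lambda>_. ennreal \<bar>det A\<bar>)"
        unfolding Av using lborel_affine_euclidean[of c 0] nz by simp
      show "(\<integral>\<^sup>+x. F x \<partial>lborel) = ennreal \<bar>det A\<bar> * (\<integral>\<^sup>+x. F (A *v x) \<partial>lborel)"
        by (subst (1) eq) (simp add: nn_integral_density nn_integral_distr nn_integral_cmult)
    qed
  next
    case (4 m n)
    let ?A = "(\<chi> i j. mat 1 $ i $ Transposition.transpose m n j) :: real ^ 'n ^ 'n"
    have Av: "?A *v x = (\<chi> i. x $ Transposition.transpose m n i)" for x
    proof -
      have "(?A *v x) $ i = x $ Transposition.transpose m n i" for i
      proof -
        have "i = Transposition.transpose m n j \<longleftrightarrow> j = Transposition.transpose m n i" for j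
          by (metis transpose_involutory)
        note tr = this
        have "(?A *v x) $ i = (\<Sum>j\<in>UNIV. if j = Transposition.transpose m n i then x $ j else 0)"
          unfolding matrix_vector_mult_def mat_def by (intro vec_lambda_beta[THEN trans] sum.cong refl) (simp add: tr)
        then show ?thesis by simp
      qed
      then show ?thesis by (simp add: vec_eq_iff)
    qed
    \<comment> \<open>A transposition is an involution, so its determinant squares to
      \<open>1\<close>; this yields the absolute value without the sign of the permutation.\<close>
    have "(?A ** ?A) *v x = mat 1 *v x" for x
      unfolding matrix_vector_mul_assoc[symmetric] Av by (simp add: vec_eq_iff)
    then have "?A ** ?A = mat 1" by (simp add: matrix_eq)
    then have "det ?A * det ?A = 1" by (metis det_I det_mul)
    then have "det ?A = 1 \<or> det ?A = -1" by (simp only: square_eq_1_iff)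
    then have "\<bar>det ?A\<bar> = 1" by (elim disjE) (simp_all only: abs_1 abs_minus_cancel)
    then show ?case unfolding P_def Av
      by (simp add: nn_integral_lborel_permute)
  next
    case (5 m n c)
    let ?A = "(\<chi> i j. if i = m \<and> j = n then c else of_bool (i = j)) :: real ^ 'n ^ 'n"
    have Av: "?A *v x = x + axis m (c * x $ n)" for x
    proof -
      have "(?A *v x) $ i = (x + axis m (c * x $ n)) $ i" for i
      proof -
        have "(?A *v x) $ i = (\<Sum>j\<in>UNIV. (if j = i then x $ j else 0) + (if j = n then (if i = m then c * x $ n else 0) else 0))"
          unfolding matrix_vector_mult_def using 5 by (auto intro!: sum.cong)
        then show ?thesis by (simp add: sum.distrib axis_def)
      qed
      then show ?thesis by (simp add: vec_eq_iff)
    qed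
    have "?A = (\<chi> k. if k = m then row m (mat 1) + c *s row n (mat 1) else row k (mat 1))"
      using 5 by (auto simp: vec_eq_iff row_def mat_def)
    then have "det ?A = 1" using det_row_operation[OF 5, of "mat 1" c] by simp
    then show ?case unfolding P_def Av using 5
      by (simp add: nn_integral_lborel_shear)
  qed
  with assms show ?thesis unfolding P_def by blast
qed

section \<open>Beta distributions\<close>

definition is_cone :: "'a::real_vector set \<Rightarrow> bool" where
  "is_cone D \<longleftrightarrow> (\<forall>x\<in>D. \<forall>c>0. c *\<^sub>R x \<in> D)"

lemma is_cone_scaleR_iff:
  assumes "is_cone D" "c > 0" shows "c *\<^sub>R x \<in> D \<longleftrightarrow> x \<in> D"
proof
  assume "c *\<^sub>R x \<in> D"
  then have "inverse c *\<^sub>R c *\<^sub>R x \<in> D" using assms unfolding is_cone_def by (meson inverse_positive_iff_positive)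
  then show "x \<in> D" using assms by simp
qed (use assms in \<open>auto simp: is_cone_def\<close>)

lemma emeasure_ball_Int_cone:
  fixes D :: "'a::euclidean_space set"
  assumes D [measurable]: "D \<in> sets borel" and "is_cone D" and r: "r > 0"
  shows "emeasure lborel (ball 0 r \<inter> D) = ennreal (r ^ DIM('a)) * emeasure lborel (ball 0 1 \<inter> D)"
proof -
  have "lborel = density (distr lborel borel (\<lambda>x::'a. r *\<^sub>R x)) (\<lambda>_. ennreal (r ^ DIM('a)))"
    using lborel_affine[of r "0::'a"] r by simp
  then have "emeasure lborel (ball 0 r \<inter> D) = emeasure (density (distr lborel borel (\<lambda>x::'a. r *\<^sub>R x)) (\<lambda>_. ennreal (r ^ DIM('a)))) (ball 0 r \<inter> D)"
    by simp
  also have "\<dots> = ennreal (r ^ DIM('a)) * emeasure lborel ((\<lambda>x. r *\<^sub>R x) -` (ball 0 r \<inter> D))"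
    by (subst emeasure_density_const) (auto simp: emeasure_distr)
  also have "(\<lambda>x. r *\<^sub>R x) -` (ball 0 r \<inter> D) = ball 0 1 \<inter> D"
    using r is_cone_scaleR_iff[OF assms(2) r] by auto
  finally show ?thesis .
qed

lemma nn_integral_has_integral_indicator:
  fixes f :: "real \<Rightarrow> real"
  assumes "\<And>x. x \<in> S \<Longrightarrow> 0 \<le> f x" "(f has_integral I) S"
  shows "(\<integral>\<^sup>+x. ennreal (f x) * indicator S x \<partial>lborel) = ennreal I"
proof -
  have "(\<integral>\<^sup>+x. ennreal (indicator S x * f x) \<partial>lborel) = ennreal I"
    by (rule nn_integral_has_integral_lebesgue[OF assms])
  then show ?thesis by (simp add: mult.commute nn_integral_set_ennreal)
qed

lemma nn_integral_powr_from_0: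
  fixes a u :: real assumes "a > 0" "u \<ge> 0"
  shows "(\<integral>\<^sup>+t. ennreal (a * t powr (a - 1)) * indicator {0<..<u} t \<partial>lborel) = ennreal (u powr a)"
proof -
  have "((\<lambda>x. x powr (a - 1)) has_integral (u powr (a - 1 + 1) / (a - 1 + 1))) {0..u}"
    using assms by (intro has_integral_powr_from_0) auto
  then have "((\<lambda>x. a * x powr (a - 1)) has_integral (a * (u powr a / a))) {0..u}"
    by (intro has_integral_mult_right) simp
  then have "(\<integral>\<^sup>+x. ennreal (a * x powr (a - 1)) * indicator {0..u} x \<partial>lborel) = ennreal (a * (u powr a / a))"
    using assms by (intro nn_integral_has_integral_indicator) auto
  moreover have "(\<integral>\<^sup>+x. ennreal (a * x powr (a - 1)) * indicator {0..u} x \<partial>lborel)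
     = (\<integral>\<^sup>+t. ennreal (a * t powr (a - 1)) * indicator {0<..<u} t \<partial>lborel)"
    by (intro nn_integral_cong_AE) (use AE_lborel_singleton[of 0] AE_lborel_singleton[of u] in
      \<open>eventually_elim, auto simp: indicator_def\<close>)
  ultimately show ?thesis using assms by simp
qed

text \<open>On a cone the squared norm has a density proportional to \<open>t powr (a - 1)\<close>,
  the factor being the volume of the cone inside the unit ball. Comparison on the half-lines
  \<open>{..<u}\<close> is enough, since the part of the cone with squared norm below
  \<open>u\<close> scales like \<open>u powr a\<close>. This is how an angle is split off from a
  rotation invariant weight.\<close>

proposition nn_integral_radial_cone:
  fixes D :: "'a::euclidean_space set" and h :: "real \<Rightarrow> ennreal"
  defines "a \<equiv> real DIM('a) / 2"
  assumes D [measurable]: "D \<in> sets borel" and cone: "is_cone D"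
    and h [measurable]: "h \<in> borel_measurable borel"
  shows "(\<integral>\<^sup>+x. h ((norm x)\<^sup>2) * indicator D x \<partial>lborel) =
     emeasure lborel (ball 0 1 \<inter> D) * (\<integral>\<^sup>+t. ennreal (a * t powr (a - 1)) * indicator {0<..} t * h t \<partial>lborel)"
proof -
  have a: "a > 0" by (simp add: a_def)
  define v where "v = emeasure lborel (ball 0 1 \<inter> D)"
  have "v \<le> emeasure lborel (ball (0::'a) 1)" unfolding v_def by (intro emeasure_mono) auto
  then have v: "v < \<infinity>" using emeasure_lborel_ball_finite[of "0::'a" 1] by (rule le_less_trans)
  define M where "M = distr (density lborel (indicator D)) borel (\<lambda>x. (norm x)\<^sup>2)"
  define N where "N = density lborel (\<lambda>t. v * (ennreal (a * t powr (a - 1)) * indicator {0<..} t))"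
  have Mu: "emeasure M {..<u} = v * ennreal (if u > 0 then u powr a else 0)" for u
  proof -
    have "emeasure M {..<u} = emeasure (density lborel (indicator D)) {x::'a. (norm x)\<^sup>2 < u}"
      unfolding M_def by (subst emeasure_distr) (simp_all add: vimage_def)
    also have "\<dots> = emeasure lborel ({x::'a. (norm x)\<^sup>2 < u} \<inter> D)"
      by (subst emeasure_restricted) (auto simp: Int_commute)
    also have "\<dots> = v * ennreal (if u > 0 then u powr a else 0)"
    proof (cases "u > 0")
      case True
      have "(norm x)\<^sup>2 < u \<longleftrightarrow> norm x < sqrt u" for x :: 'a
        using real_sqrt_less_iff[of "(norm x)\<^sup>2" u] by simp
      then have "{x::'a. (norm x)\<^sup>2 < u} = ball 0 (sqrt u)" by (simp add: set_eq_iff)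
      moreover have "sqrt u ^ DIM('a) = u powr a"
        using True by (simp add: a_def powr_half_sqrt[symmetric] powr_realpow[symmetric] powr_powr)
      ultimately show ?thesis
        using emeasure_ball_Int_cone[OF D cone, of "sqrt u"] True by (simp add: v_def mult.commute)
    next
      case False
      then have "{x::'a. (norm x)\<^sup>2 < u} = {}" by (auto simp: not_less intro: order_trans)
      with False show ?thesis by simp
    qed
    finally show ?thesis .
  qed
  have Nu: "emeasure N {..<u} = v * ennreal (if u > 0 then u powr a else 0)" for u
  proof -
    have "emeasure N {..<u} = (\<integral>\<^sup>+t. v * (ennreal (a * t powr (a - 1)) * indicator {0<..} t) * indicator {..<u} t \<partial>lborel)"
      unfolding N_def by (subst emeasure_density) auto
    also have "\<dots> = v * (\<integral>\<^sup>+t. ennreal (a * t powr (a - 1)) * indicator {0<..<max 0 u} t \<partial>lborel)"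
      by (subst nn_integral_cmult[symmetric]) (auto intro!: nn_integral_cong simp: indicator_def)
    also have "\<dots> = v * ennreal (if u > 0 then u powr a else 0)"
      by (subst nn_integral_powr_from_0) (use a in \<open>auto simp: max_def\<close>)
    finally show ?thesis .
  qed
  have "M = N"
  proof (rule measure_eqI_generator_eq)
    show "Int_stable (range (\<lambda>u::real. {..<u}))" unfolding Int_stable_def
      by (auto simp: image_iff set_eq_iff) (metis min_less_iff_conj)
    show "sets M = sigma_sets UNIV (range (\<lambda>u. {..<u}))" "sets N = sigma_sets UNIV (range (\<lambda>u. {..<u}))"
      unfolding M_def N_def by (simp_all add: borel_Iio)
    show "emeasure M X = emeasure N X" if "X \<in> range (\<lambda>u. {..<u})" for X
      using that Mu Nu by auto
    show "range (\<lambda>i::nat. {..<real i}) \<subseteq> range (\<lambda>u. {..<u})" by auto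
    show "(\<Union>i. {..<real i}) = UNIV" using reals_Archimedean2 by auto
    show "emeasure M {..<real i} \<noteq> \<infinity>" for i
      using v by (auto simp: Mu ennreal_mult_eq_top_iff)
  qed auto
  have "(\<integral>\<^sup>+x. h ((norm x)\<^sup>2) * indicator D x \<partial>lborel) = (\<integral>\<^sup>+t. h t \<partial>M)"
    unfolding M_def by (subst nn_integral_distr) (simp_all add: nn_integral_density mult.commute[of "h _"])
  also have "\<dots> = (\<integral>\<^sup>+t. v * (ennreal (a * t powr (a - 1)) * indicator {0<..} t * h t) \<partial>lborel)"
    unfolding \<open>M = N\<close> N_def by (subst nn_integral_density) (auto simp: mult.assoc)
  also have "\<dots> = v * (\<integral>\<^sup>+t. ennreal (a * t powr (a - 1)) * indicator {0<..} t * h t \<partial>lborel)"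
    by (rule nn_integral_cmult) auto
  finally show ?thesis by (simp add: v_def)
qed

lemma nn_integral_Beta:
  fixes a b :: real assumes "a > 0" "b > 0"
  shows "(\<integral>\<^sup>+t. ennreal (t powr (a - 1) * (1 - t) powr (b - 1)) * indicator {0<..<1} t \<partial>lborel) = ennreal (Beta a b)"
proof -
  have "(\<integral>\<^sup>+x. ennreal (x powr (a - 1) * (1 - x) powr (b - 1)) * indicator {0..1} x \<partial>lborel) = ennreal (Beta a b)"
    using has_integral_Beta_real[OF assms] by (intro nn_integral_has_integral_indicator) auto
  moreover have "(\<integral>\<^sup>+x. ennreal (x powr (a - 1) * (1 - x) powr (b - 1)) * indicator {0..1} x \<partial>lborel)
     = (\<integral>\<^sup>+t. ennreal (t powr (a - 1) * (1 - t) powr (b - 1)) * indicator {0<..<1} t \<partial>lborel)"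
    by (intro nn_integral_cong_AE) (use AE_lborel_singleton[of 0] AE_lborel_singleton[of 1] in
      \<open>eventually_elim, auto simp: indicator_def\<close>)
  ultimately show ?thesis by simp
qed

lemma beta_const_pos: "d > 0 \<Longrightarrow> b > -1 \<Longrightarrow> beta_const d b > 0"
  unfolding beta_const_def by (intro divide_pos_pos mult_pos_pos Gamma_real_pos) auto

lemma space_beta_dist [simp]: "space (beta_dist b) = UNIV"
  by (simp add: beta_dist_def)

lemma sets_beta_dist [simp, measurable_cong]: "sets (beta_dist b) = sets borel"
  by (simp add: beta_dist_def)

text \<open>For \<open>b > -1\<close> the radial formula, with the whole space as cone, reduces the
  total mass to a Beta integral, which together with the volume of the unit ball is the reciprocal
  of \<open>beta_const\<close>.\<close>

lemma prob_space_beta_dist: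
  assumes "b \<ge> -1"
  shows "prob_space (beta_dist b :: (real ^ 'd::finite) measure)"
proof (cases "b = -1")
  case True
  interpret prob_space "uniform_measure lborel (ball (0::real^'d) 1)"
    by (intro prob_space_uniform_measure) (auto simp: emeasure_ball less_imp_neq[OF unit_ball_vol_pos, symmetric])
  show ?thesis unfolding beta_dist_def using True by (auto intro!: prob_space_distr)
next
  case False
  with assms have b: "b > -1" by auto
  let ?d = "real CARD('d)" 
  let ?c = "beta_const CARD('d) b"
  have c: "?c > 0" using b by (intro beta_const_pos) auto
  have [measurable]: "(\<lambda>t::real. ennreal (?c * (1 - t) powr b * indicator {..<1} t)) \<in> borel_measurable borel" by measurable
  have "emeasure (beta_dist b :: (real ^ 'd) measure) UNIV =
    (\<integral>\<^sup>+x. ennreal (?c * (1 - (norm (x::real^'d))\<^sup>2) powr b * indicator {..<1} ((norm x)\<^sup>2)) * indicator UNIV x \<partial>lborel)"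
    using False unfolding beta_dist_def
    by (auto simp: emeasure_density indicator_def power_less_one_iff abs_square_less_1 intro!: nn_integral_cong)
  also have "\<dots> = emeasure lborel (ball (0::real^'d) 1 \<inter> UNIV) *
     (\<integral>\<^sup>+t. ennreal (?d / 2 * t powr (?d / 2 - 1)) * indicator {0<..} t * ennreal (?c * (1 - t) powr b * indicator {..<1} t) \<partial>lborel)"
    by (subst nn_integral_radial_cone) (auto simp: is_cone_def)
  also have "(\<integral>\<^sup>+t. ennreal (?d / 2 * t powr (?d / 2 - 1)) * indicator {0<..} t * ennreal (?c * (1 - t) powr b * indicator {..<1} t) \<partial>lborel)
    = (\<integral>\<^sup>+t. ennreal (?d / 2 * ?c) * (ennreal (t powr (?d / 2 - 1) * (1 - t) powr ((b + 1) - 1)) * indicator {0<..<1} t) \<partial>lborel)"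
    using c by (intro nn_integral_cong) (auto simp: indicator_def ennreal_mult'[symmetric] algebra_simps)
  also have "\<dots> = ennreal (?d / 2 * ?c) * ennreal (Beta (?d/2) (b + 1))"
    using b nn_integral_Beta[of "?d/2" "b + 1"] by (subst nn_integral_cmult) auto
  also have "emeasure lborel (ball (0::real^'d) 1 \<inter> UNIV) * \<dots> = ennreal (unit_ball_vol ?d * (?d / 2 * ?c * Beta (?d/2) (b + 1)))"
    using c b by (simp add: emeasure_ball Beta_def ennreal_mult'[symmetric])
  also have "unit_ball_vol ?d * (?d / 2 * ?c * Beta (?d/2) (b + 1)) = 1"
  proof -
    have G: "Gamma (?d / 2 + 1) = ?d / 2 * Gamma (?d / 2)" by (subst Gamma_plus1) (auto dest: nonpos_Ints_nonpos)
    have "Gamma (?d / 2) > 0" "Gamma (b + 1) > 0" "Gamma (?d / 2 + b + 1) > 0" 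
      using b by (auto intro!: Gamma_real_pos)
    then have "Gamma (?d / 2) \<noteq> 0" "Gamma (b + 1) \<noteq> 0" "Gamma (?d / 2 + b + 1) \<noteq> 0" by linarith+
    then show ?thesis
      unfolding unit_ball_vol_def beta_const_def Beta_def G by (simp add: add.assoc)
  qed
  finally show ?thesis by (intro prob_spaceI) simp
qed

section \<open>Angles of a simplex\<close>

text \<open>Vertex \<open>1\<close> is the base point; the coordinates enumerate the other vertices \<open>2, \<dots>, d + 1\<close>.\<close>

definition vertex_index :: "'d::finite \<Rightarrow> nat" where
  "vertex_index = (SOME e. bij_betw e UNIV {2..CARD('d) + 1})"

lemma bij_vertex_index: "bij_betw (vertex_index :: 'd::finite \<Rightarrow> nat) UNIV {2..CARD('d) + 1}"
proof -
  have "\<exists>e :: 'd \<Rightarrow> nat. bij_betw e UNIV {2..CARD('d) + 1}"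
    by (intro finite_same_card_bij) auto
  then show ?thesis unfolding vertex_index_def by (rule someI_ex)
qed

lemma inj_vertex_index: "inj (vertex_index :: 'd::finite \<Rightarrow> nat)"
  using bij_vertex_index by (auto simp: bij_betw_def)

lemma range_vertex_index: "range (vertex_index :: 'd::finite \<Rightarrow> nat) = {2..CARD('d) + 1}"
  using bij_vertex_index by (auto simp: bij_betw_def)

lemma vertex_index_bounds [simp]: "2 \<le> vertex_index (i :: 'd::finite)" "vertex_index (i :: 'd::finite) \<le> Suc CARD('d)" "vertex_index (i :: 'd::finite) \<noteq> Suc 0" "Suc 0 \<noteq> vertex_index (i :: 'd::finite)" "Suc 0 \<le> vertex_index (i :: 'd::finite)"
proof -
  have "vertex_index i \<in> {2..CARD('d) + 1}" using range_vertex_index[where 'd='d] by blast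
  then show "2 \<le> vertex_index i" "vertex_index i \<le> Suc CARD('d)" "vertex_index i \<noteq> Suc 0" "Suc 0 \<noteq> vertex_index i" "Suc 0 \<le> vertex_index i" by auto
qed

lemma atLeastAtMost_eq_insert_vertex_index: "{1..CARD('d::finite) + 1} = insert 1 (range (vertex_index :: 'd \<Rightarrow> nat))"
  unfolding range_vertex_index by auto

definition edge_mat :: "(nat \<Rightarrow> real ^ 'd::finite) \<Rightarrow> real ^ 'd ^ 'd" where
  "edge_mat X = (\<chi> r c. (X (vertex_index c) - X 1) $ r)"

lemma edge_mat_mult: "edge_mat X *v u = (\<Sum>c\<in>UNIV. u $ c *\<^sub>R (X (vertex_index c) - X 1))"
  by (simp add: vec_eq_iff edge_mat_def matrix_vector_mult_def mult.commute)

text \<open>The tangent cone at the face spanned by the vertices \<open>1, \<dots>, k\<close>: by Cramer's rule the product of the two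
  determinants has the sign of the coefficient of \<open>z\<close> at the \<open>i\<close>-th edge vector.\<close>

definition tcone :: "nat \<Rightarrow> (nat \<Rightarrow> real ^ 'd::finite) \<Rightarrow> (real ^ 'd) set" where
  "tcone k X = {z. \<forall>i. k < vertex_index i \<longrightarrow> 0 \<le> det (edge_mat X) * det (\<chi> r c. if c = i then z $ r else edge_mat X $ r $ c)}"

lemma tcone_iff:
  assumes "det (edge_mat X) \<noteq> 0"
  shows "edge_mat X *v u \<in> tcone k X \<longleftrightarrow> (\<forall>i. k < vertex_index i \<longrightarrow> 0 \<le> u $ i)"
proof -
  define D where "D i = det (\<chi> r c. if c = i then (edge_mat X *v u) $ r else edge_mat X $ r $ c)" for i
  have "u = (\<chi> i. D i / det (edge_mat X))"
    unfolding D_def by (rule cramer[OF assms, THEN iffD1]) (rule refl)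
  then have "u $ i = (\<chi> i. D i / det (edge_mat X)) $ i" for i by (rule arg_cong)
  then have "det (edge_mat X) * D i = (det (edge_mat X))\<^sup>2 * u $ i" for i
    using assms by (simp add: power2_eq_square)
  note eq = this
  have "edge_mat X *v u \<in> tcone k X \<longleftrightarrow> (\<forall>i. k < vertex_index i \<longrightarrow> 0 \<le> det (edge_mat X) * D i)"
    by (simp add: tcone_def D_def)
  then show ?thesis unfolding eq using assms by (simp add: zero_le_mult_iff)
qed

lemma inj_edge_mat: "det (edge_mat X) \<noteq> 0 \<Longrightarrow> inj ((*v) (edge_mat X))"
  by (simp add: inj_matrix_vector_mult invertible_det_nz)

lemma surj_edge_mat: "det (edge_mat X) \<noteq> 0 \<Longrightarrow> \<exists>u. z = edge_mat X *v u"
  using cramer[of "edge_mat X" _ z, THEN iffD2, OF _ refl] by metis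

lemma is_cone_tcone: "is_cone (tcone k X)" if "det (edge_mat X) \<noteq> 0"
proof -
  have "c *\<^sub>R z \<in> tcone k X" if "z \<in> tcone k X" "c > 0" for z c
  proof -
    obtain u where u: "z = edge_mat X *v u" using surj_edge_mat[OF \<open>det (edge_mat X) \<noteq> 0\<close>] by auto
    have "edge_mat X *v (c *\<^sub>R u) \<in> tcone k X"
      using that unfolding u tcone_iff[OF \<open>det (edge_mat X) \<noteq> 0\<close>] by auto
    then show ?thesis unfolding u by (simp add: matrix_vector_mult_scaleR)
  qed
  then show ?thesis by (auto simp: is_cone_def)
qed

lemma borel_measurable_det [measurable (raw)]:
  fixes A :: "'a \<Rightarrow> real ^ 'n::finite ^ 'n"
  assumes "\<And>i j. (\<lambda>x. A x $ i $ j) \<in> borel_measurable M"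
  shows "(\<lambda>x. det (A x)) \<in> borel_measurable M"
  unfolding det_def using assms by (intro borel_measurable_sum borel_measurable_times borel_measurable_prod) auto

lemma measurable_edge_mat:
  "(\<lambda>X. edge_mat X $ r $ c) \<in> borel_measurable (PiM {1..CARD('d::finite) + 1} (\<lambda>_. borel :: (real ^ 'd) measure))"
proof -
  have *: "1 \<in> {1..CARD('d) + 1}" "vertex_index c \<in> {1..CARD('d) + 1}" by auto
  have "(\<lambda>X. (X (vertex_index c) - X 1) $ r) \<in> borel_measurable (PiM {1..CARD('d::finite) + 1} (\<lambda>_. borel :: (real ^ 'd) measure))"
    by (intro measurable_compose[OF _ borel_measurable_nth] borel_measurable_diff measurable_component_singleton *)
  then show ?thesis unfolding edge_mat_def by simp
qed

lemma measurable_det_edge_mat [measurable]: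
  "(\<lambda>X. det (edge_mat X)) \<in> borel_measurable (PiM {1..CARD('d::finite) + 1} (\<lambda>_. borel :: (real ^ 'd) measure))"
  by (intro borel_measurable_det measurable_edge_mat)

lemma measurable_tcone:
  "Measurable.pred (PiM {1..CARD('d::finite) + 1} (\<lambda>_. borel :: (real ^ 'd) measure) \<Otimes>\<^sub>M borel) (\<lambda>(X, z). z \<in> tcone k X)"
proof -
  let ?P = "PiM {1..CARD('d) + 1} (\<lambda>_. borel :: (real ^ 'd) measure)"
  have [measurable]: "(\<lambda>(X, z). det (\<chi> r c. if c = i then z $ r else edge_mat X $ r $ c)) \<in> borel_measurable (?P \<Otimes>\<^sub>M borel)" for i
    unfolding case_prod_beta
  proof (intro borel_measurable_det)
    fix r c
    show "(\<lambda>x. (\<chi> r c. if c = i then snd x $ r else edge_mat (fst x) $ r $ c) $ r $ c) \<in> borel_measurable (?P \<Otimes>\<^sub>M borel)"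
    proof (cases "c = i")
      case False
      have "(\<lambda>x. edge_mat (fst x) $ r $ c) \<in> borel_measurable (?P \<Otimes>\<^sub>M (borel :: (real ^ 'd) measure))"
        by (rule measurable_compose[OF measurable_fst measurable_edge_mat])
      with False show ?thesis by simp
    next
      case True
      have "(\<lambda>x. snd x $ r) \<in> borel_measurable (?P \<Otimes>\<^sub>M (borel :: (real ^ 'd) measure))"
        by (rule measurable_compose[OF measurable_snd borel_measurable_nth])
      with True show ?thesis by simp
    qed
  qed
  show ?thesis unfolding tcone_def by measurable
qed

lemma sets_tcone [measurable]: "tcone k (X :: nat \<Rightarrow> real ^ 'd::finite) \<in> sets borel"
proof -
  have "(\<lambda>z. det (\<chi> r c. if c = i then z $ r else edge_mat X $ r $ c)) \<in> borel_measurable borel" for i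
  proof (intro borel_measurable_det)
    fix r c
    show "(\<lambda>z. (\<chi> r c. if c = i then z $ r else edge_mat X $ r $ c) $ r $ c) \<in> borel_measurable borel"
      by (cases "c = i") (auto intro: borel_measurable_nth)
  qed
  then show ?thesis unfolding tcone_def by measurable
qed

text \<open>Barycentric coordinates with the weight of vertex \<open>1\<close> eliminated; that
  weight is the slack in the inequality for the sum.\<close>

definition std_face :: "nat \<Rightarrow> (real ^ 'd::finite) set" where
  "std_face k = {u. (\<forall>i. 0 \<le> u $ i) \<and> (\<Sum>i\<in>UNIV. u $ i) \<le> 1 \<and> (\<forall>i. k < vertex_index i \<longrightarrow> u $ i = 0)}"

lemma convex_std_face: "convex (std_face k)"
proof (rule convexI)
  fix x y :: "real ^ 'd" and u v :: real
  assume *: "x \<in> std_face k" "y \<in> std_face k" "0 \<le> u" "0 \<le> v" "u + v = 1"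
  have "(\<Sum>i\<in>UNIV. (u *\<^sub>R x + v *\<^sub>R y) $ i) = u * (\<Sum>i\<in>UNIV. x $ i) + v * (\<Sum>i\<in>UNIV. y $ i)"
    by (simp add: sum.distrib sum_distrib_left)
  also have "\<dots> \<le> u * 1 + v * 1" using * by (intro add_mono mult_left_mono) (auto simp: std_face_def)
  finally show "u *\<^sub>R x + v *\<^sub>R y \<in> std_face k" using * by (auto simp: std_face_def)
qed

lemma convex_hull_face:
  fixes X :: "nat \<Rightarrow> real ^ 'd::finite"
  assumes k: "1 \<le> k" "k \<le> CARD('d) + 1"
  shows "convex hull (X ` {1..k}) = (\<lambda>u. X 1 + edge_mat X *v u) ` std_face k"
proof
  have cv: "convex ((\<lambda>u. X 1 + edge_mat X *v u) ` std_face k)"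
    using convex_translation[OF convex_linear_image[OF matrix_vector_mul_linear convex_std_face], of "X 1" "edge_mat X" k]
    by (simp add: image_image)
  show "convex hull (X ` {1..k}) \<subseteq> (\<lambda>u. X 1 + edge_mat X *v u) ` std_face k"
  proof (rule hull_minimal, rule subsetI)
    fix x assume "x \<in> X ` {1..k}"
    then obtain j where j: "j \<in> {1..k}" "x = X j" by auto
    show "x \<in> (\<lambda>u. X 1 + edge_mat X *v u) ` std_face k"
    proof (cases "j = 1")
      case True
      show ?thesis by (rule image_eqI[of _ _ 0]) (auto simp: j True std_face_def)
    next
      case False
      then have "j \<in> range (vertex_index :: 'd \<Rightarrow> nat)" using j k unfolding range_vertex_index by auto
      then obtain c :: 'd where c: "j = vertex_index c" by auto
      have "edge_mat X *v axis c 1 = X j - X 1"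
        by (simp add: matrix_vector_mult_basis c column_def edge_mat_def vec_eq_iff)
      moreover have "axis c 1 \<in> std_face k" using j c inj_vertex_index
        by (auto simp: std_face_def axis_def inj_eq[OF inj_vertex_index])
      ultimately show ?thesis by (intro image_eqI[of _ _ "axis c 1"]) (auto simp: j)
    qed
  qed (rule cv)
  show "(\<lambda>u. X 1 + edge_mat X *v u) ` std_face k \<subseteq> convex hull (X ` {1..k})"
  proof (rule image_subsetI)
    fix u :: "real ^ 'd" assume u: "u \<in> std_face k"
    define a where "a j = (if j = 1 then 1 - (\<Sum>i\<in>UNIV. u $ i) else u $ inv vertex_index j)" for j
    \<comment> \<open>Indices beyond the face carry coefficient \<open>0\<close>. Pointing them at
      \<open>X 1\<close> keeps every point inside the hull, so that the convex combination may run
      over all vertices.\<close>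
    define Y where "Y j = (if j \<le> k then X j else X 1)" for j
    have a_vertex_index: "a (vertex_index i) = u $ i" for i by (simp add: a_def inj_vertex_index)
    have sum_split: "(\<Sum>j\<in>{1..CARD('d) + 1}. g j) = g 1 + (\<Sum>i\<in>UNIV. g (vertex_index (i::'d)))"
      for g :: "nat \<Rightarrow> 'z::comm_monoid_add"
      unfolding atLeastAtMost_eq_insert_vertex_index by (subst sum.insert) (auto simp: sum.reindex[OF inj_vertex_index] o_def)
    have "(\<Sum>j\<in>{1..CARD('d) + 1}. a j *\<^sub>R Y j) \<in> convex hull (X ` {1..k})"
    proof (rule convex_sum)
      show "sum a {1..CARD('d) + 1} = 1" unfolding sum_split a_vertex_index by (simp add: a_def)
      show "0 \<le> a i" if "i \<in> {1..CARD('d) + 1}" for i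
        using u that unfolding atLeastAtMost_eq_insert_vertex_index by (auto simp: a_vertex_index std_face_def) (auto simp: a_def)
      show "Y i \<in> convex hull (X ` {1..k})" if "i \<in> {1..CARD('d) + 1}" for i
        using that k unfolding Y_def by (intro hull_inc) auto
    qed auto
    also have "(\<Sum>j\<in>{1..CARD('d) + 1}. a j *\<^sub>R Y j) = (1 - (\<Sum>i\<in>UNIV. u $ i)) *\<^sub>R X 1 + (\<Sum>i\<in>UNIV. u $ i *\<^sub>R X (vertex_index i))"
      unfolding sum_split a_vertex_index using u k
      by (intro arg_cong2[where f="(+)"] sum.cong refl) (auto simp: a_def Y_def std_face_def)
    also have "\<dots> = X 1 + edge_mat X *v u"
      unfolding edge_mat_mult by (simp add: algebra_simps sum_subtractf scaleR_sum_left)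
    finally show "X 1 + edge_mat X *v u \<in> convex hull (X ` {1..k})" .
  qed
qed

text \<open>A point is relatively interior if every segment reaching it from the face can be
  prolonged inside the face. Prolonging the segments that start at the vertices makes the
  inequalities strict.\<close>

lemma rel_interior_face:
  fixes X :: "nat \<Rightarrow> real ^ 'd::finite"
  assumes k: "1 \<le> k" "k \<le> CARD('d) + 1" and det: "det (edge_mat X) \<noteq> 0"
    and z: "z \<in> rel_interior (convex hull (X ` {1..k}))"
  obtains u where "z = X 1 + edge_mat X *v u" "\<And>i. vertex_index i \<le> k \<Longrightarrow> 0 < u $ i" "\<And>i. k < vertex_index i \<Longrightarrow> u $ i = 0"
    "(\<Sum>i\<in>UNIV. u $ i) < 1"
proof -
  let ?g = "\<lambda>u. X 1 + edge_mat X *v u"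
  let ?F = "convex hull (X ` {1..k})"
  have F: "?F = ?g ` std_face k" by (rule convex_hull_face[OF k])
  have inj: "?g v = ?g w \<Longrightarrow> v = w" for v w using inj_edge_mat[OF det] by (auto simp: inj_def)
  have zF: "z \<in> ?F" using z rel_interior_subset by blast
  then obtain u where u: "z = ?g u" "u \<in> std_face k" unfolding F by auto
  have ne: "?F \<noteq> {}" using zF by blast
  have step: "\<exists>e>1. (1 - e) *\<^sub>R v + e *\<^sub>R u \<in> std_face k" if v: "v \<in> std_face k" for v
  proof -
    have "?g v \<in> ?F" using v unfolding F by auto
    then obtain e where e: "e > 1" "(1 - e) *\<^sub>R ?g v + e *\<^sub>R z \<in> ?F"
      using z convex_rel_interior_iff[OF convex_convex_hull ne] by blast
    have "(1 - e) *\<^sub>R ?g v + e *\<^sub>R z = ?g ((1 - e) *\<^sub>R v + e *\<^sub>R u)"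
      by (simp add: u algebra_simps matrix_vector_right_distrib matrix_vector_mult_scaleR)
    then have "?g ((1 - e) *\<^sub>R v + e *\<^sub>R u) \<in> ?g ` std_face k" using e unfolding F by simp
    then show ?thesis using inj e by blast
  qed
  have pos: "0 < u $ i" if i: "vertex_index i \<le> k" for i
  proof -
    \<comment> \<open>Coming from the vertex with index \<open>vertex_index i\<close>, coordinate
      \<open>i\<close> of the prolonged point is \<open>(1 - e) + e * u $ i\<close>; it must stay
      nonnegative although \<open>1 - e < 0\<close>.\<close>
    have "axis i 1 \<in> std_face k" using i inj_vertex_index by (auto simp: std_face_def axis_def inj_eq[OF inj_vertex_index])
    from step[OF this] obtain e where e: "e > 1" "(1 - e) *\<^sub>R axis i 1 + e *\<^sub>R u \<in> std_face k" by auto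
    have "0 \<le> ((1 - e) *\<^sub>R axis i 1 + e *\<^sub>R u) $ i" using e unfolding std_face_def by blast
    then have "0 < e * u $ i" using e(1) by simp
    then show ?thesis using e(1) by (simp add: zero_less_mult_iff)
  qed
  \<comment> \<open>The coordinate vector \<open>0\<close> is vertex \<open>1\<close>; prolonging
    from it bounds \<open>e\<close> times the coordinate sum by \<open>1\<close>.\<close>
  have "0 \<in> std_face k" by (auto simp: std_face_def)
  from step[OF this] obtain e where e: "e > 1" "e *\<^sub>R u \<in> std_face k" by auto
  then have "e * (\<Sum>i\<in>UNIV. u $ i) \<le> 1" by (auto simp: std_face_def sum_distrib_left)
  then have "(\<Sum>i\<in>UNIV. u $ i) < 1" using e(1)
    by (smt (verit) mult_le_cancel_left1 mult_left_mono)
  with pos u show ?thesis by (intro that[of u]) (auto simp: std_face_def)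
qed

text \<open>Near a relatively interior point of the face the simplex coincides with a translate of
  the tangent cone, and cones scale. The quotient of volumes is thus already constant for small
  radii, and the point picked by \<open>SOME\<close> is immaterial.\<close>

lemma internal_angle_eq:
  fixes X :: "nat \<Rightarrow> real ^ 'd::finite"
  assumes k: "1 \<le> k" "k \<le> CARD('d) + 1" and det: "det (edge_mat X) \<noteq> 0"
  shows "internal_angle (convex hull (X ` {1..k})) (convex hull (X ` {1..CARD('d) + 1}))
     = measure lborel (ball 0 1 \<inter> tcone k X) / measure lborel (ball (0 :: real ^ 'd) 1)"
proof -
  let ?g = "\<lambda>u. X 1 + edge_mat X *v u"
  let ?F = "convex hull (X ` {1..k})" and ?T = "convex hull (X ` {1..CARD('d) + 1})"
  let ?K = "tcone k X"
  define z where "z = (SOME z. z \<in> rel_interior ?F)"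
  have "?F \<noteq> {}" using k by auto
  then have "rel_interior ?F \<noteq> {}" by (simp add: rel_interior_eq_empty)
  then have z: "z \<in> rel_interior ?F" unfolding z_def by (simp add: some_in_eq)
  obtain u where u: "z = ?g u" "\<And>i. vertex_index i \<le> k \<Longrightarrow> 0 < u $ i" "\<And>i. k < vertex_index i \<Longrightarrow> u $ i = 0"
    "(\<Sum>i\<in>UNIV. u $ i) < 1"
    using rel_interior_face[OF k det z] by metis
  \<comment> \<open>Displacements, in edge coordinates, that preserve every inequality strict at
    \<open>u\<close>. Within \<open>S\<close> only the constraints beyond \<open>k\<close>, tight at
    \<open>u\<close>, remain visible.\<close>
  define S where "S = {v::real^'d. (\<Sum>i\<in>UNIV. u $ i + v $ i) < 1} \<inter> (\<Inter>i\<in>{i. vertex_index i \<le> k}. {v. 0 < u $ i + v $ i})"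
  have "open S" unfolding S_def
    by (intro open_Int open_INT open_Collect_less continuous_intros ballI) auto
  moreover have "0 \<in> S" using u by (auto simp: S_def)
  ultimately obtain e where e: "e > 0" "ball 0 e \<subseteq> S" using open_contains_ball by blast
  \<comment> \<open>\<open>B\<close> converts a bound on a displacement into one on its edge
    coordinates, so displacements shorter than \<open>B * e\<close> have coordinates in
    \<open>S\<close>.\<close>
  obtain B where B: "B > 0" "\<And>v. B * norm v \<le> norm (edge_mat X *v v)"
    using linear_inj_bounded_below_pos[OF matrix_vector_mul_linear inj_edge_mat[OF det]] by blast
  have T: "?T = ?g ` std_face (CARD('d) + 1)" by (rule convex_hull_face) auto
  have inj: "?g v = ?g w \<Longrightarrow> v = w" for v w using inj_edge_mat[OF det] by (auto simp: inj_def)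
  have mem: "z + w \<in> ?T \<longleftrightarrow> w \<in> ?K" if w: "norm w < B * e" for w
  proof -
    obtain v where v: "w = edge_mat X *v v" using surj_edge_mat[OF det] by auto
    have "B * norm v < B * e" using B(2)[of v] w unfolding v by simp
    then have "v \<in> S" using B(1) e(2) by auto
    have "z + w = ?g (u + v)" by (simp add: u v matrix_vector_right_distrib)
    then have "z + w \<in> ?T \<longleftrightarrow> u + v \<in> std_face (CARD('d) + 1)" unfolding T \<open>z + w = _\<close> using inj by blast
    also have "\<dots> \<longleftrightarrow> (\<forall>i. 0 \<le> u $ i + v $ i)"
    proof -
      have "(\<Sum>i\<in>UNIV. (u + v) $ i) \<le> 1" using \<open>v \<in> S\<close> by (auto simp: S_def)
      moreover have "\<not> CARD('d) + 1 < vertex_index i" for i :: 'd using vertex_index_bounds(2)[of i] by linarith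
      ultimately show ?thesis by (simp add: std_face_def)
    qed
    also have "\<dots> \<longleftrightarrow> (\<forall>i. k < vertex_index i \<longrightarrow> 0 \<le> v $ i)"
    proof -
      have "0 \<le> u $ i + v $ i" if "\<not> k < vertex_index i" for i using \<open>v \<in> S\<close> that by (auto simp: S_def intro: less_imp_le)
      then show ?thesis using u(3) by (metis add_0)
    qed
    also have "\<dots> \<longleftrightarrow> w \<in> ?K" unfolding v by (rule tcone_iff[OF det, symmetric])
    finally show ?thesis .
  qed
  have eq: "measure lborel (ball z r \<inter> ?T) / measure lborel (ball z r) =
      measure lborel (ball 0 1 \<inter> ?K) / measure lborel (ball (0 :: real ^ 'd) 1)" if r: "0 < r" "r < B * e" for r
  proof -
    have "ball z r \<inter> ?T = (+) z ` (ball 0 r \<inter> ?K)"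
    proof (intro set_eqI iffI)
      fix x assume x: "x \<in> ball z r \<inter> ?T"
      then have "norm (x - z) < r" by (simp add: dist_norm norm_minus_commute)
      then have "x - z \<in> ball 0 r \<inter> ?K" using mem[of "x - z"] x r by simp
      then show "x \<in> (+) z ` (ball 0 r \<inter> ?K)" by (intro image_eqI[of _ _ "x - z"]) auto
    next
      fix x assume "x \<in> (+) z ` (ball 0 r \<inter> ?K)"
      then obtain w where w: "x = z + w" "norm w < r" "w \<in> ?K" by auto
      then show "x \<in> ball z r \<inter> ?T" using mem[of w] r by (simp add: dist_norm)
    qed
    note im = this
    have "compact ?T" by (intro compact_convex_hull finite_imp_compact) auto
    then have "ball z r \<inter> ?T \<in> sets borel" by (intro sets.Int[OF borel_open[OF open_ball] borel_closed] compact_imp_closed)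
    then have "measure lborel (ball z r \<inter> ?T) = measure lebesgue (ball z r \<inter> ?T)" by (simp add: measure_completion)
    also have "\<dots> = measure lebesgue ((+) z ` (ball 0 r \<inter> ?K))" unfolding im ..
    also have "\<dots> = measure lebesgue (ball 0 r \<inter> ?K)" by (rule measure_translation)
    also have "\<dots> = measure lborel (ball 0 r \<inter> ?K)" by (intro measure_completion) auto
    also have "\<dots> = r ^ DIM(real ^ 'd) * measure lborel (ball 0 1 \<inter> ?K)"
      using r unfolding measure_def emeasure_ball_Int_cone[OF sets_tcone is_cone_tcone[OF det] r(1)]
      by (simp add: enn2real_mult)
    finally have 1: "measure lborel (ball z r \<inter> ?T) = r ^ DIM(real ^ 'd) * measure lborel (ball 0 1 \<inter> ?K)" .
    have 2: "measure lborel (ball z r) = r ^ DIM(real ^ 'd) * measure lborel (ball (0 :: real ^ 'd) 1)"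
      using r by (simp add: content_ball)
    show ?thesis unfolding 1 2 using r by simp
  qed
  have "eventually (\<lambda>r. 0 < r \<and> r < B * e) (at_right 0)"
    using B e by (intro eventually_conj eventually_at_right_less eventually_at_rightI[of 0 "B * e"]) auto
  then have "((\<lambda>r. measure lborel (ball z r \<inter> ?T) / measure lborel (ball z r)) \<longlongrightarrow>
      measure lborel (ball 0 1 \<inter> ?K) / measure lborel (ball (0 :: real ^ 'd) 1)) (at_right 0)"
    by (rule tendsto_eventually[OF eventually_mono]) (use eq in blast)
  then show ?thesis unfolding internal_angle_def Let_def z_def[symmetric]
    by (intro tendsto_Lim) auto
qed

section \<open>Degenerate simplices form a null set\<close>

lemma det_replace_column:
  fixes A :: "real ^ 'n::finite ^ 'n"
  obtains v where "\<And>y. det (\<chi> r c. if c = i then y $ r else A $ r $ c) = v \<bullet> y"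
    "\<And>j. v $ j = det (\<chi> r c. if c = i then axis j 1 $ r else A $ r $ c)"
proof -
  define f where "f y = det (\<chi> r c. if c = i then y $ r else A $ r $ c)" for y :: "real ^ 'n"
  \<comment> \<open>Transposition moves the replaced column into a row, where additivity and
    homogeneity of \<open>det\<close> are available.\<close>
  have f: "f y = det (\<chi> r. if r = i then y else transpose A $ r)" for y
    unfolding f_def by (subst det_transpose[symmetric]) (auto intro!: arg_cong[where f=det] simp: transpose_def vec_eq_iff)
  have sc: "c *s x = c *\<^sub>R x" for c and x :: "real ^ 'n" by (simp add: vec_eq_iff)
  have "linear f"
  proof (rule linearI)
    show "f (x + y) = f x + f y" for x y unfolding f by (rule det_row_add)
    show "f (c *\<^sub>R x) = c *\<^sub>R f x" for c x
      unfolding f sc[symmetric] using det_row_mul[of i c "\<lambda>_. x" "\<lambda>r. transpose A $ r"] by simp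
  qed
  then have lin: "f y = (\<chi> j. f (axis j 1)) \<bullet> y" for y
    by (subst basis_expansion[of y, symmetric])
       (simp add: linear_sum sc linear_scale inner_vec_def mult.commute)
  show ?thesis
  proof (rule that)
    show "det (\<chi> r c. if c = i then y $ r else A $ r $ c) = (\<chi> j. f (axis j 1)) \<bullet> y" for y
      unfolding f_def[symmetric] by (rule lin)
    show "(\<chi> j. f (axis j 1)) $ j = det (\<chi> r c. if c = i then axis j 1 $ r else A $ r $ c)" for j
      unfolding f_def[symmetric] by simp
  qed
qed

text \<open>Start from the identity matrix and insert the edge columns one at a time. Inserting
  column \<open>i\<close> makes the determinant an affine function of the single point with index
  \<open>vertex_index i\<close>, and coordinate \<open>i\<close> of its normal vector is the
  previous determinant. Where that is nonzero, a vanishing new determinant confines the point to a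
  hyperplane.\<close>

lemma AE_det_edge_mat:
  fixes M :: "(real ^ 'd::finite) measure"
  assumes "prob_space M" and M [measurable_cong, simp]: "sets M = sets borel"
    and hyp: "\<And>a c. a \<noteq> 0 \<Longrightarrow> emeasure M {x. a \<bullet> x = c} = 0"
  shows "AE X in PiM {1..CARD('d) + 1} (\<lambda>_. M). det (edge_mat X) \<noteq> 0"
proof -
  let ?I = "{1..CARD('d) + 1}"
  let ?P = "PiM ?I (\<lambda>_. M)"
  interpret M: prob_space M by fact
  interpret P: product_sigma_finite "\<lambda>_. M" by standard
  have sp: "space M = UNIV" using sets_eq_imp_space_eq[OF M] by simp
  have setsP [measurable_cong]: "sets (PiM I (\<lambda>_. M)) = sets (PiM I (\<lambda>_. borel))" for I :: "nat set"
    by (intro sets_PiM_cong) auto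
  define A where "A S X = (\<chi> r c. if c \<in> S then edge_mat X $ r $ c else axis c 1 $ r)"
    for S :: "'d set" and X :: "nat \<Rightarrow> real ^ 'd"
  have meas [measurable]: "(\<lambda>X. det (A S X)) \<in> borel_measurable ?P" for S
  proof (intro borel_measurable_det)
    fix r c show "(\<lambda>X. A S X $ r $ c) \<in> borel_measurable ?P"
      using measurable_edge_mat[of r c] unfolding measurable_cong_sets[OF setsP refl]
      by (cases "c \<in> S") (auto simp: A_def)
  qed
  define m where "m S = (\<integral>\<^sup>+X. indicator {X. det (A S X) = 0} X \<partial>?P)" for S
  have "m S = 0" for S :: "'d set"
  proof (induction S rule: finite_induct[OF finite])
    case 1
    have "A {} X = mat 1" for X by (simp add: A_def mat_def vec_eq_iff axis_def)
    then show ?case by (simp add: m_def det_I)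
  next
    case (2 i S)
    let ?J = "?I - {vertex_index i}"
    have I: "?I = insert (vertex_index i) ?J" using vertex_index_bounds[of i] by auto
    have split: "m S' = (\<integral>\<^sup>+X. \<integral>\<^sup>+y. indicator {X. det (A S' X) = 0} (X(vertex_index i := y)) \<partial>M \<partial>PiM ?J (\<lambda>_. M))" for S'
    proof -
      have "(\<lambda>X. indicator {X. det (A S' X) = 0} X :: ennreal) \<in> borel_measurable ?P"
        using meas[of S'] by (auto simp: indicator_def intro!: measurable_If)
      then show ?thesis unfolding m_def by (subst I, subst P.product_nn_integral_insert) (use I in auto)
    qed
    \<comment> \<open>It is enough to compare inner integrals. If the old determinant vanishes, the
      right-hand indicator is constantly \<open>1\<close>; otherwise the left side is the mass of a
      hyperplane.\<close>
    have "m (insert i S) \<le> m S" unfolding split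
    proof (rule nn_integral_mono)
      fix X
      have rest: "edge_mat (X(vertex_index i := y)) $ r $ c = edge_mat X $ r $ c" if "c \<noteq> i" for r c y
        using that by (auto simp: edge_mat_def inj_eq[OF inj_vertex_index])
      obtain v where v: "\<And>y. det (\<chi> r c. if c = i then y $ r else A S X $ r $ c) = v \<bullet> y"
          "\<And>j. v $ j = det (\<chi> r c. if c = i then axis j 1 $ r else A S X $ r $ c)"
        using det_replace_column[of i "A S X"] by blast
      have "A (insert i S) (X(vertex_index i := y)) = (\<chi> r c. if c = i then (y - X 1) $ r else A S X $ r $ c)" for y
        using rest 2 by (auto simp: A_def vec_eq_iff edge_mat_def inj_eq[OF inj_vertex_index])
      then have det1: "det (A (insert i S) (X(vertex_index i := y))) = v \<bullet> y - v \<bullet> X 1" for y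
        using v(1)[of "y - X 1"] by (simp add: inner_diff_right)
      have "A S (X(vertex_index i := y)) = (\<chi> r c. if c = i then axis i 1 $ r else A S X $ r $ c)" for y
        using rest 2 by (auto simp: A_def vec_eq_iff)
      then have det2: "det (A S (X(vertex_index i := y))) = v $ i" for y using v(2)[of i] by simp
      show "(\<integral>\<^sup>+y. indicator {X. det (A (insert i S) X) = 0} (X(vertex_index i := y)) \<partial>M)
         \<le> (\<integral>\<^sup>+y. indicator {X. det (A S X) = 0} (X(vertex_index i := y)) \<partial>M)"
      proof (cases "v $ i = 0")
        case True
        then show ?thesis by (intro nn_integral_mono) (auto simp: det2 indicator_def)
      next
        case False
        then have "v \<noteq> 0" by auto
        have "(\<integral>\<^sup>+y. indicator {X. det (A (insert i S) X) = 0} (X(vertex_index i := y)) \<partial>M)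
          = (\<integral>\<^sup>+y. indicator {y. v \<bullet> y = v \<bullet> X 1} y \<partial>M)"
          by (intro nn_integral_cong) (auto simp: det1 indicator_def)
        also have "\<dots> = 0" using hyp[OF \<open>v \<noteq> 0\<close>] by (subst nn_integral_indicator) auto
        finally show ?thesis by simp
      qed
    qed
    with 2 show ?case by simp
  qed
  then have "m UNIV = 0" .
  moreover have "A UNIV X = edge_mat X" for X by (simp add: A_def vec_eq_iff)
  ultimately have "(\<integral>\<^sup>+X. indicator {X. det (edge_mat X) = 0} X \<partial>?P) = 0" by (simp add: m_def)
  moreover have "(\<lambda>X. indicator {X. det (edge_mat X) = 0} X :: ennreal) \<in> borel_measurable ?P"
    using meas[of UNIV] \<open>\<And>X. A UNIV X = edge_mat X\<close> by (auto simp: indicator_def intro!: measurable_If)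
  ultimately have "AE X in ?P. indicator {X. det (edge_mat X) = 0} X = (0::ennreal)"
    by (subst (asm) nn_integral_0_iff_AE) auto
  then show ?thesis by eventually_elim (auto simp: indicator_def split: if_splits)
qed

lemma finite_quadratic_roots:
  fixes A B C :: real assumes "A \<noteq> 0"
  shows "finite {t. A * t\<^sup>2 + B * t + C = 0}"
proof -
  have "finite {t. poly [:C, B, A:] t = 0}" using assms by (intro poly_roots_finite) auto
  then show ?thesis by (rule rev_finite_subset) (auto simp: power2_eq_square algebra_simps)
qed

text \<open>By translation invariance the measure is an average over \<open>t\<close> in
  \<open>[0, 1]\<close> of the measures of translates along \<open>v\<close>. After Fubini each line
  contributes a finite set of parameters, hence nothing.\<close>

lemma null_of_finite_lines:
  fixes Q :: "'a::euclidean_space set"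
  assumes [measurable]: "Q \<in> sets borel" and fin: "\<And>x. finite {t. x + t *\<^sub>R v \<in> Q}"
  shows "emeasure lborel Q = 0"
proof -
  have "emeasure lborel Q = (\<integral>\<^sup>+t. emeasure lborel Q * indicator {0..1::real} t \<partial>lborel)"
    by (simp add: nn_integral_cmult)
  also have "\<dots> = (\<integral>\<^sup>+t. \<integral>\<^sup>+x. indicator Q (x + t *\<^sub>R v) * indicator {0..1::real} t \<partial>lborel \<partial>lborel)"
  proof (rule nn_integral_cong)
    fix t :: real
    have "(\<integral>\<^sup>+x. indicator Q (x + t *\<^sub>R v) \<partial>lborel) = (\<integral>\<^sup>+x. indicator Q x \<partial>distr lborel borel ((+) (t *\<^sub>R v)))"
      by (subst nn_integral_distr) (auto simp: add.commute)
    also have "\<dots> = emeasure lborel Q" by (simp add: lborel_distr_plus)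
    finally show "emeasure lborel Q * indicator {0..1::real} t = (\<integral>\<^sup>+x. indicator Q (x + t *\<^sub>R v) * indicator {0..1::real} t \<partial>lborel)"
      by (subst nn_integral_multc) auto
  qed
  also have "\<dots> = (\<integral>\<^sup>+x. \<integral>\<^sup>+t. indicator Q (x + t *\<^sub>R v) * indicator {0..1::real} t \<partial>lborel \<partial>lborel)"
    by (rule lborel_pair.Fubini') measurable
  also have "\<dots> = (\<integral>\<^sup>+(x::'a). 0 \<partial>lborel)"
  proof (rule nn_integral_cong)
    fix x :: 'a
    have "AE t in lborel. t \<notin> {t. x + t *\<^sub>R v \<in> Q}"
      by (intro AE_not_in finite_imp_null_set_lborel fin)
    then have "(\<integral>\<^sup>+t. indicator Q (x + t *\<^sub>R v) * indicator {0..1::real} t \<partial>lborel) = (\<integral>\<^sup>+(t::real). 0 \<partial>lborel)"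
      by (intro nn_integral_cong_AE) (auto simp: indicator_def)
    then show "(\<integral>\<^sup>+t. indicator Q (x + t *\<^sub>R v) * indicator {0..1::real} t \<partial>lborel) = 0" by simp
  qed
  finally show ?thesis by simp
qed

lemma emeasure_hyperplane_null:
  fixes a :: "'a::euclidean_space" assumes "a \<noteq> 0"
  shows "emeasure lborel {x. a \<bullet> x = c} = 0"
proof (rule null_of_finite_lines[where v=a])
  fix x
  have "{t. x + t *\<^sub>R a \<in> {x. a \<bullet> x = c}} \<subseteq> {(c - a \<bullet> x) / (a \<bullet> a)}"
    using assms by (auto simp: inner_add_right field_simps)
  then show "finite {t. x + t *\<^sub>R a \<in> {x. a \<bullet> x = c}}" by (rule finite_subset) simp
qed measurable

text \<open>Along a direction \<open>v\<close> orthogonal to \<open>a\<close> the left side is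
  constant, while the squared norm is quadratic in \<open>t\<close> with leading coefficient
  \<open>v \<bullet> v\<close>. In dimension one there is no such \<open>v\<close>, and the set can
  be a half-line.\<close>

lemma emeasure_cone_surface_null:
  fixes a :: "'a::euclidean_space" assumes a: "a \<noteq> 0" and d: "2 \<le> DIM('a)"
  shows "emeasure lborel {x. a \<bullet> x = c * norm x} = 0"
proof (cases "c = 0")
  case True
  then show ?thesis using emeasure_hyperplane_null[OF a, of 0] by simp
next
  case False
  obtain v where v: "v \<noteq> 0" "orthogonal a v" using orthogonal_to_vector_exists[OF d] by metis
  show ?thesis
  proof (rule null_of_finite_lines[where v=v])
    fix x
    have "{t. x + t *\<^sub>R v \<in> {x. a \<bullet> x = c * norm x}} \<subseteq>
       {t. (v \<bullet> v) * t\<^sup>2 + (2 * (x \<bullet> v)) * t + (x \<bullet> x - (a \<bullet> x / c)\<^sup>2) = 0}"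
    proof safe
      fix t assume "a \<bullet> (x + t *\<^sub>R v) = c * norm (x + t *\<^sub>R v)"
      then have "norm (x + t *\<^sub>R v) = a \<bullet> x / c"
        using v(2) False by (simp add: inner_add_right orthogonal_def field_simps)
      then have "(x + t *\<^sub>R v) \<bullet> (x + t *\<^sub>R v) = (a \<bullet> x / c)\<^sup>2" by (simp add: power2_norm_eq_inner[symmetric])
      then show "(v \<bullet> v) * t\<^sup>2 + (2 * (x \<bullet> v)) * t + (x \<bullet> x - (a \<bullet> x / c)\<^sup>2) = 0"
        by (simp add: inner_add_left inner_add_right inner_commute power2_eq_square algebra_simps)
    qed
    then show "finite {t. x + t *\<^sub>R v \<in> {x. a \<bullet> x = c * norm x}}"
      by (rule finite_subset) (use v in \<open>auto intro!: finite_quadratic_roots\<close>)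
  qed measurable
qed

text \<open>On the sphere, a hyperplane pulls back under radial projection to a conical surface in
  the ball. The one-dimensional sphere is excluded because it consists of two atoms.\<close>

lemma beta_dist_hyperplane_null:
  fixes a :: "real ^ 'd::finite"
  assumes b: "b > -1 \<or> b = -1 \<and> 2 \<le> CARD('d)" and a: "a \<noteq> 0"
  shows "emeasure (beta_dist b) {x. a \<bullet> x = c} = 0"
proof (cases "b = -1")
  case False
  have [measurable]: "ball (0 :: real ^ 'd) 1 \<in> sets borel" by simp
  have [measurable]: "(\<lambda>x::real^'d. ennreal (beta_const CARD('d) b * (1 - (norm x)\<^sup>2) powr b * indicator (ball 0 1) x)) \<in> borel_measurable borel"
    by measurable
  have "emeasure (beta_dist b) {x. a \<bullet> x = c} = 
    (\<integral>\<^sup>+x. ennreal (beta_const CARD('d) b * (1 - (norm x)\<^sup>2) powr b * indicator (ball 0 1) x) * indicator {x. a \<bullet> x = c} x \<partial>lborel)"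
    using False unfolding beta_dist_def by (simp, subst emeasure_density) auto
  also have "\<dots> = 0"
  proof (subst nn_integral_0_iff_AE)
    have "AE x in lborel. x \<notin> {x. a \<bullet> x = c}"
      using emeasure_hyperplane_null[OF a] by (intro AE_not_in null_setsI) auto
    then show "AE x in lborel. ennreal (beta_const CARD('d) b * (1 - (norm x)\<^sup>2) powr b * indicator (ball 0 1) x) * indicator {x. a \<bullet> x = c} x = 0"
      by eventually_elim auto
  qed measurable
  finally show ?thesis .
next
  case True
  then have d: "2 \<le> DIM(real ^ 'd)" using b by simp
  let ?S = "{x. a \<bullet> (x /\<^sub>R norm x) = c}"
  have "emeasure (beta_dist b) {x. a \<bullet> x = c} = emeasure (uniform_measure lborel (ball 0 1)) ?S"
    using True by (simp add: beta_dist_def emeasure_distr)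
  also have "\<dots> = emeasure lborel (ball 0 1 \<inter> ?S) / emeasure lborel (ball (0::real^'d) 1)"
    by (subst emeasure_uniform_measure) auto
  also have "emeasure lborel (ball 0 1 \<inter> ?S) = 0"
  proof -
    have "emeasure lborel (ball 0 1 \<inter> ?S) \<le> emeasure lborel ({x. a \<bullet> x = c * norm x} \<union> {0})"
      by (intro emeasure_mono) (auto simp: field_simps)
    also have "\<dots> \<le> emeasure lborel {x. a \<bullet> x = c * norm x} + emeasure lborel {0 :: real ^ 'd}"
      by (intro emeasure_subadditive) auto
    also have "\<dots> = 0" using emeasure_cone_surface_null[OF a d] by simp
    finally show ?thesis by simp
  qed
  finally show ?thesis by simp
qed

section \<open>Sections of beta weights\<close>

text \<open>A function of the squared norm, so that one weight serves in all dimensions and on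
  sections; the cut-off keeps \<open>powr\<close> away from negative bases.\<close>

definition beta_weight :: "real \<Rightarrow> real \<Rightarrow> real" where
  "beta_weight b s = (if s < 1 then (1 - s) powr b else 0)"

lemma beta_weight_nonneg [simp]: "0 \<le> beta_weight b s" by (simp add: beta_weight_def)

lemma borel_measurable_beta_weight [measurable]: "beta_weight b \<in> borel_measurable borel"
  unfolding beta_weight_def[abs_def] by measurable

lemma beta_weight_ge_1: "1 \<le> s \<Longrightarrow> beta_weight b s = 0" by (simp add: beta_weight_def)

text \<open>Affine maps fixing \<open>s = 1\<close> multiply \<open>1 - s\<close> by a constant.
  This self-similarity is the reason why sections of a beta weight are beta weights with the same
  exponent.\<close>

lemma beta_weight_affine:
  assumes "h < 1" shows "beta_weight b (h + (1 - h) * s) = (1 - h) powr b * beta_weight b s"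
proof -
  have "1 - (h + (1 - h) * s) = (1 - h) * (1 - s)" by (simp add: algebra_simps)
  moreover from this have "h + (1 - h) * s < 1 \<longleftrightarrow> s < 1" using assms
    by (smt (verit) mult_pos_pos mult_nonneg_nonpos)
  ultimately show ?thesis using assms by (simp add: beta_weight_def powr_mult)
qed

text \<open>The inverse square root of \<open>I + a a\<^sup>T\<close>: it carries the ball onto the projection of a central
  section of the ball by the graph of \<open>y \<mapsto> a \<bullet> y\<close>.\<close>

definition section_mat :: "real ^ 'n::finite \<Rightarrow> real ^ 'n ^ 'n" where
  "section_mat a = (\<chi> i j. of_bool (i = j) - a $ i * a $ j / ((1 + a \<bullet> a) + sqrt (1 + a \<bullet> a)))"

lemma section_mat_mult: "section_mat a *v x = x - (a \<bullet> x / ((1 + a \<bullet> a) + sqrt (1 + a \<bullet> a))) *\<^sub>R a"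
proof -
  define w where "w = (1 + a \<bullet> a) + sqrt (1 + a \<bullet> a)"
  have "(\<Sum>j\<in>UNIV. (of_bool (i = j) - a $ i * a $ j / w) * x $ j) = x $ i - a \<bullet> x / w * a $ i" for i
  proof -
    have "(\<Sum>j\<in>UNIV. (of_bool (i = j) - a $ i * a $ j / w) * x $ j)
        = (\<Sum>j\<in>UNIV. (if i = j then x $ j else 0) - a $ i / w * (a $ j * x $ j))"
      by (intro sum.cong refl) (auto simp: left_diff_distrib)
    also have "\<dots> = x $ i - a $ i / w * (a \<bullet> x)"
      unfolding sum_subtractf sum_distrib_left[symmetric] by (simp add: inner_vec_def)
    finally show ?thesis by simp
  qed
  then show ?thesis unfolding w_def by (simp add: vec_eq_iff section_mat_def matrix_vector_mult_def)
qed

lemma section_mat_norm: "(norm (section_mat a *v x))\<^sup>2 + (a \<bullet> (section_mat a *v x))\<^sup>2 = (norm x)\<^sup>2"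
proof -
  define N where "N = a \<bullet> a"
  define s where "s = sqrt (1 + N)"
  define p where "p = a \<bullet> x"
  have N: "N \<ge> 0" by (simp add: N_def)
  have s: "s > 0" "s\<^sup>2 = 1 + N" using N by (auto simp: s_def)
  \<comment> \<open>Chosen so that \<open>1 - w * N = 1 / s\<close>: the matrix has eigenvalue
    \<open>1 / s\<close> along \<open>a\<close>, where \<open>I + a a^T\<close> has eigenvalue
    \<open>s\<^sup>2\<close>.\<close>
  define w where "w = 1 / (s * (s + 1))"
  have w: "1 / ((1 + a \<bullet> a) + sqrt (1 + a \<bullet> a)) = w"
    unfolding w_def N_def[symmetric] s_def[symmetric] using s by (simp add: power2_eq_square algebra_simps)
  have Bx: "section_mat a *v x = x - (p * w) *\<^sub>R a"
    unfolding section_mat_mult w[symmetric] p_def by simp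
  have 1: "(norm (section_mat a *v x))\<^sup>2 = (norm x)\<^sup>2 - 2 * (p * w) * p + (p * w)\<^sup>2 * N"
    unfolding Bx power2_norm_eq_inner
    by (simp add: inner_diff_left inner_diff_right inner_commute[of x a] p_def[symmetric] N_def[symmetric]
        power2_eq_square algebra_simps)
  have 2: "a \<bullet> (section_mat a *v x) = p - p * w * N"
    unfolding Bx by (simp add: inner_diff_right p_def N_def)
  have ws: "w * (s + 1) = 1 / s" using s by (simp add: w_def)
  have "s * s = 1 + N" using s(2) by (simp add: power2_eq_square)
  then have "N = (s + 1) * (s - 1)" by (simp add: algebra_simps)
  then have wN: "w * N = (1 / s) * (s - 1)" by (simp add: ws[symmetric])
  have one: "1 - w * N = 1 / s" unfolding wN using s by (simp add: field_simps)
  have "- 2 * w + w * (w * N) + (1 - w * N)\<^sup>2 = w * (w * N - 2) + (1 / s) * (1 / s)"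
    unfolding one by (simp add: power2_eq_square algebra_simps)
  also have "w * N - 2 = - (s + 1) * (1 / s)" unfolding wN using s by (simp add: field_simps)
  also have "w * (- (s + 1) * (1 / s)) = - (w * (s + 1)) * (1 / s)"
    by (simp only: mult_minus_left mult_minus_right mult.assoc)
  finally have zero: "- 2 * w + w * (w * N) + (1 - w * N)\<^sup>2 = 0" unfolding ws by simp
  have "(norm (section_mat a *v x))\<^sup>2 + (a \<bullet> (section_mat a *v x))\<^sup>2
     = (norm x)\<^sup>2 + p\<^sup>2 * (- 2 * w + w * (w * N) + (1 - w * N)\<^sup>2)"
    unfolding 1 2 by (simp add: power2_eq_square algebra_simps)
  then show ?thesis unfolding zero by simp
qed

lemma det_section_mat: "det (section_mat a) \<noteq> 0"
proof -
  have "x = 0" if "section_mat a *v x = 0" for x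
    using section_mat_norm[of a x] that by simp
  then have "inj ((*v) (section_mat a))"
    by (simp add: linear_injective_0[OF matrix_vector_mul_linear])
  then show ?thesis by (metis invertible_det_nz invertible_left_inverse matrix_left_invertible_injective inj_def)
qed

text \<open>\<open>y0\<close> lies below the point of the graph closest to the origin, and
  \<open>h\<close> is the squared distance of that point. Measured from there the squared norm
  splits by Pythagoras, and \<open>section_mat\<close> turns the metric of the graph into the
  standard one.\<close>

lemma section_norm:
  fixes a y :: "real ^ 'n::finite" and c \<rho> :: real
  defines "h \<equiv> c\<^sup>2 / (1 + a \<bullet> a)" and "y0 \<equiv> (- c / (1 + a \<bullet> a)) *\<^sub>R a"
  shows "(norm (y0 + \<rho> *\<^sub>R (section_mat a *v y)))\<^sup>2 + (a \<bullet> (y0 + \<rho> *\<^sub>R (section_mat a *v y)) + c)\<^sup>2 = h + \<rho>\<^sup>2 * (norm y)\<^sup>2"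
proof -
  define N where "N = a \<bullet> a"
  have N: "1 + N > 0" by (simp add: N_def add_pos_nonneg)
  define x where "x = \<rho> *\<^sub>R (section_mat a *v y)"
  define p where "p = a \<bullet> x"
  define e where "e = c / (1 + N)"
  have e: "e * (1 + N) = c" using N by (simp add: e_def)
  have y0: "y0 = (- e) *\<^sub>R a" by (simp add: y0_def e_def N_def)
  have "(norm (y0 + x))\<^sup>2 = (norm y0)\<^sup>2 + 2 * (y0 \<bullet> x) + (norm x)\<^sup>2"
    by (simp add: power2_norm_eq_inner inner_add_left inner_add_right inner_commute)
  moreover have "(norm y0)\<^sup>2 = e * (e * N)" unfolding y0 power2_norm_eq_inner by (simp add: N_def)
  moreover have "y0 \<bullet> x = - (e * p)" unfolding y0 by (simp add: p_def)
  ultimately have 1: "(norm (y0 + x))\<^sup>2 = e * (e * N) - 2 * (e * p) + (norm x)\<^sup>2" by simp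
  have "a \<bullet> (y0 + x) + c = p + (c - e * N)" unfolding y0 by (simp add: inner_diff_right inner_add_right p_def N_def)
  also have "c - e * N = e" using e by (simp add: algebra_simps)
  finally have 2: "a \<bullet> (y0 + x) + c = p + e" .
  have "(norm (y0 + x))\<^sup>2 + (a \<bullet> (y0 + x) + c)\<^sup>2 = e * (e * (1 + N)) + ((norm x)\<^sup>2 + p\<^sup>2)"
    unfolding 1 2 by (simp add: power2_eq_square algebra_simps)
  also have "e * (e * (1 + N)) = h" unfolding e by (simp add: e_def h_def N_def power2_eq_square)
  also have "(norm x)\<^sup>2 + p\<^sup>2 = \<rho>\<^sup>2 * ((norm (section_mat a *v y))\<^sup>2 + (a \<bullet> (section_mat a *v y))\<^sup>2)"
    unfolding distrib_left by (simp add: x_def p_def power_mult_distrib)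
  finally show ?thesis unfolding x_def section_mat_norm .
qed

lemma nn_integral_affine_matrix:
  fixes R :: "real ^ 'n::finite ^ 'n" and F :: "real ^ 'n \<Rightarrow> ennreal"
  assumes "det R \<noteq> 0" and F [measurable]: "F \<in> borel_measurable borel"
  shows "(\<integral>\<^sup>+x. F x \<partial>lborel) = ennreal \<bar>det R\<bar> * (\<integral>\<^sup>+x. F (y0 + R *v x) \<partial>lborel)"
proof -
  have "(\<integral>\<^sup>+x. F x \<partial>lborel) = (\<integral>\<^sup>+x. F x \<partial>distr lborel borel ((+) y0))" by (simp add: lborel_distr_plus)
  also have "\<dots> = (\<integral>\<^sup>+x. F (y0 + x) \<partial>lborel)" by (subst nn_integral_distr) auto
  also have "\<dots> = ennreal \<bar>det R\<bar> * (\<integral>\<^sup>+x. F (y0 + R *v x) \<partial>lborel)"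
    by (rule nn_integral_lborel_matrix[OF assms(1)]) measurable
  finally show ?thesis .
qed

text \<open>The map taking \<open>y\<close> to \<open>y0 + R *v y\<close> carries the unit ball onto
  the projected section of the unit ball by the graph; \<open>sqrt (1 - h)\<close> is the radius of
  that section. By the last property lifted lengths are a multiple of Euclidean ones, so Gaussians
  on the graph stay rotation invariant.\<close>

lemma section_beta_weight:
  fixes a :: "real ^ 'n::finite" and b c :: real
  defines "h \<equiv> c\<^sup>2 / (1 + a \<bullet> a)"
  assumes h: "h < 1"
  obtains R y0 where "\<bar>det R\<bar> = sqrt (1 - h) ^ CARD('n) * \<bar>det (section_mat a)\<bar>" "det R \<noteq> 0"
    "\<And>y. beta_weight b ((norm (y0 + R *v y))\<^sup>2 + (a \<bullet> (y0 + R *v y) + c)\<^sup>2) = (1 - h) powr b * beta_weight b ((norm y)\<^sup>2)"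
    "\<And>z. (norm (R *v z))\<^sup>2 + (a \<bullet> (R *v z))\<^sup>2 = (1 - h) * (norm z)\<^sup>2"
proof -
  define \<rho> where "\<rho> = sqrt (1 - h)"
  have \<rho>: "\<rho> > 0" "\<rho>\<^sup>2 = 1 - h" using h by (auto simp: \<rho>_def)
  define R where "R = \<rho> *\<^sub>R section_mat a"
  have Rv: "R *v y = \<rho> *\<^sub>R (section_mat a *v y)" for y
    by (simp add: R_def scaleR_matrix_vector_assoc)
  have "det R = det (\<chi> i. \<rho> *s (section_mat a $ i))"
    unfolding R_def by (intro arg_cong[where f=det]) (simp add: vec_eq_iff)
  then have detR: "det R = \<rho> ^ CARD('n) * det (section_mat a)"
    by (simp add: det_rows_mul[of "\<lambda>_. \<rho>"])
  show ?thesis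
  proof (rule that[of R "(- c / (1 + a \<bullet> a)) *\<^sub>R a"])
    show "\<bar>det R\<bar> = sqrt (1 - h) ^ CARD('n) * \<bar>det (section_mat a)\<bar>"
      using \<rho> by (simp add: detR abs_mult \<rho>_def[symmetric])
    show "det R \<noteq> 0" using \<rho> det_section_mat[of a] by (simp add: detR)
    show "beta_weight b ((norm ((- c / (1 + a \<bullet> a)) *\<^sub>R a + R *v y))\<^sup>2 + (a \<bullet> ((- c / (1 + a \<bullet> a)) *\<^sub>R a + R *v y) + c)\<^sup>2) = (1 - h) powr b * beta_weight b ((norm y)\<^sup>2)" for y
      unfolding Rv section_norm h_def[symmetric] \<rho>(2) by (rule beta_weight_affine[OF h])
    show "(norm (R *v z))\<^sup>2 + (a \<bullet> (R *v z))\<^sup>2 = (1 - h) * (norm z)\<^sup>2" for z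
      using section_mat_norm[of a z] \<rho>(2)[symmetric] by (simp add: Rv power_mult_distrib distrib_left[symmetric])
  qed
qed

text \<open>The hypothesis says that the graph has distance at least \<open>1\<close> from the
  origin and hence misses the open unit ball.\<close>

lemma section_beta_weight_ge_1:
  fixes a y :: "real ^ 'n::finite"
  assumes "c\<^sup>2 / (1 + a \<bullet> a) \<ge> 1"
  shows "beta_weight b ((norm y)\<^sup>2 + (a \<bullet> y + c)\<^sup>2) = 0"
proof -
  have "\<exists>x. section_mat a *v x = y + (c / (1 + a \<bullet> a)) *\<^sub>R a"
    using cramer[OF det_section_mat, THEN iffD2, OF refl] by blast
  then obtain x where "section_mat a *v x = y + (c / (1 + a \<bullet> a)) *\<^sub>R a" by auto
  then have "y = (- c / (1 + a \<bullet> a)) *\<^sub>R a + 1 *\<^sub>R (section_mat a *v x)" by simp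
  then have "(norm y)\<^sup>2 + (a \<bullet> y + c)\<^sup>2 = c\<^sup>2 / (1 + a \<bullet> a) + 1\<^sup>2 * (norm x)\<^sup>2"
    using section_norm[of c a 1 x] by simp
  then have "(norm y)\<^sup>2 + (a \<bullet> y + c)\<^sup>2 \<ge> 1" using add_mono[OF assms zero_le_power2[of "norm x"]] by simp
  then show ?thesis by (rule beta_weight_ge_1)
qed

lemma sets_PiM_lborel [measurable_cong]: "sets (PiM I (\<lambda>_. lborel)) = sets (PiM I (\<lambda>_. borel))"
  by (intro sets_PiM_cong) auto

section \<open>Integration over graphs of affine functions\<close>

lemma nn_integral_PiM_vertex_index:
  fixes H :: "(nat \<Rightarrow> real) \<Rightarrow> ennreal"
  assumes H [measurable]: "H \<in> borel_measurable (PiM (range (vertex_index :: 'd::finite \<Rightarrow> nat)) (\<lambda>_. borel))"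
  shows "(\<integral>\<^sup>+t. H t \<partial>PiM (range (vertex_index :: 'd \<Rightarrow> nat)) (\<lambda>_. lborel)) =
     (\<integral>\<^sup>+v. H (\<lambda>j\<in>range (vertex_index :: 'd \<Rightarrow> nat). v $ inv vertex_index j) \<partial>(lborel :: (real ^ 'd) measure))"
proof -
  let ?R = "range (vertex_index :: 'd \<Rightarrow> nat)"
  have m [measurable]: "(\<lambda>f. \<chi> i. f (vertex_index i)) \<in> measurable (PiM ?R (\<lambda>_. lborel)) (borel :: (real ^ 'd) measure)"
    by (rule borel_measurable_vec_lambda) measurable
  have r [measurable]: "(\<lambda>v. \<lambda>j\<in>?R. v $ inv vertex_index j) \<in> measurable (borel :: (real ^ 'd) measure) (PiM ?R (\<lambda>_. borel))"
    by (intro measurable_restrict borel_measurable_nth)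
  have "(\<integral>\<^sup>+v. H (\<lambda>j\<in>?R. v $ inv vertex_index j) \<partial>(lborel :: (real ^ 'd) measure))
    = (\<integral>\<^sup>+t. H (\<lambda>j\<in>?R. (\<chi> i. t (vertex_index i)) $ inv (vertex_index :: 'd \<Rightarrow> nat) j) \<partial>PiM ?R (\<lambda>_. lborel))"
    by (subst lborel_vec_eq_distr_PiM[OF inj_vertex_index], subst nn_integral_distr[OF m]) simp_all
  also have "\<dots> = (\<integral>\<^sup>+t. H t \<partial>PiM ?R (\<lambda>_. lborel))"
  proof (rule nn_integral_cong)
    fix t :: "nat \<Rightarrow> real" assume "t \<in> space (PiM ?R (\<lambda>_. lborel))"
    then have t: "t \<in> extensional ?R" by (auto simp: space_PiM PiE_def)
    have "(\<lambda>j\<in>?R. (\<chi> i. t (vertex_index i)) $ inv (vertex_index :: 'd \<Rightarrow> nat) j) = t"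
    proof (rule extensionalityI[of _ ?R])
      show "(\<lambda>j\<in>?R. (\<chi> i. t (vertex_index i)) $ inv (vertex_index :: 'd \<Rightarrow> nat) j) x = t x" if "x \<in> ?R" for x
        using that by (auto simp: inj_vertex_index)
    qed (use t in auto)
    then show "H (\<lambda>j\<in>?R. (\<chi> i. t (vertex_index i)) $ inv (vertex_index :: 'd \<Rightarrow> nat) j) = H t" by simp
  qed
  finally show ?thesis ..
qed

text \<open>Heights over \<open>d + 1\<close> affinely independent points are the values of a unique
  affine function with slope \<open>a\<close> and constant term \<open>c\<close>. Passing from the
  heights to \<open>(a, c)\<close> is a linear change of variables whose determinant is, up to sign,
  that of the edge matrix.\<close>

lemma nn_integral_graph_coordinates:
  fixes y :: "nat \<Rightarrow> real ^ 'd::finite" and H :: "(nat \<Rightarrow> real) \<Rightarrow> ennreal"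
  defines "I \<equiv> {1..CARD('d) + 1}"
  assumes det: "det (edge_mat y) \<noteq> 0" and H [measurable]: "H \<in> borel_measurable (PiM I (\<lambda>_. borel))"
  shows "(\<integral>\<^sup>+t. H t \<partial>PiM I (\<lambda>_. lborel)) =
    ennreal \<bar>det (edge_mat y)\<bar> * (\<integral>\<^sup>+c. \<integral>\<^sup>+a. H (\<lambda>j\<in>I. a \<bullet> y j + c) \<partial>lborel \<partial>lborel)"
proof -
  let ?R = "range (vertex_index :: 'd \<Rightarrow> nat)"
  let ?A = "edge_mat y"
  interpret L: product_sigma_finite "\<lambda>_::nat. lborel :: real measure" by standard
  have I: "I = insert 1 ?R" unfolding I_def by (rule atLeastAtMost_eq_insert_vertex_index)
  have nI: "1 \<notin> ?R" by auto
  define ext where "ext s v = (\<lambda>j\<in>I. if j = 1 then s else v $ inv (vertex_index :: 'd \<Rightarrow> nat) j)" for s :: real and v :: "real ^ 'd"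
  have ext_m: "(\<lambda>x. ext (f x) (g x)) \<in> measurable M (PiM I (\<lambda>_. borel))"
    if "f \<in> borel_measurable M" "g \<in> borel_measurable M" for f g and M :: "'x measure"
    unfolding ext_def
  proof (rule measurable_restrict)
    fix j assume "j \<in> I"
    show "(\<lambda>x. if j = 1 then f x else g x $ inv vertex_index j) \<in> borel_measurable M"
      using that measurable_compose[OF that(2) borel_measurable_nth] by (cases "j = 1") auto
  qed
  note [measurable] = ext_m[THEN measurable_compose, OF _ _ H]
  have "(\<integral>\<^sup>+t. H t \<partial>PiM I (\<lambda>_. lborel)) = (\<integral>\<^sup>+s. \<integral>\<^sup>+t. H (t(1 := s)) \<partial>PiM ?R (\<lambda>_. lborel) \<partial>lborel)"
    using H unfolding I by (subst L.product_nn_integral_insert_rev) (use nI in auto)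
  also have "\<dots> = (\<integral>\<^sup>+s. \<integral>\<^sup>+v. H (ext s v) \<partial>lborel \<partial>lborel)"
  proof (rule nn_integral_cong)
    fix s :: real
    have "(\<lambda>t. t(1 := s)) \<in> measurable (PiM ?R (\<lambda>_. borel)) (PiM I (\<lambda>_. borel))"
      unfolding I by (rule measurable_fun_upd[where J="?R"]) auto
    then have [measurable]: "(\<lambda>t. H (t(1 := s))) \<in> borel_measurable (PiM ?R (\<lambda>_. borel))"
      by (rule measurable_compose[OF _ H])
    have "(\<integral>\<^sup>+t. H (t(1 := s)) \<partial>PiM ?R (\<lambda>_. lborel)) = 
      (\<integral>\<^sup>+v. H ((\<lambda>j\<in>?R. v $ inv (vertex_index :: 'd \<Rightarrow> nat) j)(1 := s)) \<partial>lborel)"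
      by (rule nn_integral_PiM_vertex_index) measurable
    also have "\<dots> = (\<integral>\<^sup>+v. H (ext s v) \<partial>lborel)"
      by (intro nn_integral_cong arg_cong[where f=H]) (auto simp: ext_def I fun_eq_iff)
    finally show "(\<integral>\<^sup>+t. H (t(1 := s)) \<partial>PiM ?R (\<lambda>_. lborel)) = (\<integral>\<^sup>+v. H (ext s v) \<partial>lborel)" .
  qed
  \<comment> \<open>With the height \<open>s\<close> at vertex \<open>1\<close> fixed, the other
    heights are \<open>s\<close> plus the values of the linear part on the edges, that is, the
    entries of \<open>transpose ?A *v a\<close>.\<close>
  also have "\<dots> = (\<integral>\<^sup>+s. ennreal \<bar>det ?A\<bar> * (\<integral>\<^sup>+a. H (ext s ((\<chi> i. s) + transpose ?A *v a)) \<partial>lborel) \<partial>lborel)"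
    by (intro nn_integral_cong nn_integral_affine_matrix[of "transpose ?A", simplified det_transpose] det) measurable
  also have "\<dots> = ennreal \<bar>det ?A\<bar> * (\<integral>\<^sup>+s. \<integral>\<^sup>+a. H (ext s ((\<chi> i. s) + transpose ?A *v a)) \<partial>lborel \<partial>lborel)"
  proof (rule nn_integral_cmult)
    have [measurable]: "(\<lambda>x. (\<chi> i. fst x) + transpose ?A *v snd x) \<in> borel_measurable (borel \<Otimes>\<^sub>M borel :: (real \<times> (real^'d)) measure)"
      by (intro borel_measurable_add borel_measurable_vec_lambda) measurable
    have "(\<lambda>x. H (ext (fst x) ((\<chi> i. fst x) + transpose ?A *v snd x))) \<in> borel_measurable (borel \<Otimes>\<^sub>M borel :: (real \<times> (real^'d)) measure)"
      by measurable
    then show "(\<lambda>s. \<integral>\<^sup>+a. H (ext s ((\<chi> i. s) + transpose ?A *v a)) \<partial>lborel) \<in> borel_measurable lborel"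
      by (intro lborel.borel_measurable_nn_integral) (simp add: case_prod_beta)
  qed
  also have "(\<integral>\<^sup>+s. \<integral>\<^sup>+a. H (ext s ((\<chi> i. s) + transpose ?A *v a)) \<partial>lborel \<partial>lborel)
     = (\<integral>\<^sup>+a. \<integral>\<^sup>+s. H (ext s ((\<chi> i. s) + transpose ?A *v a)) \<partial>lborel \<partial>lborel)"
  proof (rule lborel_pair.Fubini')
    have [measurable]: "(\<lambda>x. (\<chi> i. snd x) + transpose ?A *v fst x) \<in> borel_measurable (borel \<Otimes>\<^sub>M borel :: ((real^'d) \<times> real) measure)"
      by (intro borel_measurable_add borel_measurable_vec_lambda) measurable
    have "(\<lambda>x. H (ext (snd x) ((\<chi> i. snd x) + transpose ?A *v fst x))) \<in> borel_measurable (borel \<Otimes>\<^sub>M borel :: ((real^'d) \<times> real) measure)"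
      by measurable
    then show "(\<lambda>(a, s). H (ext s ((\<chi> i. s) + transpose ?A *v a))) \<in> borel_measurable (lborel \<Otimes>\<^sub>M lborel)"
      by (simp add: case_prod_beta)
  qed
  also have "\<dots> = (\<integral>\<^sup>+a. \<integral>\<^sup>+c. H (\<lambda>j\<in>I. a \<bullet> y j + c) \<partial>lborel \<partial>lborel)"
  proof (rule nn_integral_cong)
    fix a :: "real ^ 'd"
    have mm: "(\<lambda>s. H (ext s ((\<chi> i. s) + transpose ?A *v a))) \<in> borel_measurable borel"
    proof -
      have [measurable]: "(\<lambda>s. (\<chi> i. s) + transpose ?A *v a) \<in> borel_measurable borel"
        by (intro borel_measurable_add borel_measurable_vec_lambda) measurable
      show ?thesis by measurable
    qed
    \<comment> \<open>For fixed \<open>a\<close> a translation replaces the height at vertex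
      \<open>1\<close> by the height \<open>c\<close> at the origin.\<close>
    have "(\<integral>\<^sup>+s. H (ext s ((\<chi> i. s) + transpose ?A *v a)) \<partial>lborel)
      = ennreal \<bar>1\<bar> * (\<integral>\<^sup>+c. H (ext (a \<bullet> y 1 + 1 * c) ((\<chi> i. (a \<bullet> y 1 + 1 * c)) + transpose ?A *v a)) \<partial>lborel)"
      by (rule nn_integral_real_affine[OF mm]) simp
    also have "\<dots> = (\<integral>\<^sup>+c. H (\<lambda>j\<in>I. a \<bullet> y j + c) \<partial>lborel)"
    proof -
      have "(transpose ?A *v a) $ i = a \<bullet> (y (vertex_index i) - y 1)" for i
        by (simp add: matrix_vector_mult_def transpose_def edge_mat_def inner_vec_def mult.commute)
      then have "ext (a \<bullet> y 1 + 1 * c) ((\<chi> i. (a \<bullet> y 1 + 1 * c)) + transpose ?A *v a) = (\<lambda>j\<in>I. a \<bullet> y j + c)" for c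
        by (auto simp: ext_def I fun_eq_iff inner_diff_right f_inv_into_f)
      then show ?thesis by simp
    qed
    finally show "(\<integral>\<^sup>+s. H (ext s ((\<chi> i. s) + transpose ?A *v a)) \<partial>lborel) = (\<integral>\<^sup>+c. H (\<lambda>j\<in>I. a \<bullet> y j + c) \<partial>lborel)" .
  qed
  also have "\<dots> = (\<integral>\<^sup>+c. \<integral>\<^sup>+a. H (\<lambda>j\<in>I. a \<bullet> y j + c) \<partial>lborel \<partial>lborel)"
    by (rule lborel_pair.Fubini') measurable
  finally show ?thesis .
qed

definition cone_coords :: "nat \<Rightarrow> real ^ 'd::finite \<Rightarrow> bool" where
  "cone_coords k u \<longleftrightarrow> (\<forall>i. k < vertex_index i \<longrightarrow> 0 \<le> u $ i)"

lemma measurable_cone_coords [measurable]: "Measurable.pred borel (cone_coords k :: real ^ 'd::finite \<Rightarrow> bool)"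
  unfolding cone_coords_def[abs_def] by measurable

text \<open>Unnormalised solid angle, with values in \<open>ennreal\<close> so that expectations and
  Fubini need no finiteness conditions.\<close>

definition cone_vol :: "nat \<Rightarrow> (nat \<Rightarrow> real ^ 'd::finite) \<Rightarrow> ennreal" where
  "cone_vol k X = emeasure lborel (ball 0 1 \<inter> tcone k X)"

lemma measurable_cone_vol [measurable]:
  "cone_vol k \<in> borel_measurable (PiM {1..CARD('d::finite) + 1} (\<lambda>_. borel :: (real ^ 'd) measure))"
proof -
  define P where "P = PiM {1..CARD('d) + 1} (\<lambda>_. borel :: (real ^ 'd) measure)"
  define S where "S = {x \<in> space (P \<Otimes>\<^sub>M (borel :: (real ^ 'd) measure)). snd x \<in> tcone k (fst x)}"
  have "S \<in> sets (P \<Otimes>\<^sub>M borel)"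
    using predE[OF measurable_tcone[where 'd='d and k=k]] by (simp add: S_def P_def case_prod_beta)
  then have [measurable]: "S \<in> sets (P \<Otimes>\<^sub>M lborel)"
    by (subst sets_pair_measure_cong[OF refl sets_lborel])
  have [measurable]: "ball (0 :: real ^ 'd) 1 \<in> sets borel" by simp
  have "(\<lambda>x. indicator S x * indicator (ball 0 1) (snd x) :: ennreal) \<in> borel_measurable (P \<Otimes>\<^sub>M lborel)" by measurable
  then have "(\<lambda>X. \<integral>\<^sup>+z. indicator S (X, z) * indicator (ball 0 1) z \<partial>lborel) \<in> borel_measurable P"
    by (intro lborel.borel_measurable_nn_integral) (simp add: case_prod_beta)
  also have "(\<lambda>X. \<integral>\<^sup>+z. indicator S (X, z) * indicator (ball 0 1) z \<partial>lborel) \<in> borel_measurable P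
     \<longleftrightarrow> cone_vol k \<in> borel_measurable P"
  proof (rule measurable_cong)
    fix X assume "X \<in> space P"
    then have "(\<integral>\<^sup>+z. indicator S (X, z) * indicator (ball 0 1) z \<partial>lborel)
      = (\<integral>\<^sup>+z. indicator (ball 0 1 \<inter> tcone k X) z \<partial>lborel)"
      by (intro nn_integral_cong) (auto simp: indicator_def space_pair_measure S_def)
    then show "(\<integral>\<^sup>+z. indicator S (X, z) * indicator (ball 0 1) z \<partial>lborel) = cone_vol k X"
      by (simp add: cone_vol_def)
  qed
  finally show ?thesis by (simp add: P_def)
qed

text \<open>The inner integral uses Lebesgue measure in the coefficients \<open>u\<close> and not in
  the cone that they parametrise. Weights are left unnormalised, since in the end only ratios
  between different \<open>k\<close> matter.\<close>

definition lifted_integral :: "real \<Rightarrow> nat \<Rightarrow> 'd::finite itself \<Rightarrow> ennreal" where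
  "lifted_integral b k _ = (\<integral>\<^sup>+Z. (\<Prod>j\<in>{1..CARD('d) + 1}. ennreal (beta_weight b ((norm (Z j))\<^sup>2))) *
     (\<integral>\<^sup>+u. indicator {u :: real ^ 'd. cone_coords k u} u *
        ennreal (exp (- (norm (\<Sum>i\<in>UNIV. u $ i *\<^sub>R (Z (vertex_index i) - Z 1)))\<^sup>2 / 2)) \<partial>lborel)
     \<partial>PiM {1..CARD('d) + 1} (\<lambda>_. lborel :: ((real ^ 'd) \<times> real) measure))"

text \<open>For a linear function \<open>t\<close> on the hyperplane through the lifted points, the Jacobian of the graph
  coordinates cancels against the one of the barycentric coordinates of the tangent cone.\<close>

lemma inner_graph_integral:
  fixes y :: "nat \<Rightarrow> real ^ 'd::finite"
  defines "I \<equiv> {1..CARD('d) + 1}"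
  assumes det: "det (edge_mat y) \<noteq> 0"
  shows "(\<integral>\<^sup>+t. (\<Prod>j\<in>I. ennreal (beta_weight b ((norm (y j, t j))\<^sup>2))) *
      (\<integral>\<^sup>+u. indicator {u :: real ^ 'd. cone_coords k u} u * ennreal (exp (- (norm (\<Sum>i\<in>UNIV. u $ i *\<^sub>R ((y (vertex_index i), t (vertex_index i)) - (y 1, t 1))))\<^sup>2 / 2)) \<partial>lborel)
      \<partial>PiM I (\<lambda>_. lborel :: real measure)) =
    (\<integral>\<^sup>+c. \<integral>\<^sup>+a. (\<Prod>j\<in>I. ennreal (beta_weight b ((norm (y j))\<^sup>2 + (a \<bullet> y j + c)\<^sup>2))) *
      (\<integral>\<^sup>+z. indicator (tcone k y) z * ennreal (exp (- ((norm z)\<^sup>2 + (a \<bullet> z)\<^sup>2) / 2)) \<partial>lborel) \<partial>lborel \<partial>lborel)"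
proof -
  have I1: "1 \<in> I" "\<And>i::'d. vertex_index i \<in> I" by (auto simp: I_def)
  have m1: "(\<lambda>t. t j) \<in> borel_measurable (PiM I (\<lambda>_. borel))" if "j \<in> I" for j
    using that by measurable
  have sumpair: "(\<Sum>i\<in>UNIV. u $ i *\<^sub>R ((y (vertex_index i), t (vertex_index i)) - (y 1, t 1)))
     = (edge_mat y *v u, \<Sum>i\<in>UNIV. u $ i * (t (vertex_index i) - t 1))" for u :: "real ^ 'd" and t
    by (simp add: edge_mat_mult prod_eq_iff fst_sum snd_sum)
  have np: "(norm (p, q))\<^sup>2 = (norm p)\<^sup>2 + q\<^sup>2" for p :: "real ^ 'd" and q :: real
    by (simp add: norm_Pair)
  define G where "G t = (\<Prod>j\<in>I. ennreal (beta_weight b ((norm (y j))\<^sup>2 + (t j)\<^sup>2))) *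
      (\<integral>\<^sup>+u. indicator {u :: real ^ 'd. cone_coords k u} u * ennreal (exp (- ((norm (edge_mat y *v u))\<^sup>2 + (\<Sum>i\<in>UNIV. u $ i * (t (vertex_index i) - t 1))\<^sup>2) / 2)) \<partial>lborel)" for t
  have G: "G \<in> borel_measurable (PiM I (\<lambda>_. borel))"
  proof -
    have [measurable]: "(\<lambda>x. \<Sum>i\<in>UNIV. snd x $ i * (fst x (vertex_index i) - fst x 1)) \<in> borel_measurable (PiM I (\<lambda>_. borel) \<Otimes>\<^sub>M (lborel :: (real ^ 'd) measure))"
      unfolding measurable_lborel1 measurable_cong_sets[OF sets_pair_measure_cong[OF refl sets_lborel] refl]
      by (intro borel_measurable_sum borel_measurable_times borel_measurable_diff I1
         measurable_compose[OF measurable_fst m1] measurable_compose[OF measurable_snd borel_measurable_nth])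
    have [measurable]: "{u. cone_coords k u} \<in> sets (borel :: (real ^ 'd) measure)" by measurable
    have "(\<lambda>x. indicator {u. cone_coords k u} (snd x) * ennreal (exp (- ((norm (edge_mat y *v snd x))\<^sup>2 + (\<Sum>i\<in>UNIV. snd x $ i * (fst x (vertex_index i) - fst x 1))\<^sup>2) / 2)))
       \<in> borel_measurable (PiM I (\<lambda>_. borel) \<Otimes>\<^sub>M (lborel :: (real ^ 'd) measure))"
      by measurable
    then have "(\<lambda>t. \<integral>\<^sup>+u. indicator {u. cone_coords k u} u * ennreal (exp (- ((norm (edge_mat y *v u))\<^sup>2 + (\<Sum>i\<in>UNIV. u $ i * (t (vertex_index i) - t 1))\<^sup>2) / 2)) \<partial>lborel)
       \<in> borel_measurable (PiM I (\<lambda>_. borel))"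
      by (intro lborel.borel_measurable_nn_integral) (simp add: case_prod_beta)
    moreover have "(\<lambda>t. (\<Prod>j\<in>I. ennreal (beta_weight b ((norm (y j))\<^sup>2 + (t j)\<^sup>2)))) \<in> borel_measurable (PiM I (\<lambda>_. borel))"
      by (intro borel_measurable_prod_ennreal) measurable
    ultimately show ?thesis unfolding G_def[abs_def] by (rule borel_measurable_times_ennreal[rotated])
  qed
  have "(\<integral>\<^sup>+t. (\<Prod>j\<in>I. ennreal (beta_weight b ((norm (y j, t j))\<^sup>2))) *
      (\<integral>\<^sup>+u. indicator {u :: real ^ 'd. cone_coords k u} u * ennreal (exp (- (norm (\<Sum>i\<in>UNIV. u $ i *\<^sub>R ((y (vertex_index i), t (vertex_index i)) - (y 1, t 1))))\<^sup>2 / 2)) \<partial>lborel)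
      \<partial>PiM I (\<lambda>_. lborel :: real measure)) = (\<integral>\<^sup>+t. G t \<partial>PiM I (\<lambda>_. lborel))"
    unfolding sumpair np G_def ..
  also have "\<dots> = ennreal \<bar>det (edge_mat y)\<bar> * (\<integral>\<^sup>+c. \<integral>\<^sup>+a. G (\<lambda>j\<in>I. a \<bullet> y j + c) \<partial>lborel \<partial>lborel)"
    using nn_integral_graph_coordinates[OF det] G unfolding I_def by blast
  also have "\<dots> = (\<integral>\<^sup>+c. \<integral>\<^sup>+a. ennreal \<bar>det (edge_mat y)\<bar> * G (\<lambda>j\<in>I. a \<bullet> y j + c) \<partial>lborel \<partial>lborel)"
  proof -
    have [measurable]: "(\<lambda>x. G (\<lambda>j\<in>I. snd x \<bullet> y j + fst x)) \<in> borel_measurable (borel \<Otimes>\<^sub>M borel)"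
      by (rule measurable_compose[OF _ G]) measurable
    have mc: "(\<lambda>a. G (\<lambda>j\<in>I. a \<bullet> y j + c)) \<in> borel_measurable lborel" for c
      by (rule measurable_compose[OF _ G]) measurable
    show ?thesis
      by (subst nn_integral_cmult[symmetric]) (auto simp: nn_integral_cmult[OF mc] case_prod_beta intro!: lborel.borel_measurable_nn_integral)
  qed
  also have "\<dots> = (\<integral>\<^sup>+c. \<integral>\<^sup>+a. (\<Prod>j\<in>I. ennreal (beta_weight b ((norm (y j))\<^sup>2 + (a \<bullet> y j + c)\<^sup>2))) *
      (\<integral>\<^sup>+z. indicator (tcone k y) z * ennreal (exp (- ((norm z)\<^sup>2 + (a \<bullet> z)\<^sup>2) / 2)) \<partial>lborel) \<partial>lborel \<partial>lborel)"
  proof (intro nn_integral_cong)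
    fix c :: real and a :: "real ^ 'd"
    define t where "t = (\<lambda>j\<in>I. a \<bullet> y j + c)"
    have "(\<Sum>i\<in>UNIV. u $ i * (t (vertex_index i) - t 1)) = a \<bullet> (edge_mat y *v u)" for u
      using I1 by (simp add: t_def edge_mat_mult inner_sum_right inner_diff_right)
    then have G1: "G t = (\<Prod>j\<in>I. ennreal (beta_weight b ((norm (y j))\<^sup>2 + (a \<bullet> y j + c)\<^sup>2))) *
      (\<integral>\<^sup>+u. indicator (tcone k y) (edge_mat y *v u) * ennreal (exp (- ((norm (edge_mat y *v u))\<^sup>2 + (a \<bullet> (edge_mat y *v u))\<^sup>2) / 2)) \<partial>lborel)"
      unfolding G_def by (intro arg_cong2[where f="(*)"] prod.cong nn_integral_cong)
        (auto simp: t_def indicator_def tcone_iff[OF det] cone_coords_def)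
    have "(\<integral>\<^sup>+z. indicator (tcone k y) z * ennreal (exp (- ((norm z)\<^sup>2 + (a \<bullet> z)\<^sup>2) / 2)) \<partial>lborel)
      = ennreal \<bar>det (edge_mat y)\<bar> * (\<integral>\<^sup>+u. indicator (tcone k y) (edge_mat y *v u) * ennreal (exp (- ((norm (edge_mat y *v u))\<^sup>2 + (a \<bullet> (edge_mat y *v u))\<^sup>2) / 2)) \<partial>lborel)"
      by (rule nn_integral_lborel_matrix[OF det]) measurable
    then show "ennreal \<bar>det (edge_mat y)\<bar> * G (\<lambda>j\<in>I. a \<bullet> y j + c) = (\<Prod>j\<in>I. ennreal (beta_weight b ((norm (y j))\<^sup>2 + (a \<bullet> y j + c)\<^sup>2))) *
      (\<integral>\<^sup>+z. indicator (tcone k y) z * ennreal (exp (- ((norm z)\<^sup>2 + (a \<bullet> z)\<^sup>2) / 2)) \<partial>lborel)"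
      unfolding t_def[symmetric] G1 by (simp add: mult.left_commute)
  qed
  finally show ?thesis .
qed

section \<open>Independent beta points as a density on the product space\<close>

lemma beta_dist_eq_density_beta_weight:
  assumes "b \<noteq> -1"
  shows "(beta_dist b :: (real ^ 'd::finite) measure) =
     density lborel (\<lambda>x. ennreal (beta_const CARD('d) b * beta_weight b ((norm x)\<^sup>2)))"
proof -
  have "(norm x)\<^sup>2 < 1 \<longleftrightarrow> norm x < 1" for x :: "real ^ 'd"
    by (simp add: abs_square_less_1)
  then show ?thesis
    using assms unfolding beta_dist_def by (auto simp: beta_weight_def indicator_def intro!: arg_cong2[where f=density])
qed

lemma PiM_beta_dist:
  assumes b: "b > -1" and I: "finite (I :: nat set)"
  shows "PiM I (\<lambda>_. beta_dist b :: (real ^ 'd::finite) measure) =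
    density (PiM I (\<lambda>_. lborel)) (\<lambda>y. \<Prod>j\<in>I. ennreal (beta_const CARD('d) b * beta_weight b ((norm (y j))\<^sup>2)))"
proof -
  interpret prob_space "beta_dist b :: (real ^ 'd) measure" using b by (intro prob_space_beta_dist) auto
  have "sigma_finite_measure (beta_dist b :: (real ^ 'd) measure)" by standard
  moreover have "b \<noteq> -1" using b by auto
  ultimately show ?thesis
    unfolding beta_dist_eq_density_beta_weight[OF \<open>b \<noteq> -1\<close>] using I
    by (intro PiM_density) (auto intro: sigma_finite_lborel)
qed

text \<open>The beta density is positive on the open ball, so within products of balls its null sets
  are Lebesgue null.\<close>

lemma AE_det_beta_weight:
  fixes b :: real
  assumes b: "b > -1"
  shows "AE y in PiM {1..CARD('d::finite) + 1} (\<lambda>_. lborel :: (real ^ 'd) measure).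
     (\<forall>j\<in>{1..CARD('d) + 1}. norm (y j) < 1) \<longrightarrow> det (edge_mat y) \<noteq> 0"
proof -
  let ?I = "{1..CARD('d) + 1}"
  have c: "beta_const CARD('d) b > 0" using b by (intro beta_const_pos) auto
  have "AE X in PiM ?I (\<lambda>_. beta_dist b :: (real ^ 'd) measure). det (edge_mat X) \<noteq> 0"
    using b by (intro AE_det_edge_mat prob_space_beta_dist beta_dist_hyperplane_null) auto
  moreover have [measurable]: "(\<lambda>y. \<Prod>j\<in>?I. ennreal (beta_const CARD('d) b * beta_weight b ((norm (y j))\<^sup>2))) \<in> borel_measurable (PiM ?I (\<lambda>_. lborel :: (real ^ 'd) measure))"
    by (intro borel_measurable_prod_ennreal) measurable
  ultimately have "AE y in PiM ?I (\<lambda>_. lborel :: (real ^ 'd) measure).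
     0 < (\<Prod>j\<in>?I. ennreal (beta_const CARD('d) b * beta_weight b ((norm (y j))\<^sup>2))) \<longrightarrow> det (edge_mat y) \<noteq> 0"
    unfolding PiM_beta_dist[OF b finite_atLeastAtMost] by (subst (asm) AE_density) auto
  then show ?thesis
  proof eventually_elim
    case (elim y)
    show ?case
    proof
      assume *: "\<forall>j\<in>?I. norm (y j) < 1"
      have pos: "beta_const CARD('d) b * beta_weight b ((norm (y j))\<^sup>2) > 0" if "j \<in> ?I" for j
      proof -
        have "(norm (y j))\<^sup>2 < 1" using * that by (simp add: abs_square_less_1)
        then show ?thesis using c by (simp add: beta_weight_def)
      qed
      then have "(\<Prod>j\<in>?I. ennreal (beta_const CARD('d) b * beta_weight b ((norm (y j))\<^sup>2)))
         = ennreal (\<Prod>j\<in>?I. beta_const CARD('d) b * beta_weight b ((norm (y j))\<^sup>2))"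
        by (intro prod_ennreal less_imp_le)
      moreover have "(\<Prod>j\<in>?I. beta_const CARD('d) b * beta_weight b ((norm (y j))\<^sup>2)) > 0" by (intro prod_pos pos)
      ultimately have "(\<Prod>j\<in>?I. ennreal (beta_const CARD('d) b * beta_weight b ((norm (y j))\<^sup>2))) > 0"
        by simp
      then show "det (edge_mat y) \<noteq> 0" using elim by blast
    qed
  qed
qed

text \<open>The exponent contains the squared length of the lifted vector
  \<open>(z, a \<bullet> z)\<close>, while the measure is the one of the base space.\<close>

definition cone_gauss :: "nat \<Rightarrow> (nat \<Rightarrow> real ^ 'd::finite) \<Rightarrow> real ^ 'd \<Rightarrow> ennreal" where
  "cone_gauss k y a = (\<integral>\<^sup>+z. indicator (tcone k y) z * ennreal (exp (- ((norm z)\<^sup>2 + (a \<bullet> z)\<^sup>2) / 2)) \<partial>lborel)"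

lemma measurable_cone_gauss:
  "(\<lambda>x. cone_gauss k (fst x) (snd x)) \<in> borel_measurable (PiM {1..CARD('d::finite) + 1} (\<lambda>_. borel :: (real ^ 'd) measure) \<Otimes>\<^sub>M borel)"
proof -
  define P where "P = PiM {1..CARD('d) + 1} (\<lambda>_. borel :: (real ^ 'd) measure)"
  define S where "S = {x \<in> space (P \<Otimes>\<^sub>M (borel :: (real ^ 'd) measure)). snd x \<in> tcone k (fst x)}"
  have "S \<in> sets (P \<Otimes>\<^sub>M borel)"
    using predE[OF measurable_tcone[where 'd='d and k=k]] by (simp add: S_def P_def case_prod_beta)
  then have S [measurable]: "S \<in> sets (P \<Otimes>\<^sub>M lborel)"
    by (subst sets_pair_measure_cong[OF refl sets_lborel])
  have [measurable]: "(\<lambda>x. (fst (fst x), snd x)) \<in> measurable ((P \<Otimes>\<^sub>M borel) \<Otimes>\<^sub>M lborel) (P \<Otimes>\<^sub>M (lborel :: (real ^ 'd) measure))"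
    by (intro measurable_Pair measurable_compose[OF measurable_fst measurable_fst] measurable_snd)
  have "(\<lambda>x. indicator S (fst (fst x), snd x) * ennreal (exp (- ((norm (snd x))\<^sup>2 + (snd (fst x) \<bullet> snd x)\<^sup>2) / 2)))
     \<in> borel_measurable ((P \<Otimes>\<^sub>M (borel :: (real ^ 'd) measure)) \<Otimes>\<^sub>M lborel)" by measurable
  then have "(\<lambda>w. \<integral>\<^sup>+z. indicator S (fst w, z) * ennreal (exp (- ((norm z)\<^sup>2 + (snd w \<bullet> z)\<^sup>2) / 2)) \<partial>lborel) \<in> borel_measurable (P \<Otimes>\<^sub>M borel)"
    by (intro lborel.borel_measurable_nn_integral) (simp add: case_prod_beta)
  also have "(\<lambda>w. \<integral>\<^sup>+z. indicator S (fst w, z) * ennreal (exp (- ((norm z)\<^sup>2 + (snd w \<bullet> z)\<^sup>2) / 2)) \<partial>lborel) \<in> borel_measurable (P \<Otimes>\<^sub>M borel)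
    \<longleftrightarrow> (\<lambda>x. cone_gauss k (fst x) (snd x)) \<in> borel_measurable (P \<Otimes>\<^sub>M borel)"
    unfolding cone_gauss_def
    by (intro measurable_cong nn_integral_cong) (auto simp: indicator_def S_def space_pair_measure)
  finally show ?thesis by (simp add: P_def)
qed

text \<open>Edges transform linearly, so the edge coordinates of a vector, which decide membership,
  do not change.\<close>

lemma tcone_affine:
  fixes y :: "nat \<Rightarrow> real ^ 'd::finite"
  assumes R: "det R \<noteq> 0" and det: "det (edge_mat y) \<noteq> 0"
  shows "R *v z \<in> tcone k (\<lambda>j\<in>{1..CARD('d) + 1}. y0 + R *v y j) \<longleftrightarrow> z \<in> tcone k y"
proof -
  let ?Y = "\<lambda>j\<in>{1..CARD('d) + 1}. y0 + R *v y j"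
  obtain u where u: "z = edge_mat y *v u" using surj_edge_mat[OF det] by auto
  have mult: "edge_mat ?Y *v w = R *v (edge_mat y *v w)" for w
    unfolding edge_mat_mult
    by (simp add: linear_sum[OF matrix_vector_mul_linear] matrix_vector_mult_scaleR matrix_vector_mult_diff_distrib)
  then have "edge_mat ?Y = R ** edge_mat y"
    by (simp add: matrix_eq matrix_vector_mul_assoc[symmetric])
  then have "det (edge_mat ?Y) \<noteq> 0" using R det by (simp add: det_mul)
  from tcone_iff[OF this, of u k] show ?thesis
    unfolding mult u tcone_iff[OF det] .
qed

lemma prod_beta_weight_eq_0:
  assumes "j \<in> I" "norm (y j) \<ge> 1" "finite I"
  shows "(\<Prod>j\<in>I. ennreal (beta_weight b ((norm (y j))\<^sup>2 + (f j)\<^sup>2))) = 0"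
proof -
  have "1 \<le> (norm (y j))\<^sup>2 + (f j)\<^sup>2" using one_le_power[OF assms(2), of 2] zero_le_power2[of "f j"] by linarith
  then show ?thesis using assms by (intro prod_zero bexI[of _ j]) (auto simp: beta_weight_ge_1)
qed

text \<open>Radial part of a Gaussian integral over a cone, per unit of volume inside the unit ball.
  It is absorbed into the constant that cancels later.\<close>

definition radial_const :: "nat \<Rightarrow> real \<Rightarrow> ennreal" where
  "radial_const n s = (\<integral>\<^sup>+t. ennreal (real n / 2 * t powr (real n / 2 - 1)) * indicator {0<..} t * ennreal (exp (- s * t / 2)) \<partial>lborel)"

lemma measurable_radial_const [measurable]: "radial_const n \<in> borel_measurable borel"
  unfolding radial_const_def[abs_def]
  by (intro lborel.borel_measurable_nn_integral) (simp add: case_prod_beta)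

text \<open>After substituting \<open>R\<close> the Gaussian depends on \<open>norm z\<close> only,
  so the cone enters through its volume in the unit ball alone.\<close>

lemma cone_gauss_affine:
  fixes y :: "nat \<Rightarrow> real ^ 'd::finite"
  assumes R: "det R \<noteq> 0" "\<And>z. (norm (R *v z))\<^sup>2 + (a \<bullet> (R *v z))\<^sup>2 = s * (norm z)\<^sup>2"
    and det: "det (edge_mat y) \<noteq> 0"
  shows "cone_gauss k (\<lambda>j\<in>{1..CARD('d) + 1}. y0 + R *v y j) a = ennreal \<bar>det R\<bar> * (radial_const CARD('d) s * cone_vol k y)"
proof -
  let ?Y = "\<lambda>j\<in>{1..CARD('d) + 1}. y0 + R *v y j"
  have "cone_gauss k ?Y a = ennreal \<bar>det R\<bar> * (\<integral>\<^sup>+z. indicator (tcone k ?Y) (R *v z) * ennreal (exp (- ((norm (R *v z))\<^sup>2 + (a \<bullet> (R *v z))\<^sup>2) / 2)) \<partial>lborel)"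
    unfolding cone_gauss_def by (rule nn_integral_lborel_matrix[OF R(1)]) measurable
  also have "(\<integral>\<^sup>+z. indicator (tcone k ?Y) (R *v z) * ennreal (exp (- ((norm (R *v z))\<^sup>2 + (a \<bullet> (R *v z))\<^sup>2) / 2)) \<partial>lborel)
    = (\<integral>\<^sup>+z. ennreal (exp (- s * (norm z)\<^sup>2 / 2)) * indicator (tcone k y) z \<partial>lborel)"
  proof -
    have "indicator (tcone k ?Y) (R *v z) = (indicator (tcone k y) z :: ennreal)" for z
      by (simp only: indicator_def tcone_affine[OF R(1) det])
    then show ?thesis unfolding R(2) by (simp only: mult.commute mult_minus_left)
  qed
  also have "\<dots> = cone_vol k y * radial_const CARD('d) s"
    using nn_integral_radial_cone[OF sets_tcone is_cone_tcone[OF det], of "\<lambda>t. ennreal (exp (- s * t / 2))" k]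
    unfolding cone_vol_def radial_const_def by simp
  finally show ?thesis by (simp only: mult.commute)
qed

text \<open>All vertices and the cone variable are transformed by the same \<open>R\<close>. Its
  determinant therefore occurs to the power \<open>d + 2\<close>: once for each of the
  \<open>d + 1\<close> points and once for the cone. The resulting factor depends on
  \<open>a\<close> and \<open>c\<close> but not on \<open>k\<close>.\<close>

lemma section_integral:
  fixes a :: "real ^ 'd::finite" and b c :: real
  defines "I \<equiv> {1..CARD('d) + 1}" and "h \<equiv> c\<^sup>2 / (1 + a \<bullet> a)"
  assumes b: "b > -1"
  shows "(\<integral>\<^sup>+y. (\<Prod>j\<in>I. ennreal (beta_weight b ((norm (y j))\<^sup>2 + (a \<bullet> y j + c)\<^sup>2))) * cone_gauss k y a \<partial>PiM I (\<lambda>_. lborel :: (real ^ 'd) measure)) =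
    (if h < 1 then ennreal ((sqrt (1 - h) ^ CARD('d) * \<bar>det (section_mat a)\<bar>) ^ (CARD('d) + 2) * ((1 - h) powr b) ^ (CARD('d) + 1))
        * radial_const CARD('d) (1 - h) else 0)
    * (\<integral>\<^sup>+y. (\<Prod>j\<in>I. ennreal (beta_weight b ((norm (y j))\<^sup>2))) * cone_vol k y \<partial>PiM I (\<lambda>_. lborel :: (real ^ 'd) measure))"
proof (cases "h < 1")
  case False
  have "(\<Prod>j\<in>I. ennreal (beta_weight b ((norm (y j))\<^sup>2 + (a \<bullet> y j + c)\<^sup>2))) = 0" for y
    using False section_beta_weight_ge_1[of c a b "y 1"] unfolding h_def
    by (intro prod_zero bexI[of _ 1]) (auto simp: I_def)
  then show ?thesis using False by (simp only: mult_zero_left if_False nn_integral_const)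
next
  case True
  have cI: "card I = CARD('d) + 1" "finite I" by (simp_all add: I_def)
  obtain R y0 where R: "\<bar>det R\<bar> = sqrt (1 - h) ^ CARD('d) * \<bar>det (section_mat a)\<bar>" "det R \<noteq> 0"
    "\<And>y. beta_weight b ((norm (y0 + R *v y))\<^sup>2 + (a \<bullet> (y0 + R *v y) + c)\<^sup>2) = (1 - h) powr b * beta_weight b ((norm y)\<^sup>2)"
    "\<And>z. (norm (R *v z))\<^sup>2 + (a \<bullet> (R *v z))\<^sup>2 = (1 - h) * (norm z)\<^sup>2"
    using section_beta_weight[of c a b] True unfolding h_def by metis
  define K where "K = \<bar>det R\<bar>"
  have mcg [measurable]: "(\<lambda>y. cone_gauss k y a) \<in> borel_measurable (PiM I (\<lambda>_. borel :: (real ^ 'd) measure))"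
    using measurable_compose[OF measurable_Pair2'[of a borel] measurable_cone_gauss[where 'd='d and k=k]]
    unfolding I_def by simp
  have F: "(\<lambda>y. (\<Prod>j\<in>I. ennreal (beta_weight b ((norm (y j))\<^sup>2 + (a \<bullet> y j + c)\<^sup>2))) * cone_gauss k y a) \<in> borel_measurable (PiM I (\<lambda>_. lborel :: (real ^ 'd) measure))"
    using mcg by (intro borel_measurable_times_ennreal borel_measurable_prod_ennreal) measurable
  have "(\<integral>\<^sup>+y. (\<Prod>j\<in>I. ennreal (beta_weight b ((norm (y j))\<^sup>2 + (a \<bullet> y j + c)\<^sup>2))) * cone_gauss k y a \<partial>PiM I (\<lambda>_. lborel :: (real ^ 'd) measure))
    = ennreal K ^ card I * (\<integral>\<^sup>+y. (\<Prod>j\<in>I. ennreal (beta_weight b ((norm ((\<lambda>j\<in>I. y0 + R *v y j) j))\<^sup>2 + (a \<bullet> (\<lambda>j\<in>I. y0 + R *v y j) j + c)\<^sup>2))) * cone_gauss k (\<lambda>j\<in>I. y0 + R *v y j) a \<partial>PiM I (\<lambda>_. lborel :: (real ^ 'd) measure))"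
    unfolding K_def
    by (rule nn_integral_PiM_affine[OF cI(2) sigma_finite_lborel _ _ F])
       (auto intro: nn_integral_affine_matrix[OF R(2)])
  also have "(\<integral>\<^sup>+y. (\<Prod>j\<in>I. ennreal (beta_weight b ((norm ((\<lambda>j\<in>I. y0 + R *v y j) j))\<^sup>2 + (a \<bullet> (\<lambda>j\<in>I. y0 + R *v y j) j + c)\<^sup>2))) * cone_gauss k (\<lambda>j\<in>I. y0 + R *v y j) a \<partial>PiM I (\<lambda>_. lborel :: (real ^ 'd) measure))
    = (\<integral>\<^sup>+y. (ennreal ((1 - h) powr b) ^ card I * (ennreal K * radial_const CARD('d) (1 - h))) * ((\<Prod>j\<in>I. ennreal (beta_weight b ((norm (y j))\<^sup>2))) * cone_vol k y) \<partial>PiM I (\<lambda>_. lborel :: (real ^ 'd) measure))"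
  \<comment> \<open>The transformation of the cone requires a nondegenerate simplex. Almost all
    configurations inside the ball are nondegenerate, and if a point lies outside, the weights
    vanish on both sides.\<close>
  proof (rule nn_integral_cong_AE)
    have "(\<Prod>j\<in>I. ennreal (beta_weight b ((norm ((\<lambda>j\<in>I. y0 + R *v y j) j))\<^sup>2 + (a \<bullet> (\<lambda>j\<in>I. y0 + R *v y j) j + c)\<^sup>2)))
      = ennreal ((1 - h) powr b) ^ card I * (\<Prod>j\<in>I. ennreal (beta_weight b ((norm (y j))\<^sup>2)))" for y
      by (simp add: R(3) ennreal_mult' prod.distrib)
    note P = this
    from AE_det_beta_weight[OF b, where 'd='d]
    show "AE y in PiM I (\<lambda>_. lborel :: (real ^ 'd) measure). (\<Prod>j\<in>I. ennreal (beta_weight b ((norm ((\<lambda>j\<in>I. y0 + R *v y j) j))\<^sup>2 + (a \<bullet> (\<lambda>j\<in>I. y0 + R *v y j) j + c)\<^sup>2))) * cone_gauss k (\<lambda>j\<in>I. y0 + R *v y j) a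
       = (ennreal ((1 - h) powr b) ^ card I * (ennreal K * radial_const CARD('d) (1 - h))) * ((\<Prod>j\<in>I. ennreal (beta_weight b ((norm (y j))\<^sup>2))) * cone_vol k y)"
      unfolding P I_def[symmetric]
    proof eventually_elim
      case (elim y)
      show ?case
      proof (cases "\<forall>j\<in>I. norm (y j) < 1")
        case True
        then have "det (edge_mat y) \<noteq> 0" using elim by simp
        from cone_gauss_affine[OF R(2,4) this, of k y0] show ?thesis
          unfolding I_def[symmetric] K_def[symmetric] by (simp add: mult_ac)
      next
        case False
        then obtain j where j: "j \<in> I" "norm (y j) \<ge> 1" by (auto simp: not_less)
        have "(\<Prod>j\<in>I. ennreal (beta_weight b ((norm (y j))\<^sup>2))) = 0"
          using prod_beta_weight_eq_0[where y=y and f="\<lambda>_. 0" and b=b, OF j cI(2)]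
          by (simp only: power_zero_numeral add_0_right)
        then show ?thesis by (simp only: mult_zero_left mult_zero_right)
      qed
    qed
  qed
  also have "\<dots> = (ennreal ((1 - h) powr b) ^ card I * (ennreal K * radial_const CARD('d) (1 - h))) * (\<integral>\<^sup>+y. (\<Prod>j\<in>I. ennreal (beta_weight b ((norm (y j))\<^sup>2))) * cone_vol k y \<partial>PiM I (\<lambda>_. lborel :: (real ^ 'd) measure))"
  proof (rule nn_integral_cmult)
    have cv: "cone_vol k \<in> borel_measurable (PiM I (\<lambda>_. lborel :: (real ^ 'd) measure))"
      by (simp only: measurable_cong_sets[OF sets_PiM_lborel refl] I_def measurable_cone_vol)
    have "(\<lambda>y. (\<Prod>j\<in>I. ennreal (beta_weight b ((norm (y j))\<^sup>2)))) \<in> borel_measurable (PiM I (\<lambda>_. lborel :: (real ^ 'd) measure))"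
      by (intro borel_measurable_prod_ennreal) measurable
    then show "(\<lambda>y. (\<Prod>j\<in>I. ennreal (beta_weight b ((norm (y j))\<^sup>2))) * cone_vol k y) \<in> borel_measurable (PiM I (\<lambda>_. lborel :: (real ^ 'd) measure))"
      using cv by (rule borel_measurable_times_ennreal)
  qed
  finally have *: "(\<integral>\<^sup>+y. (\<Prod>j\<in>I. ennreal (beta_weight b ((norm (y j))\<^sup>2 + (a \<bullet> y j + c)\<^sup>2))) * cone_gauss k y a \<partial>PiM I (\<lambda>_. lborel :: (real ^ 'd) measure))
   = ennreal K ^ card I * ((ennreal ((1 - h) powr b) ^ card I * (ennreal K * radial_const CARD('d) (1 - h))) * (\<integral>\<^sup>+y. (\<Prod>j\<in>I. ennreal (beta_weight b ((norm (y j))\<^sup>2))) * cone_vol k y \<partial>PiM I (\<lambda>_. lborel :: (real ^ 'd) measure)))" .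
  have "K \<ge> 0" by (simp add: K_def)
  then have "ennreal (K ^ (CARD('d) + 2) * ((1 - h) powr b) ^ (CARD('d) + 1)) = ennreal K ^ card I * (ennreal ((1 - h) powr b) ^ card I * ennreal K)"
    unfolding cI(1) by (simp add: ennreal_mult' ennreal_power mult_ac)
  then show ?thesis unfolding * using True R(1)[folded K_def] by (simp add: mult.assoc)
qed

lemma lifted_integral_eq_iterated:
  "lifted_integral b k TYPE('d::finite) = (\<integral>\<^sup>+y. \<integral>\<^sup>+t. (\<Prod>j\<in>{1..CARD('d) + 1}. ennreal (beta_weight b ((norm (y j, t j))\<^sup>2))) *
      (\<integral>\<^sup>+u. indicator {u :: real ^ 'd. cone_coords k u} u * ennreal (exp (- (norm (\<Sum>i\<in>UNIV. u $ i *\<^sub>R ((y (vertex_index i), t (vertex_index i)) - (y 1, t 1))))\<^sup>2 / 2)) \<partial>lborel)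
      \<partial>PiM {1..CARD('d) + 1} (\<lambda>_. lborel :: real measure) \<partial>PiM {1..CARD('d) + 1} (\<lambda>_. lborel :: (real ^ 'd) measure))"
proof -
  define I where "I = {1..CARD('d) + 1}"
  have I1: "1 \<in> I" "\<And>i::'d. vertex_index i \<in> I" "finite I" by (auto simp: I_def)
  let ?E = "lborel :: (real ^ 'd) measure" and ?R = "lborel :: real measure" and ?Z = "lborel :: ((real ^ 'd) \<times> real) measure"
  interpret R: product_sigma_finite "\<lambda>_::nat. ?R" by standard
  interpret PR: sigma_finite_measure "PiM I (\<lambda>_. ?R)" by (rule R.sigma_finite) (simp add: I_def)
  define F where "F Z = (\<Prod>j\<in>I. ennreal (beta_weight b ((norm (Z j))\<^sup>2))) *
     (\<integral>\<^sup>+u. indicator {u :: real ^ 'd. cone_coords k u} u *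
        ennreal (exp (- (norm (\<Sum>i\<in>UNIV. u $ i *\<^sub>R (Z (vertex_index i) - Z 1)))\<^sup>2 / 2)) \<partial>lborel)" for Z :: "nat \<Rightarrow> (real ^ 'd) \<times> real"
  have F [measurable]: "F \<in> borel_measurable (PiM I (\<lambda>_. ?Z))"
  proof -
    have m1: "(\<lambda>Z. Z j) \<in> measurable (PiM I (\<lambda>_. ?Z)) borel" if "j \<in> I" for j
      using that by measurable
    have [measurable]: "(\<lambda>x. \<Sum>i\<in>UNIV. snd x $ i *\<^sub>R (fst x (vertex_index i) - fst x 1)) \<in> borel_measurable (PiM I (\<lambda>_. ?Z) \<Otimes>\<^sub>M ?E)"
      unfolding measurable_cong_sets[OF sets_pair_measure_cong[OF refl sets_lborel] refl]
      by (intro borel_measurable_sum borel_measurable_scaleR borel_measurable_diff I1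
         measurable_compose[OF measurable_fst m1] measurable_compose[OF measurable_snd borel_measurable_nth])
    have [measurable]: "{u. cone_coords k u} \<in> sets (borel :: (real ^ 'd) measure)" by measurable
    have "(\<lambda>x. indicator {u. cone_coords k u} (snd x) * ennreal (exp (- (norm (\<Sum>i\<in>UNIV. snd x $ i *\<^sub>R (fst x (vertex_index i) - fst x 1)))\<^sup>2 / 2)))
       \<in> borel_measurable (PiM I (\<lambda>_. ?Z) \<Otimes>\<^sub>M ?E)"
      by measurable
    then have "(\<lambda>Z. \<integral>\<^sup>+u. indicator {u. cone_coords k u} u * ennreal (exp (- (norm (\<Sum>i\<in>UNIV. u $ i *\<^sub>R (Z (vertex_index i) - Z 1)))\<^sup>2 / 2)) \<partial>?E)
       \<in> borel_measurable (PiM I (\<lambda>_. ?Z))"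
      by (intro lborel.borel_measurable_nn_integral) (simp add: case_prod_beta)
    moreover have "(\<lambda>Z. (\<Prod>j\<in>I. ennreal (beta_weight b ((norm (Z j))\<^sup>2)))) \<in> borel_measurable (PiM I (\<lambda>_. ?Z))"
      by (intro borel_measurable_prod_ennreal) measurable
    ultimately show ?thesis unfolding F_def[abs_def] by (rule borel_measurable_times_ennreal[rotated])
  qed
  have id: "(\<lambda>x. x) \<in> measurable (?E \<Otimes>\<^sub>M ?R) ?Z" by (simp add: lborel_prod)
  have dZ: "distr (?E \<Otimes>\<^sub>M ?R) ?Z (\<lambda>x. x) = ?Z"
    unfolding lborel_prod by (rule distr_id)
  have "PiM I (\<lambda>_. ?Z) = distr (PiM I (\<lambda>_. ?E) \<Otimes>\<^sub>M PiM I (\<lambda>_. ?R)) (PiM I (\<lambda>_. ?Z)) (\<lambda>(y, t). \<lambda>i\<in>I. (y i, t i))"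
    using distr_PiM_pair[OF I1(3) sigma_finite_lborel sigma_finite_lborel id] sigma_finite_lborel
    unfolding dZ by blast
  then have "lifted_integral b k TYPE('d) = (\<integral>\<^sup>+Z. F Z \<partial>distr (PiM I (\<lambda>_. ?E) \<Otimes>\<^sub>M PiM I (\<lambda>_. ?R)) (PiM I (\<lambda>_. ?Z)) (\<lambda>(y, t). \<lambda>i\<in>I. (y i, t i)))"
    unfolding lifted_integral_def F_def I_def by simp
  also have m: "(\<lambda>(y, t). \<lambda>i\<in>I. (y i, t i)) \<in> measurable (PiM I (\<lambda>_. ?E) \<Otimes>\<^sub>M PiM I (\<lambda>_. ?R)) (PiM I (\<lambda>_. ?Z))"
  proof -
    have "(\<lambda>(y, t). \<lambda>i\<in>I. (y i, t i)) \<in> measurable (PiM I (\<lambda>_. ?E) \<Otimes>\<^sub>M PiM I (\<lambda>_. ?R)) (PiM I (\<lambda>_. ?E \<Otimes>\<^sub>M ?R))"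
      by measurable
    then show ?thesis by (simp add: lborel_prod)
  qed
  have "(\<integral>\<^sup>+Z. F Z \<partial>distr (PiM I (\<lambda>_. ?E) \<Otimes>\<^sub>M PiM I (\<lambda>_. ?R)) (PiM I (\<lambda>_. ?Z)) (\<lambda>(y, t). \<lambda>i\<in>I. (y i, t i)))
    = (\<integral>\<^sup>+x. F (case x of (y, t) \<Rightarrow> \<lambda>i\<in>I. (y i, t i)) \<partial>(PiM I (\<lambda>_. ?E) \<Otimes>\<^sub>M PiM I (\<lambda>_. ?R)))"
    by (rule nn_integral_distr[OF m]) (simp add: F)
  also have "\<dots> = (\<integral>\<^sup>+y. \<integral>\<^sup>+t. F (\<lambda>i\<in>I. (y i, t i)) \<partial>PiM I (\<lambda>_. ?R) \<partial>PiM I (\<lambda>_. ?E))"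
    using measurable_compose[OF m F] by (subst PR.nn_integral_fst[symmetric]) auto
  also have "\<dots> = (\<integral>\<^sup>+y. \<integral>\<^sup>+t. (\<Prod>j\<in>I. ennreal (beta_weight b ((norm (y j, t j))\<^sup>2))) *
      (\<integral>\<^sup>+u. indicator {u :: real ^ 'd. cone_coords k u} u * ennreal (exp (- (norm (\<Sum>i\<in>UNIV. u $ i *\<^sub>R ((y (vertex_index i), t (vertex_index i)) - (y 1, t 1))))\<^sup>2 / 2)) \<partial>lborel)
      \<partial>PiM I (\<lambda>_. ?R) \<partial>PiM I (\<lambda>_. ?E))"
  proof -
    have "F (\<lambda>i\<in>I. (y i, t i)) = (\<Prod>j\<in>I. ennreal (beta_weight b ((norm (y j, t j))\<^sup>2))) *
      (\<integral>\<^sup>+u. indicator {u :: real ^ 'd. cone_coords k u} u * ennreal (exp (- (norm (\<Sum>i\<in>UNIV. u $ i *\<^sub>R ((y (vertex_index i), t (vertex_index i)) - (y 1, t 1))))\<^sup>2 / 2)) \<partial>lborel)" for y t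
      unfolding F_def using I1 by simp
    then show ?thesis by simp
  qed
  finally show ?thesis unfolding I_def .
qed

text \<open>Once the base points are integrated innermost, with the graph held fixed, every slice is
  the same expectation times a factor free of \<open>k\<close>. The point is that a single
  \<open>C\<close> serves all \<open>k\<close>.\<close>

proposition lifted_integral_eq_expected_cone_vol:
  assumes b: "b > -1"
  obtains C where "\<And>k. lifted_integral b k TYPE('d::finite) = C * (\<integral>\<^sup>+X. cone_vol k X \<partial>PiM {1..CARD('d) + 1} (\<lambda>_. beta_dist b :: (real ^ 'd) measure))"
proof -
  define I where "I = {1..CARD('d) + 1}"
  have I1: "1 \<in> I" "\<And>i::'d. vertex_index i \<in> I" "finite I" "card I = CARD('d) + 1" by (auto simp: I_def)
  let ?E = "lborel :: (real ^ 'd) measure" and ?R = "lborel :: real measure"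
  interpret E: product_sigma_finite "\<lambda>_::nat. ?E" by standard
  interpret PE: sigma_finite_measure "PiM I (\<lambda>_. ?E)" by (rule E.sigma_finite) (simp add: I_def)
  interpret pE: pair_sigma_finite "PiM I (\<lambda>_. ?E)" ?E ..
  interpret pR: pair_sigma_finite "PiM I (\<lambda>_. ?E)" ?R ..
  define cst where "cst c a = (let h = c\<^sup>2 / (1 + a \<bullet> a) in
     if h < 1 then ennreal ((sqrt (1 - h) ^ CARD('d) * \<bar>det (section_mat a)\<bar>) ^ (CARD('d) + 2) * ((1 - h) powr b) ^ (CARD('d) + 1))
        * radial_const CARD('d) (1 - h) else 0)" for c and a :: "real ^ 'd"
  define B where "B k = (\<integral>\<^sup>+y. (\<Prod>j\<in>I. ennreal (beta_weight b ((norm (y j))\<^sup>2))) * cone_vol k y \<partial>PiM I (\<lambda>_. ?E))" for k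
  have cst_m: "(\<lambda>x. cst (fst x) (snd x)) \<in> borel_measurable (?R \<Otimes>\<^sub>M ?E)"
  proof -
    have [measurable]: "(\<lambda>a. det (section_mat a)) \<in> borel_measurable ?E"
      unfolding section_mat_def by (intro borel_measurable_det) simp
    show ?thesis unfolding cst_def Let_def by measurable
  qed
  have key: "lifted_integral b k TYPE('d) = (\<integral>\<^sup>+c. \<integral>\<^sup>+a. cst c a \<partial>?E \<partial>?R) * B k" for k
  proof -
    define K where "K y c a = (\<Prod>j\<in>I. ennreal (beta_weight b ((norm (y j))\<^sup>2 + (a \<bullet> y j + c)\<^sup>2))) * cone_gauss k y a"
      for y :: "nat \<Rightarrow> real ^ 'd" and c a
    have K: "(\<lambda>x. K (f x) (g x) (h x)) \<in> borel_measurable M"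
      if [measurable]: "f \<in> measurable M (PiM I (\<lambda>_. borel))" "g \<in> borel_measurable M" "h \<in> borel_measurable M" for f g h and M :: "'x measure"
    proof -
      have "(\<lambda>x. cone_gauss k (fst (f x, h x)) (snd (f x, h x))) \<in> borel_measurable M"
        using that(1) unfolding I_def
        by (intro measurable_compose[OF _ measurable_cone_gauss[where 'd='d]] measurable_Pair that)
      moreover have "(\<lambda>x. f x j) \<in> borel_measurable M" if "j \<in> I" for j
        by (rule measurable_compose[OF \<open>f \<in> _\<close>]) (use that in measurable)
      ultimately show ?thesis unfolding K_def
        by (intro borel_measurable_times_ennreal borel_measurable_prod_ennreal measurable_compose[OF _ measurable_ennreal]
             measurable_compose[OF _ borel_measurable_beta_weight] borel_measurable_add borel_measurable_power borel_measurable_norm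
             borel_measurable_inner that) simp_all
    qed
    have "lifted_integral b k TYPE('d) = (\<integral>\<^sup>+y. \<integral>\<^sup>+c. \<integral>\<^sup>+a. K y c a \<partial>?E \<partial>?R \<partial>PiM I (\<lambda>_. ?E))"
      unfolding lifted_integral_eq_iterated I_def[symmetric]
    proof (rule nn_integral_cong_AE)
      from AE_det_beta_weight[OF b, where 'd='d]
      show "AE y in PiM I (\<lambda>_. ?E). (\<integral>\<^sup>+t. (\<Prod>j\<in>I. ennreal (beta_weight b ((norm (y j, t j))\<^sup>2))) *
      (\<integral>\<^sup>+u. indicator {u :: real ^ 'd. cone_coords k u} u * ennreal (exp (- (norm (\<Sum>i\<in>UNIV. u $ i *\<^sub>R ((y (vertex_index i), t (vertex_index i)) - (y 1, t 1))))\<^sup>2 / 2)) \<partial>lborel)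
      \<partial>PiM I (\<lambda>_. ?R)) = (\<integral>\<^sup>+c. \<integral>\<^sup>+a. K y c a \<partial>?E \<partial>?R)"
        unfolding I_def[symmetric]
      proof eventually_elim
        case (elim y)
        show ?case
        proof (cases "\<forall>j\<in>I. norm (y j) < 1")
          case True
          then have "det (edge_mat y) \<noteq> 0" using elim by simp
          then show ?thesis unfolding K_def cone_gauss_def I_def by (rule inner_graph_integral)
        next
          case False
          then obtain j where j: "j \<in> I" "norm (y j) \<ge> 1" by (auto simp: not_less)
          have "(\<Prod>j\<in>I. ennreal (beta_weight b ((norm (y j))\<^sup>2 + (f j)\<^sup>2))) = 0" for f
            by (rule prod_beta_weight_eq_0[where y=y, OF j I1(3)])
          moreover from this have "(\<Prod>j\<in>I. ennreal (beta_weight b ((norm (y j, f j :: real))\<^sup>2))) = 0" for f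
            by (simp only: norm_Pair real_norm_def power2_abs real_sqrt_pow2[OF add_nonneg_nonneg[OF zero_le_power2 zero_le_power2]])
          ultimately show ?thesis unfolding K_def by (simp only: mult_zero_left nn_integral_const)
        qed
      qed
    qed
    also have "\<dots> = (\<integral>\<^sup>+c. \<integral>\<^sup>+y. \<integral>\<^sup>+a. K y c a \<partial>?E \<partial>PiM I (\<lambda>_. ?E) \<partial>?R)"
    proof (rule pR.Fubini'[symmetric])
      have "(\<lambda>x. K (fst (fst x)) (snd (fst x)) (snd x)) \<in> borel_measurable ((PiM I (\<lambda>_. ?E) \<Otimes>\<^sub>M ?R) \<Otimes>\<^sub>M ?E)"
        by (rule K) measurable
      then show "(\<lambda>(y, c). \<integral>\<^sup>+a. K y c a \<partial>?E) \<in> borel_measurable (PiM I (\<lambda>_. ?E) \<Otimes>\<^sub>M ?R)"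
        unfolding case_prod_beta by (intro lborel.borel_measurable_nn_integral) (simp add: case_prod_beta)
    qed
    also have "\<dots> = (\<integral>\<^sup>+c. \<integral>\<^sup>+a. \<integral>\<^sup>+y. K y c a \<partial>PiM I (\<lambda>_. ?E) \<partial>?E \<partial>?R)"
    proof (rule nn_integral_cong)
      fix c :: real
      have "(\<lambda>x. K (fst x) c (snd x)) \<in> borel_measurable (PiM I (\<lambda>_. ?E) \<Otimes>\<^sub>M ?E)"
        by (rule K) measurable
      then show "(\<integral>\<^sup>+y. \<integral>\<^sup>+a. K y c a \<partial>?E \<partial>PiM I (\<lambda>_. ?E)) = (\<integral>\<^sup>+a. \<integral>\<^sup>+y. K y c a \<partial>PiM I (\<lambda>_. ?E) \<partial>?E)"
        by (intro pE.Fubini'[symmetric]) (simp add: case_prod_beta)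
    qed
    also have "\<dots> = (\<integral>\<^sup>+c. \<integral>\<^sup>+a. cst c a * B k \<partial>?E \<partial>?R)"
      unfolding K_def cst_def Let_def B_def I_def section_integral[OF b] ..
    also have "\<dots> = (\<integral>\<^sup>+c. \<integral>\<^sup>+a. cst c a \<partial>?E \<partial>?R) * B k"
    proof -
      have [measurable]: "(\<lambda>a. cst c a) \<in> borel_measurable ?E" for c
        using measurable_compose[OF measurable_Pair1'[of c] cst_m] by simp
      have [measurable]: "(\<lambda>c. \<integral>\<^sup>+a. cst c a \<partial>?E) \<in> borel_measurable ?R"
        using cst_m by (intro lborel.borel_measurable_nn_integral) (simp add: case_prod_beta)
      show ?thesis by (simp add: nn_integral_multc)
    qed
    finally show ?thesis .
  qed
  have c: "beta_const CARD('d) b > 0" using b by (intro beta_const_pos) auto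
  \<comment> \<open>Normalising constants of the \<open>d + 1\<close> densities; their product is
    positive and finite and can be divided out.\<close>
  define c' where "c' = ennreal (beta_const CARD('d) b) ^ (CARD('d) + 1)"
  have "c' = ennreal (beta_const CARD('d) b ^ (CARD('d) + 1))"
    unfolding c'_def using c by (intro ennreal_power less_imp_le)
  moreover have "beta_const CARD('d) b ^ (CARD('d) + 1) > 0" using c by (rule zero_less_power)
  ultimately have c': "c' \<noteq> 0" "c' \<noteq> \<infinity>"
    by (simp_all only: ennreal_eq_0_iff not_le ennreal_neq_top infinity_ennreal_def not_False_eq_True)
  have E: "(\<integral>\<^sup>+X. cone_vol k X \<partial>PiM I (\<lambda>_. beta_dist b :: (real ^ 'd) measure)) = c' * B k" for k
  proof -
    have cv [measurable]: "cone_vol k \<in> borel_measurable (PiM I (\<lambda>_. ?E))"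
      by (simp only: measurable_cong_sets[OF sets_PiM_lborel refl] I_def measurable_cone_vol)
    have pm [measurable]: "(\<lambda>y. \<Prod>j\<in>I. ennreal (r * beta_weight b ((norm (y j))\<^sup>2))) \<in> borel_measurable (PiM I (\<lambda>_. ?E))" for r
      by (intro borel_measurable_prod_ennreal) measurable
    have "(\<integral>\<^sup>+X. cone_vol k X \<partial>PiM I (\<lambda>_. beta_dist b :: (real ^ 'd) measure)) =
       (\<integral>\<^sup>+y. (\<Prod>j\<in>I. ennreal (beta_const CARD('d) b * beta_weight b ((norm (y j))\<^sup>2))) * cone_vol k y \<partial>PiM I (\<lambda>_. ?E))"
      unfolding PiM_beta_dist[OF b I1(3)] by (rule nn_integral_density) measurable
    also have "\<dots> = (\<integral>\<^sup>+y. c' * ((\<Prod>j\<in>I. ennreal (beta_weight b ((norm (y j))\<^sup>2))) * cone_vol k y) \<partial>PiM I (\<lambda>_. ?E))"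
      unfolding c'_def using c by (simp add: ennreal_mult' prod.distrib I1(4) mult.assoc)
    also have "\<dots> = c' * B k" unfolding B_def
      using pm[of 1] by (intro nn_integral_cmult) simp
    finally show ?thesis .
  qed
  have "lifted_integral b k TYPE('d) = ((\<integral>\<^sup>+c. \<integral>\<^sup>+a. cst c a \<partial>?E \<partial>?R) / c') * (\<integral>\<^sup>+X. cone_vol k X \<partial>PiM I (\<lambda>_. beta_dist b :: (real ^ 'd) measure))" for k
  proof -
    have "((\<integral>\<^sup>+c. \<integral>\<^sup>+a. cst c a \<partial>?E \<partial>?R) / c') * (c' * B k) = (\<integral>\<^sup>+c. \<integral>\<^sup>+a. cst c a \<partial>?E \<partial>?R) * (c' / c') * B k"
      by (simp add: ennreal_times_divide ennreal_divide_times mult_ac)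
    also have "c' / c' = 1" using c' by (simp add: ennreal_divide_self less_top)
    finally show ?thesis unfolding E key by simp
  qed
  then show ?thesis unfolding I_def by (rule that)
qed

section \<open>Fourier representation\<close>

text \<open>The integral of \<open>exp (- (e - \<i> * x) * m)\<close> over the half-line
  \<open>m > 0\<close>. As \<open>e\<close> tends to \<open>0\<close>, its real part tends to \<pi>
  times a point mass at \<open>0\<close> and its imaginary part to the principal value of
  \<open>1 / x\<close>.\<close>

definition half_line_ft :: "real \<Rightarrow> real \<Rightarrow> complex" where
  "half_line_ft e x = 1 / (of_real e - \<i> * of_real x)"

definition weight_ft :: "bool \<Rightarrow> real \<Rightarrow> real \<Rightarrow> complex" where
  "weight_ft pos e x = (if pos then half_line_ft e x else half_line_ft e x + half_line_ft e (- x))"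

text \<open>A regularised indicator function of the half-line or the line; its Fourier transform is \<^const>\<open>weight_ft\<close>.\<close>

definition abel_weight :: "bool \<Rightarrow> real \<Rightarrow> real \<Rightarrow> real" where
  "abel_weight pos e m = (if pos \<and> m < 0 then 0 else exp (- (e * \<bar>m\<bar>)))"

lemma abel_weight_nonneg [simp]: "0 \<le> abel_weight pos e m" by (simp add: abel_weight_def)

lemma abel_weight_measurable [measurable]: "abel_weight pos e \<in> borel_measurable borel"
  unfolding abel_weight_def[abs_def] by measurable

lemma half_line_fourier:
  assumes e: "e > 0"
  shows "set_integrable lborel {0<..} (\<lambda>m. exp (- (of_real e - \<i> * of_real x) * of_real m) :: complex)"
    and "(LBINT m:{0<..}. exp (- (of_real e - \<i> * of_real x) * of_real m) :: complex) = half_line_ft e x"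
proof -
  define z where "z = of_real e - \<i> * of_real x"
  have z: "z \<noteq> 0" using e by (auto simp: z_def complex_eq_iff)
  have nz: "norm (exp (- z * of_real m)) = exp (- (m * e))" for m :: real
    by (simp add: z_def norm_exp_eq_Re mult.commute)
  show 1: "set_integrable lborel {0<..} (\<lambda>m. exp (- (of_real e - \<i> * of_real x) * of_real m) :: complex)"
    unfolding z_def[symmetric] set_integrable_def
    by (rule Bochner_Integration.integrable_bound[OF integrable_I0i_exp_mscale[OF e, unfolded set_integrable_def]])
       (measurable, simp only: norm_scaleR nz real_norm_def abs_exp_cancel order_refl, simp)
  have "(LBINT m=0..\<infinity>. exp (- z * of_real m)) = 0 - (- (1 / z))"
  proof (rule interval_integral_FTC_integrable[where F="\<lambda>m. - (exp (- z * of_real m) / z)"])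
    show "((\<lambda>m. - (exp (- z * of_real m) / z)) has_vector_derivative exp (- z * of_real m)) (at m)" for m :: real
    proof -
      have "((\<lambda>w. - (exp (- z * w) / z)) has_field_derivative exp (- z * of_real m)) (at (of_real m))"
        using z by (auto intro!: derivative_eq_intros)
      from has_vector_derivative_real_field[OF this] show ?thesis by (simp add: o_def)
    qed
    show "set_integrable lborel (einterval 0 \<infinity>) (\<lambda>m. exp (- z * complex_of_real m))"
      using 1 unfolding z_def[symmetric] by (simp add: zero_ereal_def)
    have "isCont (\<lambda>m. - (exp (- z * complex_of_real m) / z)) 0" using z by (intro continuous_intros) auto
    then have "((\<lambda>m. - (exp (- z * complex_of_real m) / z)) \<longlongrightarrow> - (1 / z)) (at_right 0)"
      unfolding isCont_def by (auto dest: tendsto_within_subset)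
    then show "(((\<lambda>m. - (exp (- z * complex_of_real m) / z)) \<circ> real_of_ereal) \<longlongrightarrow> - (1 / z)) (at_right 0)"
      unfolding zero_ereal_def by (simp add: ereal_tendsto_simps)
    have "((\<lambda>m. exp (- (m * e))) \<longlongrightarrow> 0) at_top" using e by real_asymp
    then have "((\<lambda>m. norm (exp (- z * complex_of_real m))) \<longlongrightarrow> 0) at_top" unfolding nz .
    then have "((\<lambda>m. exp (- z * complex_of_real m)) \<longlongrightarrow> 0) at_top" by (rule tendsto_norm_zero_cancel)
    then have "((\<lambda>m. - (exp (- z * complex_of_real m) / z)) \<longlongrightarrow> - (0 / z)) at_top"
      by (rule tendsto_minus[OF tendsto_divide[OF _ tendsto_const z]])
    then show "(((\<lambda>m. - (exp (- z * complex_of_real m) / z)) \<circ> real_of_ereal) \<longlongrightarrow> 0) (at_left \<infinity>)"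
      by (simp add: ereal_tendsto_simps)
  qed (auto intro!: continuous_intros)
  then show "(LBINT m:{0<..}. exp (- (of_real e - \<i> * of_real x) * of_real m) :: complex) = half_line_ft e x"
    unfolding z_def[symmetric] half_line_ft_def by (simp add: interval_lebesgue_integral_0_infty)
qed

lemma abel_weight_fourier:
  assumes e: "e > 0"
  shows abel_weight_iexp_integrable: "integrable lborel (\<lambda>m. of_real (abel_weight pos e m) * iexp (m * x))"
    and "(\<integral>m. of_real (abel_weight pos e m) * iexp (m * x) \<partial>lborel) = weight_ft pos e x"
proof -
  define g where "g x m = indicator {0<..} m *\<^sub>R (exp (- (of_real e - \<i> * of_real x) * of_real m) :: complex)" for x m :: real
  have g1: "integrable lborel (g x)" for x
    using half_line_fourier(1)[OF e, of x] unfolding set_integrable_def g_def[abs_def] .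
  have g2: "(\<integral>m. g x m \<partial>lborel) = half_line_ft e x" for x
    using half_line_fourier(2)[OF e, of x] unfolding set_lebesgue_integral_def g_def[abs_def] .
  have g3: "integrable lborel (\<lambda>m. g (-x) (0 + (-1) * m))" "(\<integral>m. g (-x) (0 + (-1) * m) \<partial>lborel) = half_line_ft e (- x)" for x
  proof -
    show "integrable lborel (\<lambda>m. g (-x) (0 + (-1) * m))" by (rule lborel_integrable_real_affine[OF g1]) simp
    show "(\<integral>m. g (-x) (0 + (-1) * m) \<partial>lborel) = half_line_ft e (- x)"
      using lborel_integral_real_affine[of "-1" "g (-x)" 0] g2[of "-x"] by simp
  qed
  have ex: "exp (- (of_real e - \<i> * of_real x) * of_real m) = of_real (exp (- (e * m))) * iexp (m * x)" for m x :: real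
    unfolding exp_of_real[symmetric] exp_add[symmetric] by (rule arg_cong[where f=exp]) (simp add: algebra_simps)
  \<comment> \<open>The point \<open>m = 0\<close> belongs to neither open half-line, although the
    weight is \<open>1\<close> there.\<close>
  have "AE m in lborel. of_real (abel_weight pos e m) * iexp (m * x) = g x m + (if pos then 0 else g (-x) (0 + (-1) * m))"
    using AE_lborel_singleton[of 0] 
  proof eventually_elim
    case (elim m)
    then show ?case using ex[of x m] ex[of "-x" "-m"] by (auto simp: abel_weight_def g_def indicator_def)
  qed
  note ae = this
  have "integrable lborel (\<lambda>m. g x m + (if pos then 0 else g (-x) (0 + (-1) * m)))"
    using g1 g3(1) by (cases pos) (simp_all del: add_0)
  then show "integrable lborel (\<lambda>m. of_real (abel_weight pos e m) * iexp (m * x))"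
    by (rule integrable_cong_AE_imp) (use ae in \<open>auto simp del: add_0\<close>)
  have "(\<integral>m. of_real (abel_weight pos e m) * iexp (m * x) \<partial>lborel) = (\<integral>m. g x m + (if pos then 0 else g (-x) (0 + (-1) * m)) \<partial>lborel)"
  proof (rule integral_cong_AE[OF _ _ ae])
    show "(\<lambda>m. g x m + (if pos then 0 else g (-x) (0 + (-1) * m))) \<in> borel_measurable lborel"
      using borel_measurable_integrable[OF g1] borel_measurable_integrable[OF g3(1)] by (cases pos) (simp_all del: add_0)
  qed measurable
  also have "\<dots> = weight_ft pos e x"
    using g1 g2 g3 by (cases pos) (simp_all add: weight_ft_def del: add_0)
  finally show "(\<integral>m. of_real (abel_weight pos e m) * iexp (m * x) \<partial>lborel) = weight_ft pos e x" .
qed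

lemma abel_weight_integrable:
  assumes "e > 0" shows "integrable lborel (abel_weight pos e)"
  using integrable_Re[OF abel_weight_iexp_integrable[OF assms, of pos 0]] by simp

text \<open>The characteristic function of the normal law is read backwards: a Gaussian in
  \<open>W\<close> becomes an average of characters, and characters are multiplicative over the
  edges.\<close>

lemma gaussian_fourier:
  fixes W :: "'a::euclidean_space"
  shows "(\<integral>g. iexp ((\<Sum>c\<in>Basis. g c *\<^sub>R c) \<bullet> W) \<partial>PiM Basis (\<lambda>_. std_normal_distribution)) = complex_of_real (exp (- (norm W)\<^sup>2 / 2))"
proof -
  interpret N: prob_space std_normal_distribution by (rule real_dist_normal_dist[THEN real_distribution.axioms(1)])
  interpret P: product_sigma_finite "\<lambda>_::'a. std_normal_distribution" by standard
  have "iexp ((\<Sum>c\<in>Basis. g c *\<^sub>R c) \<bullet> W) = (\<Prod>c\<in>Basis. iexp ((c \<bullet> W) * g c))" for g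
    by (simp add: inner_sum_left sum_distrib_left exp_sum mult_ac)
  then have "(\<integral>g. iexp ((\<Sum>c\<in>Basis. g c *\<^sub>R c) \<bullet> W) \<partial>PiM Basis (\<lambda>_. std_normal_distribution)) =
     (\<Prod>c\<in>Basis. \<integral>x. iexp ((c \<bullet> W) * x) \<partial>std_normal_distribution)"
    by (simp only:) (intro P.product_integral_prod finite_Basis N.integrable_const_bound[where B=1], auto)
  also have "\<dots> = (\<Prod>c\<in>Basis. complex_of_real (exp (- ((c \<bullet> W)\<^sup>2) / 2)))"
    using char_std_normal_distribution by (intro prod.cong refl) (auto simp: char_def fun_eq_iff)
  also have "\<dots> = complex_of_real (exp (\<Sum>c\<in>Basis. - ((c \<bullet> W)\<^sup>2) / 2))"
    by (simp add: exp_sum)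
  also have "(\<Sum>c\<in>Basis. - ((c \<bullet> W)\<^sup>2) / 2) = - (norm W)\<^sup>2 / 2"
    unfolding power2_norm_eq_inner by (subst (2) euclidean_inner)
      (simp add: sum_negf sum_divide_distrib[symmetric] power2_eq_square inner_commute)
  finally show ?thesis .
qed

lemma vec_product_integral:
  fixes g :: "'d::finite \<Rightarrow> real \<Rightarrow> complex"
  assumes "\<And>i. integrable lborel (g i)"
  shows "integrable (lborel :: (real ^ 'd) measure) (\<lambda>u. \<Prod>i\<in>UNIV. g i (u $ i))"
    and "(\<integral>u. (\<Prod>i\<in>UNIV. g i (u $ i)) \<partial>(lborel :: (real ^ 'd) measure)) = (\<Prod>i\<in>UNIV. integral\<^sup>L lborel (g i))"
proof -
  interpret P: product_sigma_finite "\<lambda>_::'d. lborel :: real measure" by standard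
  have m: "(\<lambda>f. \<chi> i. f i) \<in> measurable (PiM UNIV (\<lambda>_. lborel)) (borel :: (real ^ 'd) measure)"
    by (rule borel_measurable_vec_lambda) auto
  have [measurable]: "g i \<in> borel_measurable borel" for i using borel_measurable_integrable[OF assms[of i]] by simp
  have mg: "(\<lambda>u. \<Prod>i\<in>UNIV. g i (u $ i)) \<in> borel_measurable (borel :: (real ^ 'd) measure)" by measurable
  have L: "(lborel :: (real ^ 'd) measure) = distr (PiM UNIV (\<lambda>_. lborel)) borel (\<lambda>f. \<chi> i. f i)"
    using lborel_vec_eq_distr_PiM[of "\<lambda>i::'d. i"] by simp
  show "integrable (lborel :: (real ^ 'd) measure) (\<lambda>u. \<Prod>i\<in>UNIV. g i (u $ i))"
    unfolding L using integrable_distr_eq[OF m mg] P.product_integrable_prod[of UNIV g] assms by simp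
  show "(\<integral>u. (\<Prod>i\<in>UNIV. g i (u $ i)) \<partial>(lborel :: (real ^ 'd) measure)) = (\<Prod>i\<in>UNIV. integral\<^sup>L lborel (g i))"
    unfolding L using integral_distr[OF m mg] P.product_integral_prod[of UNIV g] assms by simp
qed

section \<open>Beta laws on general Euclidean spaces and their one-dimensional marginals\<close>

definition beta_weight_total :: "real \<Rightarrow> 'a::euclidean_space itself \<Rightarrow> ennreal" where
  "beta_weight_total b _ = (\<integral>\<^sup>+z. ennreal (beta_weight b ((norm (z :: 'a))\<^sup>2)) \<partial>lborel)"

lemma beta_weight_total_bounds:
  assumes b: "b > -1"
  shows "0 < beta_weight_total b TYPE('a::euclidean_space)" "beta_weight_total b TYPE('a) < \<infinity>"
proof -
  define a where "a = real DIM('a) / 2"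
  have a: "a > 0" by (simp add: a_def)
  have "beta_weight_total b TYPE('a) = (\<integral>\<^sup>+z. ennreal (beta_weight b ((norm (z :: 'a))\<^sup>2)) * indicator UNIV z \<partial>lborel)"
    by (simp add: beta_weight_total_def)
  also have "\<dots> = emeasure lborel (ball (0::'a) 1 \<inter> UNIV) * (\<integral>\<^sup>+t. ennreal (a * t powr (a - 1)) * indicator {0<..} t * ennreal (beta_weight b t) \<partial>lborel)"
    unfolding a_def by (rule nn_integral_radial_cone) (auto simp: is_cone_def)
  also have "(\<integral>\<^sup>+t. ennreal (a * t powr (a - 1)) * indicator {0<..} t * ennreal (beta_weight b t) \<partial>lborel) =
     (\<integral>\<^sup>+t. ennreal a * (ennreal (t powr (a - 1) * (1 - t) powr ((b + 1) - 1)) * indicator {0<..<1} t) \<partial>lborel)"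
    using a by (intro nn_integral_cong) (auto simp: beta_weight_def indicator_def ennreal_mult'[symmetric] mult.assoc)
  also have "\<dots> = ennreal a * ennreal (Beta a (b + 1))"
    using nn_integral_Beta[of a "b + 1"] a b by (subst nn_integral_cmult) auto
  finally have eq: "beta_weight_total b TYPE('a) = emeasure lborel (ball (0::'a) 1) * (ennreal a * ennreal (Beta a (b + 1)))" by simp
  have "Gamma a > 0" "Gamma (b + 1) > 0" "Gamma (a + (b + 1)) > 0" using a b by (auto intro!: Gamma_real_pos)
  then have "Beta a (b + 1) > 0" by (simp add: Beta_def)
  then show "0 < beta_weight_total b TYPE('a)" "beta_weight_total b TYPE('a) < \<infinity>"
    unfolding eq using a by (auto simp: emeasure_ball ennreal_mult'[symmetric])
qed

text \<open>The counterpart of \<open>beta_dist\<close> on any Euclidean space, needed for the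
  lifted space and for the line. The total mass is kept as an integral instead of a Gamma quotient
  because it cancels later.\<close>

definition ball_beta :: "real \<Rightarrow> 'a::euclidean_space measure" where
  "ball_beta b = density lborel (\<lambda>z. ennreal (beta_weight b ((norm z)\<^sup>2)) / beta_weight_total b TYPE('a))"

lemma sets_ball_beta [simp, measurable_cong]: "sets (ball_beta b) = sets borel"
  by (simp add: ball_beta_def)

lemma space_ball_beta [simp]: "space (ball_beta b) = UNIV"
  by (simp add: ball_beta_def)

lemma nn_integral_ball_beta:
  assumes [measurable]: "f \<in> borel_measurable borel"
  shows "(\<integral>\<^sup>+z. f z \<partial>(ball_beta b :: 'a::euclidean_space measure)) =
    (\<integral>\<^sup>+z. ennreal (beta_weight b ((norm z)\<^sup>2)) * f z \<partial>lborel) / beta_weight_total b TYPE('a)"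
  unfolding ball_beta_def
  by (subst nn_integral_density) (auto simp: divide_ennreal_def mult_ac nn_integral_cmult[symmetric])

lemma prob_space_ball_beta:
  assumes "b > -1" shows "prob_space (ball_beta b :: 'a::euclidean_space measure)"
proof (rule prob_spaceI)
  have "emeasure (ball_beta b :: 'a measure) UNIV = (\<integral>\<^sup>+z. 1 \<partial>(ball_beta b :: 'a measure))" by simp
  also have "\<dots> = beta_weight_total b TYPE('a) / beta_weight_total b TYPE('a)"
    by (subst nn_integral_ball_beta) (simp_all add: beta_weight_total_def)
  also have "\<dots> = 1" using beta_weight_total_bounds[OF assms, where 'a='a] by (simp add: ennreal_divide_self)
  finally show "emeasure (ball_beta b :: 'a measure) (space (ball_beta b)) = 1" by simp
qed

text \<open>Origin of the exponent \<open>b + d / 2\<close>: the weight contributes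
  \<open>(1 - h) powr b\<close>, and the volume of a section of radius \<open>sqrt (1 - h)\<close>
  contributes another half power per dimension.\<close>

lemma section_total:
  fixes a :: "real ^ 'd::finite"
  shows "(\<integral>\<^sup>+y. ennreal (beta_weight b ((norm y)\<^sup>2 + (a \<bullet> y + c)\<^sup>2)) \<partial>lborel)
     = ennreal \<bar>det (section_mat a)\<bar> * beta_weight_total b TYPE(real ^ 'd) * ennreal (beta_weight (b + real CARD('d) / 2) (c\<^sup>2 / (1 + a \<bullet> a)))"
proof (cases "c\<^sup>2 / (1 + a \<bullet> a) < 1")
  case False
  then show ?thesis by (simp add: section_beta_weight_ge_1 beta_weight_ge_1 not_less)
next
  case True
  define h where "h = c\<^sup>2 / (1 + a \<bullet> a)"
  obtain R y0 where R: "\<bar>det R\<bar> = sqrt (1 - h) ^ CARD('d) * \<bar>det (section_mat a)\<bar>" "det R \<noteq> 0"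
    "\<And>y. beta_weight b ((norm (y0 + R *v y))\<^sup>2 + (a \<bullet> (y0 + R *v y) + c)\<^sup>2) = (1 - h) powr b * beta_weight b ((norm y)\<^sup>2)"
    using section_beta_weight[of c a b] True unfolding h_def by metis
  have "(\<integral>\<^sup>+y. ennreal (beta_weight b ((norm y)\<^sup>2 + (a \<bullet> y + c)\<^sup>2)) \<partial>lborel)
     = ennreal \<bar>det R\<bar> * (\<integral>\<^sup>+y. ennreal (beta_weight b ((norm (y0 + R *v y))\<^sup>2 + (a \<bullet> (y0 + R *v y) + c)\<^sup>2)) \<partial>lborel)"
    by (rule nn_integral_affine_matrix[OF R(2)]) measurable
  also have "\<dots> = ennreal \<bar>det R\<bar> * (ennreal ((1 - h) powr b) * beta_weight_total b TYPE(real ^ 'd))"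
    unfolding R(3) beta_weight_total_def by (simp add: ennreal_mult' nn_integral_cmult)
  also have "\<dots> = ennreal \<bar>det (section_mat a)\<bar> * beta_weight_total b TYPE(real ^ 'd) * ennreal (sqrt (1 - h) ^ CARD('d) * (1 - h) powr b)"
    unfolding R(1) using True by (simp add: ennreal_mult' mult_ac h_def)
  also have "sqrt (1 - h) ^ CARD('d) * (1 - h) powr b = beta_weight (b + real CARD('d) / 2) h"
    using True unfolding h_def[symmetric]
    by (simp add: beta_weight_def powr_add powr_half_sqrt[symmetric] powr_realpow[symmetric] powr_powr mult.commute)
  finally show ?thesis by (simp add: h_def)
qed

text \<open>The hyperplane \<open>\<xi> \<bullet> z = s\<close> is treated as a graph over the first
  factor, which needs a nonzero last coordinate of \<xi>; its distance from the origin is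
  \<open>\<bar>s\<bar> / norm \<xi>\<close>. Integrating the weight over these sections gives the
  marginal without any rotation.\<close>

lemma distr_ball_beta_inner:
  fixes \<xi> :: "(real ^ 'd::finite) \<times> real"
  assumes b: "b > -1" and \<tau>: "snd \<xi> \<noteq> 0"
  shows "distr (ball_beta b) borel (\<lambda>z. \<xi> \<bullet> z) = distr (ball_beta (b + real CARD('d) / 2) :: real measure) borel (\<lambda>s. norm \<xi> * s)"
proof -
  define \<eta> \<tau> p r where "\<eta> = fst \<xi>" and "\<tau> = snd \<xi>" and "p = b + real CARD('d) / 2" and "r = norm \<xi>"
  have \<tau>0: "\<tau> \<noteq> 0" using assms by (simp add: \<tau>_def)
  have xi: "\<xi> \<bullet> (y, t) = \<eta> \<bullet> y + \<tau> * t" for y t by (simp add: \<eta>_def \<tau>_def inner_prod_def)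
  have r2: "r\<^sup>2 = \<eta> \<bullet> \<eta> + \<tau>\<^sup>2"
    unfolding r_def power2_norm_eq_inner inner_prod_def by (simp add: \<eta>_def \<tau>_def power2_eq_square)
  have r: "r > 0" using \<tau>0 by (auto simp: r_def \<tau>_def)
  have p: "p > -1" using b by (simp add: p_def add_strict_increasing)
  \<comment> \<open>Slope of the graph: solving \<open>\<eta> \<bullet> y + \<tau> * t = s\<close>
    for \<open>t\<close> gives \<open>t = a \<bullet> y + s / \<tau>\<close>.\<close>
  define a where "a = (- 1 / \<tau>) *\<^sub>R \<eta>"
  define \<kappa> where "\<kappa> = ennreal \<bar>1 / \<tau>\<bar> * (ennreal \<bar>det (section_mat a)\<bar> * beta_weight_total b TYPE(real ^ 'd)) * ennreal r"
  have main: "(\<integral>\<^sup>+z. ennreal (beta_weight b ((norm z)\<^sup>2)) * H (\<xi> \<bullet> z) \<partial>lborel) = \<kappa> * (\<integral>\<^sup>+s. ennreal (beta_weight p ((norm s)\<^sup>2)) * H (r * s) \<partial>lborel)"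
    if H [measurable]: "H \<in> borel_measurable borel" for H
  proof -
    have "(\<integral>\<^sup>+z. ennreal (beta_weight b ((norm z)\<^sup>2)) * H (\<xi> \<bullet> z) \<partial>lborel) =
       (\<integral>\<^sup>+z. ennreal (beta_weight b ((norm z)\<^sup>2)) * H (\<xi> \<bullet> z) \<partial>(lborel \<Otimes>\<^sub>M lborel))"
      by (simp only: lborel_prod)
    also have "\<dots> = (\<integral>\<^sup>+y. \<integral>\<^sup>+t. ennreal (beta_weight b ((norm (y, t))\<^sup>2)) * H (\<xi> \<bullet> (y, t)) \<partial>lborel \<partial>lborel)"
      by (subst lborel.nn_integral_fst[symmetric]) (auto simp: lborel_prod)
    also have "\<dots> = (\<integral>\<^sup>+y. \<integral>\<^sup>+t. ennreal (beta_weight b ((norm y)\<^sup>2 + t\<^sup>2)) * H (\<eta> \<bullet> y + \<tau> * t) \<partial>lborel \<partial>lborel)"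
      unfolding xi by (simp add: norm_Pair)
    also have "\<dots> = (\<integral>\<^sup>+y. ennreal \<bar>1 / \<tau>\<bar> * (\<integral>\<^sup>+s. ennreal (beta_weight b ((norm y)\<^sup>2 + (a \<bullet> y + 1 / \<tau> * s)\<^sup>2)) * H (\<eta> \<bullet> y + \<tau> * (a \<bullet> y + 1 / \<tau> * s)) \<partial>lborel) \<partial>lborel)"
      using \<tau>0 by (intro nn_integral_cong nn_integral_real_affine) auto
    also have "\<dots> = (\<integral>\<^sup>+y. ennreal \<bar>1 / \<tau>\<bar> * (\<integral>\<^sup>+s. ennreal (beta_weight b ((norm y)\<^sup>2 + (a \<bullet> y + s / \<tau>)\<^sup>2)) * H s \<partial>lborel) \<partial>lborel)"
    proof -
      have "\<eta> \<bullet> y + \<tau> * (a \<bullet> y + 1 / \<tau> * s) = s" for y s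
        using \<tau>0 by (simp add: a_def field_simps)
      then show ?thesis by (simp only: mult_1 times_divide_eq_left)
    qed
    also have "\<dots> = ennreal \<bar>1 / \<tau>\<bar> * (\<integral>\<^sup>+y. \<integral>\<^sup>+s. ennreal (beta_weight b ((norm y)\<^sup>2 + (a \<bullet> y + s / \<tau>)\<^sup>2)) * H s \<partial>lborel \<partial>lborel)"
      by (rule nn_integral_cmult) measurable
    also have "(\<integral>\<^sup>+y. \<integral>\<^sup>+s. ennreal (beta_weight b ((norm y)\<^sup>2 + (a \<bullet> y + s / \<tau>)\<^sup>2)) * H s \<partial>lborel \<partial>lborel)
      = (\<integral>\<^sup>+s. \<integral>\<^sup>+y. ennreal (beta_weight b ((norm y)\<^sup>2 + (a \<bullet> y + s / \<tau>)\<^sup>2)) * H s \<partial>lborel \<partial>lborel)"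
      by (rule lborel_pair.Fubini') measurable
    also have "\<dots> = (\<integral>\<^sup>+s. ennreal \<bar>det (section_mat a)\<bar> * beta_weight_total b TYPE(real ^ 'd) * (ennreal (beta_weight p (s\<^sup>2 / r\<^sup>2)) * H s) \<partial>lborel)"
    proof (rule nn_integral_cong)
      fix s
      have "(s / \<tau>)\<^sup>2 / (1 + a \<bullet> a) = s\<^sup>2 / r\<^sup>2"
      proof -
        have "1 + a \<bullet> a = r\<^sup>2 / \<tau>\<^sup>2" using \<tau>0 by (simp add: r2[unfolded power2_eq_square] a_def power2_eq_square field_simps)
        then show ?thesis using \<tau>0 by (simp add: power_divide)
      qed
      then show "(\<integral>\<^sup>+y. ennreal (beta_weight b ((norm y)\<^sup>2 + (a \<bullet> y + s / \<tau>)\<^sup>2)) * H s \<partial>lborel)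
        = ennreal \<bar>det (section_mat a)\<bar> * beta_weight_total b TYPE(real ^ 'd) * (ennreal (beta_weight p (s\<^sup>2 / r\<^sup>2)) * H s)"
        by (subst nn_integral_multc) (auto simp: section_total p_def mult.assoc)
    qed
    also have "\<dots> = ennreal \<bar>det (section_mat a)\<bar> * beta_weight_total b TYPE(real ^ 'd) * (\<integral>\<^sup>+s. ennreal (beta_weight p (s\<^sup>2 / r\<^sup>2)) * H s \<partial>lborel)"
      by (rule nn_integral_cmult) measurable
    also have "(\<integral>\<^sup>+s. ennreal (beta_weight p (s\<^sup>2 / r\<^sup>2)) * H s \<partial>lborel) = ennreal \<bar>r\<bar> * (\<integral>\<^sup>+s. ennreal (beta_weight p ((0 + r * s)\<^sup>2 / r\<^sup>2)) * H (0 + r * s) \<partial>lborel)"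
      using r by (intro nn_integral_real_affine) auto
    also have "\<dots> = ennreal r * (\<integral>\<^sup>+s. ennreal (beta_weight p ((norm s)\<^sup>2)) * H (r * s) \<partial>lborel)"
      using r by (simp add: power_mult_distrib)
    finally show ?thesis by (simp only: \<kappa>_def mult.assoc)
  qed
  \<comment> \<open>Testing with the constant function \<open>1\<close> relates the two total
    masses, so \<kappa> drops out of the normalised laws.\<close>
  have tot: "beta_weight_total b TYPE((real ^ 'd) \<times> real) = \<kappa> * beta_weight_total p TYPE(real)"
    using main[of "\<lambda>_. 1"] unfolding beta_weight_total_def by simp
  have bd: "0 < beta_weight_total b TYPE((real ^ 'd) \<times> real)" "beta_weight_total b TYPE((real ^ 'd) \<times> real) < \<infinity>"
    "0 < beta_weight_total p TYPE(real)" "beta_weight_total p TYPE(real) < \<infinity>"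
    using beta_weight_total_bounds[OF b, where 'a="(real ^ 'd) \<times> real"] beta_weight_total_bounds[OF p, where 'a=real] by auto
  have \<kappa>: "\<kappa> \<noteq> 0" "\<kappa> \<noteq> \<infinity>" using bd unfolding tot by (auto simp: ennreal_mult_less_top)
  show ?thesis unfolding p_def[symmetric] r_def[symmetric]
  proof (rule measure_eqI)
    fix A assume "A \<in> sets (distr (ball_beta b) borel (\<lambda>z. \<xi> \<bullet> z))"
    then have [measurable]: "A \<in> sets borel" by simp
    have "emeasure (distr (ball_beta b) borel (\<lambda>z. \<xi> \<bullet> z)) A = (\<integral>\<^sup>+z. indicator A (\<xi> \<bullet> z) \<partial>ball_beta b)"
      by (subst nn_integral_indicator[symmetric], simp, subst nn_integral_distr) auto
    also have "\<dots> = (\<kappa> * (\<integral>\<^sup>+s. ennreal (beta_weight p ((norm s)\<^sup>2)) * indicator A (r * s) \<partial>lborel)) / (\<kappa> * beta_weight_total p TYPE(real))"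
      by (subst nn_integral_ball_beta) (simp_all add: main tot)
    also have "\<dots> = (\<integral>\<^sup>+s. ennreal (beta_weight p ((norm s)\<^sup>2)) * indicator A (r * s) \<partial>lborel) / beta_weight_total p TYPE(real)"
      using \<kappa> by (simp add: mult.commute[of \<kappa>] divide_mult_eq)
    also have "\<dots> = (\<integral>\<^sup>+s. indicator A (r * s) \<partial>(ball_beta p :: real measure))"
      by (subst nn_integral_ball_beta) simp_all
    also have "\<dots> = emeasure (distr (ball_beta p :: real measure) borel (\<lambda>s. r * s)) A"
      by (subst nn_integral_indicator[symmetric], simp, subst nn_integral_distr) auto
    finally show "emeasure (distr (ball_beta b) borel (\<lambda>z. \<xi> \<bullet> z)) A = emeasure (distr (ball_beta p :: real measure) borel (\<lambda>s. r * s)) A" .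
  qed simp
qed

lemma weight_ft_scale:
  assumes "r > 0" shows "weight_ft pos e (r * x) = weight_ft pos (e / r) x / of_real r"
proof -
  have "half_line_ft e (r * x) = half_line_ft (e / r) x / of_real r" for x
  proof -
    have "of_real e - \<i> * of_real (r * x) = of_real r * (of_real (e / r) - \<i> * of_real x)"
      using assms by (simp add: field_simps)
    then show ?thesis unfolding half_line_ft_def by simp
  qed
  from this[of x] this[of "-x"] show ?thesis by (simp add: weight_ft_def add_divide_distrib)
qed

lemma measurable_weight_ft [measurable]: "weight_ft pos e \<in> borel_measurable borel"
  unfolding weight_ft_def[abs_def] half_line_ft_def by (cases pos) simp_all

lemma norm_weight_ft_le: "e > 0 \<Longrightarrow> norm (weight_ft pos e x) \<le> 2 / e"
proof -
  assume e: "e > 0"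
  have "norm (half_line_ft e x) \<le> 1 / e" for x
  proof -
    have "e \<le> norm (of_real e - \<i> * of_real x)" using complex_Re_le_cmod[of "of_real e - \<i> * of_real x"] by simp
    then show ?thesis unfolding half_line_ft_def norm_divide using e by (simp add: frac_le)
  qed
  note half_line_ft = this
  have "norm (half_line_ft e x + half_line_ft e (- x)) \<le> 1 / e + 1 / e"
    using norm_triangle_ineq[of "half_line_ft e x" "half_line_ft e (-x)"] half_line_ft[of x] half_line_ft[of "-x"] by linarith
  moreover have "1 / e \<le> 2 / e" using e by (simp add: divide_right_mono)
  ultimately show ?thesis using order_trans[OF half_line_ft[of x]] by (simp add: weight_ft_def)
qed

text \<open>The reduction to dimension one: the Fourier side of \<open>lifted_integral_reg\<close> below, along a fixed direction.\<close>

definition profile_integral_reg :: "'d::finite itself \<Rightarrow> nat \<Rightarrow> real \<Rightarrow> real \<Rightarrow> complex" where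
  "profile_integral_reg _ k p e = (\<integral>S. (\<Prod>i\<in>UNIV. weight_ft (k < vertex_index (i::'d)) e (S (vertex_index i) - S 1)) \<partial>PiM {1..CARD('d) + 1} (\<lambda>_. ball_beta p :: real measure))"

text \<open>\<open>weight_ft\<close> is homogeneous of degree \<open>-1\<close> when
  \<open>e\<close> is scaled along with the argument. Rescaling by \<open>norm \<xi>\<close> thus
  costs one power for each of the \<open>d\<close> edges.\<close>

lemma integral_projection:
  fixes \<xi> :: "(real ^ 'd::finite) \<times> real"
  assumes b: "b > -1" and \<tau>: "snd \<xi> \<noteq> 0" and e: "e > 0"
  shows "(\<integral>Z. (\<Prod>i\<in>UNIV. weight_ft (k < vertex_index (i::'d)) e (\<xi> \<bullet> (Z (vertex_index i) - Z 1))) \<partial>PiM {1..CARD('d) + 1} (\<lambda>_. ball_beta b))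
    = profile_integral_reg TYPE('d) k (b + real CARD('d) / 2) (e / norm \<xi>) / of_real (norm \<xi> ^ CARD('d))"
proof -
  define I where "I = {1..CARD('d) + 1}"
  have I1: "1 \<in> I" "\<And>i::'d. vertex_index i \<in> I" "finite I" by (auto simp: I_def)
  define p where "p = b + real CARD('d) / 2"
  have p: "p > -1" using b by (simp add: p_def add_strict_increasing)
  define r where "r = norm \<xi>"
  have r: "r > 0" using \<tau> by (auto simp: r_def)
  let ?Q = "ball_beta b :: ((real ^ 'd) \<times> real) measure" and ?F = "ball_beta p :: real measure"
  let ?B = "borel :: real measure"
  have pr: "prob_space ?Q" "prob_space ?F" by (intro prob_space_ball_beta b p)+
  define G where "G S = (\<Prod>i\<in>UNIV. weight_ft (k < vertex_index (i::'d)) e (S (vertex_index i) - S 1))" for S :: "nat \<Rightarrow> real"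
  have G [measurable]: "G \<in> borel_measurable (PiM I (\<lambda>_. ?F))"
    unfolding G_def
    by (intro borel_measurable_prod measurable_compose[OF _ measurable_weight_ft] borel_measurable_diff
       measurable_component_singleton[where M="\<lambda>_. ?F", unfolded measurable_cong_sets[OF refl sets_ball_beta]] I1)
  have dist: "distr (PiM I (\<lambda>_. ?Q)) (PiM I (\<lambda>_. ?F)) (compose I (\<lambda>z. \<xi> \<bullet> z)) = distr (PiM I (\<lambda>_. ?F)) (PiM I (\<lambda>_. ?F)) (compose I (\<lambda>s. r * s))"
  proof -
    have "distr ?Q ?F (\<lambda>z. \<xi> \<bullet> z) = distr ?F ?F (\<lambda>s. r * s)"
    proof -
      have "distr ?Q ?F (\<lambda>z. \<xi> \<bullet> z) = distr ?Q borel (\<lambda>z. \<xi> \<bullet> z)" by (rule distr_cong) auto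
      moreover have "distr ?F ?F (\<lambda>s. r * s) = distr ?F borel (\<lambda>s. r * s)" by (rule distr_cong) auto
      ultimately show ?thesis
        using distr_ball_beta_inner[OF b \<tau>] unfolding p_def[symmetric] r_def[symmetric] by simp
    qed
    moreover have "distr (PiM I (\<lambda>_. ?Q)) (PiM I (\<lambda>_. ?F)) (compose I (\<lambda>z. \<xi> \<bullet> z)) = PiM I (\<lambda>i. distr ?Q ?F (\<lambda>z. \<xi> \<bullet> z))"
      by (rule distr_PiM_finite_prob_space') (use I1 pr in auto)
    moreover have "distr (PiM I (\<lambda>_. ?F)) (PiM I (\<lambda>_. ?F)) (compose I (\<lambda>s. r * s)) = PiM I (\<lambda>i. distr ?F ?F (\<lambda>s. r * s))"
      by (rule distr_PiM_finite_prob_space') (use I1 pr in auto)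
    ultimately show ?thesis by simp
  qed
  have cm: "compose I (\<lambda>z. \<xi> \<bullet> z) \<in> measurable (PiM I (\<lambda>_. ?Q)) (PiM I (\<lambda>_. ?F))"
    "compose I (\<lambda>s. r * s) \<in> measurable (PiM I (\<lambda>_. ?F)) (PiM I (\<lambda>_. ?F))"
    unfolding compose_def by measurable
  have "(\<integral>Z. (\<Prod>i\<in>UNIV. weight_ft (k < vertex_index (i::'d)) e (\<xi> \<bullet> (Z (vertex_index i) - Z 1))) \<partial>PiM I (\<lambda>_. ?Q)) = (\<integral>Z. G (compose I (\<lambda>z. \<xi> \<bullet> z) Z) \<partial>PiM I (\<lambda>_. ?Q))"
    unfolding G_def compose_def using I1 by (simp add: inner_diff_right)
  also have "\<dots> = (\<integral>S. G S \<partial>distr (PiM I (\<lambda>_. ?F)) (PiM I (\<lambda>_. ?F)) (compose I (\<lambda>s. r * s)))"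
    unfolding dist[symmetric] by (rule integral_distr[OF cm(1) G, symmetric])
  also have "\<dots> = (\<integral>S. G (compose I (\<lambda>s. r * s) S) \<partial>PiM I (\<lambda>_. ?F))"
    by (rule integral_distr[OF cm(2) G])
  also have "\<dots> = (\<integral>S. (\<Prod>i\<in>UNIV. weight_ft (k < vertex_index (i::'d)) (e / r) (S (vertex_index i) - S 1)) / of_real r ^ CARD('d) \<partial>PiM I (\<lambda>_. ?F))"
    unfolding G_def compose_def using I1 r
    by (simp add: right_diff_distrib[symmetric] weight_ft_scale prod_dividef)
  also have "\<dots> = profile_integral_reg TYPE('d) k p (e / r) / of_real r ^ CARD('d)"
    unfolding profile_integral_reg_def I_def by (rule integral_divide_zero)
  finally show ?thesis by (simp add: I_def p_def r_def)
qed

text \<open>The cone indicator is replaced by integrable weights, which increase to it as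
  \<open>e\<close> decreases to \<open>0\<close>; the points are normalised to probability
  laws.\<close>

definition lifted_integral_reg :: "'d::finite itself \<Rightarrow> real \<Rightarrow> nat \<Rightarrow> real \<Rightarrow> ennreal" where
  "lifted_integral_reg _ b k e = (\<integral>\<^sup>+x. (\<Prod>i\<in>UNIV. abel_weight (k < vertex_index (i::'d)) e (snd x $ i)) *
      exp (- (norm (\<Sum>i\<in>UNIV. snd x $ i *\<^sub>R (fst x (vertex_index i) - fst x 1)))\<^sup>2 / 2)
      \<partial>(PiM {1..CARD('d) + 1} (\<lambda>_. ball_beta b :: ((real ^ 'd) \<times> real) measure) \<Otimes>\<^sub>M lborel))"

section \<open>Gaussian directions\<close>

abbreviation std_gauss :: "('a::euclidean_space \<Rightarrow> real) measure" where
  "std_gauss \<equiv> PiM Basis (\<lambda>_. std_normal_distribution)"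

definition gauss_vec :: "('a::euclidean_space \<Rightarrow> real) \<Rightarrow> 'a" where
  "gauss_vec g = (\<Sum>c\<in>Basis. g c *\<^sub>R c)"

lemma prob_space_std_normal: "prob_space std_normal_distribution"
  by (rule real_dist_normal_dist[THEN real_distribution.axioms(1)])

lemma prob_space_std_gauss: "prob_space (std_gauss :: ('a::euclidean_space \<Rightarrow> real) measure)"
  by (intro prob_space_PiM prob_space_std_normal)

lemma measurable_gauss_vec [measurable]: "gauss_vec \<in> measurable std_gauss (borel :: 'a::euclidean_space measure)"
  unfolding gauss_vec_def by measurable

lemma gauss_vec_inner_Basis: "c \<in> Basis \<Longrightarrow> gauss_vec g \<bullet> c = g c"
  unfolding gauss_vec_def by (simp add: inner_sum_left inner_Basis if_distrib[of "\<lambda>x. _ * x"] cong: if_cong)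

lemma AE_gauss_vec_inner_nonzero:
  assumes c: "c \<in> (Basis :: 'a::euclidean_space set)"
  shows "AE g in std_gauss. gauss_vec g \<bullet> c \<noteq> 0"
proof -
  have "AE x in std_normal_distribution. x \<noteq> 0"
    by (subst AE_density) (auto intro!: AE_I[OF _ _ ] eventually_mono[OF AE_lborel_singleton[of 0]])
  then have "AE g in std_gauss. g c \<noteq> 0"
    using c by (intro AE_PiM_component prob_space_std_normal) auto
  then show ?thesis using c by (simp add: gauss_vec_inner_Basis)
qed

lemma inverse_powr_integrable_at_0:
  fixes a :: real assumes a: "0 \<le> a" "a < 1"
  shows "integrable std_normal_distribution (\<lambda>x. \<bar>x\<bar> powr (- a))"
proof (rule integrableI_bounded)
  have half: "(\<integral>\<^sup>+x. ennreal (x powr (- a)) * indicator {0<..<1} x \<partial>lborel) < \<infinity>"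
  proof -
    have "(\<integral>\<^sup>+t. ennreal ((1 - a) * t powr ((1 - a) - 1)) * indicator {0<..<1} t \<partial>lborel) = ennreal (1 powr (1 - a))"
      by (rule nn_integral_powr_from_0) (use a in auto)
    moreover have "(\<integral>\<^sup>+t. ennreal ((1 - a) * t powr ((1 - a) - 1)) * indicator {0<..<1} t \<partial>lborel)
       = ennreal (1 - a) * (\<integral>\<^sup>+x. ennreal (x powr (- a)) * indicator {0<..<1} x \<partial>lborel)"
      using a by (subst nn_integral_cmult[symmetric]) (auto simp: ennreal_mult' mult.assoc)
    ultimately have "ennreal (1 - a) * (\<integral>\<^sup>+x. ennreal (x powr (- a)) * indicator {0<..<1} x \<partial>lborel) < \<infinity>" by simp
    then show ?thesis using a by (auto simp: ennreal_mult_less_top)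
  qed
  let ?f = "\<lambda>x::real. ennreal (x powr (- a)) * indicator {0<..<1} x"
  have "(\<integral>\<^sup>+x. ennreal (norm (\<bar>x\<bar> powr (- a))) \<partial>std_normal_distribution)
     = (\<integral>\<^sup>+x. ennreal (std_normal_density x) * ennreal (\<bar>x\<bar> powr (- a)) \<partial>lborel)"
    by (subst nn_integral_density) auto
  also have "\<dots> \<le> (\<integral>\<^sup>+x. ?f x + ?f (0 + (-1) * x) + ennreal (std_normal_density x) \<partial>lborel)"
  proof (rule nn_integral_mono)
    fix x :: real
    have d1: "std_normal_density x \<le> 1"
    proof -
      have "1 \<le> sqrt (2 * pi)" using pi_ge_two by simp
      then have "1 / sqrt (2 * pi) \<le> 1" by simp
      moreover have "exp (- x\<^sup>2 / 2) \<le> 1" by simp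
      ultimately show ?thesis unfolding std_normal_density_def by (intro mult_le_one) auto
    qed
    consider "x = 0" | "\<bar>x\<bar> \<ge> 1" | "0 < x" "x < 1" | "x < 0" "- 1 < x" by linarith
    then show "ennreal (std_normal_density x) * ennreal (\<bar>x\<bar> powr (- a)) \<le> ?f x + ?f (0 + (-1) * x) + ennreal (std_normal_density x)"
    proof cases
      case 2
      then have "\<bar>x\<bar> powr (- a) \<le> 1" using a by (simp add: powr_minus ge_one_powr_ge_zero inverse_le_1_iff)
      then have "ennreal (std_normal_density x) * ennreal (\<bar>x\<bar> powr (- a)) \<le> ennreal (std_normal_density x)"
        by (simp add: ennreal_mult'[symmetric] mult_left_le)
      then show ?thesis by (rule order_trans) simp
    next
      case 3
      then have "ennreal (std_normal_density x) * ennreal (\<bar>x\<bar> powr (- a)) \<le> ?f x"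
        using d1 by (simp add: ennreal_mult'[symmetric] mult_right_le_one_le mult_left_le_one_le)
      then show ?thesis by (rule order_trans) (simp add: add.assoc)
    next
      case 4
      then have "ennreal (std_normal_density x) * ennreal (\<bar>x\<bar> powr (- a)) \<le> ?f (0 + (-1) * x)"
        using d1 by (simp add: ennreal_mult'[symmetric] mult_left_le_one_le)
      then show ?thesis by (rule order_trans) simp
    qed simp
  qed
  also have "\<dots> = (\<integral>\<^sup>+x. ?f x \<partial>lborel) + (\<integral>\<^sup>+x. ?f (0 + (-1) * x) \<partial>lborel) + (\<integral>\<^sup>+x. ennreal (std_normal_density x) \<partial>lborel)"
    by (subst nn_integral_add, measurable)+
  also have "(\<integral>\<^sup>+x. ?f (0 + (-1) * x) \<partial>lborel) = (\<integral>\<^sup>+x. ?f x \<partial>lborel)"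
    using nn_integral_real_affine[of ?f "-1" 0] by simp
  also have "(\<integral>\<^sup>+x. ennreal (std_normal_density x) \<partial>lborel) = ennreal (\<integral>x. std_normal_density x \<partial>lborel)"
    by (rule nn_integral_eq_integral) auto
  also have "(\<integral>\<^sup>+x. ?f x \<partial>lborel) + (\<integral>\<^sup>+x. ?f x \<partial>lborel) + ennreal (\<integral>x. std_normal_density x \<partial>lborel) < \<infinity>"
    using half by simp
  finally show "(\<integral>\<^sup>+x. ennreal (norm (\<bar>x\<bar> powr (- a))) \<partial>std_normal_distribution) < \<infinity>" .
qed measurable

text \<open>The norm dominates each of the \<open>d + 1\<close> coordinates, so its power
  \<open>- d\<close> is at most the product of their absolute values to the power
  \<open>- d / (d + 1)\<close>. Each factor has exponent above \<open>-1\<close> and is integrable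
  by itself.\<close>

lemma integrable_norm_gauss_vec:
  assumes d: "d + 1 = DIM('a::euclidean_space)"
  shows "integrable (std_gauss :: ('a \<Rightarrow> real) measure) (\<lambda>g. 1 / norm (gauss_vec g) ^ d)"
proof -
  define a where "a = real d / real (d + 1)"
  have a: "0 \<le> a" "a < 1" by (auto simp: a_def)
  interpret N: prob_space std_normal_distribution by (rule prob_space_std_normal)
  interpret P: product_sigma_finite "\<lambda>_::'a. std_normal_distribution" by standard
  have "integrable (std_gauss :: ('a \<Rightarrow> real) measure) (\<lambda>g. \<Prod>c\<in>Basis. \<bar>g c\<bar> powr (- a))"
    by (intro P.product_integrable_prod inverse_powr_integrable_at_0 a finite_Basis)
  then show ?thesis
  proof (rule Bochner_Integration.integrable_bound)
    have "AE g in (std_gauss :: ('a \<Rightarrow> real) measure). \<forall>c\<in>Basis. gauss_vec g \<bullet> c \<noteq> 0"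
      by (subst AE_ball_countable) (auto intro: AE_gauss_vec_inner_nonzero countable_finite)
    then show "AE g in (std_gauss :: ('a \<Rightarrow> real) measure). norm (1 / norm (gauss_vec g) ^ d) \<le> norm (\<Prod>c\<in>Basis. \<bar>g c\<bar> powr (- a))"
    proof eventually_elim
      case (elim g)
      have "norm (gauss_vec g) > 0" using elim by (metis SOME_Basis inner_zero_left zero_less_norm_iff)
      then have "1 / norm (gauss_vec g) ^ d = norm (gauss_vec g) powr (- real d)"
        by (simp add: powr_minus powr_realpow divide_inverse)
      also have "real d = a * real DIM('a)" by (simp add: a_def d[symmetric])
      also have "norm (gauss_vec g) powr (- (a * real DIM('a))) = (norm (gauss_vec g) powr (- a)) ^ DIM('a)"
        using \<open>norm (gauss_vec g) > 0\<close> by (simp add: powr_realpow[symmetric] powr_powr)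
      also have "\<dots> = (\<Prod>c\<in>(Basis::'a set). norm (gauss_vec g) powr (- a))" by simp
      also have "\<dots> \<le> (\<Prod>c\<in>Basis. \<bar>g c\<bar> powr (- a))"
      proof (intro prod_mono conjI)
        fix c :: 'a assume c: "c \<in> Basis"
        have "\<bar>g c\<bar> \<le> norm (gauss_vec g)" using Basis_le_norm[OF c, of "gauss_vec g"] by (simp add: gauss_vec_inner_Basis[OF c])
        moreover have "gauss_vec g \<bullet> c \<noteq> 0" using elim c by blast
        then have "\<bar>g c\<bar> > 0" by (simp add: gauss_vec_inner_Basis[OF c])
        ultimately show "norm (gauss_vec g) powr (- a) \<le> \<bar>g c\<bar> powr (- a)" using a by (intro powr_mono2') auto
      qed auto
      finally show ?case by (simp add: abs_prod)
    qed
  qed measurable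
qed

lemma integral_norm_gauss_vec_pos:
  assumes d: "d + 1 = DIM('a::euclidean_space)"
  shows "(\<integral>g. 1 / norm (gauss_vec g) ^ d \<partial>(std_gauss :: ('a \<Rightarrow> real) measure)) > 0"
proof -
  interpret G: prob_space "std_gauss :: ('a \<Rightarrow> real) measure" by (rule prob_space_std_gauss)
  obtain c :: 'a where c: "c \<in> Basis" using nonempty_Basis by blast
  have "AE g in (std_gauss :: ('a \<Rightarrow> real) measure). 0 < 1 / norm (gauss_vec g) ^ d"
    using AE_gauss_vec_inner_nonzero[OF c] by eventually_elim (auto intro!: zero_less_power)
  then have "0 < integral\<^sup>L (std_gauss :: ('a \<Rightarrow> real) measure) (\<lambda>g. 1 / norm (gauss_vec g) ^ d)"
    by (intro G.integral_less_AE_space[where X="\<lambda>_. 0", simplified] integrable_norm_gauss_vec[OF d])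
       (auto simp: G.emeasure_space_1)
  then show ?thesis .
qed

lemma measurable_edge_sum:
  fixes M :: "((real ^ 'd::finite) \<times> real) measure"
  assumes [measurable_cong, simp]: "sets M = sets borel"
  shows "(\<lambda>x. \<Sum>i\<in>UNIV. snd x $ i *\<^sub>R (fst x (vertex_index (i::'d)) - fst x 1)) \<in> borel_measurable (PiM {1..CARD('d) + 1} (\<lambda>_. M) \<Otimes>\<^sub>M (lborel :: (real ^ 'd) measure))"
proof -
  define I where "I = {1..CARD('d) + 1}"
  have I1: "1 \<in> I" "\<And>i::'d. vertex_index i \<in> I" "finite I" by (auto simp: I_def)
  have m1: "(\<lambda>Z. Z j) \<in> measurable (PiM I (\<lambda>_. M)) borel" if "j \<in> I" for j
    using that by measurable
  show ?thesis unfolding I_def[symmetric] 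
    unfolding measurable_cong_sets[OF sets_pair_measure_cong[OF refl sets_lborel] refl]
    by (intro borel_measurable_sum borel_measurable_scaleR borel_measurable_diff I1
         measurable_compose[OF measurable_fst m1] measurable_compose[OF measurable_snd borel_measurable_nth])
qed

lemma measurable_profile_integral_reg:
  assumes p: "p > -1"
  shows "profile_integral_reg TYPE('d::finite) k p \<in> borel_measurable borel"
proof -
  have True: "sigma_finite_measure (PiM {1..CARD('d) + 1} (\<lambda>_. ball_beta p :: real measure))"
    by (intro prob_space_imp_sigma_finite prob_space_PiM prob_space_ball_beta p)
  define I where "I = {1..CARD('d) + 1}"
  have I1: "1 \<in> I" "\<And>i::'d. vertex_index i \<in> I" by (auto simp: I_def)
  interpret sigma_finite_measure "PiM I (\<lambda>_. ball_beta p :: real measure)" using True by (simp add: I_def)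
  have m1: "(\<lambda>S. S j) \<in> borel_measurable (PiM I (\<lambda>_. ball_beta p :: real measure))" if "j \<in> I" for j
    using that by measurable
  have c: "(\<lambda>x. half_line_ft (u x) (v x)) \<in> borel_measurable M" if [measurable]: "u \<in> borel_measurable M" "v \<in> borel_measurable M"
    for u v and M :: "'z measure" unfolding half_line_ft_def by measurable
  have h: "(\<lambda>x. weight_ft pos (u x) (v x)) \<in> borel_measurable M" if "u \<in> borel_measurable M" "v \<in> borel_measurable M"
    for u v pos and M :: "'z measure"
    using c[OF that] c[OF that(1) borel_measurable_uminus[OF that(2)]] unfolding weight_ft_def by (cases pos) auto
  have "(\<lambda>x. \<Prod>i\<in>UNIV. weight_ft (k < vertex_index (i::'d)) (fst x) (snd x (vertex_index i) - snd x 1)) \<in> borel_measurable (borel \<Otimes>\<^sub>M PiM I (\<lambda>_. ball_beta p :: real measure))"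
    by (intro borel_measurable_prod h measurable_fst borel_measurable_diff measurable_compose[OF measurable_snd m1] I1)
  then show ?thesis unfolding profile_integral_reg_def[abs_def] I_def[symmetric]
    by (intro borel_measurable_lebesgue_integral) (simp add: case_prod_beta)
qed

text \<open>Exchanging the Gaussian direction with the points and coefficients is legitimate because
  characters have modulus one and the Abel weights are integrable. For a fixed direction the
  integral over \<open>u\<close> factorises over the edges. The second claim rules out that
  \<open>ennreal\<close> truncates a negative number.\<close>

proposition lifted_integral_reg_eq_profile_integral_reg:
  fixes b e :: real
  assumes b: "b > -1" and e: "e > 0"
  shows "lifted_integral_reg TYPE('d::finite) b k e = ennreal (Re (\<integral>g. profile_integral_reg TYPE('d) k (b + real CARD('d) / 2) (e / norm (gauss_vec g)) / of_real (norm (gauss_vec g) ^ CARD('d))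
      \<partial>(std_gauss :: (((real ^ 'd) \<times> real) \<Rightarrow> real) measure)))"
    and "0 \<le> Re (\<integral>g. profile_integral_reg TYPE('d) k (b + real CARD('d) / 2) (e / norm (gauss_vec g)) / of_real (norm (gauss_vec g) ^ CARD('d))
      \<partial>(std_gauss :: (((real ^ 'd) \<times> real) \<Rightarrow> real) measure))"
proof -
  define I where "I = {1..CARD('d) + 1}"
  have I1: "1 \<in> I" "\<And>i::'d. vertex_index i \<in> I" "finite I" by (auto simp: I_def)
  define p where "p = b + real CARD('d) / 2"
  have p: "p > -1" using b by (simp add: p_def add_strict_increasing)
  let ?Q = "PiM I (\<lambda>_. ball_beta b :: ((real ^ 'd) \<times> real) measure)"
  let ?L = "lborel :: (real ^ 'd) measure"
  let ?G = "std_gauss :: (((real ^ 'd) \<times> real) \<Rightarrow> real) measure"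
  interpret Q: prob_space ?Q by (intro prob_space_PiM prob_space_ball_beta b)
  interpret G: prob_space ?G by (rule prob_space_std_gauss)
  interpret QL: pair_sigma_finite ?Q ?L ..
  interpret QLG: pair_sigma_finite "?Q \<Otimes>\<^sub>M ?L" ?G ..
  define w where "w u = (\<Prod>i\<in>UNIV. abel_weight (k < vertex_index (i::'d)) e (u $ i))" for u :: "real ^ 'd"
  define W where "W x = (\<Sum>i\<in>UNIV. snd x $ i *\<^sub>R (fst x (vertex_index (i::'d)) - fst x 1))" for x :: "(nat \<Rightarrow> (real ^ 'd) \<times> real) \<times> (real ^ 'd)"
  have w0: "0 \<le> w u" for u unfolding w_def by (intro prod_nonneg) auto
  have wm [measurable]: "w \<in> borel_measurable borel" unfolding w_def by measurable
  have Wm [measurable]: "W \<in> borel_measurable (?Q \<Otimes>\<^sub>M ?L)"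
    unfolding W_def I_def by (rule measurable_edge_sum) simp
  have wi: "integrable ?L w"
    using integrable_Re[OF vec_product_integral(1)[of "\<lambda>i m. of_real (abel_weight (k < vertex_index (i::'d)) e m)"]] abel_weight_integrable[OF e]
    by (simp add: w_def[abs_def] of_real_prod[symmetric] del: of_real_prod)
  have iw: "(\<integral>\<^sup>+x. ennreal (w (snd x)) \<partial>(?Q \<Otimes>\<^sub>M ?L)) < \<infinity>"
  proof -
    have "(\<integral>\<^sup>+x. ennreal (w (snd x)) \<partial>(?Q \<Otimes>\<^sub>M ?L)) = (\<integral>\<^sup>+Z. \<integral>\<^sup>+u. ennreal (w u) \<partial>?L \<partial>?Q)"
      by (subst lborel.nn_integral_fst[symmetric]) auto
    also have "\<dots> = (\<integral>\<^sup>+u. ennreal (w u) \<partial>?L)" by (simp add: Q.emeasure_space_1)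
    also have "\<dots> < \<infinity>" using wi w0 by (simp add: integrable_iff_bounded)
    finally show ?thesis .
  qed
  define f where "f x = w (snd x) * exp (- (norm (W x))\<^sup>2 / 2)" for x
  have fm [measurable]: "f \<in> borel_measurable (?Q \<Otimes>\<^sub>M ?L)" unfolding f_def by measurable
  have f0: "0 \<le> f x" for x unfolding f_def using w0 by simp
  have fi: "integrable (?Q \<Otimes>\<^sub>M ?L) f"
  proof (rule integrableI_bounded)
    have "(\<integral>\<^sup>+x. ennreal (norm (f x)) \<partial>(?Q \<Otimes>\<^sub>M ?L)) \<le> (\<integral>\<^sup>+x. ennreal (w (snd x)) \<partial>(?Q \<Otimes>\<^sub>M ?L))"
      using w0 by (intro nn_integral_mono ennreal_leI) (auto simp: f_def abs_mult mult_left_le)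
    then show "(\<integral>\<^sup>+x. ennreal (norm (f x)) \<partial>(?Q \<Otimes>\<^sub>M ?L)) < \<infinity>" using iw by (rule le_less_trans)
  qed measurable
  define F where "F x g = of_real (w (snd x)) * iexp (gauss_vec g \<bullet> W x)" for x and g :: "((real ^ 'd) \<times> real) \<Rightarrow> real"
  have Fm [measurable]: "(\<lambda>(x, g). F x g) \<in> borel_measurable ((?Q \<Otimes>\<^sub>M ?L) \<Otimes>\<^sub>M ?G)"
    unfolding F_def by measurable
  have Fn: "norm (F x g) = w (snd x)" for x g unfolding F_def using w0 by (simp add: norm_mult)
  have Fi: "integrable ((?Q \<Otimes>\<^sub>M ?L) \<Otimes>\<^sub>M ?G) (\<lambda>(x, g). F x g)"
  proof (rule integrableI_bounded)
    have "(\<integral>\<^sup>+y. ennreal (norm (case y of (x, g) \<Rightarrow> F x g)) \<partial>((?Q \<Otimes>\<^sub>M ?L) \<Otimes>\<^sub>M ?G)) = (\<integral>\<^sup>+x. \<integral>\<^sup>+g. ennreal (norm (F x g)) \<partial>?G \<partial>(?Q \<Otimes>\<^sub>M ?L))"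
      by (subst G.nn_integral_fst[symmetric]) auto
    also have "\<dots> = (\<integral>\<^sup>+x. ennreal (w (snd x)) \<partial>(?Q \<Otimes>\<^sub>M ?L))"
      unfolding Fn by (simp add: G.emeasure_space_1)
    finally show "(\<integral>\<^sup>+y. ennreal (norm (case y of (x, g) \<Rightarrow> F x g)) \<partial>((?Q \<Otimes>\<^sub>M ?L) \<Otimes>\<^sub>M ?G)) < \<infinity>" using iw by simp
  qed measurable
  have inner: "(\<integral>x. F x g \<partial>(?Q \<Otimes>\<^sub>M ?L)) = profile_integral_reg TYPE('d) k p (e / norm (gauss_vec g)) / of_real (norm (gauss_vec g) ^ CARD('d))"
    if g: "snd (gauss_vec g) \<noteq> 0" and gs: "g \<in> space ?G" for g
  proof -
    have [measurable]: "(\<lambda>x. F x g) \<in> borel_measurable (?Q \<Otimes>\<^sub>M ?L)" unfolding F_def by measurable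
    have "integrable (?Q \<Otimes>\<^sub>M ?L) (\<lambda>x. F x g)"
      by (rule integrableI_bounded) (use iw in \<open>simp_all add: Fn\<close>)
    then have "(\<integral>x. F x g \<partial>(?Q \<Otimes>\<^sub>M ?L)) = (\<integral>Z. \<integral>u. F (Z, u) g \<partial>?L \<partial>?Q)"
      by (rule QL.integral_fst'[symmetric])
    also have "\<dots> = (\<integral>Z. (\<Prod>i\<in>UNIV. weight_ft (k < vertex_index (i::'d)) e (gauss_vec g \<bullet> (Z (vertex_index i) - Z 1))) \<partial>?Q)"
    proof (rule Bochner_Integration.integral_cong[OF refl])
      fix Z
      have "F (Z, u) g = (\<Prod>i\<in>UNIV. of_real (abel_weight (k < vertex_index (i::'d)) e (u $ i)) * iexp (u $ i * (gauss_vec g \<bullet> (Z (vertex_index i) - Z 1))))" for u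
        unfolding F_def w_def W_def
        by (simp add: prod.distrib inner_sum_right exp_sum sum_distrib_left)
      then show "(\<integral>u. F (Z, u) g \<partial>?L) = (\<Prod>i\<in>UNIV. weight_ft (k < vertex_index (i::'d)) e (gauss_vec g \<bullet> (Z (vertex_index i) - Z 1)))"
        by (simp only: vec_product_integral(2)[OF abel_weight_iexp_integrable[OF e]] abel_weight_fourier(2)[OF e])
    qed
    also have "\<dots> = profile_integral_reg TYPE('d) k p (e / norm (gauss_vec g)) / of_real (norm (gauss_vec g) ^ CARD('d))"
      unfolding I_def p_def by (rule integral_projection[OF b g e])
    finally show ?thesis .
  qed
  have "complex_of_real (\<integral>x. f x \<partial>(?Q \<Otimes>\<^sub>M ?L)) = (\<integral>x. complex_of_real (f x) \<partial>(?Q \<Otimes>\<^sub>M ?L))"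
    by (rule integral_complex_of_real[symmetric])
  also have "\<dots> = (\<integral>x. \<integral>g. F x g \<partial>?G \<partial>(?Q \<Otimes>\<^sub>M ?L))"
  proof (rule Bochner_Integration.integral_cong[OF refl])
    fix x
    have "(\<integral>g. F x g \<partial>?G) = of_real (w (snd x)) * (\<integral>g. iexp (gauss_vec g \<bullet> W x) \<partial>?G)"
      unfolding F_def by (rule integral_mult_right_zero)
    also have "\<dots> = complex_of_real (f x)"
      unfolding gauss_vec_def gaussian_fourier f_def by simp
    finally show "complex_of_real (f x) = (\<integral>g. F x g \<partial>?G)" ..
  qed
  also have "\<dots> = (\<integral>g. \<integral>x. F x g \<partial>(?Q \<Otimes>\<^sub>M ?L) \<partial>?G)"
    by (rule QLG.Fubini_integral[OF Fi, symmetric])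
  also have "\<dots> = (\<integral>g. profile_integral_reg TYPE('d) k p (e / norm (gauss_vec g)) / of_real (norm (gauss_vec g) ^ CARD('d)) \<partial>?G)"
  proof -
    have "(0, 1) \<in> (Basis :: ((real ^ 'd) \<times> real) set)" by (simp add: Basis_prod_def)
    from AE_gauss_vec_inner_nonzero[OF this] have ae: "AE g in ?G. snd (gauss_vec g) \<noteq> 0"
      by (simp add: inner_prod_def)
    have m: "(\<lambda>g. \<integral>x. F x g \<partial>(?Q \<Otimes>\<^sub>M ?L)) \<in> borel_measurable ?G"
      by (rule sigma_finite_measure.borel_measurable_lebesgue_integral[OF QL.sigma_finite_measure_axioms])
         (unfold F_def case_prod_beta, measurable)
    have eq: "AE g in ?G. (\<integral>x. F x g \<partial>(?Q \<Otimes>\<^sub>M ?L)) = profile_integral_reg TYPE('d) k p (e / norm (gauss_vec g)) / of_real (norm (gauss_vec g) ^ CARD('d))"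
      using ae AE_space by eventually_elim (rule inner)
    show ?thesis
      by (rule integral_cong_AE[OF m _ eq]) (intro borel_measurable_divide measurable_compose[OF _ measurable_profile_integral_reg[OF p]], measurable)
  qed
  finally have eq: "complex_of_real (\<integral>x. f x \<partial>(?Q \<Otimes>\<^sub>M ?L)) = \<dots>" .
  have re: "(\<integral>x. f x \<partial>(?Q \<Otimes>\<^sub>M ?L)) = Re (\<integral>g. profile_integral_reg TYPE('d) k p (e / norm (gauss_vec g)) / of_real (norm (gauss_vec g) ^ CARD('d)) \<partial>?G)"
    unfolding eq[symmetric] by simp
  have "lifted_integral_reg TYPE('d) b k e = (\<integral>\<^sup>+x. ennreal (f x) \<partial>(?Q \<Otimes>\<^sub>M ?L))"
    unfolding lifted_integral_reg_def f_def w_def W_def I_def by simp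
  also have "\<dots> = ennreal (\<integral>x. f x \<partial>(?Q \<Otimes>\<^sub>M ?L))"
    by (rule nn_integral_eq_integral[OF fi]) (simp add: f0)
  finally show "lifted_integral_reg TYPE('d) b k e = ennreal (Re (\<integral>g. profile_integral_reg TYPE('d) k (b + real CARD('d) / 2) (e / norm (gauss_vec g)) / of_real (norm (gauss_vec g) ^ CARD('d)) \<partial>?G))"
    unfolding re p_def .
  show "0 \<le> Re (\<integral>g. profile_integral_reg TYPE('d) k (b + real CARD('d) / 2) (e / norm (gauss_vec g)) / of_real (norm (gauss_vec g) ^ CARD('d)) \<partial>?G)"
    using f0 unfolding p_def[symmetric] re[symmetric] by (intro Bochner_Integration.integral_nonneg)
qed

section \<open>Principal values\<close>

text \<open>What the boundary limit of a Cauchy transform requires: bounded support and bounded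
  difference quotients. The beta profile qualifies for exponents \<open>p \<ge> 1\<close>.\<close>

locale lipschitz_profile =
  fixes f :: "real \<Rightarrow> real" and L :: real
  assumes lipschitz: "\<And>x y. \<bar>f x - f y\<bar> \<le> L * \<bar>x - y\<bar>" and support: "\<And>x. 1 \<le> \<bar>x\<bar> \<Longrightarrow> f x = 0"
    and f_measurable [measurable]: "f \<in> borel_measurable borel"
begin

lemma L_nonneg: "0 \<le> L"
  using lipschitz[of 0 1] abs_ge_zero[of "f 0 - f 1"] by simp

lemma f_bound: "\<bar>f x\<bar> \<le> 2 * L"
proof (cases "1 \<le> \<bar>x\<bar>")
  case False
  then have "L * \<bar>x - 1\<bar> \<le> L * 2" by (intro mult_left_mono L_nonneg) auto
  with lipschitz[of x 1] have "\<bar>f x - f 1\<bar> \<le> L * 2" by linarith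
  then show ?thesis using support[of 1] by simp
qed (use L_nonneg support in simp)

text \<open>Subtracting \<open>f s\<close> makes the integrand bounded; \<open>[-2, 2]\<close> suffices since \<open>f\<close> vanishes outside \<open>[-1, 1]\<close>
  and only \<open>\<bar>s\<bar> \<le> 1\<close> matters.\<close>

definition pv :: "real \<Rightarrow> real" where
  "pv s = (\<integral>u. indicator {-2..2} u * ((f (s + u) - f s) / u) \<partial>lborel)"

text \<open>Boundary value of \<open>cauchy_reg\<close> as \<open>e\<close> tends to
  \<open>0\<close>, in the form of the Sokhotski-Plemelj formula.\<close>

definition cauchy_bdry :: "real \<Rightarrow> complex" where
  "cauchy_bdry s = of_real (pi * f s) + \<i> * of_real (pv s)"

definition cauchy_reg :: "real \<Rightarrow> real \<Rightarrow> complex" where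
  "cauchy_reg e s = (\<integral>t. of_real (f t) * half_line_ft e (t - s) \<partial>lborel)"

lemma half_line_ft_bound: "norm (of_real (f (s + u) - f s) * half_line_ft e u) \<le> L"
proof (cases "u = 0")
  case False
  have "\<bar>u\<bar> \<le> norm (of_real e - \<i> * of_real u)" using abs_Im_le_cmod[of "of_real e - \<i> * of_real u"] by simp
  then have "\<bar>f (s + u) - f s\<bar> / norm (of_real e - \<i> * of_real u) \<le> L * \<bar>u\<bar> / \<bar>u\<bar>"
    using lipschitz[of "s + u" s] False L_nonneg by (intro frac_le) auto
  then show ?thesis using False unfolding half_line_ft_def norm_mult norm_divide norm_of_real by simp
qed (use L_nonneg in simp)

lemma integrable_half_line_ft_diff:
  "integrable lborel (\<lambda>u. indicator {-2..2::real} u *\<^sub>R (of_real (f (s + u) - f s) * half_line_ft e u))"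
proof (rule Bochner_Integration.integrable_bound)
  have [measurable]: "half_line_ft e \<in> borel_measurable borel" unfolding half_line_ft_def[abs_def] by measurable
  show "integrable lborel (\<lambda>u. indicator {-2..2::real} u *\<^sub>R L)" by simp
  show "AE u in lborel. norm (indicator {-2..2::real} u *\<^sub>R (of_real (f (s + u) - f s) * half_line_ft e u)) \<le> norm (indicator {-2..2::real} u *\<^sub>R L)"
    using half_line_ft_bound[of s _ e] L_nonneg by (auto simp: indicator_def)
  show "(\<lambda>u. indicator {-2..2::real} u *\<^sub>R (of_real (f (s + u) - f s) * half_line_ft e u)) \<in> borel_measurable lborel"
    by measurable
qed

text \<open>A primitive is \<open>\<i> * Ln (e - \<i> * u)\<close>. Its logarithms at the two
  endpoints are conjugate, which makes the value real.\<close>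

lemma half_line_ft_interval:
  assumes e: "e > 0"
  shows "has_bochner_integral lborel (\<lambda>u. indicator {-2..2} u *\<^sub>R half_line_ft e u) (of_real (2 * Im (Ln (of_real e + 2 * \<i>))))"
proof -
  have "has_bochner_integral lborel (\<lambda>u. indicator {-2..2} u *\<^sub>R half_line_ft e u)
     (\<i> * Ln (of_real e - \<i> * of_real 2) - \<i> * Ln (of_real e - \<i> * of_real (-2)))"
  proof (rule has_bochner_integral_FTC_Icc)
    show "((\<lambda>u. \<i> * Ln (of_real e - \<i> * of_real u)) has_vector_derivative half_line_ft e u) (at u within {-2..2})" for u
    proof -
      have "of_real e - \<i> * of_real u \<notin> \<real>\<^sub>\<le>\<^sub>0" using e by (auto simp: complex_nonpos_Reals_iff)
      then have "((\<lambda>w. \<i> * Ln (of_real e - \<i> * w)) has_field_derivative half_line_ft e u) (at (of_real u))"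
        by (auto intro!: derivative_eq_intros simp: half_line_ft_def mult.assoc inverse_eq_divide)
      from has_vector_derivative_real_field[OF this] show ?thesis
        by (simp add: o_def has_vector_derivative_at_within)
    qed
    have "of_real e - \<i> * of_real x \<noteq> 0" for x :: real using e by (auto simp: complex_eq_iff)
    then show "continuous_on {-2..2} (half_line_ft e)" unfolding half_line_ft_def[abs_def] by (intro continuous_intros) auto
  qed simp
  also have "Ln (of_real e - \<i> * of_real 2) = cnj (Ln (of_real e + 2 * \<i>))"
    using e by (subst cnj_Ln) (auto simp: complex_nonpos_Reals_iff mult.commute)
  also have "\<i> * cnj (Ln (of_real e + 2 * \<i>)) - \<i> * Ln (of_real e - \<i> * of_real (-2)) = of_real (2 * Im (Ln (of_real e + 2 * \<i>)))"
    by (simp add: complex_eq_iff mult.commute)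
  finally show ?thesis .
qed

text \<open>Since \<open>s\<close> and the support lie in \<open>[-1, 1]\<close>, the difference
  \<open>u = t - s\<close> may be restricted to \<open>[-2, 2]\<close>. Splitting off
  \<open>f s\<close> there leaves an integrand bounded uniformly in \<open>e\<close> and an explicit
  logarithm.\<close>

lemma cauchy_reg_eq:
  assumes e: "e > 0" and s: "\<bar>s\<bar> \<le> 1"
  shows "cauchy_reg e s = (\<integral>u. indicator {-2..2} u *\<^sub>R (of_real (f (s + u) - f s) * half_line_ft e u) \<partial>lborel) + of_real (f s) * of_real (2 * Im (Ln (of_real e + 2 * \<i>)))"
proof -
  note hi = half_line_ft_interval[OF e]
  have [measurable]: "half_line_ft e \<in> borel_measurable borel" unfolding half_line_ft_def[abs_def] by measurable
  have "cauchy_reg e s = (\<integral>u. of_real (f (s + u)) * half_line_ft e u \<partial>lborel)"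
    unfolding cauchy_reg_def
    using lborel_integral_real_affine[of 1 "\<lambda>t. of_real (f t) * half_line_ft e (t - s)" s] by simp
  also have "\<dots> = (\<integral>u. indicator {-2..2} u *\<^sub>R (of_real (f (s + u) - f s) * half_line_ft e u) + of_real (f s) * (indicator {-2..2} u *\<^sub>R half_line_ft e u) \<partial>lborel)"
  proof (rule Bochner_Integration.integral_cong[OF refl])
    fix u
    show "of_real (f (s + u)) * half_line_ft e u = indicator {-2..2} u *\<^sub>R (of_real (f (s + u) - f s) * half_line_ft e u) + of_real (f s) * (indicator {-2..2} u *\<^sub>R half_line_ft e u)"
    proof (cases "u \<in> {-2..2}")
      case False
      then have "1 \<le> \<bar>s + u\<bar>" using s by auto
      then show ?thesis using False support by simp
    qed (simp add: algebra_simps)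
  qed
  also have "\<dots> = (\<integral>u. indicator {-2..2} u *\<^sub>R (of_real (f (s + u) - f s) * half_line_ft e u) \<partial>lborel) + of_real (f s) * of_real (2 * Im (Ln (of_real e + 2 * \<i>)))"
    by (subst Bochner_Integration.integral_add[OF integrable_half_line_ft_diff integrable_mult_right[OF integrable.intros[OF hi]]])
       (simp only: integral_mult_right_zero has_bochner_integral_integral_eq[OF hi])
  finally show ?thesis .
qed

lemma cauchy_reg_bound:
  assumes e: "e > 0" and s: "\<bar>s\<bar> \<le> 1"
  shows "norm (cauchy_reg e s) \<le> 4 * L + 4 * pi * L"
proof -
  have [measurable]: "half_line_ft e \<in> borel_measurable borel" unfolding half_line_ft_def[abs_def] by measurable
  have "norm (\<integral>u. indicator {-2..2} u *\<^sub>R (of_real (f (s + u) - f s) * half_line_ft e u) \<partial>lborel)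
     \<le> (\<integral>u. indicator {-2..2::real} u * L \<partial>lborel)"
  proof (rule Bochner_Integration.integral_norm_bound_integral[OF integrable_half_line_ft_diff])
    show "norm (indicator {-2..2::real} u *\<^sub>R (of_real (f (s + u) - f s) * half_line_ft e u)) \<le> indicator {-2..2} u * L" for u
      using half_line_ft_bound[of s u e] by (simp add: indicator_def)
  qed simp
  also have "\<dots> = 4 * L" by simp
  finally have 1: "norm (\<integral>u. indicator {-2..2} u *\<^sub>R (of_real (f (s + u) - f s) * half_line_ft e u) \<partial>lborel) \<le> 4 * L" .
  have "of_real e + 2 * \<i> \<noteq> 0" by (auto simp: complex_eq_iff)
  then have "\<bar>Im (Ln (of_real e + 2 * \<i>))\<bar> \<le> pi" using mpi_less_Im_Ln Im_Ln_le_pi by (metis abs_le_iff less_imp_le minus_le_iff)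
  then have "\<bar>f s\<bar> * \<bar>2 * Im (Ln (of_real e + 2 * \<i>))\<bar> \<le> (2 * L) * (2 * pi)"
    using f_bound[of s] L_nonneg by (intro mult_mono) auto
  then have 2: "norm (of_real (f s) * complex_of_real (2 * Im (Ln (of_real e + 2 * \<i>)))) \<le> 4 * pi * L"
    by (simp add: norm_mult abs_mult)
  show ?thesis unfolding cauchy_reg_eq[OF e s] using norm_triangle_le[OF add_mono[OF 1 2]] .
qed

lemma cauchy_reg_tendsto:
  assumes e: "\<And>m. e m > 0" "e \<longlonglongrightarrow> 0" and s: "\<bar>s\<bar> \<le> 1"
  shows "(\<lambda>m. cauchy_reg (e m) s) \<longlonglongrightarrow> cauchy_bdry s"
proof -
  have [measurable]: "half_line_ft e \<in> borel_measurable borel" for e unfolding half_line_ft_def[abs_def] by measurable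
  have "(\<lambda>m. \<integral>u. indicator {-2..2} u *\<^sub>R (of_real (f (s + u) - f s) * half_line_ft (e m) u) \<partial>lborel)
      \<longlonglongrightarrow> (\<integral>u. \<i> * of_real (indicator {-2..2} u * ((f (s + u) - f s) / u)) \<partial>lborel)"
  proof (rule integral_dominated_convergence[where w="\<lambda>u. indicator {-2..2} u * L"])
    show "AE u in lborel. (\<lambda>m. indicator {-2..2} u *\<^sub>R (of_real (f (s + u) - f s) * half_line_ft (e m) u))
       \<longlonglongrightarrow> \<i> * of_real (indicator {-2..2} u * ((f (s + u) - f s) / u))"
      using AE_lborel_singleton[of 0]
    proof eventually_elim
      case (elim u)
      have "(\<lambda>m. half_line_ft (e m) u) \<longlonglongrightarrow> 1 / (of_real 0 - \<i> * of_real u)"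
        unfolding half_line_ft_def using elim by (intro tendsto_intros e) auto
      then have "(\<lambda>m. indicator {-2..2} u *\<^sub>R (of_real (f (s + u) - f s) * half_line_ft (e m) u))
         \<longlonglongrightarrow> indicator {-2..2} u *\<^sub>R (of_real (f (s + u) - f s) * (1 / (of_real 0 - \<i> * of_real u)))"
        by (intro tendsto_intros)
      also have "indicator {-2..2} u *\<^sub>R (of_real (f (s + u) - f s) * (1 / (of_real 0 - \<i> * of_real u))) = \<i> * of_real (indicator {-2..2} u * ((f (s + u) - f s) / u))"
        using elim by (simp add: indicator_def field_simps)
      finally show ?case .
    qed
    show "AE u in lborel. norm (indicator {-2..2} u *\<^sub>R (of_real (f (s + u) - f s) * half_line_ft (e m) u)) \<le> indicator {-2..2} u * L" for m
      using half_line_ft_bound[of s _ "e m"] L_nonneg by (auto simp: indicator_def)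
  qed (auto intro!: borel_measurable_scaleR)
  note lim = this
  have lim0: "(\<lambda>m. Im (Ln (of_real (e m) + 2 * \<i>))) \<longlonglongrightarrow> Im (Ln (of_real 0 + 2 * \<i>))"
    using e by (intro tendsto_intros) (auto simp: complex_nonpos_Reals_iff)
  \<comment> \<open>Twice this value, multiplied by \<open>f s\<close>, is the term
    \<open>pi * f s\<close> of the boundary value.\<close>
  have eqp: "Im (Ln (of_real 0 + 2 * \<i>)) = pi / 2"
    using Ln_times_of_real[of 2 \<i>] Ln_of_real[of 2] by simp
  have lim_Ln: "(\<lambda>m. Im (Ln (of_real (e m) + 2 * \<i>))) \<longlonglongrightarrow> pi / 2"
    using lim0 unfolding eqp .
  have "(\<lambda>m. (\<integral>u. indicator {-2..2} u *\<^sub>R (of_real (f (s + u) - f s) * half_line_ft (e m) u) \<partial>lborel) + of_real (f s) * of_real (2 * Im (Ln (of_real (e m) + 2 * \<i>))))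
     \<longlonglongrightarrow> (\<integral>u. \<i> * of_real (indicator {-2..2} u * ((f (s + u) - f s) / u)) \<partial>lborel) + of_real (f s) * of_real (2 * (pi / 2))"
    by (rule tendsto_add[OF lim tendsto_mult[OF tendsto_const tendsto_of_real[OF tendsto_mult[OF tendsto_const lim_Ln]]]])
  moreover have "(\<integral>u. \<i> * complex_of_real (indicator {-2..2} u * ((f (s + u) - f s) / u)) \<partial>lborel) = \<i> * of_real (pv s)"
    unfolding pv_def by (subst integral_mult_right_zero, subst integral_complex_of_real) simp
  ultimately show ?thesis
    unfolding cauchy_reg_eq[OF e(1) s] cauchy_bdry_def by (simp add: add.commute mult.commute)
qed

end

section \<open>The beta profile on the line\<close>

lemma powr_lipschitz:
  fixes a b p :: real
  assumes p: "p \<ge> 1" and a: "0 \<le> a" "a \<le> 1" and b: "0 \<le> b" "b \<le> 1"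
  shows "\<bar>a powr p - b powr p\<bar> \<le> p * \<bar>a - b\<bar>"
proof -
  have *: "\<bar>a powr p - b powr p\<bar> \<le> p * \<bar>a - b\<bar>" if ab: "0 \<le> b" "b < a" "a \<le> 1" for a b :: real
  proof -
    have der: "((\<lambda>x. x powr p) has_real_derivative p * x powr (p - 1)) (at x)" if "b < x" for x
      using that ab by (auto intro!: derivative_eq_intros)
    have "continuous_on {b..a} (\<lambda>x. x powr p)"
      using ab p by (intro continuous_on_powr' continuous_intros) auto
    then obtain l z where z: "b < z" "z < a" "DERIV (\<lambda>x. x powr p) z :> l" "a powr p - b powr p = (a - b) * l"
      using MVT[of b a "\<lambda>x. x powr p"] ab(2) der real_differentiable_def by blast
    have l: "l = p * z powr (p - 1)" using DERIV_unique[OF z(3) der[OF z(1)]] .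
    note z = z(1,2) z(4)[unfolded l]
    have "z powr (p - 1) \<le> 1" using z ab p by (intro powr_le1) auto
    then have "(a - b) * (p * z powr (p - 1)) \<le> (a - b) * (p * 1)" using ab p by (intro mult_left_mono) auto
    moreover have "0 \<le> (a - b) * (p * z powr (p - 1))" using ab p by simp
    ultimately show ?thesis using z ab by (simp add: mult.commute)
  qed
  consider "b < a" | "a < b" | "a = b" by linarith
  then show ?thesis using *[of b a] *[of a b] a b by cases (auto simp: abs_minus_commute)
qed

definition profile :: "real \<Rightarrow> real \<Rightarrow> real" where
  "profile p s = beta_weight p (s\<^sup>2) / enn2real (beta_weight_total p TYPE(real))"

lemma beta_weight_lipschitz:
  assumes p: "p \<ge> 1"
  shows "\<bar>beta_weight p (x\<^sup>2) - beta_weight p (y\<^sup>2)\<bar> \<le> 2 * p * \<bar>x - y\<bar>"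
proof -
  \<comment> \<open>Clamping to \<open>[-1, 1]\<close> makes one formula valid on the whole line,
    and it does not increase distances.\<close>
  define c where "c x = max (- 1) (min 1 x)" for x :: real
  have beta_weight: "beta_weight p (x\<^sup>2) = (1 - (c x)\<^sup>2) powr p" for x
  proof (cases "\<bar>x\<bar> < 1")
    case True
    then have "c x = x" by (auto simp: c_def)
    then show ?thesis using True by (simp add: beta_weight_def abs_square_less_1)
  next
    case False
    then have "c x = 1 \<or> c x = - 1" by (auto simp: c_def)
    moreover have "\<not> x\<^sup>2 < 1" using False by (simp add: abs_square_less_1)
    ultimately show ?thesis using p by (auto simp: beta_weight_def)
  qed
  have c: "\<bar>c x\<bar> \<le> 1" for x by (auto simp: c_def)
  have c2: "(c x)\<^sup>2 \<le> 1" for x using c[of x] by (simp add: abs_square_le_1)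
  have "\<bar>beta_weight p (x\<^sup>2) - beta_weight p (y\<^sup>2)\<bar> \<le> p * \<bar>(1 - (c x)\<^sup>2) - (1 - (c y)\<^sup>2)\<bar>"
    unfolding beta_weight using c2 by (intro powr_lipschitz p) auto
  also have "(1 - (c x)\<^sup>2) - (1 - (c y)\<^sup>2) = (c y - c x) * (c x + c y)" by (simp add: power2_eq_square algebra_simps)
  also have "p * \<bar>(c y - c x) * (c x + c y)\<bar> \<le> p * (\<bar>x - y\<bar> * 2)"
    unfolding abs_mult
  proof (intro mult_left_mono mult_mono)
    show "\<bar>c y - c x\<bar> \<le> \<bar>x - y\<bar>" by (auto simp: c_def)
    show "\<bar>c x + c y\<bar> \<le> 2" using c[of x] c[of y] by linarith
  qed (use p in auto)
  finally show ?thesis by (simp add: mult_ac)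
qed

lemma profile_lipschitz:
  assumes p: "p \<ge> 1"
  shows "lipschitz_profile (profile p) (2 * p / enn2real (beta_weight_total p TYPE(real)))"
proof
  define T where "T = enn2real (beta_weight_total p TYPE(real))"
  have "T \<ge> 0" by (simp add: T_def)
  fix x y :: real
  have "\<bar>profile p x - profile p y\<bar> = \<bar>beta_weight p (x\<^sup>2) - beta_weight p (y\<^sup>2)\<bar> / T"
    using \<open>T \<ge> 0\<close> by (simp add: profile_def T_def[symmetric] diff_divide_distrib[symmetric] abs_divide)
  also have "\<dots> \<le> 2 * p * \<bar>x - y\<bar> / T" using beta_weight_lipschitz[OF p] \<open>T \<ge> 0\<close> by (rule divide_right_mono)
  finally show "\<bar>profile p x - profile p y\<bar> \<le> 2 * p / T * \<bar>x - y\<bar>" by simp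
next
  show "profile p x = 0" if "1 \<le> \<bar>x\<bar>" for x
    using one_le_power[OF that, of 2] by (simp add: profile_def beta_weight_ge_1)
  show "profile p \<in> borel_measurable borel" unfolding profile_def[abs_def] by measurable
qed

lemma ball_beta_real:
  assumes "p > -1" shows "(ball_beta p :: real measure) = density lborel (\<lambda>s. ennreal (profile p s))"
proof -
  have "beta_weight_total p TYPE(real) = ennreal (enn2real (beta_weight_total p TYPE(real)))" "0 < enn2real (beta_weight_total p TYPE(real))"
    using beta_weight_total_bounds[OF assms, where 'a=real] by (auto simp: enn2real_positive_iff)
  then have "ennreal (beta_weight p ((norm s)\<^sup>2)) / beta_weight_total p TYPE(real) = ennreal (profile p s)" for s :: real
    unfolding profile_def by (metis beta_weight_nonneg divide_ennreal power2_abs real_norm_def)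
  then show ?thesis unfolding ball_beta_def by simp
qed

lemma profile_nonneg [simp]: "0 \<le> profile p s" by (simp add: profile_def)

lemma half_line_ft_minus: "half_line_ft e (- x) = cnj (half_line_ft e x)"
  by (simp add: half_line_ft_def)

lemma card_vertex_index_gt:
  assumes "1 \<le> k" "k \<le> CARD('d::finite) + 1"
  shows "card {i :: 'd. k < vertex_index i} = CARD('d) + 1 - k" "card {i :: 'd. \<not> k < vertex_index i} = k - 1"
proof -
  have "card {i :: 'd. k < vertex_index i} = card (vertex_index ` {i :: 'd. k < vertex_index i})"
    by (metis card_image inj_vertex_index inj_on_subset subset_UNIV)
  also have "vertex_index ` {i :: 'd. k < vertex_index i} = {j \<in> range (vertex_index :: 'd \<Rightarrow> nat). k < j}" by auto
  also have "\<dots> = {k<..CARD('d) + 1}" unfolding range_vertex_index using assms by auto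
  finally show 1: "card {i :: 'd. k < vertex_index i} = CARD('d) + 1 - k" by simp
  have "card {i :: 'd. \<not> k < vertex_index i} = CARD('d) - card {i :: 'd. k < vertex_index i}"
    by (subst card_Diff_subset[symmetric]) (auto intro!: arg_cong[where f=card])
  then show "card {i :: 'd. \<not> k < vertex_index i} = k - 1" unfolding 1 using assms by simp
qed

text \<open>Given the value \<open>s\<close> at vertex \<open>1\<close>, the other \<open>d\<close>
  values are independent. Each of the \<open>k - 1\<close> edges inside the face has a coefficient
  on the full line and contributes \<open>cauchy_reg\<close> plus its conjugate; each remaining edge
  contributes \<open>cauchy_reg\<close> itself.\<close>

lemma profile_integral_reg_eq:
  assumes p: "p \<ge> 1" and e: "e > 0" and k: "1 \<le> k" "k \<le> CARD('d::finite) + 1"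
  shows "profile_integral_reg TYPE('d) k p e = (\<integral>s. of_real (2 * Re (lipschitz_profile.cauchy_reg (profile p) e s)) ^ (k - 1)
      * lipschitz_profile.cauchy_reg (profile p) e s ^ (CARD('d) + 1 - k) \<partial>(ball_beta p :: real measure))"
proof -
  interpret lipschitz_profile "profile p" "2 * p / enn2real (beta_weight_total p TYPE(real))" by (rule profile_lipschitz[OF p])
  let ?F = "ball_beta p :: real measure"
  let ?R = "range (vertex_index :: 'd \<Rightarrow> nat)"
  have p1: "p > -1" using p by simp
  interpret F: prob_space ?F by (rule prob_space_ball_beta[OF p1])
  interpret P: product_sigma_finite "\<lambda>_::nat. ?F" by standard
  interpret R: prob_space "PiM ?R (\<lambda>_. ?F)" by (intro prob_space_PiM F.prob_space_axioms)
  interpret PF: pair_sigma_finite "PiM ?R (\<lambda>_. ?F)" ?F ..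
  have nR: "1 \<notin> ?R" by auto
  define G where "G S = (\<Prod>i\<in>UNIV. weight_ft (k < vertex_index (i::'d)) e (S (vertex_index i) - S 1))" for S :: "nat \<Rightarrow> real"
  have Gb: "norm (G S) \<le> (2 / e) ^ CARD('d)" for S
    unfolding G_def prod_norm[symmetric] using prod_mono[of UNIV "\<lambda>i. norm (weight_ft (k < vertex_index (i::'d)) e (S (vertex_index i) - S 1))" "\<lambda>_. 2 / e"] norm_weight_ft_le[OF e]
    by simp
  have Gm: "G \<in> borel_measurable (PiM (insert 1 ?R) (\<lambda>_. ?F))"
    unfolding G_def
    by (intro borel_measurable_prod measurable_compose[OF _ measurable_weight_ft] borel_measurable_diff
       measurable_component_singleton[where M="\<lambda>_. ?F", unfolded measurable_cong_sets[OF refl sets_ball_beta]]) auto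
  interpret IR: prob_space "PiM (insert 1 ?R) (\<lambda>_. ?F)" by (intro prob_space_PiM F.prob_space_axioms)
  have Gi: "integrable (PiM (insert 1 ?R) (\<lambda>_. ?F)) G"
    by (rule IR.integrable_const_bound[OF AE_I2[OF Gb] Gm])
  have "profile_integral_reg TYPE('d) k p e = (\<integral>S. G S \<partial>PiM (insert 1 ?R) (\<lambda>_. ?F))"
    unfolding profile_integral_reg_def G_def atLeastAtMost_eq_insert_vertex_index ..
  also have "\<dots> = (\<integral>S. \<integral>s. G (S(1 := s)) \<partial>?F \<partial>PiM ?R (\<lambda>_. ?F))"
    by (rule P.product_integral_insert[OF _ nR Gi]) simp
  also have "\<dots> = (\<integral>s. \<integral>S. G (S(1 := s)) \<partial>PiM ?R (\<lambda>_. ?F) \<partial>?F)"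
  proof (rule PF.Fubini_integral[symmetric])
    have "(\<lambda>x. (fst x)(1 := snd x)) \<in> measurable (PiM ?R (\<lambda>_. ?F) \<Otimes>\<^sub>M ?F) (PiM (insert 1 ?R) (\<lambda>_. ?F))"
      by (rule measurable_fun_upd[where J="?R"]) auto
    then have "(\<lambda>x. G ((fst x)(1 := snd x))) \<in> borel_measurable (PiM ?R (\<lambda>_. ?F) \<Otimes>\<^sub>M ?F)"
      by (rule measurable_compose[OF _ Gm])
    moreover have "(\<lambda>(S, s). G (S(1 := s))) = (\<lambda>x. G ((fst x)(1 := snd x)))" by auto
    ultimately have m: "(\<lambda>(S, s). G (S(1 := s))) \<in> borel_measurable (PiM ?R (\<lambda>_. ?F) \<Otimes>\<^sub>M ?F)" by simp
    interpret PP: pair_prob_space "PiM ?R (\<lambda>_. ?F)" ?F ..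
    show "integrable (PiM ?R (\<lambda>_. ?F) \<Otimes>\<^sub>M ?F) (\<lambda>(S, s). G (S(1 := s)))"
      using m by (intro PP.integrable_const_bound[where B="(2 / e) ^ CARD('d)"]) (auto simp: Gb)
  qed
  also have "\<dots> = (\<integral>s. of_real (2 * Re (cauchy_reg e s)) ^ (k - 1) * cauchy_reg e s ^ (CARD('d) + 1 - k) \<partial>?F)"
  proof (rule Bochner_Integration.integral_cong[OF refl])
    fix s
    have int: "integrable ?F (\<lambda>t. weight_ft pos e (t - s))" for pos
      by (rule F.integrable_const_bound[OF AE_I2[OF norm_weight_ft_le[OF e]]]) measurable
    have "(\<integral>S. G (S(1 := s)) \<partial>PiM ?R (\<lambda>_. ?F)) = (\<integral>S. (\<Prod>j\<in>?R. weight_ft (k < j) e (S j - s)) \<partial>PiM ?R (\<lambda>_. ?F))"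
      unfolding G_def by (simp add: prod.reindex[OF inj_vertex_index])
    also have "\<dots> = (\<Prod>j\<in>?R. \<integral>t. weight_ft (k < j) e (t - s) \<partial>?F)"
      by (rule P.product_integral_prod) (use int in auto)
    also have "\<dots> = (\<Prod>i\<in>UNIV. \<integral>t. weight_ft (k < vertex_index (i::'d)) e (t - s) \<partial>?F)"
      by (simp add: prod.reindex[OF inj_vertex_index])
    also have "\<dots> = (\<Prod>i\<in>UNIV. if k < vertex_index (i::'d) then cauchy_reg e s else of_real (2 * Re (cauchy_reg e s)))"
    proof (intro prod.cong refl)
      fix i :: 'd
      have 1: "(\<integral>t. half_line_ft e (t - s) \<partial>?F) = cauchy_reg e s"
        unfolding ball_beta_real[OF p1] cauchy_reg_def
        by (subst integral_density) (auto simp: scaleR_conv_of_real half_line_ft_def)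
      have i1: "integrable ?F (\<lambda>t. half_line_ft e (t - s))" using int[of True] by (simp add: weight_ft_def)
      have "(\<integral>t. weight_ft False e (t - s) \<partial>?F) = (\<integral>t. half_line_ft e (t - s) + cnj (half_line_ft e (t - s)) \<partial>?F)"
        by (simp only: weight_ft_def half_line_ft_minus if_False)
      also have "\<dots> = cauchy_reg e s + cnj (cauchy_reg e s)"
        using i1 1 by (subst Bochner_Integration.integral_add) auto
      also have "\<dots> = of_real (2 * Re (cauchy_reg e s))" by (simp add: complex_eq_iff)
      finally show "(\<integral>t. weight_ft (k < vertex_index i) e (t - s) \<partial>?F) = (if k < vertex_index i then cauchy_reg e s else of_real (2 * Re (cauchy_reg e s)))"
        using 1 by (cases "k < vertex_index i") (simp_all add: weight_ft_def)
    qed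
    also have "\<dots> = cauchy_reg e s ^ (CARD('d) + 1 - k) * of_real (2 * Re (cauchy_reg e s)) ^ (k - 1)"
    proof -
      have "UNIV \<inter> {i :: 'd. k < vertex_index i} = {i. k < vertex_index i}" "UNIV \<inter> - {i :: 'd. k < vertex_index i} = {i. \<not> k < vertex_index i}" by auto
      then show ?thesis
        by (simp only: prod.If_cases[OF finite_class.finite_UNIV] prod_constant card_vertex_index_gt[OF k])
    qed
    finally show "(\<integral>S. G (S(1 := s)) \<partial>PiM ?R (\<lambda>_. ?F)) = of_real (2 * Re (cauchy_reg e s)) ^ (k - 1) * cauchy_reg e s ^ (CARD('d) + 1 - k)"
      by (simp add: mult.commute)
  qed
  finally show ?thesis .
qed

text \<open>The limit of \<open>profile_integral_reg\<close> as \<open>e\<close> tends to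
  \<open>0\<close>; \<open>2 * pi * profile p s\<close> is twice the real part of the boundary
  value.\<close>

definition profile_integral :: "nat \<Rightarrow> nat \<Rightarrow> real \<Rightarrow> complex" where
  "profile_integral n k p = (\<integral>s. of_real (2 * pi * profile p s) ^ (k - 1) *
      (of_real (pi * profile p s) + \<i> * of_real (lipschitz_profile.pv (profile p) s)) ^ (n - k) \<partial>(ball_beta p :: real measure))"

lemma AE_ball_beta: "p > -1 \<Longrightarrow> AE s in (ball_beta p :: real measure). \<bar>s\<bar> \<le> 1"
  unfolding ball_beta_real
proof (subst AE_density)
  have "profile p s = 0" if "1 \<le> \<bar>s\<bar>" for s
    using one_le_power[OF that, of 2] by (simp add: profile_def beta_weight_ge_1)
  then show "AE s in lborel. 0 < ennreal (profile p s) \<longrightarrow> \<bar>s\<bar> \<le> 1"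
    by (intro AE_I2) (metis less_irrefl ennreal_0 linorder_le_cases)
  show "(\<lambda>s. ennreal (profile p s)) \<in> borel_measurable lborel" unfolding profile_def[abs_def] by measurable
qed

text \<open>The bound is uniform in \<open>e\<close> because the regularised integral is later
  evaluated at \<open>e / norm (gauss_vec g)\<close>, which can be any positive number, and
  dominated over \<open>g\<close>.\<close>

lemma profile_integral_reg_bounded:
  assumes p: "p \<ge> 1" and k: "1 \<le> k" "k \<le> CARD('d::finite) + 1"
  obtains B where "\<And>e. e > 0 \<Longrightarrow> norm (profile_integral_reg TYPE('d) k p e) \<le> B"
  and "\<And>e. (\<And>m. e m > 0) \<Longrightarrow> e \<longlonglongrightarrow> 0 \<Longrightarrow> (\<lambda>m. profile_integral_reg TYPE('d) k p (e m)) \<longlonglongrightarrow> profile_integral (CARD('d) + 1) k p"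
proof -
  interpret lipschitz_profile "profile p" "2 * p / enn2real (beta_weight_total p TYPE(real))" by (rule profile_lipschitz[OF p])
  let ?F = "ball_beta p :: real measure" and ?L = "2 * p / enn2real (beta_weight_total p TYPE(real))"
  have p1: "p > -1" using p by simp
  interpret F: prob_space ?F by (rule prob_space_ball_beta[OF p1])
  define K where "K = 4 * ?L + 4 * pi * ?L"
  have K: "K \<ge> 0" unfolding K_def by (intro add_nonneg_nonneg mult_nonneg_nonneg L_nonneg) auto
  define g where "g c = of_real (2 * Re c) ^ (k - 1) * c ^ (CARD('d) + 1 - k)" for c
  have gb: "norm (g c) \<le> (2 * K) ^ (k - 1) * K ^ (CARD('d) + 1 - k)" if "norm c \<le> K" for c
    unfolding g_def norm_mult norm_power using that abs_Re_le_cmod[of c] K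
    by (intro mult_mono power_mono) auto
  have gm [measurable]: "g \<in> borel_measurable borel" unfolding g_def by measurable
  have crm [measurable]: "cauchy_reg e \<in> borel_measurable borel" for e
  proof -
    have "(\<lambda>x. of_real (profile p (snd x)) * half_line_ft e (snd x - fst x)) \<in> borel_measurable (borel \<Otimes>\<^sub>M lborel)"
      unfolding half_line_ft_def by measurable
    then show ?thesis unfolding cauchy_reg_def[abs_def]
      by (intro lborel.borel_measurable_lebesgue_integral) (simp add: case_prod_beta)
  qed
  have T: "profile_integral_reg TYPE('d) k p e = (\<integral>s. g (cauchy_reg e s) \<partial>?F)" if "e > 0" for e
    unfolding g_def by (rule profile_integral_reg_eq[OF p that k])
  have ae: "AE s in ?F. norm (g (cauchy_reg e s)) \<le> (2 * K) ^ (k - 1) * K ^ (CARD('d) + 1 - k)" if "e > 0" for e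
    using AE_ball_beta[OF p1] by eventually_elim (intro gb, unfold K_def, rule cauchy_reg_bound[OF that])
  show ?thesis
  proof (rule that)
    fix e :: real assume e: "e > 0"
    show "norm (profile_integral_reg TYPE('d) k p e) \<le> (2 * K) ^ (k - 1) * K ^ (CARD('d) + 1 - k)"
      unfolding T[OF e]
    proof -
      have i: "integrable ?F (\<lambda>s. g (cauchy_reg e s))" by (rule F.integrable_const_bound[OF ae[OF e]]) measurable
      have "norm (\<integral>s. g (cauchy_reg e s) \<partial>?F) \<le> (\<integral>s. norm (g (cauchy_reg e s)) \<partial>?F)" by (rule integral_norm_bound)
      also have "\<dots> \<le> (2 * K) ^ (k - 1) * K ^ (CARD('d) + 1 - k)"
        by (rule F.integral_le_const) (use i ae[OF e] in auto)
      finally show "norm (\<integral>s. g (cauchy_reg e s) \<partial>?F) \<le> (2 * K) ^ (k - 1) * K ^ (CARD('d) + 1 - k)" .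
    qed
  next
    fix e :: "nat \<Rightarrow> real" assume e: "\<And>m. e m > 0" "e \<longlonglongrightarrow> 0"
    have lim: "(\<lambda>m. cauchy_reg (e m) s) \<longlonglongrightarrow> cauchy_bdry s" if "\<bar>s\<bar> \<le> 1" for s
      by (rule cauchy_reg_tendsto[OF e that])
    have cbm: "(\<lambda>s. g (cauchy_bdry s)) \<in> borel_measurable ?F"
    proof -
      have "(\<lambda>x. indicator {-2..2} (snd x) * ((profile p (fst x + snd x) - profile p (fst x)) / snd x)) \<in> borel_measurable (borel \<Otimes>\<^sub>M lborel)"
        by measurable
      then have [measurable]: "pv \<in> borel_measurable borel" unfolding pv_def[abs_def]
        by (intro lborel.borel_measurable_lebesgue_integral) (simp add: case_prod_beta)
      show ?thesis unfolding cauchy_bdry_def by measurable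
    qed
    have "(\<lambda>m. \<integral>s. g (cauchy_reg (e m) s) \<partial>?F) \<longlonglongrightarrow> (\<integral>s. g (cauchy_bdry s) \<partial>?F)"
    proof (rule integral_dominated_convergence[where w="\<lambda>_. (2 * K) ^ (k - 1) * K ^ (CARD('d) + 1 - k)"])
      show "AE s in ?F. (\<lambda>m. g (cauchy_reg (e m) s)) \<longlonglongrightarrow> g (cauchy_bdry s)"
        using AE_ball_beta[OF p1]
      proof eventually_elim
        case (elim s)
        show ?case unfolding g_def by (intro tendsto_intros lim elim)
      qed
    qed (use cbm ae[OF e(1)] in auto)
    moreover have "2 * Re (cauchy_bdry s) = 2 * pi * profile p s" for s by (simp add: cauchy_bdry_def)
    then have "(\<integral>s. g (cauchy_bdry s) \<partial>?F) = profile_integral (CARD('d) + 1) k p"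
      unfolding profile_integral_def g_def by (simp only: cauchy_bdry_def)
    ultimately show "(\<lambda>m. profile_integral_reg TYPE('d) k p (e m)) \<longlonglongrightarrow> profile_integral (CARD('d) + 1) k p"
      unfolding T[OF e(1)] by simp
  qed
qed

lemma ennreal_eq_times_of_divide_eq:
  fixes x y c :: ennreal
  assumes "c \<noteq> 0" "c \<noteq> \<infinity>" "x / c = y"
  shows "x = y * c"
  unfolding assms(3)[symmetric] using assms(1,2) by (simp add: ennreal_divide_times ennreal_divide_self less_top)

text \<open>Monotone convergence along \<open>e = 1 / (m + 1)\<close>. The power of the total mass
  appears because the regularised integral uses normalised points.\<close>

lemma lifted_integral_limit:
  fixes b :: real
  assumes b: "b > -1"
  shows "(\<lambda>m. lifted_integral_reg TYPE('d::finite) b k (inverse (real (Suc m)))) \<longlonglongrightarrow>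
     lifted_integral b k TYPE('d) / beta_weight_total b TYPE((real ^ 'd) \<times> real) ^ (CARD('d) + 1)"
proof -
  define I where "I = {1..CARD('d) + 1}"
  have I1: "1 \<in> I" "\<And>i::'d. vertex_index i \<in> I" "finite I" "card I = CARD('d) + 1" by (auto simp: I_def)
  let ?M = "ball_beta b :: ((real ^ 'd) \<times> real) measure"
  let ?Q = "PiM I (\<lambda>_. ?M)" and ?L = "lborel :: (real ^ 'd) measure" and ?Z = "lborel :: ((real ^ 'd) \<times> real) measure"
  let ?T = "beta_weight_total b TYPE((real ^ 'd) \<times> real)"
  interpret M: prob_space ?M by (rule prob_space_ball_beta[OF b])
  interpret Q: prob_space ?Q by (intro prob_space_PiM M.prob_space_axioms)
  interpret QL: pair_sigma_finite ?Q ?L ..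
  define W where "W x = (\<Sum>i\<in>UNIV. snd x $ i *\<^sub>R (fst x (vertex_index (i::'d)) - fst x 1))" for x :: "(nat \<Rightarrow> (real ^ 'd) \<times> real) \<times> (real ^ 'd)"
  have Wm [measurable]: "W \<in> borel_measurable (?Q \<Otimes>\<^sub>M ?L)"
    unfolding W_def I_def by (rule measurable_edge_sum) simp
  define w where "w m u = (\<Prod>i\<in>UNIV. abel_weight (k < vertex_index (i::'d)) (inverse (real (Suc m))) (u $ i))" for m and u :: "real ^ 'd"
  have wm [measurable]: "w m \<in> borel_measurable borel" for m unfolding w_def by measurable
  define f where "f m x = ennreal (w m (snd x) * exp (- (norm (W x))\<^sup>2 / 2))" for m x
  define f0 where "f0 x = indicator {u. cone_coords k u} (snd x) * ennreal (exp (- (norm (W x))\<^sup>2 / 2))" for x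
  have [measurable]: "{u. cone_coords k u} \<in> sets (borel :: (real ^ 'd) measure)" by measurable
  have T: "?T \<noteq> 0" "?T \<noteq> \<infinity>" using beta_weight_total_bounds[OF b, where 'a="(real ^ 'd) \<times> real"] by auto
  have "(\<lambda>m. \<integral>\<^sup>+x. f m x \<partial>(?Q \<Otimes>\<^sub>M ?L)) \<longlonglongrightarrow> (\<integral>\<^sup>+x. f0 x \<partial>(?Q \<Otimes>\<^sub>M ?L))"
  proof (rule nn_integral_LIMSEQ)
    show "incseq f"
    proof (rule incseq_SucI, rule le_funI)
      fix m x
      have "abel_weight pos (inverse (real (Suc m))) t \<le> abel_weight pos (inverse (real (Suc (Suc m)))) t" for pos t
      proof -
        have "inverse (real (Suc (Suc m))) * \<bar>t\<bar> \<le> inverse (real (Suc m)) * \<bar>t\<bar>"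
          by (intro mult_right_mono le_imp_inverse_le) auto
        then show ?thesis by (simp add: abel_weight_def)
      qed
      then show "f m x \<le> f (Suc m) x" unfolding f_def w_def
        by (intro ennreal_leI mult_right_mono prod_mono) auto
    qed
    show "f m \<in> borel_measurable (?Q \<Otimes>\<^sub>M ?L)" for m unfolding f_def by measurable
    fix x
    have w: "(\<lambda>m. abel_weight pos (inverse (real (Suc m))) t) \<longlonglongrightarrow> (if pos \<and> t < 0 then 0 else 1)" for pos t
    proof -
      have "(\<lambda>m. exp (- (inverse (real (Suc m)) * \<bar>t\<bar>))) \<longlonglongrightarrow> exp (- (0 * \<bar>t\<bar>))"
        by (intro tendsto_intros LIMSEQ_inverse_real_of_nat)
      then show ?thesis by (auto simp: abel_weight_def)
    qed
    have "(\<lambda>m. (\<Prod>i\<in>UNIV. abel_weight (k < vertex_index (i::'d)) (inverse (real (Suc m))) (snd x $ i)) * exp (- (norm (W x))\<^sup>2 / 2))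
       \<longlonglongrightarrow> (\<Prod>i\<in>UNIV. if k < vertex_index (i::'d) \<and> snd x $ i < 0 then 0 else 1) * exp (- (norm (W x))\<^sup>2 / 2)"
      by (intro tendsto_mult tendsto_prod w tendsto_const)
    moreover have "(\<Prod>i\<in>UNIV. if k < vertex_index (i::'d) \<and> snd x $ i < 0 then 0 else 1) = (indicator {u. cone_coords k u} (snd x) :: real)"
    proof (cases "cone_coords k (snd x)")
      case True
      then show ?thesis by (auto simp: indicator_def cone_coords_def not_less intro!: prod.neutral)
    next
      case False
      then obtain i where "k < vertex_index i" "snd x $ i < 0" by (auto simp: cone_coords_def not_le)
      then have "(\<Prod>i\<in>UNIV. if k < vertex_index (i::'d) \<and> snd x $ i < 0 then 0 else 1) = (0::real)"
        by (intro prod_zero bexI[of _ i]) auto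
      with False show ?thesis by simp
    qed
    ultimately have "(\<lambda>m. ennreal ((\<Prod>i\<in>UNIV. abel_weight (k < vertex_index (i::'d)) (inverse (real (Suc m))) (snd x $ i)) * exp (- (norm (W x))\<^sup>2 / 2)))
       \<longlonglongrightarrow> ennreal (indicator {u. cone_coords k u} (snd x) * exp (- (norm (W x))\<^sup>2 / 2))"
      by (intro tendsto_ennrealI) simp
    also have "ennreal (indicator {u. cone_coords k u} (snd x) * exp (- (norm (W x))\<^sup>2 / 2)) = f0 x"
      by (simp add: f0_def indicator_def)
    finally show "(\<lambda>m. f m x) \<longlonglongrightarrow> f0 x" unfolding f_def w_def .
  qed
  moreover have "(\<integral>\<^sup>+x. f m x \<partial>(?Q \<Otimes>\<^sub>M ?L)) = lifted_integral_reg TYPE('d) b k (inverse (real (Suc m)))" for m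
    unfolding f_def w_def lifted_integral_reg_def W_def I_def ..
  moreover have "(\<integral>\<^sup>+x. f0 x \<partial>(?Q \<Otimes>\<^sub>M ?L)) = lifted_integral b k TYPE('d) / ?T ^ (CARD('d) + 1)"
  proof -
    have f0m: "f0 \<in> borel_measurable (?Q \<Otimes>\<^sub>M ?L)" unfolding f0_def by measurable
    define g where "g Z = (\<integral>\<^sup>+u. f0 (Z, u) \<partial>?L)" for Z
    have gm: "g \<in> borel_measurable ?Q"
      unfolding g_def by (rule lborel.borel_measurable_nn_integral) (use f0m in simp)
    have sQ: "sets ?Q = sets (PiM I (\<lambda>_. ?Z))" by (intro sets_PiM_cong) auto
    have gm' [measurable]: "g \<in> borel_measurable (PiM I (\<lambda>_. ?Z))" using gm unfolding measurable_cong_sets[OF sQ refl] .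
    have dQ: "?Q = density (PiM I (\<lambda>_. ?Z)) (\<lambda>Z. \<Prod>j\<in>I. ennreal (beta_weight b ((norm (Z j))\<^sup>2)) / ?T)"
      unfolding ball_beta_def
      by (rule PiM_density[OF I1(3) sigma_finite_lborel])
         (use M.sigma_finite_measure_axioms in \<open>simp_all add: ball_beta_def\<close>)
    have "(\<integral>\<^sup>+x. f0 x \<partial>(?Q \<Otimes>\<^sub>M ?L)) = (\<integral>\<^sup>+Z. g Z \<partial>?Q)"
      unfolding g_def by (rule lborel.nn_integral_fst[OF f0m, symmetric])
    also have "\<dots> = (\<integral>\<^sup>+Z. g Z \<partial>density (PiM I (\<lambda>_. ?Z)) (\<lambda>Z. \<Prod>j\<in>I. ennreal (beta_weight b ((norm (Z j))\<^sup>2)) / ?T))"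
      by (simp only: dQ)
    also have "(\<integral>\<^sup>+Z. g Z \<partial>density (PiM I (\<lambda>_. ?Z)) (\<lambda>Z. \<Prod>j\<in>I. ennreal (beta_weight b ((norm (Z j))\<^sup>2)) / ?T))
      = (\<integral>\<^sup>+Z. (\<Prod>j\<in>I. ennreal (beta_weight b ((norm (Z j))\<^sup>2)) / ?T) * g Z \<partial>PiM I (\<lambda>_. ?Z))"
      by (rule nn_integral_density) (intro borel_measurable_prod_ennreal, measurable)
    also have "\<dots> = (\<integral>\<^sup>+Z. inverse ?T ^ card I * ((\<Prod>j\<in>I. ennreal (beta_weight b ((norm (Z j))\<^sup>2))) * g Z) \<partial>PiM I (\<lambda>_. ?Z))"
      by (simp add: divide_ennreal_def prod.distrib mult_ac)
    also have "\<dots> = inverse ?T ^ card I * (\<integral>\<^sup>+Z. (\<Prod>j\<in>I. ennreal (beta_weight b ((norm (Z j))\<^sup>2))) * g Z \<partial>PiM I (\<lambda>_. ?Z))"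
      by (rule nn_integral_cmult) (intro borel_measurable_times_ennreal borel_measurable_prod_ennreal, measurable)
    also have "(\<integral>\<^sup>+Z. (\<Prod>j\<in>I. ennreal (beta_weight b ((norm (Z j))\<^sup>2))) * g Z \<partial>PiM I (\<lambda>_. ?Z)) = lifted_integral b k TYPE('d)"
      unfolding lifted_integral_def g_def f0_def W_def I_def by simp
    also have "inverse ?T ^ card I * lifted_integral b k TYPE('d) = lifted_integral b k TYPE('d) / ?T ^ (CARD('d) + 1)"
      unfolding I1(4) by (simp only: divide_ennreal_def ennreal_inverse_power mult.commute)
    finally show ?thesis .
  qed
  ultimately show ?thesis by simp
qed

text \<open>For \<open>k = n\<close> the cone is the whole space, so the expectation is the volume
  of the ball; this calibrates the unknown constant \<open>C\<close>. The identity is stated as a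
  product to avoid division in \<open>ennreal\<close>.\<close>

theorem expected_cone_vol:
  fixes b :: real
  defines "p \<equiv> \<lambda>n::nat. b + real n / 2"
  assumes b: "b > -1" and p: "p CARD('d::finite) \<ge> 1" and k: "1 \<le> k" "k \<le> CARD('d) + 1"
  shows "(\<integral>\<^sup>+X. cone_vol k X \<partial>PiM {1..CARD('d) + 1} (\<lambda>_. beta_dist b :: (real ^ 'd) measure)) * ennreal (Re (profile_integral (CARD('d) + 1) (CARD('d) + 1) (p CARD('d))))
     = emeasure lborel (ball (0 :: real ^ 'd) 1) * ennreal (Re (profile_integral (CARD('d) + 1) k (p CARD('d))))"
    and "0 \<le> Re (profile_integral (CARD('d) + 1) k (p CARD('d)))"
proof -
  let ?n = "CARD('d) + 1"
  let ?p = "b + real CARD('d) / 2"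
  have p': "?p \<ge> 1" using p by (simp add: p_def)
  let ?G = "std_gauss :: (((real ^ 'd) \<times> real) \<Rightarrow> real) measure"
  let ?T = "beta_weight_total b TYPE((real ^ 'd) \<times> real) ^ ?n"
  have "beta_weight_total b TYPE((real ^ 'd) \<times> real) \<noteq> 0" "beta_weight_total b TYPE((real ^ 'd) \<times> real) \<noteq> \<infinity>"
    using beta_weight_total_bounds[OF b, where 'a="(real ^ 'd) \<times> real"] by auto
  then obtain r where r: "beta_weight_total b TYPE((real ^ 'd) \<times> real) = ennreal r" "r > 0"
    by (cases "beta_weight_total b TYPE((real ^ 'd) \<times> real)") (auto simp: ennreal_eq_0_iff)
  have "?T = ennreal (r ^ ?n)" unfolding r(1) using r(2) by (intro ennreal_power less_imp_le)
  moreover have "r ^ ?n > 0" using r(2) by (rule zero_less_power)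
  ultimately have T: "?T \<noteq> 0" "?T \<noteq> \<infinity>"
    by (simp_all only: ennreal_eq_0_iff not_le ennreal_neq_top infinity_ennreal_def not_False_eq_True)
  define \<rho> where "\<rho> = (\<integral>g. 1 / norm (gauss_vec g) ^ CARD('d) \<partial>?G)"
  have dim: "CARD('d) + 1 = DIM((real ^ 'd) \<times> real)" by simp
  have \<rho>: "\<rho> > 0" unfolding \<rho>_def by (rule integral_norm_gauss_vec_pos[OF dim])
  have \<rho>i: "integrable ?G (\<lambda>g. 1 / norm (gauss_vec g) ^ CARD('d))" by (rule integrable_norm_gauss_vec[OF dim])
  have key: "lifted_integral b k TYPE('d) / ?T = ennreal (\<rho> * Re (profile_integral ?n k ?p)) \<and> 0 \<le> \<rho> * Re (profile_integral ?n k ?p)"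
    if k: "1 \<le> k" "k \<le> ?n" for k
  proof -
    obtain B where B: "\<And>e. e > 0 \<Longrightarrow> norm (profile_integral_reg TYPE('d) k ?p e) \<le> B"
      and lim: "\<And>e. (\<And>m. e m > 0) \<Longrightarrow> e \<longlonglongrightarrow> 0 \<Longrightarrow> (\<lambda>m. profile_integral_reg TYPE('d) k ?p (e m)) \<longlonglongrightarrow> profile_integral ?n k ?p"
      using profile_integral_reg_bounded[OF p' k] by metis
    have B0: "B \<ge> 0" using B[of 1] norm_ge_zero[of "profile_integral_reg TYPE('d) k ?p 1"] by linarith
    have "(0, 1) \<in> (Basis :: ((real ^ 'd) \<times> real) set)" by (simp add: Basis_prod_def)
    have ae: "AE g in ?G. norm (gauss_vec g) > 0"
      using AE_gauss_vec_inner_nonzero[OF \<open>(0, 1) \<in> (Basis :: ((real ^ 'd) \<times> real) set)\<close>] by eventually_elim auto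
    let ?f = "\<lambda>m g. profile_integral_reg TYPE('d) k ?p (inverse (real (Suc m)) / norm (gauss_vec g)) / of_real (norm (gauss_vec g) ^ CARD('d))"
    have "?p > -1" using p' by linarith
    note mT = measurable_profile_integral_reg[OF this, where 'd='d and k=k]
    have "(\<lambda>m. \<integral>g. ?f m g \<partial>?G) \<longlonglongrightarrow> (\<integral>g. profile_integral ?n k ?p * of_real (1 / norm (gauss_vec g) ^ CARD('d)) \<partial>?G)"
    proof (rule integral_dominated_convergence[where w="\<lambda>g. B * (1 / norm (gauss_vec g) ^ CARD('d))"])
      show "AE g in ?G. (\<lambda>m. ?f m g) \<longlonglongrightarrow> profile_integral ?n k ?p * of_real (1 / norm (gauss_vec g) ^ CARD('d))"
        using ae
      proof eventually_elim
        case (elim g)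
        have "(\<lambda>m. inverse (real (Suc m)) / norm (gauss_vec g)) \<longlonglongrightarrow> 0 / norm (gauss_vec g)"
          using elim by (intro tendsto_intros LIMSEQ_inverse_real_of_nat) auto
        then have "(\<lambda>m. profile_integral_reg TYPE('d) k ?p (inverse (real (Suc m)) / norm (gauss_vec g))) \<longlonglongrightarrow> profile_integral ?n k ?p"
          using elim by (intro lim) auto
        then have "(\<lambda>m. profile_integral_reg TYPE('d) k ?p (inverse (real (Suc m)) / norm (gauss_vec g)) * of_real (1 / norm (gauss_vec g) ^ CARD('d))) \<longlonglongrightarrow> profile_integral ?n k ?p * of_real (1 / norm (gauss_vec g) ^ CARD('d))"
          by (rule tendsto_mult[OF _ tendsto_const])
        then show ?case by simp
      qed
      show "AE g in ?G. norm (?f m g) \<le> B * (1 / norm (gauss_vec g) ^ CARD('d))" for m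
        using ae
      proof eventually_elim
        case (elim g)
        have "norm (profile_integral_reg TYPE('d) k ?p (inverse (real (Suc m)) / norm (gauss_vec g))) \<le> B"
          using elim by (intro B) auto
        then show ?case by (simp add: norm_divide norm_power divide_right_mono)
      qed
      show "?f m \<in> borel_measurable ?G" for m
        by (intro borel_measurable_divide measurable_compose[OF _ mT]) measurable
      show "integrable ?G (\<lambda>g. B * (1 / norm (gauss_vec g) ^ CARD('d)))" by (rule integrable_mult_right[OF \<rho>i])
      show "(\<lambda>g. profile_integral ?n k ?p * of_real (1 / norm (gauss_vec g) ^ CARD('d))) \<in> borel_measurable ?G" by measurable
    qed
    also have "(\<integral>g. profile_integral ?n k ?p * of_real (1 / norm (gauss_vec g) ^ CARD('d)) \<partial>?G) = profile_integral ?n k ?p * of_real \<rho>"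
      unfolding \<rho>_def by (subst integral_mult_right_zero, subst integral_complex_of_real) (rule refl)
    finally have "(\<lambda>m. Re (\<integral>g. ?f m g \<partial>?G)) \<longlonglongrightarrow> Re (profile_integral ?n k ?p * of_real \<rho>)" by (rule tendsto_Re)
    then have l1: "(\<lambda>m. Re (\<integral>g. ?f m g \<partial>?G)) \<longlonglongrightarrow> \<rho> * Re (profile_integral ?n k ?p)" by (simp add: mult.commute)
    have N: "lifted_integral_reg TYPE('d) b k (inverse (real (Suc m))) = ennreal (Re (\<integral>g. ?f m g \<partial>?G))" "0 \<le> Re (\<integral>g. ?f m g \<partial>?G)" for m
      using lifted_integral_reg_eq_profile_integral_reg[OF b, of "inverse (real (Suc m))" k, where 'd='d] by auto
    have "(\<lambda>m. lifted_integral_reg TYPE('d) b k (inverse (real (Suc m)))) \<longlonglongrightarrow> ennreal (\<rho> * Re (profile_integral ?n k ?p))"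
      unfolding N(1) by (rule tendsto_ennrealI[OF l1])
    from LIMSEQ_unique[OF lifted_integral_limit[OF b, where 'd='d and k=k] this]
    show ?thesis using LIMSEQ_le_const[OF l1, of 0] N(2) by auto
  qed
  obtain C where C: "\<And>k. lifted_integral b k TYPE('d) = C * (\<integral>\<^sup>+X. cone_vol k X \<partial>PiM {1..?n} (\<lambda>_. beta_dist b :: (real ^ 'd) measure))"
    using lifted_integral_eq_expected_cone_vol[OF b] by metis
  let ?E = "\<lambda>k. \<integral>\<^sup>+X. cone_vol k X \<partial>PiM {1..?n} (\<lambda>_. beta_dist b :: (real ^ 'd) measure)"
  let ?v = "emeasure lborel (ball (0 :: real ^ 'd) 1)"
  have En: "?E ?n = ?v"
  proof -
    interpret prob_space "PiM {1..?n} (\<lambda>_. beta_dist b :: (real ^ 'd) measure)"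
      using b by (intro prob_space_PiM prob_space_beta_dist) auto
    have "tcone ?n X = UNIV" for X :: "nat \<Rightarrow> real ^ 'd" using vertex_index_bounds(2)[where 'd='d] by (auto simp: tcone_def not_less[symmetric])
    then show ?thesis by (simp only: cone_vol_def Int_UNIV_right nn_integral_const emeasure_space_1 mult_1_right)
  qed
  have pos: "0 \<le> Re (profile_integral ?n k ?p)" if "1 \<le> k" "k \<le> ?n" for k
    using key[OF that] \<rho> by (simp add: zero_le_mult_iff)
  show "0 \<le> Re (profile_integral (CARD('d) + 1) k (p CARD('d)))" using pos[OF k] by (simp add: p_def)
  have NT: "lifted_integral b k TYPE('d) = ennreal (\<rho> * Re (profile_integral ?n k ?p)) * ?T" if "1 \<le> k" "k \<le> ?n" for k
    using ennreal_eq_times_of_divide_eq[OF T key[OF that, THEN conjunct1]] .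
  have a: "C * ?E k = ennreal (\<rho> * Re (profile_integral ?n k ?p)) * ?T" using NT[OF k] C by simp
  have b: "C * ?v = ennreal (\<rho> * Re (profile_integral ?n ?n ?p)) * ?T" using NT[of ?n] C[of ?n] En by simp
  have s: "ennreal (\<rho> * x) * ?T = (ennreal \<rho> * ?T) * ennreal x" for x
    using \<rho> by (simp add: ennreal_mult' mult_ac)
  \<comment> \<open>Multiplying crosswise eliminates \<open>C\<close>. What is left in common,
    \<open>ennreal \<rho> * ?T\<close>, is positive and finite and can be cancelled.\<close>
  have "?E k * (C * ?v) = ?v * (C * ?E k)" by (simp only: mult_ac)
  then have "(ennreal \<rho> * ?T) * (?E k * ennreal (Re (profile_integral ?n ?n ?p))) = (ennreal \<rho> * ?T) * (?v * ennreal (Re (profile_integral ?n k ?p)))"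
    unfolding a b s by (simp only: mult.left_commute)
  moreover have "ennreal \<rho> * ?T \<noteq> 0" "ennreal \<rho> * ?T \<noteq> top"
    using \<rho> T by (auto simp: ennreal_mult_eq_top_iff)
  ultimately have "?E k * ennreal (Re (profile_integral ?n ?n ?p)) = ?v * ennreal (Re (profile_integral ?n k ?p))"
    by (simp only: ennreal_mult_cancel_left) blast
  then show "?E k * ennreal (Re (profile_integral (CARD('d) + 1) (CARD('d) + 1) (p CARD('d)))) = ?v * ennreal (Re (profile_integral (CARD('d) + 1) k (p CARD('d))))"
    by (simp only: p_def)
qed

section \<open>Moments of the logit function\<close>

definition logit :: "real \<Rightarrow> real" where "logit t = ln t - ln (1 - t)"

text \<open>Under \<open>s = 2 * t - 1\<close> the function \<open>L\<close> becomes
  \<open>logit\<close>; adding \<open>\<i> * pi\<close> gives a branch of the logarithm of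
  \<open>t / (t - 1)\<close>.\<close>

definition logit_c :: "real \<Rightarrow> complex" where "logit_c t = of_real (logit t) + \<i> * of_real pi"

lemma borel_measurable_logit [measurable]: "logit \<in> borel_measurable borel"
  unfolding logit_def[abs_def] by measurable

lemma borel_measurable_logit_c [measurable]: "logit_c \<in> borel_measurable borel"
  unfolding logit_c_def[abs_def] by measurable

lemma exp_logit:
  assumes "0 < t" "t < 1"
  shows "exp (u * logit t) = t powr u * (1 - t) powr (- u)"
  using assms by (simp add: logit_def powr_def exp_add[symmetric] algebra_simps)

lemma has_bochner_integral_exp_logit:
  assumes "\<bar>u\<bar> < 1"
  shows "has_bochner_integral lborel (\<lambda>t. indicator {0<..<1} t * (t ^ a * exp (u * logit t))) (Beta (real a + 1 + u) (1 - u))"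
proof (rule has_bochner_integral_nn_integral)
  have eq: "ennreal (indicator {0<..<1} t * (t ^ a * exp (u * logit t)))
    = ennreal (t powr (real a + 1 + u - 1) * (1 - t) powr (1 - u - 1)) * indicator {0<..<1} t" for t :: real
    by (auto simp: indicator_def exp_logit powr_add powr_realpow)
  show "(\<integral>\<^sup>+t. ennreal (indicator {0<..<1} t * (t ^ a * exp (u * logit t))) \<partial>lborel) = ennreal (Beta (real a + 1 + u) (1 - u))"
    unfolding eq using assms by (intro nn_integral_Beta) auto
  show "0 \<le> Beta (real a + 1 + u) (1 - u)"
    unfolding Beta_def using assms by (intro divide_nonneg_pos mult_nonneg_nonneg less_imp_le[OF Gamma_real_pos] Gamma_real_pos) auto
qed (auto simp: indicator_def)

text \<open>Going from \<open>Gamma u\<close> to \<open>Gamma (a + 1 + u)\<close> costs a rising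
  factorial, and the sine absorbs \<open>Gamma u * Gamma (1 - u)\<close> by reflection. At
  \<open>u = 0\<close>, a pole of \<open>Gamma\<close>, both sides vanish.\<close>

lemma sin_times_Beta:
  assumes "\<bar>u\<bar> < 1"
  shows "sin (pi * u) * Beta (real a + 1 + u) (1 - u) = pi * pochhammer u (Suc a) / fact (Suc a)"
proof (cases "u = 0")
  case True
  then show ?thesis by (simp add: pochhammer_rec)
next
  case False
  have nz: "u \<notin> \<int>\<^sub>\<le>\<^sub>0"
  proof
    assume "u \<in> \<int>\<^sub>\<le>\<^sub>0"
    then obtain n where "u = - of_nat n" by (auto elim!: nonpos_Ints_cases')
    with assms False show False by auto
  qed
  have g: "Gamma (real a + 1 + u) = pochhammer u (Suc a) * Gamma u"
    using pochhammer_Gamma[OF nz, of "Suc a"] Gamma_eq_zero_iff[of u] nz by (simp add: field_simps add_ac)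
  have "complex_of_real (rGamma u * rGamma (1 - u)) = complex_of_real (sin (pi * u) / pi)"
    using rGamma_reflection_complex[of "complex_of_real u"]
    by (simp add: rGamma_complex_of_real[symmetric] sin_of_real[symmetric])
  then have "rGamma u * rGamma (1 - u) = sin (pi * u) / pi" by (simp only: of_real_eq_iff)
  moreover have "Gamma u \<noteq> 0" "Gamma (1 - u) \<noteq> 0"
    using nz assms Gamma_real_pos[of "1 - u"] by (auto simp: Gamma_eq_zero_iff)
  ultimately have "sin (pi * u) * (Gamma u * Gamma (1 - u)) = pi"
    by (simp add: rGamma_inverse_Gamma field_simps)
  moreover have "Gamma (real a + 1 + u + (1 - u)) = fact (Suc a)"
    using Gamma_fact[of "Suc a", where 'a=real] by (simp add: add_ac)
  ultimately show ?thesis unfolding Beta_def g by (simp add: field_simps)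
qed

lemma powser_real_eq_0:
  fixes a :: "nat \<Rightarrow> real"
  assumes r: "r > 0" and s: "\<And>u. \<bar>u\<bar> < r \<Longrightarrow> (\<lambda>n. a n * u ^ n) sums 0"
  shows "a n = 0"
proof (rule ccontr)
  assume n: "a n \<noteq> 0"
  have "a 0 = 0" using sums_unique2[OF powser_sums_zero[of a] s[of 0]] r by simp
  with n have "n > 0" by (cases n) auto
  show False
  proof (rule powser_0_nonzero[of r "0::real" a "\<lambda>_. 0" n])
    fix e :: real assume "0 < e" "\<And>z::real. z \<in> cball 0 e - {0} \<Longrightarrow> (0::real) \<noteq> 0"
    from this(1) this(2)[of e] show False by auto
  qed (use r s n \<open>n > 0\<close> in auto)
qed

text \<open>Both sides of the Beta identity are expanded at \<open>u = 0\<close>. On the integral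
  side the coefficient of \<open>u ^ j\<close> is the moment divided by \<open>fact j\<close>; on
  the other side the rising factorial has the unsigned Stirling numbers of the first kind as
  coefficients.\<close>

lemma logit_moment:
  shows integrable_logit_moment: "integrable lborel (\<lambda>t. indicator {0<..<1} t * (t ^ a * Im (logit_c t ^ j)))"
    and integral_logit_moment: "(\<integral>t. indicator {0<..<1} t * (t ^ a * Im (logit_c t ^ j)) \<partial>lborel)
      = pi * fact j * of_nat (stirling (Suc a) j) / fact (Suc a)"
proof -
  let ?i = "indicator {0<..<1} :: real \<Rightarrow> real"
  define K where "K j t = ?i t * (t ^ a * Im (logit_c t ^ j))" for j t
  define f where "f u j t = K j t * u ^ j / fact j" for u j t
  have Km [measurable]: "K j \<in> borel_measurable lborel" for j unfolding K_def[abs_def] by measurable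
  have fm [measurable]: "f u j \<in> borel_measurable lborel" for u j unfolding f_def[abs_def] by measurable
  \<comment> \<open>Majorant of all partial sums: \<open>cmod (logit_c t)\<close> is at most
    \<open>\<bar>logit t\<bar> + pi\<close>, and the two exponentials cover both signs of
    \<open>logit t\<close>. It is integrable as long as \<open>\<bar>u\<bar> < 1\<close>.\<close>
  define G where "G u t = exp (\<bar>u\<bar> * pi) * (?i t * (t ^ a * exp (u * logit t)) + ?i t * (t ^ a * exp ((- u) * logit t)))" for u t
  have Gi: "integrable lborel (G u)" if "\<bar>u\<bar> < 1" for u
  proof -
    have "integrable lborel (\<lambda>t. ?i t * (t ^ a * exp (v * logit t)))" if "\<bar>v\<bar> < 1" for v
      using has_bochner_integral_exp_logit[OF that, of a] by (rule integrable.intros)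
    from this[of u] this[of "- u"] that show ?thesis
      unfolding G_def[abs_def] by (intro integrable_mult_right Bochner_Integration.integrable_add) simp_all
  qed
  have fb: "\<bar>f u j t\<bar> \<le> ?i t * t ^ a * ((\<bar>u\<bar> * cmod (logit_c t)) ^ j / fact j)" for u j t
  proof -
    have "\<bar>Im (logit_c t ^ j)\<bar> \<le> cmod (logit_c t) ^ j" using abs_Im_le_cmod[of "logit_c t ^ j"] by (simp add: norm_power)
    then have "?i t * t ^ a * (\<bar>u\<bar> ^ j / fact j) * \<bar>Im (logit_c t ^ j)\<bar> \<le> ?i t * t ^ a * (\<bar>u\<bar> ^ j / fact j) * cmod (logit_c t) ^ j"
      by (intro mult_left_mono) (auto simp: indicator_def)
    then show ?thesis
      by (auto simp: f_def K_def indicator_def abs_mult power_abs power_mult_distrib mult_ac)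
  qed
  have es: "(\<lambda>j. ?i t * t ^ a * ((\<bar>u\<bar> * cmod (logit_c t)) ^ j / fact j)) sums (?i t * t ^ a * exp (\<bar>u\<bar> * cmod (logit_c t)))" for u t
    using sums_mult[OF exp_converges[of "\<bar>u\<bar> * cmod (logit_c t)"], of "?i t * t ^ a"] by (simp add: divide_inverse mult_ac)
  have eG: "?i t * t ^ a * exp (\<bar>u\<bar> * cmod (logit_c t)) \<le> G u t" for u t
  proof (cases "t \<in> {0<..<1}")
    case True
    have "cmod (logit_c t) \<le> \<bar>logit t\<bar> + pi"
      using cmod_le[of "logit_c t"] by (simp add: logit_c_def)
    then have "\<bar>u\<bar> * cmod (logit_c t) \<le> \<bar>u\<bar> * pi + \<bar>u * logit t\<bar>"
      using mult_left_mono[of "cmod (logit_c t)" "\<bar>logit t\<bar> + pi" "\<bar>u\<bar>"] by (simp add: abs_mult algebra_simps)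
    then have "exp (\<bar>u\<bar> * cmod (logit_c t)) \<le> exp (\<bar>u\<bar> * pi) * exp \<bar>u * logit t\<bar>"
      by (simp add: exp_add[symmetric])
    also have "exp \<bar>u * logit t\<bar> \<le> exp (u * logit t) + exp ((- u) * logit t)"
      by (auto simp: abs_if)
    finally have "exp (\<bar>u\<bar> * cmod (logit_c t)) \<le> exp (\<bar>u\<bar> * pi) * (exp (u * logit t) + exp ((- u) * logit t))" by simp
    then have "t ^ a * exp (\<bar>u\<bar> * cmod (logit_c t)) \<le> t ^ a * (exp (\<bar>u\<bar> * pi) * (exp (u * logit t) + exp ((- u) * logit t)))"
      using True by (intro mult_left_mono) auto
    then show ?thesis using True by (simp add: G_def algebra_simps)
  qed (simp add: G_def)
  have psum: "(\<Sum>j<n. \<bar>f u j t\<bar>) \<le> G u t" for u n t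
  proof -
    have "(\<Sum>j<n. \<bar>f u j t\<bar>) \<le> (\<Sum>j<n. ?i t * t ^ a * ((\<bar>u\<bar> * cmod (logit_c t)) ^ j / fact j))"
      by (intro sum_mono fb)
    also have "\<dots> \<le> (\<Sum>j. ?i t * t ^ a * ((\<bar>u\<bar> * cmod (logit_c t)) ^ j / fact j))"
      by (intro sum_le_suminf sums_summable[OF es]) (auto simp: indicator_def)
    also have "\<dots> = ?i t * t ^ a * exp (\<bar>u\<bar> * cmod (logit_c t))" by (rule sums_unique[OF es, symmetric])
    finally show ?thesis using eG[of t u] by linarith
  qed
  have fi: "integrable lborel (f u j)" if "\<bar>u\<bar> < 1" for u j
  proof (rule Bochner_Integration.integrable_bound[OF Gi[OF that]])
    have "\<bar>f u j t\<bar> \<le> (\<Sum>j<Suc j. \<bar>f u j t\<bar>)" for t by (rule member_le_sum[of j "{..<Suc j}"]) auto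
    then show "AE t in lborel. norm (f u j t) \<le> norm (G u t)" using psum[of u t "Suc j" for t]
      by (intro AE_I2) (smt (verit) real_norm_def)
  qed measurable
  have Ki: "integrable lborel (K j)" for j
  proof -
    \<comment> \<open>Integrability of the term of index \<open>j\<close> at any nonzero
      \<open>u\<close> with \<open>\<bar>u\<bar> < 1\<close> gives that of the moment;
      \<open>1/2\<close> is such a \<open>u\<close>.\<close>
    have "integrable lborel (\<lambda>t. f (1/2) j t * (fact j * 2 ^ j))" by (intro integrable_mult_left fi) auto
    then show ?thesis by (simp add: f_def power_divide)
  qed
  then show "integrable lborel (\<lambda>t. ?i t * (t ^ a * Im (logit_c t ^ j)))" unfolding K_def .
  define S where "S j = pi * of_nat (stirling (Suc a) j) / fact (Suc a)" for j
  have main: "(\<lambda>j. (integral\<^sup>L lborel (K j) / fact j - S j) * u ^ j) sums 0" if u: "\<bar>u\<bar> < 1" for u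
  proof -
    have s1: "(\<lambda>j. f u j t) sums (sin (pi * u) * (?i t * (t ^ a * exp (u * logit t))))" for t
    proof -
      have "(\<lambda>j. Im ((of_real u * logit_c t) ^ j /\<^sub>R fact j)) sums Im (exp (of_real u * logit_c t))"
        by (intro sums_Im exp_converges)
      moreover have "Im (exp (of_real u * logit_c t)) = exp (u * logit t) * sin (pi * u)"
        by (simp add: Im_exp logit_c_def mult.commute)
      moreover have "Im ((of_real u * logit_c t) ^ j /\<^sub>R fact j) = Im (logit_c t ^ j) * u ^ j / fact j" for j
        by (simp add: power_mult_distrib divide_inverse flip: of_real_power)
      ultimately have "(\<lambda>j. Im (logit_c t ^ j) * u ^ j / fact j) sums (exp (u * logit t) * sin (pi * u))" by simp
      from sums_mult[OF this, of "?i t * t ^ a"] show ?thesis by (simp add: f_def K_def mult_ac)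
    qed
    have "(\<lambda>j. integral\<^sup>L lborel (f u j)) sums (\<integral>t. (\<Sum>j. f u j t) \<partial>lborel)"
    proof (rule sums_integral)
      show "integrable lborel (f u j)" for j by (rule fi[OF u])
      show "AE t in lborel. summable (\<lambda>j. norm (f u j t))"
      proof (rule AE_I2)
        fix t show "summable (\<lambda>j. norm (f u j t))"
          by (rule summable_comparison_test'[OF sums_summable[OF es[of t u]], of 0]) (use fb in auto)
      qed
      show "summable (\<lambda>j. \<integral>t. norm (f u j t) \<partial>lborel)"
      proof (rule bounded_imp_summable)
        fix n
        have "(\<Sum>j\<le>n. \<integral>t. norm (f u j t) \<partial>lborel) = (\<integral>t. (\<Sum>j\<le>n. norm (f u j t)) \<partial>lborel)"
          by (rule Bochner_Integration.integral_sum[symmetric]) (intro integrable_norm fi[OF u])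
        also have "\<dots> \<le> (\<integral>t. G u t \<partial>lborel)"
          using psum[of u _ "Suc n"] by (intro integral_mono Gi[OF u] Bochner_Integration.integrable_sum integrable_norm fi[OF u]) (simp add: lessThan_Suc_atMost)
        finally show "(\<Sum>j\<le>n. \<integral>t. norm (f u j t) \<partial>lborel) \<le> (\<integral>t. G u t \<partial>lborel)" .
      qed simp
    qed
    also have "(\<integral>t. (\<Sum>j. f u j t) \<partial>lborel) = (\<integral>t. sin (pi * u) * (?i t * (t ^ a * exp (u * logit t))) \<partial>lborel)"
      by (simp only: sums_unique[OF s1, symmetric])
    also have "\<dots> = sin (pi * u) * Beta (real a + 1 + u) (1 - u)"
      by (subst integral_mult_right_zero) (simp only: has_bochner_integral_integral_eq[OF has_bochner_integral_exp_logit[OF u]])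
    also have "\<dots> = (\<Sum>j\<le>Suc a. S j * u ^ j)"
      unfolding sin_times_Beta[OF u] stirling_pochhammer[symmetric] S_def
      unfolding sum_distrib_left sum_divide_distrib by (rule sum.cong[OF refl]) (simp only: times_divide_eq_left times_divide_eq_right mult_ac)
    finally have "(\<lambda>j. integral\<^sup>L lborel (f u j)) sums (\<Sum>j\<le>Suc a. S j * u ^ j)" .
    moreover have "integral\<^sup>L lborel (f u j) = integral\<^sup>L lborel (K j) / fact j * u ^ j" for j
      unfolding f_def[abs_def] by simp
    moreover have "(\<lambda>j. S j * u ^ j) sums (\<Sum>j\<le>Suc a. S j * u ^ j)"
      by (rule sums_finite) (auto simp: S_def not_le)
    ultimately show ?thesis using sums_diff by (fastforce simp: left_diff_distrib)
  qed
  have "integral\<^sup>L lborel (K j) / fact j - S j = 0"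
    by (rule powser_real_eq_0[of 1]) (use main in auto)
  then have "integral\<^sup>L lborel (K j) = S j * fact j" by (simp add: field_simps)
  then show "(\<integral>t. ?i t * (t ^ a * Im (logit_c t ^ j)) \<partial>lborel) = pi * fact j * of_nat (stirling (Suc a) j) / fact (Suc a)"
    unfolding K_def[abs_def] S_def by (simp only: times_divide_eq_left times_divide_eq_right mult_ac)
qed

section \<open>The profile without its normalising constant\<close>

definition bump :: "real \<Rightarrow> real \<Rightarrow> real" where "bump p s = beta_weight p (s\<^sup>2)"

definition bump_pv :: "real \<Rightarrow> real \<Rightarrow> real" where
  "bump_pv p s = (\<integral>u. indicator {-2..2} u * ((bump p (s + u) - bump p s) / u) \<partial>lborel)"

definition bump_bdry :: "real \<Rightarrow> real \<Rightarrow> complex" where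
  "bump_bdry p s = of_real (pi * bump p s) + \<i> * of_real (bump_pv p s)"

text \<open>Of the \<open>k\<close> powers of \<open>bump\<close>, one is the density at vertex
  \<open>1\<close> and \<open>k - 1\<close> come from the edges inside the face.\<close>

definition bump_integral :: "nat \<Rightarrow> nat \<Rightarrow> real \<Rightarrow> real" where
  "bump_integral k m p = (\<integral>s. bump p s ^ k * Re (bump_bdry p s ^ m) \<partial>lborel)"

lemma bump_nonneg [simp]: "0 \<le> bump p s" by (simp add: bump_def)

lemma bump_eq_0: "1 \<le> \<bar>s\<bar> \<Longrightarrow> bump p s = 0"
  using one_le_power[of "\<bar>s\<bar>" 2] by (simp add: bump_def beta_weight_ge_1)

lemma bump_le_1: "0 \<le> p \<Longrightarrow> bump p s \<le> 1"
  by (auto simp: bump_def beta_weight_def intro: powr_le1)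

lemma borel_measurable_bump [measurable]: "bump p \<in> borel_measurable borel"
  unfolding bump_def[abs_def] by measurable

lemma bump_lipschitz: "p \<ge> 1 \<Longrightarrow> \<bar>bump p x - bump p y\<bar> \<le> 2 * p * \<bar>x - y\<bar>"
  unfolding bump_def by (rule beta_weight_lipschitz)

lemma bump_quotient_bound: "p \<ge> 1 \<Longrightarrow> \<bar>indicator {-2..2} u * ((bump p (s + u) - bump p s) / u)\<bar> \<le> indicator {-2..2} u * (2 * p)"
  using bump_lipschitz[of p "s + u" s] by (auto simp: indicator_def divide_le_eq)

lemma bump_quotient_integrable:
  assumes "p \<ge> 1"
  shows "integrable lborel (\<lambda>u. indicator {-2..2} u * ((bump p (s + u) - bump p s) / u))"
proof (rule Bochner_Integration.integrable_bound)
  show "integrable lborel (\<lambda>u::real. indicator {-2..2} u * (2 * p))" by simp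
  show "AE u in lborel. norm (indicator {-2..2} u * ((bump p (s + u) - bump p s) / u)) \<le> norm (indicator {-2..2} u * (2 * p))"
    using bump_quotient_bound[OF assms] by (intro AE_I2) (metis abs_ge_self order_trans real_norm_def)
qed measurable

lemma bump_pv_bound:
  assumes "p \<ge> 1" shows "\<bar>bump_pv p s\<bar> \<le> 8 * p"
proof -
  have "norm (bump_pv p s) \<le> (\<integral>u. norm (indicator {-2..2} u * ((bump p (s + u) - bump p s) / u)) \<partial>lborel)"
    unfolding bump_pv_def by (rule integral_norm_bound)
  also have "\<dots> \<le> (\<integral>u. indicator {-2..2::real} u * (2 * p) \<partial>lborel)"
    using bump_quotient_bound[OF assms] by (intro integral_mono integrable_norm bump_quotient_integrable[OF assms]) auto
  also have "\<dots> = 8 * p" by simp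
  finally show ?thesis by simp
qed

lemma borel_measurable_bump_pv [measurable]: "bump_pv p \<in> borel_measurable borel"
proof -
  have "(\<lambda>x. indicator {-2..2} (snd x) * ((bump p (fst x + snd x) - bump p (fst x)) / snd x)) \<in> borel_measurable (borel \<Otimes>\<^sub>M lborel)"
    by measurable
  then show ?thesis unfolding bump_pv_def[abs_def]
    by (intro lborel.borel_measurable_lebesgue_integral) (simp add: case_prod_beta)
qed

lemma borel_measurable_bump_bdry [measurable]: "bump_bdry p \<in> borel_measurable borel"
  unfolding bump_bdry_def[abs_def] by measurable

lemma bump_bdry_bound:
  assumes "p \<ge> 1" shows "norm (bump_bdry p s) \<le> pi + 8 * p"
proof -
  have "norm (bump_bdry p s) \<le> \<bar>pi * bump p s\<bar> + \<bar>bump_pv p s\<bar>"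
    using cmod_le[of "bump_bdry p s"] by (simp add: bump_bdry_def)
  also have "\<dots> \<le> pi * 1 + 8 * p"
    using assms bump_pv_bound[OF assms, of s] bump_le_1[of p s] by (intro add_mono) (auto simp: abs_mult)
  finally show ?thesis by simp
qed

lemma bump_power_bdry_bound:
  assumes p: "p \<ge> 1" and k: "k \<ge> 1"
  shows "norm (of_real (bump p s ^ k) * bump_bdry p s ^ m) \<le> indicator {-1..1} s * (pi + 8 * p) ^ m"
proof (cases "\<bar>s\<bar> \<le> 1")
  case True
  have "bump p s ^ k * norm (bump_bdry p s) ^ m \<le> 1 * (pi + 8 * p) ^ m"
    using p bump_le_1[of p s] by (intro mult_mono power_mono bump_bdry_bound power_le_one) auto
  with True show ?thesis by (simp add: norm_mult norm_power abs_le_iff indicator_def)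
next
  case False
  then show ?thesis using bump_eq_0[of s p] k p by (simp add: power_0_left indicator_def)
qed

text \<open>The integrand is homogeneous of degree \<open>n\<close> in the profile: one density,
  \<open>k - 1\<close> real factors and \<open>n - k\<close> complex ones. The power of the
  normalising constant is therefore the same for every \<open>k\<close> and cancels in
  quotients.\<close>

lemma Re_profile_integral:
  assumes p: "p \<ge> 1" and k: "1 \<le> k" "k \<le> n"
  shows "Re (profile_integral n k p) = (2 * pi) ^ (k - 1) / enn2real (beta_weight_total p TYPE(real)) ^ n * bump_integral k (n - k) p"
proof -
  define T where "T = enn2real (beta_weight_total p TYPE(real))"
  interpret lipschitz_profile "profile p" "2 * p / T" unfolding T_def by (rule profile_lipschitz[OF p])
  have prof: "profile p s = bump p s / T" for s by (simp add: profile_def bump_def T_def)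
  have pv: "pv s = bump_pv p s / T" for s
  proof -
    have "pv s = (\<integral>u. indicator {-2..2} u * ((bump p (s + u) - bump p s) / u) / T \<partial>lborel)"
      unfolding pv_def prof by (simp add: diff_divide_distrib algebra_simps)
    then show ?thesis unfolding bump_pv_def by (simp only: integral_divide_zero)
  qed
  have pm: "pv \<in> borel_measurable borel" unfolding pv[abs_def] by measurable
  have prm: "profile p \<in> borel_measurable borel" unfolding prof[abs_def] by measurable
  define c :: complex where "c = of_real ((2 * pi) ^ (k - 1) / T ^ n)"
  have "profile_integral n k p = (\<integral>s. profile p s *\<^sub>R (of_real (2 * pi * profile p s) ^ (k - 1) *
      (of_real (pi * profile p s) + \<i> * of_real (pv s)) ^ (n - k)) \<partial>lborel)"
    unfolding profile_integral_def using p by (subst ball_beta_real) (auto intro!: integral_density borel_measurable_times borel_measurable_power borel_measurable_add measurable_compose[OF _ borel_measurable_of_real] pm prm)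
  also have "\<dots> = (\<integral>s. c * (of_real (bump p s ^ k) * bump_bdry p s ^ (n - k)) \<partial>lborel)"
  proof (rule Bochner_Integration.integral_cong[OF refl])
    fix s
    have "of_real (pi * profile p s) + \<i> * of_real (pv s) = bump_bdry p s / of_real T"
      unfolding prof pv bump_bdry_def by (simp add: add_divide_distrib)
    moreover have "profile p s * (2 * pi * profile p s) ^ (k - 1) = (2 * pi) ^ (k - 1) / T ^ k * bump p s ^ k"
      using k(1) unfolding prof by (cases k) (auto simp: power_mult_distrib power_divide)
    moreover have "T ^ n = T ^ k * T ^ (n - k)" using k by (simp flip: power_add)
    ultimately show "profile p s *\<^sub>R (of_real (2 * pi * profile p s) ^ (k - 1) * (of_real (pi * profile p s) + \<i> * of_real (pv s)) ^ (n - k))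
      = c * (of_real (bump p s ^ k) * bump_bdry p s ^ (n - k))"
      unfolding c_def scaleR_conv_of_real mult.assoc[symmetric] of_real_power[symmetric] of_real_mult[symmetric]
      by (simp add: power_divide)
  qed
  also have "\<dots> = c * (\<integral>s. of_real (bump p s ^ k) * bump_bdry p s ^ (n - k) \<partial>lborel)" by (rule integral_mult_right_zero)
  finally have "Re (profile_integral n k p) = (2 * pi) ^ (k - 1) / T ^ n * Re (\<integral>s. of_real (bump p s ^ k) * bump_bdry p s ^ (n - k) \<partial>lborel)"
    by (simp add: c_def del: of_real_power of_real_divide of_real_mult)
  also have "Re (\<integral>s. of_real (bump p s ^ k) * bump_bdry p s ^ (n - k) \<partial>lborel) = bump_integral k (n - k) p"
  proof -
    have "integrable lborel (\<lambda>s. of_real (bump p s ^ k) * bump_bdry p s ^ (n - k))"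
    proof (rule Bochner_Integration.integrable_bound)
      show "integrable lborel (\<lambda>s::real. indicator {-1..1} s * (pi + 8 * p) ^ (n - k))" by simp
      show "AE s in lborel. norm (of_real (bump p s ^ k) * bump_bdry p s ^ (n - k)) \<le> norm (indicator {-1..1} s * (pi + 8 * p) ^ (n - k))"
        using bump_power_bdry_bound[OF p k(1), of _ "n - k"] by (intro AE_I2) (metis abs_ge_self order_trans real_norm_def)
    qed measurable
    from integral_Re[OF this] show ?thesis unfolding bump_integral_def
      by (simp del: of_real_power)
  qed
  finally show ?thesis unfolding T_def .
qed

lemma bump_integral_0_pos:
  assumes p: "p \<ge> 1" and k: "k \<ge> 1"
  shows "bump_integral k 0 p > 0"
proof -
  have i: "integrable lborel (\<lambda>s. bump p s ^ k)"
  proof (rule Bochner_Integration.integrable_bound)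
    show "integrable lborel (\<lambda>s::real. indicator {-1..1} s * (1::real))" by simp
    show "AE s in lborel. norm (bump p s ^ k) \<le> norm (indicator {-1..1} s * (1::real))"
      using bump_power_bdry_bound[OF p k, of _ 0] by (simp add: norm_power)
  qed measurable
  have "\<not> (AE s in lborel. bump p s ^ k = 0)"
  proof
    assume "AE s in lborel. bump p s ^ k = 0"
    then have "AE s in lborel. s \<notin> {-1<..<1::real}"
    proof eventually_elim
      case (elim s)
      have "bump p s \<noteq> 0" if "s \<in> {-1<..<1}"
        using that by (auto simp: bump_def beta_weight_def abs_square_less_1 square_eq_1_iff power2_eq_1_iff)
      with elim k show ?case by auto
    qed
    then have "{-1<..<1::real} \<in> null_sets lborel" by (subst AE_iff_null_sets) auto
    then have "emeasure lborel {-1<..<1::real} = 0" by (rule null_setsD1)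
    then show False by simp
  qed
  then have "0 < (\<integral>s. bump p s ^ k \<partial>lborel)"
    using integral_nonneg_eq_0_iff_AE[OF i] by (subst less_le) (auto intro!: integral_nonneg_AE)
  then show ?thesis by (simp add: bump_integral_def)
qed

section \<open>Polynomial functions with rational coefficients\<close>

definition rat_coeffs :: "real poly \<Rightarrow> bool" where
  "rat_coeffs q \<longleftrightarrow> (\<forall>i. coeff q i \<in> \<rat>)"

definition rat_poly_fun :: "(real \<Rightarrow> real) \<Rightarrow> bool" where
  "rat_poly_fun f \<longleftrightarrow> (\<exists>q. rat_coeffs q \<and> f = poly q)"

lemma sum_in_Rats: "(\<And>i. i \<in> A \<Longrightarrow> f i \<in> \<rat>) \<Longrightarrow> sum f A \<in> \<rat>" for f :: "'a \<Rightarrow> real"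
  by (induction A rule: infinite_finite_induct) auto

lemma rat_coeffs_mult: "rat_coeffs p \<Longrightarrow> rat_coeffs q \<Longrightarrow> rat_coeffs (p * q)"
  by (auto simp: rat_coeffs_def coeff_mult intro!: sum_in_Rats Rats_mult)

lemma rat_coeffs_pCons: "c \<in> \<rat> \<Longrightarrow> rat_coeffs p \<Longrightarrow> rat_coeffs (pCons c p)"
  by (auto simp: rat_coeffs_def coeff_pCons split: nat.split)

lemma rat_coeffs_0: "rat_coeffs 0"
  by (simp add: rat_coeffs_def)

lemma rat_coeffs_power: "rat_coeffs p \<Longrightarrow> rat_coeffs (p ^ n)"
  by (induction n) (simp add: rat_coeffs_def coeff_pCons split: nat.split, simp only: power_Suc rat_coeffs_mult)

lemma rat_poly_fun_const: "c \<in> \<rat> \<Longrightarrow> rat_poly_fun (\<lambda>_. c)"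
  unfolding rat_poly_fun_def by (intro exI[of _ "[:c:]"]) (auto intro: rat_coeffs_pCons rat_coeffs_0)

lemma rat_poly_fun_id: "rat_poly_fun (\<lambda>t. t)"
  unfolding rat_poly_fun_def by (intro exI[of _ "[:0, 1:]"]) (auto intro!: rat_coeffs_pCons rat_coeffs_0)

lemma rat_poly_fun_add: "rat_poly_fun f \<Longrightarrow> rat_poly_fun g \<Longrightarrow> rat_poly_fun (\<lambda>t. f t + g t)"
  unfolding rat_poly_fun_def
proof (elim exE conjE)
  fix p q assume "rat_coeffs p" "f = poly p" "rat_coeffs q" "g = poly q"
  then show "\<exists>r. rat_coeffs r \<and> (\<lambda>t. f t + g t) = poly r"
    by (intro exI[of _ "p + q"]) (auto simp: rat_coeffs_def)
qed

lemma rat_poly_fun_mult: "rat_poly_fun f \<Longrightarrow> rat_poly_fun g \<Longrightarrow> rat_poly_fun (\<lambda>t. f t * g t)"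
  unfolding rat_poly_fun_def
proof (elim exE conjE)
  fix p q assume "rat_coeffs p" "f = poly p" "rat_coeffs q" "g = poly q"
  then show "\<exists>r. rat_coeffs r \<and> (\<lambda>t. f t * g t) = poly r"
    by (intro exI[of _ "p * q"]) (auto simp: rat_coeffs_mult)
qed

lemma rat_poly_fun_diff: "rat_poly_fun f \<Longrightarrow> rat_poly_fun g \<Longrightarrow> rat_poly_fun (\<lambda>t. f t - g t)"
  using rat_poly_fun_add[of f "\<lambda>t. - 1 * g t"] rat_poly_fun_mult[OF rat_poly_fun_const[of "-1"], of g] by simp

lemma rat_poly_fun_power: "rat_poly_fun f \<Longrightarrow> rat_poly_fun (\<lambda>t. f t ^ n)"
  by (induction n) (auto intro: rat_poly_fun_mult rat_poly_fun_const)

lemma rat_poly_fun_sum: "(\<And>i. i \<in> A \<Longrightarrow> rat_poly_fun (f i)) \<Longrightarrow> rat_poly_fun (\<lambda>t. \<Sum>i\<in>A. f i t)"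
  by (induction A rule: infinite_finite_induct) (auto intro: rat_poly_fun_add rat_poly_fun_const)

lemmas rat_poly_fun_intros = rat_poly_fun_const rat_poly_fun_id rat_poly_fun_add rat_poly_fun_mult rat_poly_fun_diff
  rat_poly_fun_power rat_poly_fun_sum

lemma logit_moment_rat_poly:
  assumes "rat_poly_fun g"
  obtains q where "q \<in> \<rat>"
    "has_bochner_integral lborel (\<lambda>t. indicator {0<..<1} t * (g t * Im (logit_c t ^ j))) (pi * q)"
proof -
  obtain r where r: "\<And>i. coeff r i \<in> \<rat>" "g = poly r"
    using assms by (auto simp: rat_poly_fun_def rat_coeffs_def)
  define q where "q = (\<Sum>i\<le>degree r. coeff r i * (fact j * of_nat (stirling (Suc i) j) / fact (Suc i)))"
  have "fact n \<in> (\<rat> :: real set)" for n by (metis of_nat_fact Rats_of_nat)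
  then have "q \<in> \<rat>" unfolding q_def by (intro sum_in_Rats Rats_mult Rats_divide r) auto
  moreover have "has_bochner_integral lborel (\<lambda>t. indicator {0<..<1} t * (t ^ a * Im (logit_c t ^ j)))
      (pi * (fact j * of_nat (stirling (Suc a) j) / fact (Suc a)))" for a
    using has_bochner_integral_integrable[OF integrable_logit_moment[of a j]] unfolding integral_logit_moment by (simp add: mult.assoc)
  then have "has_bochner_integral lborel (\<lambda>t. \<Sum>i\<le>degree r. coeff r i * (indicator {0<..<1} t * (t ^ i * Im (logit_c t ^ j))))
     (\<Sum>i\<le>degree r. coeff r i * (pi * (fact j * of_nat (stirling (Suc i) j) / fact (Suc i))))"
    by (intro has_bochner_integral_sum has_bochner_integral_mult_right)
  moreover have "(\<Sum>i\<le>degree r. coeff r i * (indicator {0<..<1} t * (t ^ i * Im (logit_c t ^ j))))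
     = indicator {0<..<1} t * (g t * Im (logit_c t ^ j))" for t
    unfolding r(2) poly_altdef by (simp add: sum_distrib_left sum_distrib_right mult_ac)
  moreover have "(\<Sum>i\<le>degree r. coeff r i * (pi * (fact j * of_nat (stirling (Suc i) j) / fact (Suc i)))) = pi * q"
    unfolding q_def sum_distrib_left by (intro sum.cong refl) (simp only: mult.left_commute)
  ultimately show ?thesis using that by simp
qed

text \<open>Binomial expansion leaves real polynomial coefficients in front of the powers of
  \<open>logit_c\<close>. Taking imaginary parts is linear over the reals, so each term is a moment
  already known to be a rational multiple of \<pi>.\<close>

lemma integral_Im_power_rat:
  assumes g: "rat_poly_fun g" and w: "rat_poly_fun w" and R: "rat_poly_fun R"
  obtains q where "q \<in> \<rat>"
    "has_bochner_integral lborel (\<lambda>t. indicator {0<..<1} t * (g t * Im ((of_real (w t) * logit_c t - of_real (R t)) ^ m))) (pi * q)"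
proof -
  define h where "h j t = g t * (of_nat (m choose j) * w t ^ j * (- 1 * R t) ^ (m - j))" for j t
  have "rat_poly_fun (h j)" for j unfolding h_def[abs_def]
    using g w R by (intro rat_poly_fun_intros) auto
  then have "\<exists>q. q \<in> \<rat> \<and> has_bochner_integral lborel (\<lambda>t. indicator {0<..<1} t * (h j t * Im (logit_c t ^ j))) (pi * q)" for j
    by (rule logit_moment_rat_poly) auto
  then obtain q where q: "\<And>j. q j \<in> \<rat>"
    "\<And>j. has_bochner_integral lborel (\<lambda>t. indicator {0<..<1} t * (h j t * Im (logit_c t ^ j))) (pi * q j)" by metis
  have "has_bochner_integral lborel (\<lambda>t. \<Sum>j\<le>m. indicator {0<..<1} t * (h j t * Im (logit_c t ^ j))) (\<Sum>j\<le>m. pi * q j)"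
    by (intro has_bochner_integral_sum q)
  moreover have "(\<Sum>j\<le>m. indicator {0<..<1} t * (h j t * Im (logit_c t ^ j)))
      = indicator {0<..<1} t * (g t * Im ((of_real (w t) * logit_c t - of_real (R t)) ^ m))" for t
  proof -
    have "(of_real (w t) * logit_c t - of_real (R t)) ^ m
      = (\<Sum>j\<le>m. of_real (of_nat (m choose j) * w t ^ j * (- 1 * R t) ^ (m - j)) * logit_c t ^ j)"
      using binomial_ring[of "of_real (w t) * logit_c t" "- of_real (R t)" m]
      by (simp add: power_mult_distrib mult_ac)
    then show ?thesis unfolding h_def
      by (simp add: sum_distrib_left mult.assoc del: of_real_mult of_real_power)
  qed
  ultimately have "has_bochner_integral lborel (\<lambda>t. indicator {0<..<1} t * (g t * Im ((of_real (w t) * logit_c t - of_real (R t)) ^ m))) (pi * (\<Sum>j\<le>m. q j))"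
    by (simp add: sum_distrib_left)
  then show ?thesis using q(1) by (intro that[of "\<Sum>j\<le>m. q j"] sum_in_Rats)
qed

section \<open>Integer exponents\<close>

definition bump_poly :: "nat \<Rightarrow> real poly" where "bump_poly N = [:1, 0, -1:] ^ N"

lemma bump_nat: "\<bar>s\<bar> < 1 \<Longrightarrow> bump (real N) s = poly (bump_poly N) s"
  using abs_square_less_1[of s] by (simp add: bump_def beta_weight_def bump_poly_def powr_realpow) (simp add: power2_eq_square)

lemma rat_coeffs_bump_poly: "rat_coeffs (bump_poly N)"
  unfolding bump_poly_def by (intro rat_coeffs_power rat_coeffs_pCons rat_coeffs_0) auto

text \<open>The integral over \<open>[-1, 1]\<close> of the divided difference of \<^term>\<open>bump_poly N\<close> at \<open>s\<close>.\<close>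

definition bump_rem :: "nat \<Rightarrow> real \<Rightarrow> real" where
  "bump_rem N s = (\<Sum>j\<le>degree (bump_poly N). \<Sum>i<j. coeff (bump_poly N) j * s ^ (j - Suc i) * ((1 - (- 1) ^ Suc i) / real (Suc i)))"

text \<open>While \<open>s + u\<close> stays in \<open>[-1, 1]\<close> the difference quotient is a
  polynomial. On the rest of \<open>[-2, 2]\<close> only \<open>- bump (real N) s / u\<close> is
  left, and its two logarithmic integrals combine so that \<open>ln 2\<close>, the trace of the
  cut-off, cancels.\<close>

lemma bump_pv_nat:
  assumes N: "N \<ge> 1" and s: "\<bar>s\<bar> < 1"
  shows "bump_pv (real N) s = bump_rem N s - bump (real N) s * (ln (1 + s) - ln (1 - s))"
proof -
  define P where "P = bump_poly N"
  let ?W = "bump (real N)"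
  have p: "has_bochner_integral lborel (\<lambda>u. indicator {-1-s..1-s} u *\<^sub>R (s + u) ^ i) ((1 - (- 1) ^ Suc i) / real (Suc i))" for i
  proof -
    have "has_bochner_integral lborel (\<lambda>u. indicator {-1-s..1-s} u *\<^sub>R (s + u) ^ i)
       ((s + (1 - s)) ^ Suc i / real (Suc i) - (s + (-1 - s)) ^ Suc i / real (Suc i))"
    proof (rule has_bochner_integral_FTC_Icc)
      show "((\<lambda>u. (s + u) ^ Suc i / real (Suc i)) has_vector_derivative (s + u) ^ i) (at u within {-1-s..1-s})" for u
        unfolding has_real_derivative_iff_has_vector_derivative[symmetric]
        by (auto intro!: derivative_eq_intros simp del: of_nat_Suc power_Suc)
    qed (auto intro!: continuous_intros)
    then show ?thesis by (simp add: diff_divide_distrib del: power_Suc of_nat_Suc)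
  qed
  have l1: "has_bochner_integral lborel (\<lambda>u. indicator {1-s..2} u *\<^sub>R (1 / u)) (ln 2 - ln (1 - s))"
  proof (rule has_bochner_integral_FTC_Icc)
    show "(ln has_vector_derivative 1 / u) (at u within {1-s..2})" if "1 - s \<le> u" "u \<le> 2" for u
      unfolding has_real_derivative_iff_has_vector_derivative[symmetric]
      using that s by (auto intro!: derivative_eq_intros)
  qed (use s in \<open>auto intro!: continuous_intros\<close>)
  have l2: "has_bochner_integral lborel (\<lambda>u. indicator {-2..-1-s} u *\<^sub>R (1 / u)) (ln (- (-1 - s)) - ln (- (-2)))"
  proof (rule has_bochner_integral_FTC_Icc[where F="\<lambda>u. ln (- u)"])
    show "((\<lambda>u. ln (- u)) has_vector_derivative 1 / u) (at u within {-2..-1-s})" if "-2 \<le> u" "u \<le> -1-s" for u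
      unfolding has_real_derivative_iff_has_vector_derivative[symmetric]
      using that s by (auto intro!: derivative_eq_intros)
  qed (use s in \<open>auto intro!: continuous_intros\<close>)
  let ?g = "\<lambda>u. (\<Sum>j\<le>degree P. \<Sum>i<j. coeff P j * s ^ (j - Suc i) * (indicator {-1-s..1-s} u *\<^sub>R (s + u) ^ i))
      + ((- ?W s) * (indicator {1-s..2} u *\<^sub>R (1 / u)) + (- ?W s) * (indicator {-2..-1-s} u *\<^sub>R (1 / u)))"
  have "has_bochner_integral lborel ?g ((\<Sum>j\<le>degree P. \<Sum>i<j. coeff P j * s ^ (j - Suc i) * ((1 - (- 1) ^ Suc i) / real (Suc i)))
      + ((- ?W s) * (ln 2 - ln (1 - s)) + (- ?W s) * (ln (- (-1 - s)) - ln (- (-2)))))"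
    by (intro has_bochner_integral_add has_bochner_integral_sum has_bochner_integral_mult_right p l1 l2)
  also have "(\<Sum>j\<le>degree P. \<Sum>i<j. coeff P j * s ^ (j - Suc i) * ((1 - (- 1) ^ Suc i) / real (Suc i))) = bump_rem N s"
    unfolding bump_rem_def P_def ..
  finally have g: "integral\<^sup>L lborel ?g = bump_rem N s - ?W s * (ln (1 + s) - ln (1 - s))" 
    and gi: "integrable lborel ?g"
    by (auto simp: has_bochner_integral_iff algebra_simps)
  have "bump_pv (real N) s = integral\<^sup>L lborel ?g"
    unfolding bump_pv_def
  proof (rule integral_cong_AE)
    show "AE u in lborel. indicator {-2..2} u * ((?W (s + u) - ?W s) / u) = ?g u"
      using AE_lborel_singleton[of "0::real"] AE_lborel_singleton[of "1 - s"] AE_lborel_singleton[of "- 1 - s"]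
    proof eventually_elim
      case (elim u)
      consider "- 1 - s < u" "u < 1 - s" | "1 - s < u" | "u < - 1 - s" using elim by linarith
      then show ?case
      proof cases
        case 1
        have "(s + u) ^ j - s ^ j = u * (\<Sum>i<j. s ^ (j - Suc i) * (s + u) ^ i)" for j
          using power_diff_sumr2[of "s + u" j s] by simp
        then have "poly P (s + u) - poly P s = u * (\<Sum>j\<le>degree P. \<Sum>i<j. coeff P j * s ^ (j - Suc i) * (s + u) ^ i)"
          unfolding poly_altdef sum_subtractf[symmetric] right_diff_distrib[symmetric]
          by (simp add: sum_distrib_left mult_ac)
        moreover have "\<bar>s + u\<bar> < 1" using 1 by linarith
        ultimately have "?W (s + u) - ?W s = u * (\<Sum>j\<le>degree P. \<Sum>i<j. coeff P j * s ^ (j - Suc i) * (s + u) ^ i)"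
          using s by (simp add: bump_nat P_def)
        moreover have "- 2 \<le> u" "u \<le> 2" using 1 s by linarith+
        ultimately show ?thesis using 1 elim by (simp add: indicator_def)
      next
        case 2
        then have "?W (s + u) = 0" using s by (intro bump_eq_0) auto
        then show ?thesis using 2 s by (auto simp: indicator_def)
      next
        case 3
        then have "?W (s + u) = 0" using s by (intro bump_eq_0) auto
        then show ?thesis using 3 s by (auto simp: indicator_def)
      qed
    qed
    show "?g \<in> borel_measurable lborel" using gi by auto
  qed measurable
  then show ?thesis unfolding g .
qed

text \<open>With \<open>t = (1 + s) / 2\<close> the boundary value is \<open>- \<i>\<close> times
  \<open>w * logit_c - R\<close>. An odd power of \<open>- \<i>\<close> is again plus or minus \<i>,
  so the real part of the power is, up to sign, the imaginary part controlled by the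
  moments.\<close>

theorem bump_integral_nat_odd:
  assumes N: "N \<ge> 1" and m: "odd m" and k: "k \<ge> 1"
  obtains q where "q \<in> \<rat>" "bump_integral k m (real N) = pi * q"
proof -
  define w where "w t = poly (bump_poly N) (2 * t - 1)" for t
  define R where "R t = bump_rem N (2 * t - 1)" for t
  have lin: "rat_poly_fun (\<lambda>t. 2 * t - 1)" by (intro rat_poly_fun_intros) auto
  have coeff: "coeff (bump_poly N) i \<in> \<rat>" for i using rat_coeffs_bump_poly[of N] by (simp add: rat_coeffs_def)
  have w: "rat_poly_fun w" unfolding w_def[abs_def] poly_altdef
    by (intro rat_poly_fun_sum rat_poly_fun_mult rat_poly_fun_power rat_poly_fun_const lin coeff)
  have R: "rat_poly_fun R" unfolding R_def[abs_def] bump_rem_def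
    by (intro rat_poly_fun_sum rat_poly_fun_mult rat_poly_fun_power rat_poly_fun_const lin coeff) auto
  obtain q where q: "q \<in> \<rat>" "has_bochner_integral lborel (\<lambda>t. indicator {0<..<1} t * (w t ^ k * Im ((of_real (w t) * logit_c t - of_real (R t)) ^ m))) (pi * q)"
    by (rule integral_Im_power_rat[OF rat_poly_fun_power[OF w] w R])
  obtain l where l: "m = 2 * l + 1" using m by (elim oddE)
  have im: "(- \<i>) ^ m = of_real ((- 1) ^ l) * (- \<i>)" unfolding l by (simp add: power_mult)
  have eq: "bump (real N) (2 * t - 1) ^ k * Re (bump_bdry (real N) (2 * t - 1) ^ m)
     = (- 1) ^ l * (indicator {0<..<1} t * (w t ^ k * Im ((of_real (w t) * logit_c t - of_real (R t)) ^ m)))" for t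
  proof (cases "0 < t \<and> t < 1")
    case True
    let ?s = "2 * t - 1"
    have s: "\<bar>?s\<bar> < 1" using True by auto
    have W: "bump (real N) ?s = w t" unfolding w_def by (rule bump_nat[OF s])
    have "ln (1 + ?s) - ln (1 - ?s) = logit t"
    proof -
      have "ln (1 + ?s) = ln 2 + ln t" "ln (1 - ?s) = ln 2 + ln (1 - t)"
        using True ln_mult[of 2 t] ln_mult[of 2 "1 - t"] by (simp_all add: algebra_simps)
      then show ?thesis by (simp add: logit_def)
    qed
    then have pv: "bump_pv (real N) ?s = R t - w t * logit t"
      unfolding bump_pv_nat[OF N s] W R_def by simp
    have "bump_bdry (real N) ?s = - \<i> * (of_real (w t) * logit_c t - of_real (R t))"
      unfolding bump_bdry_def W pv logit_c_def by (simp add: algebra_simps)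
    then have "bump_bdry (real N) ?s ^ m = of_real ((- 1) ^ l) * ((- \<i>) * (of_real (w t) * logit_c t - of_real (R t)) ^ m)"
      by (simp only: power_mult_distrib im mult.assoc)
    then have "Re (bump_bdry (real N) ?s ^ m) = (- 1) ^ l * Im ((of_real (w t) * logit_c t - of_real (R t)) ^ m)"
      by (simp del: of_real_power of_real_minus of_real_mult)
    then show ?thesis using True W by simp
  next
    case False
    then have "1 \<le> \<bar>2 * t - 1\<bar>" by auto
    then have "bump (real N) (2 * t - 1) = 0" by (rule bump_eq_0)
    then show ?thesis using False k by (auto simp: indicator_def power_0_left)
  qed
  have "bump_integral k m (real N) = 2 * (\<integral>t. bump (real N) (2 * t - 1) ^ k * Re (bump_bdry (real N) (2 * t - 1) ^ m) \<partial>lborel)"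
    unfolding bump_integral_def
    by (subst lborel_integral_real_affine[where c=2 and t="-1"]) (auto simp: algebra_simps)
  also have "\<dots> = pi * (2 * ((- 1) ^ l * q))"
    unfolding eq using has_bochner_integral_integral_eq[OF q(2)] by simp
  finally show ?thesis using q(1) by (intro that[of "2 * ((- 1) ^ l * q)"]) auto
qed

theorem bump_integral_nat_0:
  assumes k: "k \<ge> 1"
  shows "bump_integral k 0 (real N) \<in> \<rat>"
proof -
  let ?P = "bump_poly N ^ k"
  have "rat_coeffs ?P" by (intro rat_coeffs_power rat_coeffs_bump_poly)
  then have c: "coeff ?P i \<in> \<rat>" for i by (simp add: rat_coeffs_def)
  have p: "has_bochner_integral lborel (\<lambda>s. indicator {-1..1} s *\<^sub>R s ^ i) (1 ^ Suc i / real (Suc i) - (- 1) ^ Suc i / real (Suc i))" for i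
  proof (rule has_bochner_integral_FTC_Icc)
    show "((\<lambda>s. s ^ Suc i / real (Suc i)) has_vector_derivative s ^ i) (at s within {-1..1})" for s
      unfolding has_real_derivative_iff_has_vector_derivative[symmetric]
      by (auto intro!: derivative_eq_intros simp del: of_nat_Suc power_Suc)
  qed (auto intro!: continuous_intros)
  have "has_bochner_integral lborel (\<lambda>s. \<Sum>i\<le>degree ?P. coeff ?P i * (indicator {-1..1} s *\<^sub>R s ^ i))
      (\<Sum>i\<le>degree ?P. coeff ?P i * (1 ^ Suc i / real (Suc i) - (- 1) ^ Suc i / real (Suc i)))"
    by (intro has_bochner_integral_sum has_bochner_integral_mult_right p)
  from has_bochner_integral_integral_eq[OF this]
  have "(\<integral>s. (\<Sum>i\<le>degree ?P. coeff ?P i * (indicator {-1..1} s *\<^sub>R s ^ i)) \<partial>lborel) \<in> \<rat>"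
    by (simp only:) (intro sum_in_Rats Rats_mult Rats_diff Rats_divide c Rats_power Rats_of_nat, auto)
  moreover have "bump_integral k 0 (real N) = (\<integral>s. (\<Sum>i\<le>degree ?P. coeff ?P i * (indicator {-1..1} s *\<^sub>R s ^ i)) \<partial>lborel)"
    unfolding bump_integral_def
  proof (rule integral_cong_AE)
    show "AE s in lborel. bump (real N) s ^ k * Re (bump_bdry (real N) s ^ 0) = (\<Sum>i\<le>degree ?P. coeff ?P i * (indicator {-1..1} s *\<^sub>R s ^ i))"
      using AE_lborel_singleton[of "1::real"] AE_lborel_singleton[of "-1::real"]
    proof eventually_elim
      case (elim s)
      have "(\<Sum>i\<le>degree ?P. coeff ?P i * (indicator {-1..1} s *\<^sub>R s ^ i)) = indicator {-1..1} s * poly ?P s"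
        unfolding poly_altdef by (simp add: sum_distrib_left mult_ac)
      moreover have "bump (real N) s ^ k = indicator {-1..1} s * poly ?P s"
      proof (cases "\<bar>s\<bar> < 1")
        case True then show ?thesis by (simp add: bump_nat poly_power indicator_def abs_less_iff)
      next
        case False
        then have "bump (real N) s = 0" "\<not> (-1 \<le> s \<and> s \<le> 1)" using elim by (auto intro!: bump_eq_0)
        then show ?thesis using k by (simp add: indicator_def power_0_left)
      qed
      ultimately show ?case by simp
    qed
  qed (measurable, (intro borel_measurable_sum borel_measurable_times borel_measurable_scaleR, auto)?)
  ultimately show ?thesis by simp
qed

section \<open>The uniform distribution on the sphere as a limit\<close>

lemma nn_integral_lborel_scaleR:
  fixes g :: "'a::euclidean_space \<Rightarrow> ennreal"
  assumes [measurable]: "g \<in> borel_measurable borel" and c: "c > 0"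
  shows "(\<integral>\<^sup>+x. g x \<partial>lborel) = ennreal (c ^ DIM('a)) * (\<integral>\<^sup>+x. g (c *\<^sub>R x) \<partial>lborel)"
  using c by (subst lborel_affine[of c 0]) (simp_all add: nn_integral_density nn_integral_distr nn_integral_cmult)

lemma nn_integral_powr_tail:
  assumes a: "a > 0" and c: "c > 0"
  shows "(\<integral>\<^sup>+r. ennreal (r powr (- a - 1)) * indicator {c<..} r \<partial>lborel) = ennreal (c powr (- a) / a)"
proof -
  have "(\<integral>\<^sup>+r. ennreal (r powr (- a - 1)) * indicator {c<..} r \<partial>lborel) = (\<integral>\<^sup>+r. ennreal (r powr (- a - 1)) * indicator {c..} r \<partial>lborel)"
    by (intro nn_integral_cong_AE) (use AE_lborel_singleton[of c] in \<open>eventually_elim, auto simp: indicator_def\<close>)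
  also have "\<dots> = ennreal (0 - (- (c powr (- a) / a)))"
  proof (rule nn_integral_FTC_atLeast)
    show "((\<lambda>r. - (r powr (- a) / a)) has_real_derivative r powr (- a - 1)) (at r)" if "c \<le> r" for r
      using that a c by (auto intro!: derivative_eq_intros)
    have "((\<lambda>r. r powr (- a)) \<longlongrightarrow> 0) at_top" using a by (intro tendsto_neg_powr filterlim_ident) auto
    then have "((\<lambda>r. - (r powr (- a) / a)) \<longlongrightarrow> - (0 / a)) at_top" using a by (intro tendsto_intros) auto
    then show "((\<lambda>r. - (r powr (- a) / a)) \<longlongrightarrow> 0) at_top" by simp
  qed auto
  finally show ?thesis by simp
qed

text \<open>Polar coordinates with \<open>t = \<parallel>x\<parallel>\<^sup>2\<close>, the direction being that of a uniform point of the ball: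
  the substitution \<open>t = r \<parallel>x\<parallel>\<^sup>2\<close> reduces this to scaling and Fubini.\<close>

lemma nn_integral_polar:
  fixes g :: "'a::euclidean_space \<Rightarrow> ennreal"
  assumes [measurable]: "g \<in> borel_measurable borel"
  defines "a \<equiv> real DIM('a) / 2"
  shows "(\<integral>\<^sup>+x. g x \<partial>lborel) =
    (\<integral>\<^sup>+x. indicator (ball 0 1) x * (\<integral>\<^sup>+t. ennreal (a * t powr (a - 1)) * indicator {0<..} t * g (sqrt t *\<^sub>R (x /\<^sub>R norm x)) \<partial>lborel) \<partial>lborel)"
proof -
  have a: "a > 0" by (simp add: a_def)
  have [measurable]: "ball (0::'a) 1 \<in> sets borel" by simp
  have pw: "x powr (2 * a) = x ^ DIM('a)" if "x > 0" for x
    using that by (simp add: a_def powr_realpow)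
  define H where "H r y = indicator {y. norm y ^ 2 < r} y * ennreal ((norm y) powr (2 * a)) * g y" for r and y :: 'a
  have [measurable]: "(\<lambda>x. H (fst x) (snd x)) \<in> borel_measurable (lborel \<Otimes>\<^sub>M lborel)"
  proof -
    have "(\<lambda>x. (if norm (snd x) ^ 2 < fst x then 1 else 0) * ennreal ((norm (snd x)) powr (2 * a)) * g (snd x)) \<in> borel_measurable (lborel \<Otimes>\<^sub>M lborel)"
      by measurable
    then show ?thesis unfolding H_def by (simp add: indicator_def)
  qed
  let ?J = "\<lambda>r x. ennreal (a * r powr (a - 1)) * indicator {0<..} r * (indicator (ball 0 1) x * ennreal (norm x powr (2 * a)) * g (sqrt r *\<^sub>R x))"
  have inner: "indicator (ball 0 1) x * (\<integral>\<^sup>+t. ennreal (a * t powr (a - 1)) * indicator {0<..} t * g (sqrt t *\<^sub>R (x /\<^sub>R norm x)) \<partial>lborel)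
     = (\<integral>\<^sup>+r. ?J r x \<partial>lborel)" if "x \<noteq> 0" for x
  proof -
    have n: "norm x > 0" using that by simp
    have "(\<integral>\<^sup>+t. ennreal (a * t powr (a - 1)) * indicator {0<..} t * g (sqrt t *\<^sub>R (x /\<^sub>R norm x)) \<partial>lborel)
      = ennreal ((norm x)\<^sup>2) * (\<integral>\<^sup>+r. ennreal (a * (0 + (norm x)\<^sup>2 * r) powr (a - 1)) * indicator {0<..} (0 + (norm x)\<^sup>2 * r) * g (sqrt (0 + (norm x)\<^sup>2 * r) *\<^sub>R (x /\<^sub>R norm x)) \<partial>lborel)"
      using n by (subst nn_integral_real_affine[where c="(norm x)\<^sup>2" and t=0]) auto
    also have "\<dots> = (\<integral>\<^sup>+r. ennreal ((norm x)\<^sup>2) * (ennreal (a * (0 + (norm x)\<^sup>2 * r) powr (a - 1)) * indicator {0<..} (0 + (norm x)\<^sup>2 * r) * g (sqrt (0 + (norm x)\<^sup>2 * r) *\<^sub>R (x /\<^sub>R norm x))) \<partial>lborel)"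
      by (rule nn_integral_cmult[symmetric]) measurable
    also have "\<dots> = (\<integral>\<^sup>+r. ennreal (a * r powr (a - 1)) * indicator {0<..} r * (ennreal (norm x powr (2 * a)) * g (sqrt r *\<^sub>R x)) \<partial>lborel)"
    proof (rule nn_integral_cong)
      fix r :: real
      show "ennreal ((norm x)\<^sup>2) * (ennreal (a * (0 + (norm x)\<^sup>2 * r) powr (a - 1)) * indicator {0<..} (0 + (norm x)\<^sup>2 * r) * g (sqrt (0 + (norm x)\<^sup>2 * r) *\<^sub>R (x /\<^sub>R norm x)))
        = ennreal (a * r powr (a - 1)) * indicator {0<..} r * (ennreal (norm x powr (2 * a)) * g (sqrt r *\<^sub>R x))"
      proof (cases "r > 0")
        case True
        have "(norm x)\<^sup>2 * ((norm x)\<^sup>2 * r) powr (a - 1) = r powr (a - 1) * norm x powr (2 * a)"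
          using n True by (simp add: powr_mult powr_powr[symmetric] powr_diff flip: powr_numeral)
        then have e: "ennreal ((norm x)\<^sup>2) * ennreal (a * ((norm x)\<^sup>2 * r) powr (a - 1)) = ennreal (a * r powr (a - 1)) * ennreal (norm x powr (2 * a))"
          using a by (simp add: ennreal_mult'[symmetric] mult_ac)
        have "sqrt ((norm x)\<^sup>2 * r) *\<^sub>R (x /\<^sub>R norm x) = sqrt r *\<^sub>R x" using n by (simp add: real_sqrt_mult)
        then show ?thesis using True n e by (simp add: mult.assoc[symmetric])
      qed (use n in \<open>simp add: indicator_def zero_less_mult_iff\<close>)
    qed
    finally show ?thesis
      by (cases "x \<in> ball 0 1") (simp_all add: mult_ac)
  qed
  have "(\<integral>\<^sup>+x. indicator (ball 0 1) x * (\<integral>\<^sup>+t. ennreal (a * t powr (a - 1)) * indicator {0<..} t * g (sqrt t *\<^sub>R (x /\<^sub>R norm x)) \<partial>lborel) \<partial>lborel)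
     = (\<integral>\<^sup>+x. \<integral>\<^sup>+r. ?J r x \<partial>lborel \<partial>lborel)"
  proof (rule nn_integral_cong_AE)
    show "AE x in lborel. indicator (ball 0 1) x * (\<integral>\<^sup>+t. ennreal (a * t powr (a - 1)) * indicator {0<..} t * g (sqrt t *\<^sub>R (x /\<^sub>R norm x)) \<partial>lborel) = (\<integral>\<^sup>+r. ?J r x \<partial>lborel)"
      using AE_lborel_singleton[of "0::'a"] by eventually_elim (rule inner)
  qed
  also have "\<dots> = (\<integral>\<^sup>+r. \<integral>\<^sup>+x. ?J r x \<partial>lborel \<partial>lborel)"
    by (rule lborel_pair.Fubini') measurable
  also have "\<dots> = (\<integral>\<^sup>+r. \<integral>\<^sup>+y. ennreal (a * r powr (- a - 1)) * indicator {0<..} r * H r y \<partial>lborel \<partial>lborel)"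
  proof (rule nn_integral_cong)
    fix r :: real
    show "(\<integral>\<^sup>+x. ?J r x \<partial>lborel) = (\<integral>\<^sup>+y. ennreal (a * r powr (- a - 1)) * indicator {0<..} r * H r y \<partial>lborel)"
    proof (cases "r > 0")
      case True
      have [measurable]: "H r \<in> borel_measurable borel" unfolding H_def[abs_def] by measurable
      have sq: "sqrt r ^ DIM('a) = r powr a" using True pw[of "sqrt r"] by (simp add: powr_half_sqrt[symmetric] powr_powr)
      have eq: "indicator (ball 0 1) x * ennreal (norm x powr (2 * a)) * g (sqrt r *\<^sub>R x) = ennreal (r powr (- a)) * H r (sqrt r *\<^sub>R x)" for x
      proof -
        have "(norm (sqrt r *\<^sub>R x))\<^sup>2 < r \<longleftrightarrow> norm x < 1"
          using True by (simp add: power_mult_distrib abs_square_less_1)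
        moreover have "norm (sqrt r *\<^sub>R x) powr (2 * a) = r powr a * norm x powr (2 * a)"
          using True by (simp add: powr_mult powr_half_sqrt[symmetric] powr_powr)
        moreover have "r powr (- a) * (r powr a * norm x powr (2 * a)) = norm x powr (2 * a)"
          using True by (simp add: powr_minus)
        then have "ennreal (r powr (- a)) * ennreal (r powr a * norm x powr (2 * a)) = ennreal (norm x powr (2 * a))"
          by (simp only: ennreal_mult'[symmetric] powr_ge_zero)
        ultimately show ?thesis unfolding H_def
          by (auto simp: indicator_def mult.assoc[symmetric])
      qed
      have "(\<integral>\<^sup>+x. ?J r x \<partial>lborel) = (\<integral>\<^sup>+x. ennreal (a * r powr (a - 1)) * (ennreal (r powr (- a)) * H r (sqrt r *\<^sub>R x)) \<partial>lborel)"
        using True unfolding eq by simp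
      also have "\<dots> = ennreal (a * r powr (a - 1)) * (ennreal (r powr (- a)) * (\<integral>\<^sup>+x. H r (sqrt r *\<^sub>R x) \<partial>lborel))"
        by (simp add: nn_integral_cmult)
      also have "\<dots> = ennreal (a * r powr (- a - 1)) * (ennreal (r powr a) * (\<integral>\<^sup>+x. H r (sqrt r *\<^sub>R x) \<partial>lborel))"
      proof -
        have "(a * r powr (a - 1)) * r powr (- a) = (a * r powr (- a - 1)) * r powr a"
          using True by (simp add: powr_add[symmetric] mult.assoc)
        then have "ennreal (a * r powr (a - 1)) * ennreal (r powr (- a)) = ennreal (a * r powr (- a - 1)) * ennreal (r powr a)"
          using a by (simp add: ennreal_mult'[symmetric])
        then show ?thesis by (simp add: mult.assoc[symmetric])
      qed
      also have "ennreal (r powr a) * (\<integral>\<^sup>+x. H r (sqrt r *\<^sub>R x) \<partial>lborel) = (\<integral>\<^sup>+y. H r y \<partial>lborel)"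
        using nn_integral_lborel_scaleR[of "H r" "sqrt r"] True by (simp add: sq)
      finally show ?thesis using True by (simp add: nn_integral_cmult)
    qed simp
  qed
  also have "\<dots> = (\<integral>\<^sup>+y. \<integral>\<^sup>+r. ennreal (a * r powr (- a - 1)) * indicator {0<..} r * H r y \<partial>lborel \<partial>lborel)"
    by (rule lborel_pair.Fubini'[symmetric]) measurable
  also have "\<dots> = (\<integral>\<^sup>+y. g y \<partial>lborel)"
  proof (rule nn_integral_cong_AE)
    show "AE y in lborel. (\<integral>\<^sup>+r. ennreal (a * r powr (- a - 1)) * indicator {0<..} r * H r y \<partial>lborel) = g y"
      using AE_lborel_singleton[of "0::'a"]
    proof eventually_elim
      case (elim y)
      have n: "norm y > 0" using elim by simp
      then have c: "(norm y)\<^sup>2 > 0" by simp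
      have "(\<integral>\<^sup>+r. ennreal (a * r powr (- a - 1)) * indicator {0<..} r * H r y \<partial>lborel)
        = (\<integral>\<^sup>+r. (ennreal a * ennreal (norm y powr (2 * a)) * g y) * (ennreal (r powr (- a - 1)) * indicator {(norm y)\<^sup>2<..} r) \<partial>lborel)"
      proof (rule nn_integral_cong)
        fix r :: real
        show "ennreal (a * r powr (- a - 1)) * indicator {0<..} r * H r y = (ennreal a * ennreal (norm y powr (2 * a)) * g y) * (ennreal (r powr (- a - 1)) * indicator {(norm y)\<^sup>2<..} r)"
        proof (cases "(norm y)\<^sup>2 < r")
          case True
          then have "r > 0" using c by linarith
          then show ?thesis using True a by (simp add: H_def ennreal_mult mult_ac)
        qed (simp add: H_def)
      qed
      also have "\<dots> = (ennreal a * ennreal (norm y powr (2 * a)) * g y) * ennreal (((norm y)\<^sup>2) powr (- a) / a)"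
        by (subst nn_integral_cmult) (simp_all add: nn_integral_powr_tail[OF a c])
      also have "\<dots> = ennreal (a * norm y powr (2 * a) * (((norm y)\<^sup>2) powr (- a) / a)) * g y"
      proof -
        have "ennreal a * ennreal (norm y powr (2 * a)) * ennreal (((norm y)\<^sup>2) powr (- a) / a) = ennreal (a * norm y powr (2 * a) * (((norm y)\<^sup>2) powr (- a) / a))"
          by (simp only: ennreal_mult'[symmetric] less_imp_le[OF a] mult_nonneg_nonneg powr_ge_zero)
        then show ?thesis by (subst mult.assoc, subst mult.commute[of "g y"], subst mult.assoc[symmetric]) simp
      qed
      also have "a * norm y powr (2 * a) * (((norm y)\<^sup>2) powr (- a) / a) = 1"
        using a n by (simp add: powr_powr powr_add[symmetric] flip: powr_numeral)
      finally show ?case by simp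
    qed
  qed
  finally show ?thesis ..
qed

text \<open>One probability space for all parameters: a point of the ball supplies the direction, a
  uniform variable the radius. This coupling turns convergence of laws into pointwise
  convergence.\<close>

definition ball_unit_interval :: "((real ^ 'd::finite) \<times> real) measure" where
  "ball_unit_interval = uniform_measure lborel (ball 0 1) \<Otimes>\<^sub>M uniform_measure lborel {0<..<1}"

text \<open>For \<open>b = 1 / q - 1\<close> the law of the squared norm \<open>t\<close> has the
  singular factor \<open>(1 - t) powr (1 / q - 1)\<close>. Substituting \<open>1 - t = s ^ q\<close>
  removes it, and for \<open>0 < s < 1\<close> the radius tends to \<open>1\<close> as
  \<open>q\<close> grows.\<close>

definition shell :: "nat \<Rightarrow> (real ^ 'd::finite) \<times> real \<Rightarrow> real ^ 'd" where
  "shell q x = sqrt (1 - snd x ^ q) *\<^sub>R (fst x /\<^sub>R norm (fst x))"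

lemma sets_ball_unit_interval [simp, measurable_cong]: "sets ball_unit_interval = sets (borel \<Otimes>\<^sub>M borel)"
  unfolding ball_unit_interval_def by (rule sets_pair_measure_cong) auto

lemma prob_space_uniform_ball: "prob_space (uniform_measure lborel (ball (0 :: real ^ 'd::finite) 1))"
proof -
  have "unit_ball_vol (real CARD('d)) \<noteq> 0" using unit_ball_vol_pos[of "real CARD('d)", OF of_nat_0_le_iff] by linarith
  then show ?thesis by (intro prob_space_uniform_measure) (auto simp: emeasure_ball)
qed

lemma prob_space_uniform_unit_interval: "prob_space (uniform_measure lborel {0<..<1::real})"
  by (rule prob_space_uniform_measure) auto

lemma prob_space_ball_unit_interval: "prob_space (ball_unit_interval :: ((real ^ 'd::finite) \<times> real) measure)"
proof -
  interpret A: prob_space "uniform_measure lborel (ball (0 :: real ^ 'd) 1)" by (rule prob_space_uniform_ball)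
  interpret B: prob_space "uniform_measure lborel {0<..<1::real}" by (rule prob_space_uniform_unit_interval)
  interpret pair_prob_space "uniform_measure lborel (ball (0 :: real ^ 'd) 1)" "uniform_measure lborel {0<..<1::real}" ..
  show ?thesis unfolding ball_unit_interval_def by (rule prob_space_axioms)
qed

lemma measurable_shell [measurable]: "shell q \<in> measurable (borel \<Otimes>\<^sub>M borel) borel"
  unfolding shell_def[abs_def] by measurable

text \<open>In the substitution \<open>1 - t = s ^ q\<close> the derivative cancels the singular
  power exactly and leaves the constant \<open>q\<close>.\<close>

lemma nn_integral_one_minus_power:
  assumes [measurable]: "\<phi> \<in> borel_measurable borel" and q: "q \<ge> 1"
  shows "(\<integral>\<^sup>+t. indicator {0<..<1} t * ennreal ((1 - t) powr (1 / real q - 1)) * \<phi> t \<partial>lborel)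
    = ennreal (real q) * (\<integral>\<^sup>+s. indicator {0<..<1} s * \<phi> (1 - s ^ q) \<partial>lborel)"
proof -
  let ?f = "\<lambda>u. ennreal (u powr (1 / real q - 1)) * \<phi> (1 - u)"
  have "(\<integral>\<^sup>+t. indicator {0<..<1} t * ennreal ((1 - t) powr (1 / real q - 1)) * \<phi> t \<partial>lborel)
    = (\<integral>\<^sup>+u. indicator {0<..<1} (1 - u) * ennreal ((1 - (1 - u)) powr (1 / real q - 1)) * \<phi> (1 - u) \<partial>lborel)"
    by (subst nn_integral_real_affine[where c="-1" and t=1]) auto
  also have "\<dots> = (\<integral>\<^sup>+u. ?f u * indicator {0 ^ q..1 ^ q} u \<partial>lborel)"
    by (intro nn_integral_cong_AE) (use AE_lborel_singleton[of "0::real"] AE_lborel_singleton[of "1::real"] in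
       \<open>eventually_elim, use q in \<open>auto simp: indicator_def mult_ac power_0_left\<close>\<close>)
  also have "\<dots> = (\<integral>\<^sup>+s. ?f (s ^ q) * ennreal (real q * s ^ (q - 1)) * indicator {0..1} s \<partial>lborel)"
    by (rule nn_integral_substitution_aux) (auto intro!: derivative_eq_intros continuous_intros)
  also have "\<dots> = (\<integral>\<^sup>+s. ennreal (real q) * (indicator {0<..<1} s * \<phi> (1 - s ^ q)) \<partial>lborel)"
  proof (rule nn_integral_cong_AE)
    show "AE s in lborel. ?f (s ^ q) * ennreal (real q * s ^ (q - 1)) * indicator {0..1} s = ennreal (real q) * (indicator {0<..<1} s * \<phi> (1 - s ^ q))"
      using AE_lborel_singleton[of "0::real"] AE_lborel_singleton[of "1::real"]
    proof eventually_elim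
      case (elim s)
      show ?case
      proof (cases "0 < s \<and> s < 1")
        case True
        have "(s ^ q) powr (1 / real q - 1) * (real q * s ^ (q - 1)) = real q"
          using True q by (simp add: powr_realpow[symmetric] powr_powr powr_add[symmetric] algebra_simps of_nat_diff)
        then have "ennreal ((s ^ q) powr (1 / real q - 1)) * ennreal (real q * s ^ (q - 1)) = ennreal (real q)"
          using True by (simp add: ennreal_mult'[symmetric])
        then have "\<phi> (1 - s ^ q) * (ennreal ((s ^ q) powr (1 / real q - 1)) * ennreal (real q * s ^ (q - 1))) = ennreal (real q) * \<phi> (1 - s ^ q)"
          by (simp only: mult.commute)
        then show ?thesis using True by (simp add: mult_ac)
      qed (use elim in \<open>auto simp: indicator_def\<close>)
    qed
  qed
  also have "\<dots> = ennreal (real q) * (\<integral>\<^sup>+s. indicator {0<..<1} s * \<phi> (1 - s ^ q) \<partial>lborel)"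
    by (rule nn_integral_cmult) measurable
  finally show ?thesis .
qed

lemma nn_integral_ball_unit_interval:
  assumes [measurable]: "h \<in> borel_measurable (borel \<Otimes>\<^sub>M borel)"
  shows "(\<integral>\<^sup>+x. h x \<partial>(ball_unit_interval :: ((real ^ 'd::finite) \<times> real) measure))
    = (\<integral>\<^sup>+x. indicator (ball 0 1) x * (\<integral>\<^sup>+s. indicator {0<..<1} s * h (x, s) \<partial>lborel) \<partial>lborel) / emeasure lborel (ball (0 :: real ^ 'd) 1)"
proof -
  let ?A = "uniform_measure lborel (ball (0 :: real ^ 'd) 1)" and ?B = "uniform_measure lborel {0<..<1::real}"
  interpret B: prob_space ?B by (rule prob_space_uniform_unit_interval)
  have "sets (?A \<Otimes>\<^sub>M ?B) = sets (borel \<Otimes>\<^sub>M borel)" by (rule sets_pair_measure_cong) auto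
  then have hm: "h \<in> borel_measurable (?A \<Otimes>\<^sub>M ?B)" by (simp cong: measurable_cong_sets)
  have "(\<integral>\<^sup>+x. h x \<partial>(ball_unit_interval :: ((real ^ 'd) \<times> real) measure)) = (\<integral>\<^sup>+x. \<integral>\<^sup>+s. h (x, s) \<partial>?B \<partial>?A)"
    unfolding ball_unit_interval_def by (rule B.nn_integral_fst[OF hm, symmetric])
  also have "\<dots> = (\<integral>\<^sup>+x. \<integral>\<^sup>+s. indicator {0<..<1} s * h (x, s) \<partial>lborel \<partial>?A)"
    using mult_divide_eq_ennreal[of "1::ennreal"] by (intro nn_integral_cong, subst nn_integral_uniform_measure) (simp_all add: mult.commute)
  also have "\<dots> = (\<integral>\<^sup>+x. indicator (ball 0 1) x * (\<integral>\<^sup>+s. indicator {0<..<1} s * h (x, s) \<partial>lborel) \<partial>lborel) / emeasure lborel (ball (0 :: real ^ 'd) 1)"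
    by (subst nn_integral_uniform_measure) (simp_all add: mult.commute)
  finally show ?thesis .
qed

text \<open>Polar coordinates contribute \<open>t powr (d / 2 - 1)\<close> with
  \<open>t = 1 - s ^ q\<close>, which stays behind as a density. All constants are collected in
  \<open>C\<close>; in the limit they are recovered from the total mass.\<close>

lemma beta_dist_shell:
  assumes q: "q \<ge> 1"
  obtains C where "C > 0" "(beta_dist (1 / real q - 1) :: (real ^ 'd::finite) measure)
    = distr (density ball_unit_interval (\<lambda>x. ennreal (C * (1 - snd x ^ q) powr (real CARD('d) / 2 - 1)))) borel (shell q)"
proof -
  define b where "b = 1 / real q - 1"
  define a where "a = real CARD('d) / 2"
  define v where "v = measure lborel (ball (0 :: real ^ 'd) 1)"
  have [measurable]: "ball (0 :: real ^ 'd) 1 \<in> sets borel" by simp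
  have b: "b > -1" using q by (simp add: b_def)
  have a: "a > 0" by (simp add: a_def)
  have fb: "emeasure lborel (ball (0 :: real ^ 'd) 1) < \<infinity>" by (simp add: emeasure_ball)
  have v: "emeasure lborel (ball (0 :: real ^ 'd) 1) = ennreal v" unfolding v_def
    using fb by (intro emeasure_eq_ennreal_measure) auto
  have "v > 0" unfolding v_def by (simp add: content_ball_pos)
  define c where "c = beta_const CARD('d) b"
  have c: "c > 0" unfolding c_def using b by (intro beta_const_pos) auto
  define K where "K = c * a * real q"
  have K: "K > 0" unfolding K_def using c a q by simp
  have key: "(\<integral>\<^sup>+x. g x \<partial>(beta_dist b :: (real ^ 'd) measure))
     = (\<integral>\<^sup>+x. ennreal (K * v * (1 - snd x ^ q) powr (a - 1)) * g (shell q x) \<partial>ball_unit_interval)"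
    if [measurable]: "g \<in> borel_measurable borel" for g
  proof -
    let ?w = "\<lambda>x::real ^ 'd. ennreal (c * (1 - (norm x)\<^sup>2) powr b * indicator (ball 0 1) x)"
    let ?J = "\<lambda>x. \<integral>\<^sup>+s. indicator {0<..<1} s * (ennreal ((1 - s ^ q) powr (a - 1)) * g (shell q (x, s))) \<partial>lborel"
    have "(\<integral>\<^sup>+x. g x \<partial>(beta_dist b :: (real ^ 'd) measure)) = (\<integral>\<^sup>+x. ?w x * g x \<partial>lborel)"
    proof -
      have eq: "(beta_dist b :: (real ^ 'd) measure) = density lborel ?w" using b by (simp add: beta_dist_def c_def)
      show ?thesis unfolding eq by (rule nn_integral_density) measurable
    qed
    also have "\<dots> = (\<integral>\<^sup>+x. indicator (ball 0 1) x * (\<integral>\<^sup>+t. ennreal (a * t powr (a - 1)) * indicator {0<..} t * (?w (sqrt t *\<^sub>R (x /\<^sub>R norm x)) * g (sqrt t *\<^sub>R (x /\<^sub>R norm x))) \<partial>lborel) \<partial>lborel)"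
      unfolding a_def by (subst nn_integral_polar) simp_all
    also have "\<dots> = (\<integral>\<^sup>+x. indicator (ball 0 1) x * (ennreal K * ?J x) \<partial>lborel)"
    proof (rule nn_integral_cong_AE)
      show "AE x in lborel. indicator (ball 0 1) x * (\<integral>\<^sup>+t. ennreal (a * t powr (a - 1)) * indicator {0<..} t * (?w (sqrt t *\<^sub>R (x /\<^sub>R norm x)) * g (sqrt t *\<^sub>R (x /\<^sub>R norm x))) \<partial>lborel)
        = indicator (ball 0 1) x * (ennreal K * ?J x)"
        using AE_lborel_singleton[of "0 :: real ^ 'd"]
      proof eventually_elim
        case (elim x)
        define \<phi> where "\<phi> t = ennreal (t powr (a - 1)) * g (sqrt t *\<^sub>R (x /\<^sub>R norm x))" for t
        have [measurable]: "\<phi> \<in> borel_measurable borel" unfolding \<phi>_def[abs_def] by measurable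
        have "ennreal (a * t powr (a - 1)) * indicator {0<..} t * (?w (sqrt t *\<^sub>R (x /\<^sub>R norm x)) * g (sqrt t *\<^sub>R (x /\<^sub>R norm x)))
          = ennreal (c * a) * (indicator {0<..<1} t * ennreal ((1 - t) powr (1 / real q - 1)) * \<phi> t)" for t
        proof (cases "0 < t \<and> t < 1")
          case True
          define y where "y = sqrt t *\<^sub>R (x /\<^sub>R norm x)"
          have "norm y = sqrt t" unfolding y_def using elim True by simp
          then have "?w y = ennreal (c * (1 - t) powr b)" using True by simp
          then have "?w (sqrt t *\<^sub>R (x /\<^sub>R norm x)) = ennreal (c * (1 - t) powr b)" unfolding y_def .
          then show ?thesis using True a c unfolding \<phi>_def b_def
            by (simp add: ennreal_mult mult_ac)
        next
          case False
          then consider "t \<le> 0" | "1 \<le> t" by linarith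
          then show ?thesis
          proof cases
            case 2
            define y where "y = sqrt t *\<^sub>R (x /\<^sub>R norm x)"
            have "norm y = sqrt t" unfolding y_def using elim 2 by simp
            then have "?w y = 0" using 2 by simp
            then have "?w (sqrt t *\<^sub>R (x /\<^sub>R norm x)) = 0" unfolding y_def .
            then show ?thesis using 2 by simp
          qed simp
        qed
        then have "(\<integral>\<^sup>+t. ennreal (a * t powr (a - 1)) * indicator {0<..} t * (?w (sqrt t *\<^sub>R (x /\<^sub>R norm x)) * g (sqrt t *\<^sub>R (x /\<^sub>R norm x))) \<partial>lborel)
          = ennreal (c * a) * (\<integral>\<^sup>+t. indicator {0<..<1} t * ennreal ((1 - t) powr (1 / real q - 1)) * \<phi> t \<partial>lborel)"
          by (simp only:) (rule nn_integral_cmult, measurable)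
        also have "\<dots> = ennreal (c * a) * (ennreal (real q) * (\<integral>\<^sup>+s. indicator {0<..<1} s * \<phi> (1 - s ^ q) \<partial>lborel))"
          by (subst nn_integral_one_minus_power[OF _ q]) simp_all
        also have "\<dots> = ennreal K * ?J x"
          unfolding K_def \<phi>_def shell_def using c a by (simp add: ennreal_mult mult.assoc)
        finally show ?case by simp
      qed
    qed
    also have "\<dots> = (\<integral>\<^sup>+x. ennreal (K * v * (1 - snd x ^ q) powr (a - 1)) * g (shell q x) \<partial>ball_unit_interval)"
    proof -
      let ?h = "\<lambda>x. ennreal (K * v * (1 - snd x ^ q) powr (a - 1)) * g (shell q x)"
      have "(\<integral>\<^sup>+s. indicator {0<..<1} s * ?h (x, s) \<partial>lborel) = ennreal (K * v) * ?J x" for x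
        using K \<open>v > 0\<close> by (subst nn_integral_cmult[symmetric]) (auto intro!: nn_integral_cong simp: ennreal_mult mult_ac)
      then have "(\<integral>\<^sup>+x. ?h x \<partial>ball_unit_interval) = (\<integral>\<^sup>+x. indicator (ball 0 1) x * (ennreal (K * v) * ?J x) \<partial>lborel) / ennreal v"
        by (subst nn_integral_ball_unit_interval) (auto simp: v)
      also have "\<dots> = (\<integral>\<^sup>+x. ennreal v * (indicator (ball 0 1) x * (ennreal K * ?J x)) \<partial>lborel) / ennreal v"
        using K \<open>v > 0\<close> by (simp add: ennreal_mult mult_ac)
      also have "\<dots> = ennreal v * (\<integral>\<^sup>+x. indicator (ball 0 1) x * (ennreal K * ?J x) \<partial>lborel) / ennreal v"
        by (subst nn_integral_cmult) simp_all
      also have "\<dots> = (\<integral>\<^sup>+x. indicator (ball 0 1) x * (ennreal K * ?J x) \<partial>lborel)"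
        using \<open>v > 0\<close> by (subst mult.commute) (simp add: mult_divide_eq_ennreal)
      finally show ?thesis ..
    qed
    finally show ?thesis .
  qed
  have "(beta_dist b :: (real ^ 'd) measure)
    = distr (density ball_unit_interval (\<lambda>x. ennreal (K * v * (1 - snd x ^ q) powr (a - 1)))) borel (shell q)" (is "_ = ?R")
  proof (rule measure_eqI)
    fix A assume "A \<in> sets (beta_dist b :: (real ^ 'd) measure)"
    then have [measurable]: "A \<in> sets borel" by simp
    have "emeasure ?R A = (\<integral>\<^sup>+x. indicator A x \<partial>?R)" by simp
    also have "\<dots> = (\<integral>\<^sup>+x. ennreal (K * v * (1 - snd x ^ q) powr (a - 1)) * indicator A (shell q x) \<partial>ball_unit_interval)"
      by (subst nn_integral_distr, simp_all, subst nn_integral_density) simp_all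
    also have "\<dots> = (\<integral>\<^sup>+x. indicator A x \<partial>(beta_dist b :: (real ^ 'd) measure))" by (rule key[symmetric]) simp
    finally show "emeasure (beta_dist b) A = emeasure ?R A" by simp
  qed simp
  then show ?thesis using K \<open>v > 0\<close> by (intro that[of "K * v"]) (auto simp: b_def a_def)
qed

text \<open>The second coordinate is integrated out; carrying it along places the sphere on the same
  space as the approximating laws.\<close>

lemma beta_dist_minus_one: "(beta_dist (-1) :: (real ^ 'd::finite) measure) = distr ball_unit_interval borel (\<lambda>x. fst x /\<^sub>R norm (fst x))"
proof (rule measure_eqI)
  let ?A = "uniform_measure lborel (ball (0 :: real ^ 'd) 1)" and ?B = "uniform_measure lborel {0<..<1::real}"
  let ?R = "distr (ball_unit_interval :: ((real ^ 'd) \<times> real) measure) borel (\<lambda>x. fst x /\<^sub>R norm (fst x))"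
  interpret B: prob_space ?B by (rule prob_space_uniform_unit_interval)
  fix A assume "A \<in> sets (beta_dist (-1) :: (real ^ 'd) measure)"
  then have [measurable]: "A \<in> sets borel" by simp
  have "emeasure ?R A = (\<integral>\<^sup>+x. indicator A x \<partial>?R)" by simp
  also have "\<dots> = (\<integral>\<^sup>+x. indicator A (fst x /\<^sub>R norm (fst x)) \<partial>(?A \<Otimes>\<^sub>M ?B))"
    by (subst nn_integral_distr) (simp_all add: ball_unit_interval_def)
  also have "\<dots> = (\<integral>\<^sup>+x. \<integral>\<^sup>+s. indicator A (x /\<^sub>R norm x) \<partial>?B \<partial>?A)"
    by (subst B.nn_integral_fst[symmetric]) simp_all
  also have "\<dots> = (\<integral>\<^sup>+x. indicator A (x /\<^sub>R norm x) \<partial>?A)"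
    using B.emeasure_space_1 by simp
  also have "\<dots> = (\<integral>\<^sup>+x. indicator A x \<partial>(beta_dist (-1) :: (real ^ 'd) measure))"
    unfolding beta_dist_def if_P[OF refl] by (subst nn_integral_distr) simp_all
  finally show "emeasure (beta_dist (-1)) A = emeasure ?R A" by simp
qed simp

section \<open>Passage to the limit\<close>

lemma tendsto_det:
  fixes A :: "'a \<Rightarrow> real ^ 'n::finite ^ 'n"
  assumes "\<And>i j. ((\<lambda>m. A m $ i $ j) \<longlongrightarrow> B $ i $ j) F"
  shows "((\<lambda>m. det (A m)) \<longlongrightarrow> det B) F"
  unfolding det_def by (intro tendsto_sum tendsto_mult tendsto_prod tendsto_const assms)

lemma cone_vol_le: "cone_vol k (X :: nat \<Rightarrow> real ^ 'd::finite) \<le> emeasure lborel (ball (0 :: real ^ 'd) 1)"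
  unfolding cone_vol_def by (intro emeasure_mono) auto

text \<open>Membership in the tangent cone is a sign condition on products of determinants, which
  depend continuously on the vertices. For a nondegenerate limit each product vanishes only for
  \<open>z\<close> on a hyperplane, so for almost every \<open>z\<close> the signs are eventually
  constant and the indicators converge.\<close>

lemma cone_vol_tendsto:
  fixes X :: "nat \<Rightarrow> real ^ 'd::finite"
  assumes lim: "\<And>i. i \<in> {1..CARD('d) + 1} \<Longrightarrow> (\<lambda>m. Xs m i) \<longlonglongrightarrow> X i" and nz: "det (edge_mat X) \<noteq> 0"
  shows "(\<lambda>m. cone_vol k (Xs m)) \<longlonglongrightarrow> cone_vol k X"
proof -
  let ?r = "\<lambda>X i z. \<chi> r c. if c = i then z $ r else edge_mat X $ r $ c"
  define D where "D X i z = det (edge_mat X) * det (?r X i z)" for X :: "nat \<Rightarrow> real ^ 'd" and i z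
  have I: "1 \<in> {1..CARD('d) + 1}" "vertex_index (c :: 'd) \<in> {1..CARD('d) + 1}" for c by auto
  have e: "(\<lambda>m. edge_mat (Xs m) $ r $ c) \<longlonglongrightarrow> edge_mat X $ r $ c" for r c
  proof -
    have "(\<lambda>m. (Xs m (vertex_index c) - Xs m 1) $ r) \<longlonglongrightarrow> (X (vertex_index c) - X 1) $ r"
      by (intro tendsto_vec_nth tendsto_diff lim I)
    then show ?thesis by (simp add: edge_mat_def)
  qed
  have D: "(\<lambda>m. D (Xs m) i z) \<longlonglongrightarrow> D X i z" for i z
  proof -
    have "(\<lambda>m. ?r (Xs m) i z $ r $ c) \<longlonglongrightarrow> ?r X i z $ r $ c" for r c
      by (cases "c = i") (simp_all add: e)
    then show ?thesis unfolding D_def by (intro tendsto_mult tendsto_det e)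
  qed
  have ae: "AE z in lborel. D X i z \<noteq> 0" for i
  proof -
    obtain v where v: "\<And>y. det (?r X i y) = v \<bullet> y" and "\<And>j. v $ j = det (?r X i (axis j 1))" using det_replace_column[of i "edge_mat X"] by blast
    have "?r X i (\<chi> r. edge_mat X $ r $ i) = edge_mat X" by (simp add: vec_eq_iff)
    then have "v \<noteq> 0" using v[of "\<chi> r. edge_mat X $ r $ i"] nz by auto
    then have "emeasure lborel {z. v \<bullet> z = 0} = 0" by (rule emeasure_hyperplane_null)
    then have "{z. v \<bullet> z = 0} \<in> null_sets lborel" by (auto simp: null_sets_def)
    then have "AE z in lborel. z \<notin> {z. v \<bullet> z = 0}" by (rule AE_not_in)
    then show ?thesis by eventually_elim (simp add: D_def v nz)
  qed
  have "(\<lambda>m. \<integral>\<^sup>+z. indicator (ball 0 1 \<inter> tcone k (Xs m)) z \<partial>lborel) \<longlonglongrightarrow> (\<integral>\<^sup>+z. indicator (ball 0 1 \<inter> tcone k X) z \<partial>lborel)"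
  proof (rule nn_integral_dominated_convergence[where w="indicator (ball 0 1)"])
    show "AE z in lborel. indicator (ball 0 1 \<inter> tcone k (Xs m)) z \<le> (indicator (ball 0 1) z :: ennreal)" for m
      by (auto simp: indicator_def)
    show "(\<integral>\<^sup>+z. indicator (ball (0 :: real ^ 'd) 1) z \<partial>lborel) < \<infinity>" by (simp add: emeasure_ball)
    have "AE z in lborel. \<forall>i. D X i z \<noteq> 0" using AE_finite_allI[of "UNIV :: 'd set" "\<lambda>i z. D X i z \<noteq> 0" lborel] ae by simp
    then show "AE z in lborel. (\<lambda>m. indicator (ball 0 1 \<inter> tcone k (Xs m)) z) \<longlonglongrightarrow> (indicator (ball 0 1 \<inter> tcone k X) z :: ennreal)"
    proof eventually_elim
      case (elim z)
      have "\<forall>\<^sub>F m in sequentially. \<forall>i. (0 \<le> D (Xs m) i z) = (0 \<le> D X i z)"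
      proof (rule eventually_all_finite)
        fix i
        consider "0 < D X i z" | "D X i z < 0" using elim by (meson linorder_neqE_linordered_idom)
        then show "\<forall>\<^sub>F m in sequentially. (0 \<le> D (Xs m) i z) = (0 \<le> D X i z)"
        proof cases
          case 1
          from order_tendstoD(1)[OF D 1] show ?thesis by eventually_elim (use 1 in auto)
        next
          case 2
          from order_tendstoD(2)[OF D 2] show ?thesis by eventually_elim (use 2 in auto)
        qed
      qed
      then have "\<forall>\<^sub>F m in sequentially. indicator (ball 0 1 \<inter> tcone k (Xs m)) z = (indicator (ball 0 1 \<inter> tcone k X) z :: ennreal)"
        by eventually_elim (simp add: tcone_def D_def indicator_def)
      then show ?case by (rule tendsto_eventually)
    qed
  qed (auto intro!: borel_measurable_indicator sets.Int sets_tcone)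
  then show ?thesis unfolding cone_vol_def by simp
qed

lemma measurable_compose_PiM:
  assumes "f \<in> measurable M N"
  shows "compose I f \<in> measurable (PiM I (\<lambda>_. M)) (PiM I (\<lambda>_. N))"
  unfolding compose_def[abs_def]
  by (rule measurable_restrict) (rule measurable_compose[OF measurable_component_singleton[where M="\<lambda>_. M"] assms])

text \<open>Dominated convergence on the coupled space. The residual densities \<open>h\<close> are
  bounded by \<open>1\<close>, because \<open>d \<ge> 2\<close>, and tend to \<open>1\<close>. The
  same limit for the constant function \<open>1\<close> forces the normalising factors to tend to
  \<open>1\<close> as well.\<close>

lemma nn_integral_beta_dist_limit:
  fixes F :: "(nat \<Rightarrow> real ^ 'd::finite) \<Rightarrow> ennreal"
  assumes d: "2 \<le> CARD('d)" and I: "finite I" and F [measurable]: "F \<in> borel_measurable (PiM I (\<lambda>_. borel))"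
    and bound: "\<And>X. F X \<le> B" "B < \<infinity>"
    and cont: "AE X in PiM I (\<lambda>_. beta_dist (-1)). \<forall>Xs. (\<forall>i\<in>I. (\<lambda>m. Xs m i) \<longlonglongrightarrow> X i) \<longrightarrow> (\<lambda>m. F (Xs m)) \<longlonglongrightarrow> F X"
  shows "(\<lambda>m. \<integral>\<^sup>+X. F X \<partial>PiM I (\<lambda>_. beta_dist (1 / real (Suc m) - 1))) \<longlonglongrightarrow> (\<integral>\<^sup>+X. F X \<partial>PiM I (\<lambda>_. beta_dist (-1)))"
proof -
  let ?B = "ball_unit_interval :: ((real ^ 'd) \<times> real) measure"
  let ?P = "PiM I (\<lambda>_. ?B)" and ?N = "PiM I (\<lambda>_. borel :: (real ^ 'd) measure)"
  define a where "a = real CARD('d) / 2"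
  have a: "a \<ge> 1" using d by (simp add: a_def)
  interpret B: prob_space ?B by (rule prob_space_ball_unit_interval)
  interpret P: prob_space ?P by (intro prob_space_PiM B.prob_space_axioms)
  define sh0 where "sh0 x = fst x /\<^sub>R norm (fst x)" for x :: "(real ^ 'd) \<times> real"
  have s0 [measurable]: "sh0 \<in> measurable ?B borel" unfolding sh0_def[abs_def] by measurable
  have sm [measurable]: "shell q \<in> measurable ?B borel" for q by measurable
  define h where "h q x = (1 - snd x ^ q) powr (a - 1)" for q :: nat and x :: "(real ^ 'd) \<times> real"
  have hm [measurable]: "h q \<in> borel_measurable ?B" for q unfolding h_def[abs_def] by measurable
  note sm' = measurable_compose_PiM[OF sm, of I] and s0' = measurable_compose_PiM[OF s0, of I]
  \<comment> \<open>\<open>distr_PiM_finite_prob_space'\<close> wants a probability space as target.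
    A point mass provides one with the Borel sets; only the sets matter for an image
    measure.\<close>
  have R: "prob_space (return borel (0 :: real ^ 'd))" by (rule prob_space_return) simp
  have Fm: "F \<in> borel_measurable (PiM I (\<lambda>_. M))" if "sets M = sets borel" for M
    using F that by (subst measurable_cong_sets[OF sets_PiM_cong refl]) auto
  have dist: "PiM I (\<lambda>_. distr M borel f) = distr (PiM I (\<lambda>_. M)) ?N (compose I f)"
    if "prob_space M" "f \<in> measurable M borel" for M :: "((real ^ 'd) \<times> real) measure" and f :: "(real ^ 'd) \<times> real \<Rightarrow> real ^ 'd"
  proof -
    have sN: "sets ?N = sets (PiM I (\<lambda>_. return borel 0))" by (intro sets_PiM_cong) auto
    have "distr (PiM I (\<lambda>_. M)) (PiM I (\<lambda>_. return borel 0)) (compose I f) = PiM I (\<lambda>i. distr M (return borel 0) f)"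
      by (rule distr_PiM_finite_prob_space'[OF I]) (use that R in auto)
    moreover have "distr M (return borel 0) f = distr M borel f" by (intro distr_cong) auto
    moreover have "distr (PiM I (\<lambda>_. M)) (PiM I (\<lambda>_. return borel 0)) (compose I f) = distr (PiM I (\<lambda>_. M)) ?N (compose I f)"
      by (intro distr_cong sN[symmetric] refl)
    ultimately show ?thesis by simp
  qed
  define G where "G q F = (\<integral>\<^sup>+\<omega>. (\<Prod>i\<in>I. ennreal (h q (\<omega> i))) * F (compose I (shell q) \<omega>) \<partial>?P)" for q and F :: "(nat \<Rightarrow> real ^ 'd) \<Rightarrow> ennreal"
  have Gm: "(\<lambda>\<omega>. (\<Prod>i\<in>I. ennreal (h q (\<omega> i))) * F (compose I (shell q) \<omega>)) \<in> borel_measurable ?P"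
    if "F \<in> borel_measurable ?N" for q F
    by (intro borel_measurable_times_ennreal borel_measurable_prod_ennreal measurable_compose[OF sm' that]
       measurable_compose[OF measurable_component_singleton] measurable_compose[OF hm] measurable_ennreal) auto
  obtain C where C: "\<And>q F. q \<ge> 1 \<Longrightarrow> F \<in> borel_measurable ?N \<Longrightarrow> (\<integral>\<^sup>+X. F X \<partial>PiM I (\<lambda>_. beta_dist (1 / real q - 1))) = C q * G q F"
  proof -
    have "\<exists>c. \<forall>F \<in> borel_measurable ?N. (\<integral>\<^sup>+X. F X \<partial>PiM I (\<lambda>_. beta_dist (1 / real q - 1))) = c * G q F" if q: "q \<ge> 1" for q
    proof -
      obtain c where c: "c > 0" "(beta_dist (1 / real q - 1) :: (real ^ 'd) measure) = distr (density ?B (\<lambda>x. ennreal (c * h q x))) borel (shell q)"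
        using beta_dist_shell[OF q, where 'd='d] unfolding h_def a_def by metis
      let ?D = "density ?B (\<lambda>x. ennreal (c * h q x))"
      have "prob_space (beta_dist (1 / real q - 1) :: (real ^ 'd) measure)" using q by (intro prob_space_beta_dist) simp
      then have "prob_space ?D" unfolding c(2) by (rule prob_space_distrD[rotated]) simp
      have PD: "PiM I (\<lambda>_. ?D) = density ?P (\<lambda>\<omega>. \<Prod>i\<in>I. ennreal (c * h q (\<omega> i)))"
        by (rule PiM_density[OF I B.sigma_finite_measure_axioms]) (use \<open>prob_space ?D\<close> prob_space_imp_sigma_finite in auto)
      have "(\<integral>\<^sup>+X. F X \<partial>PiM I (\<lambda>_. beta_dist (1 / real q - 1))) = ennreal c ^ card I * G q F" if F: "F \<in> borel_measurable ?N" for F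
      proof -
        have "(\<integral>\<^sup>+X. F X \<partial>PiM I (\<lambda>_. beta_dist (1 / real q - 1))) = (\<integral>\<^sup>+X. F X \<partial>distr (density ?P (\<lambda>\<omega>. \<Prod>i\<in>I. ennreal (c * h q (\<omega> i)))) ?N (compose I (shell q)))"
          unfolding c(2) PD[symmetric] by (subst dist) (use \<open>prob_space ?D\<close> in auto)
        also have "\<dots> = (\<integral>\<^sup>+\<omega>. F (compose I (shell q) \<omega>) \<partial>density ?P (\<lambda>\<omega>. \<Prod>i\<in>I. ennreal (c * h q (\<omega> i))))"
          by (rule nn_integral_distr) (use sm' F in auto)
        also have "\<dots> = (\<integral>\<^sup>+\<omega>. (\<Prod>i\<in>I. ennreal (c * h q (\<omega> i))) * F (compose I (shell q) \<omega>) \<partial>?P)"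
          by (rule nn_integral_density)
            (intro borel_measurable_prod_ennreal measurable_compose[OF measurable_component_singleton] measurable_ennreal borel_measurable_times borel_measurable_const hm measurable_compose[OF _ hm] measurable_component_singleton measurable_compose[OF sm' F]; simp)+
        also have "\<dots> = (\<integral>\<^sup>+\<omega>. ennreal c ^ card I * ((\<Prod>i\<in>I. ennreal (h q (\<omega> i))) * F (compose I (shell q) \<omega>)) \<partial>?P)"
          using c(1) by (simp add: ennreal_mult' prod.distrib mult.assoc)
        also have "\<dots> = ennreal c ^ card I * G q F"
          unfolding G_def by (rule nn_integral_cmult[OF Gm[OF F]])
        finally show ?thesis .
      qed
      then show ?thesis by blast
    qed
    then show ?thesis using that by metis
  qed
  \<comment> \<open>The exponent \<open>a - 1\<close> is nonnegative because
    \<open>a \<ge> 1\<close>, which keeps \<open>h\<close> below \<open>1\<close>.\<close>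
  have h1: "h q x \<le> 1" "0 \<le> h q x" if "0 < snd x" "snd x < 1" for q x
    using that a power_le_one[of "snd x" q] by (auto simp: h_def intro!: powr_le1)
  have ae: "AE \<omega> in ?P. \<forall>i\<in>I. 0 < snd (\<omega> i) \<and> snd (\<omega> i) < 1"
  proof -
    have "AE x in ?B. 0 < snd x \<and> snd x < 1"
    proof -
      interpret A': prob_space "uniform_measure lborel (ball (0 :: real ^ 'd) 1)" by (rule prob_space_uniform_ball)
      interpret B': prob_space "uniform_measure lborel {0<..<1::real}" by (rule prob_space_uniform_unit_interval)
      interpret AB: pair_prob_space "uniform_measure lborel (ball (0 :: real ^ 'd) 1)" "uniform_measure lborel {0<..<1::real}" ..
      have "AE s in uniform_measure lborel {0<..<1::real}. 0 < s \<and> s < 1" by (rule AE_uniform_measureI) auto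
      then have "AE x in uniform_measure lborel (ball (0 :: real ^ 'd) 1). AE s in uniform_measure lborel {0<..<1::real}. 0 < snd (x, s) \<and> snd (x, s) < 1" by simp
      then show ?thesis unfolding ball_unit_interval_def by (rule AB.AE_pair_measure[rotated]) measurable
    qed
    then have "AE \<omega> in ?P. 0 < snd (\<omega> i) \<and> snd (\<omega> i) < 1" if "i \<in> I" for i
      using that by (intro AE_PiM_component B.prob_space_axioms) auto
    then show ?thesis using I by (simp add: AE_finite_allI)
  qed
  have G_lim: "(\<lambda>m. G (Suc m) H) \<longlonglongrightarrow> (\<integral>\<^sup>+X. H X \<partial>PiM I (\<lambda>_. beta_dist (-1)))"
    if H: "H \<in> borel_measurable ?N" and bound: "\<And>X. H X \<le> K" "K < \<infinity>"
    and cont: "AE X in PiM I (\<lambda>_. beta_dist (-1)). \<forall>Xs. (\<forall>i\<in>I. (\<lambda>m. Xs m i) \<longlonglongrightarrow> X i) \<longrightarrow> (\<lambda>m. H (Xs m)) \<longlonglongrightarrow> H X" for H K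
  proof -
    have b1: "PiM I (\<lambda>_. beta_dist (-1)) = distr ?P ?N (compose I sh0)"
      unfolding beta_dist_minus_one sh0_def[symmetric] using dist[OF B.prob_space_axioms s0] by (simp add: sh0_def[abs_def])
    have c0: "AE \<omega> in ?P. \<forall>Xs. (\<forall>i\<in>I. (\<lambda>m. Xs m i) \<longlonglongrightarrow> compose I sh0 \<omega> i) \<longrightarrow> (\<lambda>m. H (Xs m)) \<longlonglongrightarrow> H (compose I sh0 \<omega>)"
      using cont unfolding b1 by (rule AE_distrD[OF s0'])
    have "(\<lambda>m. G (Suc m) H) \<longlonglongrightarrow> (\<integral>\<^sup>+\<omega>. H (compose I sh0 \<omega>) \<partial>?P)"
      unfolding G_def
    proof (rule nn_integral_dominated_convergence[where w="\<lambda>_. K"])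
      show "(\<lambda>\<omega>. H (compose I sh0 \<omega>)) \<in> borel_measurable ?P" by (rule measurable_compose[OF s0' H])
      show "(\<integral>\<^sup>+\<omega>. K \<partial>?P) < \<infinity>" using bound(2) P.emeasure_space_1 by simp
      show "AE \<omega> in ?P. (\<Prod>i\<in>I. ennreal (h (Suc m) (\<omega> i))) * H (compose I (shell (Suc m)) \<omega>) \<le> K" for m
        using ae
      proof eventually_elim
        case (elim \<omega>)
        have "(\<Prod>i\<in>I. ennreal (h (Suc m) (\<omega> i))) \<le> 1"
          using elim h1(1) by (intro prod_le_1) auto
        then have "(\<Prod>i\<in>I. ennreal (h (Suc m) (\<omega> i))) * H (compose I (shell (Suc m)) \<omega>) \<le> 1 * K"
          by (intro mult_mono bound) auto
        then show ?case by simp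
      qed
      show "AE \<omega> in ?P. (\<lambda>m. (\<Prod>i\<in>I. ennreal (h (Suc m) (\<omega> i))) * H (compose I (shell (Suc m)) \<omega>)) \<longlonglongrightarrow> H (compose I sh0 \<omega>)"
        using ae c0
      proof eventually_elim
        case (elim \<omega>)
        have p: "(\<lambda>m. 1 - snd (\<omega> i) ^ Suc m) \<longlonglongrightarrow> 1 - 0" if "i \<in> I" for i
          using elim that by (intro tendsto_diff tendsto_const LIMSEQ_Suc[OF LIMSEQ_realpow_zero]) auto
        have "(\<lambda>m. h (Suc m) (\<omega> i)) \<longlonglongrightarrow> (1 - 0) powr (a - 1)" if "i \<in> I" for i
          unfolding h_def by (rule tendsto_powr[OF p[OF that] tendsto_const]) simp
        then have "(\<lambda>m. h (Suc m) (\<omega> i)) \<longlonglongrightarrow> 1" if "i \<in> I" for i using that by simp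
        then have "(\<lambda>m. \<Prod>i\<in>I. h (Suc m) (\<omega> i)) \<longlonglongrightarrow> (\<Prod>i\<in>I. 1)" by (intro tendsto_prod) auto
        then have "(\<lambda>m. ennreal (\<Prod>i\<in>I. h (Suc m) (\<omega> i))) \<longlonglongrightarrow> ennreal 1" by (intro tendsto_ennrealI) simp
        moreover have "ennreal (\<Prod>i\<in>I. h (Suc m) (\<omega> i)) = (\<Prod>i\<in>I. ennreal (h (Suc m) (\<omega> i)))" for m
          by (rule prod_ennreal[symmetric]) (simp add: h_def)
        ultimately have hl: "(\<lambda>m. \<Prod>i\<in>I. ennreal (h (Suc m) (\<omega> i))) \<longlonglongrightarrow> 1" by simp
        have "(\<lambda>m. compose I (shell (Suc m)) \<omega> i) \<longlonglongrightarrow> compose I sh0 \<omega> i" if "i \<in> I" for i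
        proof -
          have "(\<lambda>m. sqrt (1 - snd (\<omega> i) ^ Suc m) *\<^sub>R sh0 (\<omega> i)) \<longlonglongrightarrow> sqrt (1 - 0) *\<^sub>R sh0 (\<omega> i)"
            by (intro tendsto_scaleR tendsto_real_sqrt p[OF that] tendsto_const)
          then show ?thesis using that by (simp add: compose_def shell_def sh0_def)
        qed
        then have "(\<lambda>m. H (compose I (shell (Suc m)) \<omega>)) \<longlonglongrightarrow> H (compose I sh0 \<omega>)" by (rule elim(2)[rule_format])
        then have "(\<lambda>m. (\<Prod>i\<in>I. ennreal (h (Suc m) (\<omega> i))) * H (compose I (shell (Suc m)) \<omega>)) \<longlonglongrightarrow> 1 * H (compose I sh0 \<omega>)"
          using bound(1)[of "compose I sh0 \<omega>"] bound(2) by (intro tendsto_mult_ennreal hl) auto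
        then show ?case by simp
      qed
    qed (use Gm[OF H] in auto)
    also have "(\<integral>\<^sup>+\<omega>. H (compose I sh0 \<omega>) \<partial>?P) = (\<integral>\<^sup>+X. H X \<partial>PiM I (\<lambda>_. beta_dist (-1)))"
      unfolding b1 by (subst nn_integral_distr[OF s0']) (use H in simp_all)
    finally show ?thesis .
  qed
  have pr: "prob_space (PiM I (\<lambda>_. beta_dist b :: (real ^ 'd) measure))" if "b \<ge> -1" for b
    using that by (intro prob_space_PiM prob_space_beta_dist)
  have one: "(\<integral>\<^sup>+X. 1 \<partial>PiM I (\<lambda>_. beta_dist b :: (real ^ 'd) measure)) = 1" if "b \<ge> -1" for b
    using prob_space.emeasure_space_1[OF pr[OF that]] by simp
  \<comment> \<open>Total mass one identifies the unknown factor as the reciprocal of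
    \<open>G\<close> at the constant function.\<close>
  have G1: "C (Suc m) * G (Suc m) (\<lambda>_. 1) = 1" for m
    using C[of "Suc m" "\<lambda>_. 1"] one[of "1 / real (Suc m) - 1"] by simp
  have "(\<lambda>m. G (Suc m) (\<lambda>_. 1)) \<longlonglongrightarrow> (\<integral>\<^sup>+X. 1 \<partial>PiM I (\<lambda>_. beta_dist (-1) :: (real ^ 'd) measure))"
    by (rule G_lim[of "\<lambda>_. 1" 1]) auto
  then have "(\<lambda>m. G (Suc m) (\<lambda>_. 1)) \<longlonglongrightarrow> 1" by (simp only: one order_refl)
  then have "(\<lambda>m. inverse (G (Suc m) (\<lambda>_. 1))) \<longlonglongrightarrow> inverse 1"
    by (rule continuous_on_tendsto_compose[where s=UNIV, OF continuous_on_inverse_ennreal[OF continuous_on_id]]) auto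
  moreover have "inverse (G (Suc m) (\<lambda>_. 1)) = C (Suc m)" for m
  proof -
    have g0: "G (Suc m) (\<lambda>_. 1) \<noteq> 0" using G1[of m] by (metis mult_zero_right zero_neq_one)
    have g1: "G (Suc m) (\<lambda>_. 1) \<noteq> top"
    proof
      assume "G (Suc m) (\<lambda>_. 1) = top"
      with G1[of m] show False by (cases "C (Suc m) = 0") (simp_all add: ennreal_mult_top)
    qed
    note g = g0 g1
    have "C (Suc m) = C (Suc m) * G (Suc m) (\<lambda>_. 1) / G (Suc m) (\<lambda>_. 1)" using g by (simp add: mult_divide_eq_ennreal)
    then show ?thesis unfolding G1 by (simp add: divide_ennreal_def)
  qed
  ultimately have "(\<lambda>m. C (Suc m)) \<longlonglongrightarrow> 1" by (simp add: divide_ennreal_def[symmetric])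
  then have "(\<lambda>m. C (Suc m) * G (Suc m) F) \<longlonglongrightarrow> 1 * (\<integral>\<^sup>+X. F X \<partial>PiM I (\<lambda>_. beta_dist (-1)))"
  proof (rule tendsto_mult_ennreal)
    show "(\<lambda>m. G (Suc m) F) \<longlonglongrightarrow> (\<integral>\<^sup>+X. F X \<partial>PiM I (\<lambda>_. beta_dist (-1)))" by (rule G_lim[OF F bound cont])
    interpret N1: prob_space "PiM I (\<lambda>_. beta_dist (-1) :: (real ^ 'd) measure)" by (rule pr) simp
    have "(\<integral>\<^sup>+X. F X \<partial>PiM I (\<lambda>_. beta_dist (-1))) \<le> (\<integral>\<^sup>+X. B \<partial>PiM I (\<lambda>_. beta_dist (-1) :: (real ^ 'd) measure))"
      by (intro nn_integral_mono bound)
    also have "\<dots> = B" using N1.emeasure_space_1 by simp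
    finally show "\<not> ((1 :: ennreal) = 0 \<and> (\<integral>\<^sup>+X. F X \<partial>PiM I (\<lambda>_. beta_dist (-1))) = \<infinity> \<or> (1 :: ennreal) = \<infinity> \<and> (\<integral>\<^sup>+X. F X \<partial>PiM I (\<lambda>_. beta_dist (-1))) = 0)"
      using zero_neq_one[where 'a=ennreal] by simp
  qed
  moreover have "(\<integral>\<^sup>+X. F X \<partial>PiM I (\<lambda>_. beta_dist (1 / real (Suc m) - 1))) = C (Suc m) * G (Suc m) F" for m
    by (rule C[OF _ F]) simp
  ultimately show ?thesis by (simp only: mult_1_left)
qed

lemma bump_tendsto:
  assumes "p \<longlonglongrightarrow> p0" shows "(\<lambda>m. bump (p m) s) \<longlonglongrightarrow> bump p0 s"
proof (cases "s\<^sup>2 < 1")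
  case True
  then show ?thesis unfolding bump_def beta_weight_def by (auto intro!: tendsto_powr[OF tendsto_const assms])
qed (simp add: bump_def beta_weight_def)

text \<open>Dominated convergence is applied twice, first to the principal value and then to the
  outer integral. The Lipschitz constants \<open>2 * p m\<close> are at most \<open>2 * M\<close>,
  which gives majorants free of \<open>m\<close>.\<close>

lemma bump_integral_tendsto:
  assumes p: "\<And>m. 1 \<le> p m" "\<And>m. p m \<le> M" "p \<longlonglongrightarrow> p0" and k: "k \<ge> 1"
  shows "(\<lambda>m. bump_integral k j (p m)) \<longlonglongrightarrow> bump_integral k j p0"
proof -
  have pv: "(\<lambda>m. bump_pv (p m) s) \<longlonglongrightarrow> bump_pv p0 s" for s
    unfolding bump_pv_def
  proof (rule integral_dominated_convergence[where w="\<lambda>u. indicator {-2..2} u * (2 * M)"])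
    show "AE u in lborel. (\<lambda>m. indicator {-2..2} u * ((bump (p m) (s + u) - bump (p m) s) / u)) \<longlonglongrightarrow> indicator {-2..2} u * ((bump p0 (s + u) - bump p0 s) / u)"
      using AE_lborel_singleton[of "0::real"]
      by eventually_elim (auto intro!: tendsto_intros bump_tendsto p)
    show "AE u in lborel. norm (indicator {-2..2} u * ((bump (p m) (s + u) - bump (p m) s) / u)) \<le> indicator {-2..2} u * (2 * M)" for m
    proof (rule AE_I2)
      fix u :: real
      have "indicator {-2..2} u * (2 * p m) \<le> indicator {-2..2} u * (2 * M)" using p(2)[of m] by (intro mult_left_mono) auto
      then show "norm (indicator {-2..2} u * ((bump (p m) (s + u) - bump (p m) s) / u)) \<le> indicator {-2..2} u * (2 * M)"
        using bump_quotient_bound[OF p(1), of u m s] unfolding real_norm_def by linarith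
    qed
    show "integrable lborel (\<lambda>u::real. indicator {-2..2} u * (2 * M))" by simp
    show "(\<lambda>u. indicator {-2..2} u * ((bump (p m) (s + u) - bump (p m) s) / u)) \<in> borel_measurable lborel" for m by measurable
    show "(\<lambda>u. indicator {-2..2} u * ((bump p0 (s + u) - bump p0 s) / u)) \<in> borel_measurable lborel" by measurable
  qed
  have bd: "(\<lambda>m. bump_bdry (p m) s) \<longlonglongrightarrow> bump_bdry p0 s" for s
    unfolding bump_bdry_def by (intro tendsto_intros bump_tendsto pv p)
  show ?thesis unfolding bump_integral_def
  proof (rule integral_dominated_convergence[where w="\<lambda>s. indicator {-1..1} s * (pi + 8 * M) ^ j"])
    show "AE s in lborel. (\<lambda>m. bump (p m) s ^ k * Re (bump_bdry (p m) s ^ j)) \<longlonglongrightarrow> bump p0 s ^ k * Re (bump_bdry p0 s ^ j)"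
      by (intro AE_I2 tendsto_intros bump_tendsto bd p)
    show "AE s in lborel. norm (bump (p m) s ^ k * Re (bump_bdry (p m) s ^ j)) \<le> indicator {-1..1} s * (pi + 8 * M) ^ j" for m
    proof (rule AE_I2)
      fix s :: real
      have "norm (bump (p m) s ^ k * Re (bump_bdry (p m) s ^ j)) \<le> norm (of_real (bump (p m) s ^ k) * bump_bdry (p m) s ^ j)"
        unfolding norm_mult norm_of_real by (simp add: mult_left_mono abs_Re_le_cmod)
      also have "\<dots> \<le> indicator {-1..1} s * (pi + 8 * p m) ^ j" by (rule bump_power_bdry_bound[OF p(1) k])
      also have "\<dots> \<le> indicator {-1..1} s * (pi + 8 * M) ^ j"
        using p(1,2)[of m] by (intro mult_left_mono power_mono) auto
      finally show "norm (bump (p m) s ^ k * Re (bump_bdry (p m) s ^ j)) \<le> indicator {-1..1} s * (pi + 8 * M) ^ j" .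
    qed
    show "integrable lborel (\<lambda>s::real. indicator {-1..1} s * (pi + 8 * M) ^ j)" by simp
    show "(\<lambda>s. bump (p m) s ^ k * Re (bump_bdry (p m) s ^ j)) \<in> borel_measurable lborel" for m by measurable
    show "(\<lambda>s. bump p0 s ^ k * Re (bump_bdry p0 s ^ j)) \<in> borel_measurable lborel" by measurable
  qed
qed

text \<open>For \<open>b > -1\<close> the powers of \<open>2 * pi\<close> and of the total mass
  shared by the indices \<open>k\<close> and \<open>n\<close> are cancelled. For
  \<open>b = -1\<close> both sides are limits along \<open>1 / (m + 1) - 1\<close>, and an identity
  between products passes to the limit.\<close>

lemma expected_cone_vol_bump:
  fixes b :: real
  defines "p \<equiv> \<lambda>n::nat. b + real n / 2"
  assumes b: "b \<ge> -1" and p: "p CARD('d::finite) \<ge> 1" and k: "1 \<le> k" "k \<le> CARD('d) + 1"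
  shows "(\<integral>\<^sup>+X. cone_vol k X \<partial>PiM {1..CARD('d) + 1} (\<lambda>_. beta_dist b :: (real ^ 'd) measure))
        * ennreal ((2 * pi) ^ (CARD('d) + 1 - k) * bump_integral (CARD('d) + 1) 0 (p CARD('d)))
     = emeasure lborel (ball (0 :: real ^ 'd) 1) * ennreal (bump_integral k (CARD('d) + 1 - k) (p CARD('d)))"
    and "0 \<le> bump_integral k (CARD('d) + 1 - k) (p CARD('d))"
proof -
  let ?n = "CARD('d) + 1" and ?v = "emeasure lborel (ball (0 :: real ^ 'd) 1)"
  let ?E = "\<lambda>b. \<integral>\<^sup>+X. cone_vol k X \<partial>PiM {1..?n} (\<lambda>_. beta_dist b :: (real ^ 'd) measure)"
  let ?L = "\<lambda>q. (2 * pi) ^ (?n - k) * bump_integral ?n 0 q"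
  let ?R = "\<lambda>q. bump_integral k (?n - k) q"
  have gt: "?E b * ennreal (?L (b + real CARD('d) / 2)) = ?v * ennreal (?R (b + real CARD('d) / 2)) \<and> 0 \<le> ?R (b + real CARD('d) / 2)"
    if b: "b > -1" and q: "b + real CARD('d) / 2 \<ge> 1" for b :: real
  proof -
    let ?q = "b + real CARD('d) / 2"
    define T where "T = enn2real (beta_weight_total ?q TYPE(real))"
    have "?q > -1" using q by linarith
    then have T: "T > 0" using beta_weight_total_bounds[of ?q, where 'a=real] by (auto simp: T_def enn2real_positive_iff)
    define c where "c = (2 * pi) ^ (k - 1) / T ^ ?n"
    have c: "c > 0" using T by (simp add: c_def)
    have nk: "(2 * pi) ^ (?n - 1) = (2 * pi) ^ (k - 1) * (2 * pi) ^ (?n - k)"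
      unfolding power_add[symmetric] using k by (intro arg_cong[where f="\<lambda>e. (2 * pi) ^ e"]) linarith
    have n: "1 \<le> ?n" "?n \<le> ?n" by auto
    have "Re (profile_integral ?n ?n ?q) = (2 * pi) ^ (?n - 1) / T ^ ?n * bump_integral ?n (?n - ?n) ?q"
      unfolding T_def by (rule Re_profile_integral[OF q n])
    then have Tn: "Re (profile_integral ?n ?n ?q) = c * ?L ?q" unfolding nk c_def by simp
    have Tk: "Re (profile_integral ?n k ?q) = c * ?R ?q" unfolding c_def T_def by (rule Re_profile_integral[OF q k])
    note main = expected_cone_vol[OF b q k, unfolded Tn Tk]
    have R: "0 \<le> ?R ?q" using main(2) c by (simp add: zero_le_mult_iff)
    have s: "ennreal (c * x) = ennreal c * ennreal x" for x using c by (simp add: ennreal_mult')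
    have "ennreal c * (?E b * ennreal (?L ?q)) = ennreal c * (?v * ennreal (?R ?q))"
      using main(1) unfolding s by (simp only: mult_ac)
    then have "?E b * ennreal (?L ?q) = ?v * ennreal (?R ?q)"
      using c unfolding ennreal_mult_cancel_left by auto
    with R show ?thesis by simp
  qed
  have main: "?E b * ennreal (?L (p CARD('d))) = ?v * ennreal (?R (p CARD('d))) \<and> 0 \<le> ?R (p CARD('d))"
  proof (cases "b = -1")
    case False
    then show ?thesis using gt[of b] b p unfolding p_def by simp
  next
    case True
    have d: "2 \<le> CARD('d)" using p True by (simp add: p_def)
    \<comment> \<open>Parameters above \<open>-1\<close> of the form treated by the coupling; the
      exponents \<open>pm\<close> stay between \<open>1\<close> and
      \<open>p CARD('d) + 1\<close>.\<close>
    define bm where "bm m = 1 / real (Suc m) - 1" for m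
    define pm where "pm m = bm m + real CARD('d) / 2" for m
    have bm1: "bm m > -1" for m by (simp add: bm_def)
    have pm1: "1 \<le> pm m" "pm m \<le> p CARD('d) + 1" for m
    proof -
      have "pm m = 1 / real (Suc m) + p CARD('d)" using True by (simp add: pm_def bm_def p_def)
      moreover have "0 \<le> 1 / real (Suc m)" "1 / real (Suc m) \<le> 1" by simp_all
      ultimately show "1 \<le> pm m" "pm m \<le> p CARD('d) + 1" using p by linarith+
    qed
    have inv: "(\<lambda>m. 1 / real (Suc m)) \<longlonglongrightarrow> 0" using LIMSEQ_inverse_real_of_nat by (simp add: inverse_eq_divide)
    have "pm \<longlonglongrightarrow> 0 - 1 + real CARD('d) / 2" unfolding pm_def[abs_def] bm_def by (intro tendsto_intros inv)
    then have pml: "pm \<longlonglongrightarrow> p CARD('d)" using True by (simp add: p_def)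
    have L: "(\<lambda>m. ?L (pm m)) \<longlonglongrightarrow> ?L (p CARD('d))" and R: "(\<lambda>m. ?R (pm m)) \<longlonglongrightarrow> ?R (p CARD('d))"
      using k by (intro tendsto_intros bump_integral_tendsto[OF pm1 pml]; simp)+
    have eq: "?E (bm m) * ennreal (?L (pm m)) = ?v * ennreal (?R (pm m))" "0 \<le> ?R (pm m)" for m
      using gt[OF bm1[of m]] pm1(1)[of m] unfolding pm_def by auto
    have pr: "prob_space (PiM {1..?n} (\<lambda>_. beta_dist (-1) :: (real ^ 'd) measure))"
      by (intro prob_space_PiM prob_space_beta_dist) simp
    interpret P: prob_space "PiM {1..?n} (\<lambda>_. beta_dist (-1) :: (real ^ 'd) measure)" by (rule pr)
    have "prob_space (beta_dist (-1) :: (real ^ 'd) measure)" by (rule prob_space_beta_dist) simp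
    then have aedet: "AE X in PiM {1..?n} (\<lambda>_. beta_dist (-1) :: (real ^ 'd) measure). det (edge_mat X) \<noteq> 0"
      by (rule AE_det_edge_mat) (use d in \<open>auto intro!: beta_dist_hyperplane_null\<close>)
    have vfin: "?v < \<infinity>" by (simp add: emeasure_ball)
    have "(\<lambda>m. ?E (1 / real (Suc m) - 1)) \<longlonglongrightarrow> ?E (-1)"
    proof (rule nn_integral_beta_dist_limit[OF d finite_atLeastAtMost measurable_cone_vol cone_vol_le vfin])
      show "AE X in PiM {1..?n} (\<lambda>_. beta_dist (-1) :: (real ^ 'd) measure). \<forall>Xs. (\<forall>i\<in>{1..?n}. (\<lambda>m. Xs m i) \<longlonglongrightarrow> X i) \<longrightarrow> (\<lambda>m. cone_vol k (Xs m)) \<longlonglongrightarrow> cone_vol k X"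
        using aedet by eventually_elim (blast intro: cone_vol_tendsto)
    qed
    then have E: "(\<lambda>m. ?E (bm m)) \<longlonglongrightarrow> ?E (-1)" unfolding bm_def .
    have "?E (-1) \<le> (\<integral>\<^sup>+X. ?v \<partial>PiM {1..?n} (\<lambda>_. beta_dist (-1) :: (real ^ 'd) measure))"
      by (intro nn_integral_mono cone_vol_le)
    then have Efin: "?E (-1) \<noteq> \<infinity>" using vfin P.emeasure_space_1 by (auto simp: top_unique)
    have "(\<lambda>m. ?E (bm m) * ennreal (?L (pm m))) \<longlonglongrightarrow> ?E (-1) * ennreal (?L (p CARD('d)))"
      by (intro tendsto_mult_ennreal E tendsto_ennrealI L) (use Efin in auto)
    moreover have "(\<lambda>m. ?v * ennreal (?R (pm m))) \<longlonglongrightarrow> ?v * ennreal (?R (p CARD('d)))"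
      by (intro tendsto_mult_ennreal tendsto_const tendsto_ennrealI R) (use vfin in auto)
    ultimately have "?E (-1) * ennreal (?L (p CARD('d))) = ?v * ennreal (?R (p CARD('d)))"
      unfolding eq(1) by (rule LIMSEQ_unique)
    moreover have "0 \<le> ?R (p CARD('d))" using eq(2) by (intro LIMSEQ_le_const[OF R]) auto
    ultimately show ?thesis using True by simp
  qed
  then show "?E b * ennreal (?L (p CARD('d))) = ?v * ennreal (?R (p CARD('d)))" and "0 \<le> ?R (p CARD('d))" by auto
qed

section \<open>Expected angles\<close>

definition solid_angle :: "nat \<Rightarrow> (nat \<Rightarrow> real ^ 'd::finite) \<Rightarrow> real" where
  "solid_angle k X = measure lborel (ball 0 1 \<inter> tcone k X) / measure lborel (ball (0 :: real ^ 'd) 1)"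

lemma solid_angle_eq: "solid_angle k (X :: nat \<Rightarrow> real ^ 'd) = enn2real (cone_vol k X) / measure lborel (ball (0 :: real ^ 'd::finite) 1)"
  by (simp add: solid_angle_def cone_vol_def measure_def)

text \<open>Back from \<open>ennreal\<close> to real numbers: the cone volume is bounded by that of
  the ball, and the divisor is positive because \<open>bump\<close> is positive on the open
  interval.\<close>

lemma integral_solid_angle:
  fixes b :: real
  assumes b: "b \<ge> -1" and p: "b + real CARD('d::finite) / 2 \<ge> 1" and k: "1 \<le> k" "k \<le> CARD('d) + 1"
  shows "(\<integral>X. solid_angle k X \<partial>PiM {1..CARD('d) + 1} (\<lambda>_. beta_dist b :: (real ^ 'd) measure))
    = bump_integral k (CARD('d) + 1 - k) (b + real CARD('d) / 2) / ((2 * pi) ^ (CARD('d) + 1 - k) * bump_integral (CARD('d) + 1) 0 (b + real CARD('d) / 2))"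
proof -
  let ?n = "CARD('d) + 1" and ?p = "b + real CARD('d) / 2"
  let ?P = "PiM {1..?n} (\<lambda>_. beta_dist b :: (real ^ 'd) measure)"
  define v where "v = measure lborel (ball (0 :: real ^ 'd) 1)"
  have v: "v > 0" by (simp add: v_def content_ball_pos)
  have ev: "emeasure lborel (ball (0 :: real ^ 'd) 1) = ennreal v" unfolding v_def
    by (rule emeasure_eq_ennreal_measure) (simp add: emeasure_ball)
  interpret P: prob_space ?P using b by (intro prob_space_PiM prob_space_beta_dist)
  have "sets ?P = sets (PiM {1..?n} (\<lambda>_. borel :: (real ^ 'd) measure))" by (intro sets_PiM_cong) auto
  then have cm: "cone_vol k \<in> borel_measurable ?P" using measurable_cone_vol by (simp cong: measurable_cong_sets)
  define E where "E = (\<integral>\<^sup>+X. cone_vol k X \<partial>?P)"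
  have cf: "cone_vol k X \<noteq> top" for X :: "nat \<Rightarrow> real ^ 'd"
    using cone_vol_le[of k X] unfolding ev by (auto simp: top_unique)
  have "E \<le> (\<integral>\<^sup>+X. ennreal v \<partial>?P)" unfolding E_def ev[symmetric] by (intro nn_integral_mono cone_vol_le)
  then have Efin: "E \<noteq> top" using P.emeasure_space_1 by (auto simp: top_unique)
  have "(\<integral>X. enn2real (cone_vol k X) \<partial>?P) = enn2real (\<integral>\<^sup>+X. ennreal (enn2real (cone_vol k X)) \<partial>?P)"
    using cm by (intro integral_eq_nn_integral) auto
  also have "\<dots> = enn2real E" unfolding E_def using cf by (simp add: less_top)
  finally have int: "(\<integral>X. solid_angle k X \<partial>?P) = enn2real E / v"
    unfolding solid_angle_eq v_def by simp
  define L where "L = (2 * pi) ^ (?n - k) * bump_integral ?n 0 ?p"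
  have L: "L > 0" unfolding L_def by (intro mult_pos_pos bump_integral_0_pos p) auto
  define R where "R = bump_integral k (?n - k) ?p"
  have R: "R \<ge> 0" unfolding R_def by (rule expected_cone_vol_bump(2)[OF b p k])
  have "E * ennreal L = ennreal v * ennreal R"
    unfolding E_def L_def R_def ev[symmetric] by (rule expected_cone_vol_bump(1)[OF b p k])
  moreover obtain e where e: "E = ennreal e" "e \<ge> 0" using Efin by (cases E) auto
  ultimately have "e * L = v * R" using v R L by (simp add: ennreal_mult[symmetric])
  then show ?thesis unfolding int e(1) L_def[symmetric] R_def[symmetric] using v L e(2) by (simp add: field_simps)
qed

text \<open>Only one vertex lies beyond \<open>k = d\<close>, so a single linear inequality cuts out
  the tangent cone. The map \<open>z \<mapsto> - z\<close> exchanges it with the opposite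
  half-space, and the two overlap in a hyperplane.\<close>

lemma solid_angle_half_space:
  fixes X :: "nat \<Rightarrow> real ^ 'd::finite"
  assumes nz: "det (edge_mat X) \<noteq> 0"
  shows "solid_angle CARD('d) X = 1 / 2"
proof -
  have "CARD('d) + 1 \<in> range (vertex_index :: 'd \<Rightarrow> nat)" unfolding range_vertex_index by (auto simp: Suc_le_eq)
  then obtain i :: 'd where i: "vertex_index i = CARD('d) + 1" by auto
  have iff: "CARD('d) < vertex_index j \<longleftrightarrow> j = i" for j :: 'd
  proof
    assume "CARD('d) < vertex_index j"
    then have "vertex_index j = vertex_index i" using vertex_index_bounds(2)[of j] i by linarith
    then show "j = i" by (rule injD[OF inj_vertex_index])
  qed (simp add: i)
  let ?r = "\<lambda>z. \<chi> r c. if c = i then z $ r else edge_mat X $ r $ c"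
  obtain v where v: "\<And>y. det (?r y) = v \<bullet> y" and "\<And>j. v $ j = det (?r (axis j 1))"
    using det_replace_column[of i "edge_mat X"] by blast
  have "?r (\<chi> r. edge_mat X $ r $ i) = edge_mat X" by (simp add: vec_eq_iff)
  then have "v \<noteq> 0" using v[of "\<chi> r. edge_mat X $ r $ i"] nz by auto
  define w where "w = det (edge_mat X) *\<^sub>R v"
  have w: "w \<noteq> 0" using nz \<open>v \<noteq> 0\<close> by (simp add: w_def)
  have tc: "tcone CARD('d) X = {z. 0 \<le> w \<bullet> z}" by (auto simp: tcone_def iff v w_def)
  let ?B = "ball (0 :: real ^ 'd) 1" and ?H = "{z. 0 \<le> w \<bullet> z}" and ?G = "{z. w \<bullet> z \<le> 0}"
  have cl: "?H \<in> sets borel" "?G \<in> sets borel"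
    by (auto intro!: borel_closed closed_Collect_le continuous_intros)
  have fin: "emeasure lborel ?B < \<infinity>" by (simp add: emeasure_ball)
  have fin': "emeasure lborel (?B \<inter> S) \<noteq> \<infinity>" for S
    using fin emeasure_mono[of "?B \<inter> S" ?B lborel] by (auto simp: top_unique)
  have refl: "measure lborel (?B \<inter> ?G) = measure lborel (?B \<inter> ?H)"
  proof -
    have "emeasure lborel (?B \<inter> ?G) = emeasure (distr lborel borel (\<lambda>z. - z)) (?B \<inter> ?G)"
      using lborel_affine[of "-1" "0 :: real ^ 'd"] by (simp add: density_1)
    also have "\<dots> = emeasure lborel (?B \<inter> ?H)"
      using cl by (subst emeasure_distr) (auto intro!: arg_cong2[where f=emeasure] borel_measurable_uminus)
    finally show ?thesis by (simp add: measure_def)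
  qed
  have "emeasure lborel {z. w \<bullet> z = 0} = 0" by (rule emeasure_hyperplane_null[OF w])
  moreover have "{z. w \<bullet> z = 0} \<in> sets lborel"
    using borel_closed[OF closed_hyperplane[of w 0]] by simp
  moreover have "(?B \<inter> ?H) \<inter> (?B \<inter> ?G) \<subseteq> {z. w \<bullet> z = 0}" by auto
  ultimately have "emeasure lborel ((?B \<inter> ?H) \<inter> (?B \<inter> ?G)) = 0" by (metis emeasure_eq_0)
  then have null: "measure lborel ((?B \<inter> ?H) \<inter> (?B \<inter> ?G)) = 0" by (simp add: measure_def)
  have "measure lborel ((?B \<inter> ?H) \<union> (?B \<inter> ?G)) = measure lborel (?B \<inter> ?H) + measure lborel (?B \<inter> ?G) - measure lborel ((?B \<inter> ?H) \<inter> (?B \<inter> ?G))"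
    using cl fin' by (intro measure_Un3) (auto simp: fmeasurable_def less_top)
  moreover have "(?B \<inter> ?H) \<union> (?B \<inter> ?G) = ?B" by auto
  ultimately have "measure lborel ?B = 2 * measure lborel (?B \<inter> ?H)" unfolding null refl by simp
  moreover have "measure lborel ?B > 0" by (simp add: content_ball_pos)
  ultimately show ?thesis unfolding solid_angle_def tc by simp
qed

theorem theorem1p5:
  fixes b :: real and m :: int and n k :: nat
  assumes "b = real_of_int m / 2"
    and "b \<ge> -1"
    and "n = CARD('d::finite) + 1"
    and "1 \<le> k" and "k \<le> n"
    and "odd (m + int n)"
    and "odd (n - k)"
  shows "\<exists>q \<in> \<rat>. J TYPE('d) k b = q * pi powr (- real (n - k - 1))"
proof -
  let ?P = "PiM {1..n} (\<lambda>_. beta_dist b :: (real ^ 'd) measure)"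
  let ?A = "\<lambda>X :: nat \<Rightarrow> real ^ 'd. internal_angle (convex hull (X ` {1..k})) (convex hull (X ` {1..n}))"
  have J: "J TYPE('d) k b = real (n choose k) * (\<integral>X. ?A X \<partial>?P)"
    unfolding J_def Let_def assms(3) ..
  interpret P: prob_space ?P using assms(2) by (intro prob_space_PiM prob_space_beta_dist)
  have kn: "k < n" using assms(5,7) by (cases "k = n") auto
  \<comment> \<open>The two-point sphere, \<open>b = -1\<close> with \<open>d = 1\<close>, would
    produce degenerate simplices with positive probability; there \<open>m + n = 0\<close>, against
    the parity assumption.\<close>
  have d: "b > -1 \<or> b = -1 \<and> 2 \<le> CARD('d)"
  proof (rule ccontr)
    assume "\<not> ?thesis"
    then have "b = -1" "\<not> 2 \<le> CARD('d)" using assms(2) by auto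
    then have "m = -2" "CARD('d) = 1" using assms(1) zero_less_card_finite[where 'a='d] by linarith+
    then show False using assms(3,6) by simp
  qed
  have "prob_space (beta_dist b :: (real ^ 'd) measure)" using assms(2) by (rule prob_space_beta_dist)
  then have det: "AE X in ?P. det (edge_mat X) \<noteq> 0"
    unfolding assms(3) by (rule AE_det_edge_mat) (use d in \<open>auto intro!: beta_dist_hyperplane_null\<close>)
  have angle: "AE X in ?P. ?A X = solid_angle k X"
    using det
  proof eventually_elim
    case (elim X)
    show ?case unfolding solid_angle_def assms(3)
      by (rule internal_angle_eq) (use assms elim in auto)
  qed
  have "sets ?P = sets (PiM {1..CARD('d) + 1} (\<lambda>_. borel :: (real ^ 'd) measure))"
    unfolding assms(3) by (intro sets_PiM_cong) auto
  then have "cone_vol k \<in> borel_measurable ?P" using measurable_cone_vol by (simp cong: measurable_cong_sets)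
  then have sm: "solid_angle k \<in> borel_measurable ?P" unfolding solid_angle_eq[abs_def] by measurable
  have "\<exists>q \<in> \<rat>. (\<integral>X. solid_angle k X \<partial>?P) = q * pi powr (- real (n - k - 1))"
  \<comment> \<open>When \<open>n - k = 1\<close> the exponent can be below \<open>1\<close>, out of
    reach of the integral formula, but the cone is a half-space.\<close>
  proof (cases "n - k = 1")
    case True
    then have k: "k = CARD('d)" using assms(3) kn by linarith
    have "(\<integral>X. solid_angle k X \<partial>?P) = (\<integral>X. 1 / 2 \<partial>?P)"
      using det sm unfolding k by (intro integral_cong_AE) (auto simp: solid_angle_half_space)
    then have "(\<integral>X. solid_angle k X \<partial>?P) = 1 / 2" using P.prob_space by simp
    then show ?thesis using True by (intro bexI[of _ "1 / 2"]) auto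
  next
    case False
    \<comment> \<open>This gives \<open>n \<ge> 4\<close>. With \<open>m \<ge> -2\<close> the
      integer \<open>(m + n - 1) / 2\<close> is at least \<open>1 / 2\<close>, hence at least
      \<open>1\<close>.\<close>
    have nk: "n - k \<ge> 3" using False assms(7) by presburger
    define N where "N = nat ((m + int n - 1) div 2)"
    have "even (m + int n - 1)" using assms(6) by simp
    then have "m + int n - 1 = 2 * ((m + int n - 1) div 2)" by simp
    then have "real_of_int m + real n - 1 = 2 * real_of_int ((m + int n - 1) div 2)"
      by (metis (mono_tags) of_int_add of_int_diff of_int_1 of_int_mult of_int_numeral of_int_of_nat_eq)
    moreover have "m \<ge> -2" "n \<ge> 4" using assms(1,2,4) nk by linarith+
    ultimately have N: "b + real CARD('d) / 2 = real N" "N \<ge> 1"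
      using assms(1,3) by (auto simp: N_def)
    have p: "b + real CARD('d) / 2 \<ge> 1" using N by simp
    obtain q where q: "q \<in> \<rat>" "bump_integral k (n - k) (real N) = pi * q"
      by (rule bump_integral_nat_odd[OF N(2) assms(7,4)])
    have Q: "bump_integral n 0 (real N) \<in> \<rat>" using assms(3) by (intro bump_integral_nat_0) simp
    have "(\<integral>X. solid_angle k X \<partial>?P) = bump_integral k (n - k) (real N) / ((2 * pi) ^ (n - k) * bump_integral n 0 (real N))"
      using integral_solid_angle[OF assms(2) p assms(4)] assms(3,5) unfolding N(1) by simp
    also have "\<dots> = (q / (2 ^ (n - k) * bump_integral n 0 (real N))) * (pi / pi ^ (n - k))"
      unfolding q(2) by (simp add: power_mult_distrib mult_ac)
    \<comment> \<open>One factor \<pi> from the moments stands against \<open>n - k\<close> factors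
      from the normalisation of the angle.\<close>
    also have "pi / pi ^ (n - k) = pi powr (- real (n - k - 1))"
      using nk by (simp add: powr_minus powr_realpow divide_inverse[symmetric] power_diff of_nat_diff[symmetric] del: of_nat_diff)
    finally show ?thesis using q(1) Q
      by (intro bexI[of _ "q / (2 ^ (n - k) * bump_integral n 0 (real N))"]) auto
  qed
  then obtain q where q: "q \<in> \<rat>" "(\<integral>X. solid_angle k X \<partial>?P) = q * pi powr (- real (n - k - 1))" by blast
  show ?thesis
  proof (cases "?A \<in> borel_measurable ?P")
    case True
    then have "(\<integral>X. ?A X \<partial>?P) = (\<integral>X. solid_angle k X \<partial>?P)" by (intro integral_cong_AE sm angle)
    then show ?thesis using q unfolding J by (intro bexI[of _ "real (n choose k) * q"]) auto
  next
    case False \<comment> \<open>this case need not be excluded: the Bochner integral is then \<open>0\<close> by convention\<close>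
    then have "\<not> integrable ?P ?A" by auto
    then show ?thesis unfolding J by (intro bexI[of _ 0]) (auto simp: not_integrable_integral_eq)
  qed
qed

end
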